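(* Let $\Omega\subset\mathbb{R}^d$ be convex and compact with non-empty interior, and let $\mathcal{H}$ be equal to the (fractional) Sobolev space $H^m=H^m(\Omega)$ with equivalent norms. Let $\alpha\in\mathbb{N}^d$ be a multi-index and suppose $m>d/2+|\alpha|$. Suppose the design satisfies the norm-comparison property. Suppose $\lambda=o(1)$ and $\lambda^{-1}=o(n^{2m/d})$. Let $x_0$ be an interior point of $\Omega$ and $$\mathrm{VAR}=\sigma^2D^\alpha K(x_0,X)(K(X,X)+\lambda nI)^{-2}D^\alpha K(X,x_0).$$ Then: 1. $\mathrm{VAR}\asymp\sigma^2n^{-1}\lambda^{-\frac{d+2|\alpha|}{2m}}$. 2. $\sup_{\|f\|_{\mathcal H}\le1}\big|\mathbb{E}_ED^\alpha\hat f(x_0)-D^\alpha f(x_0)\big|\asymp\lambda^{\frac12-\frac{d+2|\alpha|}{4m}}$. 3. Regarding $\sigma^2$ as a positive constant, under the optimal order $\lambda\asymp n^{-1}$, $\sup_{\|f\|_{\mathcal H}\le1}|D^\alpha\hat f(x_0)-D^\alpha f(x_0)|\asymp n^{-\frac12+\frac{d+2|\alpha|}{4m}}$. 4. In addition, if $\sigma^2>0$ and $\lambda=o(n^{-1})$, then $(\mathrm{VAR})^{-1/2}(D^\alpha\hat f(x_0)-D^\alpha f(x_0))\xrightarrow{\mathscr L}N(0,1)$.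
   Context: Setting: $K$ is a reproducing kernel on $\Omega\subset\mathbb{R}^d$ with reproducing kernel Hilbert space $\mathcal{H}$ (norm $\|\cdot\|_{\mathcal H}$). For each $n$ there are design points $x_1,\dots,x_n\in\Omega$ (deterministic or random, may depend on $n$) and data $y_i=f(x_i)+e_i$, with $f\in\mathcal{H}$ and $e_1,e_2,\dots$ i.i.d. with mean zero and finite variance $\sigma^2$; the errors are independent of the design. The function $f$ may depend on $n$. Write $X=(x_1,\dots,x_n)^T$, $E=(e_1,\dots,e_n)^T$, $K(A,B)=(K(a_i,b_j))_{ij}$. The smoothing parameter $\lambda>0$ may depend on $n$. Asymptotics are as $n\to\infty$. The kernel ridge regression (KRR) estimator is $\hat f=\operatorname{argmin}_{v\in\mathcal{H}}\frac1n\sum_{i=1}^n(y_i-v(x_i))^2+\lambda\|v\|_{\mathcal{H}}^2$, i.e. $\hat f(x)=K(x,X)(K(X,X)+\lambda nI)^{-1}Y$ with $Y=(y_1,\dots,y_n)^T$. For $\alpha=(\alpha_1,\dots,\alpha_d)$, $|\alpha|=\alpha_1+\dots+\alpha_d$ and $D^\alpha$ is the corresponding partial derivative; $D^\alpha K(x_0,X)$ is the row vector whose $i$-th entry is the $\alpha$-th derivative of $K(\cdot,x_i)$ at $x_0$, and $D^\alpha K(X,x_0)$ is its transpose. $\mathbb{E}_E$ is expectation with respect to $E$ only ($X$ held fixed). In suprema over $\|f\|_{\mathcal H}\le1$, only $f$ varies (the same $\lambda$ is used for all $f$), and $\hat f$ is the KRR estimator from $y_i=f(x_i)+e_i$. Also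 $\|v\|_n^2=\frac1n\sum_{i=1}^n v(x_i)^2$, and $\|\cdot\|_{L_2}$ is the $L_2(\Omega)$ norm. Norm-comparison property of the design: $X$, if random, is independent of $E$; and there is $C_1>0$, and for each $\epsilon>0$ a $C_\epsilon>0$, all independent of $n$ and $X$, such that $\mathbb{P}(\Xi_\epsilon)\ge1-\epsilon$, where $\Xi_\epsilon$ is the event that, for all $v\in\mathcal H$, $\|v\|_{L_2}\le\max\{C_1\|v\|_n,C_\epsilon n^{-m/d}\|v\|_{\mathcal H}\}$ and $\|v\|_n\le\max\{C_1\|v\|_{L_2},C_\epsilon n^{-m/d}\|v\|_{\mathcal H}\}$ (for deterministic $X$ these inequalities hold unconditionally). For (possibly random) sequences, $a_n\lesssim b_n$ means $a_n/b_n$ is bounded in probability; $a_n\asymp b_n$ means $a_n\lesssim b_n$ and $b_n\lesssim a_n$. Convention $0/0=0$. $\xrightarrow{\mathscr L}$ denotes convergence in distribution.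
   Formalization: In part 4, where f may depend on n, the norms of f in H are assumed bounded in n; without a bound (e.g. f of norm of order (λn)^{-1/2} in the worst direction) the bias is comparable to VAR^{1/2} and the normal limit fails. *)

theory Defs
  imports
    "HOL-Probability.Probability"
    "HOL-Library.Landau_Symbols"
    "Jordan_Normal_Form.Gauss_Jordan_Elimination"
begin

text \<open>Real-valued functions on a set \<open>\<Omega>\<close> are represented throughout by total functions
  that are only evaluated on \<open>\<Omega>\<close>; members of a function space on \<open>\<Omega>\<close> are normalised to
  vanish outside \<open>\<Omega>\<close>, so that they are determined by their values on \<open>\<Omega>\<close>.\<close>

subsection \<open>Partial derivatives\<close>

definition partial_deriv :: "'d \<Rightarrow> (real ^ 'd::finite \<Rightarrow> real) \<Rightarrow> real ^ 'd \<Rightarrow> real" where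
  "partial_deriv i f x = deriv (\<lambda>t. f (x + t *\<^sub>R axis i 1)) 0"

definition iter_partial :: "'d list \<Rightarrow> (real ^ 'd::finite \<Rightarrow> real) \<Rightarrow> real ^ 'd \<Rightarrow> real" where
  "iter_partial is f = foldr partial_deriv is f"

definition mi_order :: "('d::finite \<Rightarrow> nat) \<Rightarrow> nat" where
  "mi_order \<alpha> = (\<Sum>i\<in>UNIV. \<alpha> i)"

text \<open>The derivative of multi-index \<open>\<alpha>\<close>. The coordinates carry no linear order, so some order of
  differentiation is fixed; it is irrelevant for functions of class \<open>C\<close> to the \<open>mi_order \<alpha>\<close>.\<close>

definition mi_deriv :: "('d \<Rightarrow> nat) \<Rightarrow> (real ^ 'd::finite \<Rightarrow> real) \<Rightarrow> real ^ 'd \<Rightarrow> real" where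
  "mi_deriv \<alpha> = iter_partial (SOME is. \<forall>i. count_list is i = \<alpha> i)"

subsection \<open>Fractional Sobolev spaces\<close>

definition test_function :: "(real ^ 'd::finite) set \<Rightarrow> (real ^ 'd \<Rightarrow> real) \<Rightarrow> bool" where
  "test_function U \<phi> \<longleftrightarrow>
     (\<forall>is x. iter_partial is \<phi> differentiable (at x)) \<and>
     compact (closure {x. \<phi> x \<noteq> 0}) \<and> closure {x. \<phi> x \<noteq> 0} \<subseteq> U"

definition L2_on :: "(real ^ 'd::finite) set \<Rightarrow> (real ^ 'd \<Rightarrow> real) \<Rightarrow> bool" where
  "L2_on U u \<longleftrightarrow> set_borel_measurable lborel U u \<and> set_integrable lborel U (\<lambda>x. (u x)\<^sup>2)"

definition L2_norm :: "(real ^ 'd::finite) set \<Rightarrow> (real ^ 'd \<Rightarrow> real) \<Rightarrow> real" where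
  "L2_norm U u = sqrt (LINT x:U|lborel. (u x)\<^sup>2)"

definition has_weak_deriv ::
  "(real ^ 'd::finite) set \<Rightarrow> ('d \<Rightarrow> nat) \<Rightarrow> (real ^ 'd \<Rightarrow> real) \<Rightarrow> (real ^ 'd \<Rightarrow> real) \<Rightarrow> bool" where
  "has_weak_deriv U \<beta> u g \<longleftrightarrow> L2_on U g \<and>
     (\<forall>\<phi>. test_function U \<phi> \<longrightarrow>
        (LINT x:U|lborel. u x * mi_deriv \<beta> \<phi> x) =
        (-1) ^ mi_order \<beta> * (LINT x:U|lborel. g x * \<phi> x))"

definition weak_deriv ::
  "(real ^ 'd::finite) set \<Rightarrow> ('d \<Rightarrow> nat) \<Rightarrow> (real ^ 'd \<Rightarrow> real) \<Rightarrow> real ^ 'd \<Rightarrow> real" where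
  "weak_deriv U \<beta> u = (SOME g. has_weak_deriv U \<beta> u g)"

text \<open>The square of the Gagliardo (Slobodeckij) seminorm of order \<open>s\<close> in \<open>(0,1)\<close>.\<close>

definition gagliardo :: "(real ^ 'd::finite) set \<Rightarrow> real \<Rightarrow> (real ^ 'd \<Rightarrow> real) \<Rightarrow> ennreal" where
  "gagliardo U s g =
     (\<integral>\<^sup>+ x\<in>U. (\<integral>\<^sup>+ y\<in>U.
        ennreal ((g x - g y)\<^sup>2 / norm (x - y) powr (real CARD('d) + 2 * s)) \<partial>lborel) \<partial>lborel)"

text \<open>\<open>H\<^sup>m(U)\<close> for an open set \<open>U\<close> and real \<open>m > 0\<close>: weak derivatives up to the order \<open>\<lfloor>m\<rfloor>\<close> are
  in \<open>L\<^sub>2(U)\<close>, and for non-integer \<open>m\<close> those of order \<open>\<lfloor>m\<rfloor>\<close> have finite Gagliardo seminorm of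
  order \<open>m - \<lfloor>m\<rfloor>\<close>.\<close>

definition in_sobolev :: "(real ^ 'd::finite) set \<Rightarrow> real \<Rightarrow> (real ^ 'd \<Rightarrow> real) \<Rightarrow> bool" where
  "in_sobolev U m u \<longleftrightarrow> L2_on U u \<and>
     (\<forall>\<beta>. mi_order \<beta> \<le> nat \<lfloor>m\<rfloor> \<longrightarrow> (\<exists>g. has_weak_deriv U \<beta> u g)) \<and>
     (m \<notin> \<int> \<longrightarrow> (\<forall>\<beta>. mi_order \<beta> = nat \<lfloor>m\<rfloor> \<longrightarrow> gagliardo U (frac m) (weak_deriv U \<beta> u) < \<infinity>))"

definition sobolev_norm :: "(real ^ 'd::finite) set \<Rightarrow> real \<Rightarrow> (real ^ 'd \<Rightarrow> real) \<Rightarrow> real" where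
  "sobolev_norm U m u = sqrt
     ((\<Sum>\<beta> | mi_order \<beta> \<le> nat \<lfloor>m\<rfloor>. (L2_norm U (weak_deriv U \<beta> u))\<^sup>2) +
      (if m \<in> \<int> then 0
       else (\<Sum>\<beta> | mi_order \<beta> = nat \<lfloor>m\<rfloor>. enn2real (gagliardo U (frac m) (weak_deriv U \<beta> u)))))"

subsection \<open>Reproducing kernel Hilbert spaces\<close>

definition ip_norm :: "(('a \<Rightarrow> real) \<Rightarrow> ('a \<Rightarrow> real) \<Rightarrow> real) \<Rightarrow> ('a \<Rightarrow> real) \<Rightarrow> real" where
  "ip_norm ip v = sqrt (ip v v)"

text \<open>\<open>H\<close> with inner product \<open>ip\<close> is the reproducing kernel Hilbert space of \<open>K\<close> on \<open>\<Omega>\<close>.\<close>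

locale rkhs =
  fixes \<Omega> :: "'a set"
    and K :: "'a \<Rightarrow> 'a \<Rightarrow> real"
    and H :: "('a \<Rightarrow> real) set"
    and ip :: "('a \<Rightarrow> real) \<Rightarrow> ('a \<Rightarrow> real) \<Rightarrow> real"
  assumes zero_outside: "u \<in> H \<Longrightarrow> x \<notin> \<Omega> \<Longrightarrow> u x = 0"
    and zero_mem: "(\<lambda>x. 0) \<in> H"
    and add_mem: "u \<in> H \<Longrightarrow> v \<in> H \<Longrightarrow> (\<lambda>x. u x + v x) \<in> H"
    and scale_mem: "u \<in> H \<Longrightarrow> (\<lambda>x. c * u x) \<in> H"
    and ip_sym: "u \<in> H \<Longrightarrow> v \<in> H \<Longrightarrow> ip u v = ip v u"
    and ip_add: "u \<in> H \<Longrightarrow> v \<in> H \<Longrightarrow> w \<in> H \<Longrightarrow> ip (\<lambda>x. u x + v x) w = ip u w + ip v w"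
    and ip_scale: "u \<in> H \<Longrightarrow> v \<in> H \<Longrightarrow> ip (\<lambda>x. c * u x) v = c * ip u v"
    and ip_pos: "u \<in> H \<Longrightarrow> u \<noteq> (\<lambda>x. 0) \<Longrightarrow> ip u u > 0"
    and complete: "(\<And>n. s n \<in> H) \<Longrightarrow>
       (\<forall>\<epsilon>>0. \<exists>N. \<forall>p\<ge>N. \<forall>q\<ge>N. ip_norm ip (\<lambda>x. s p x - s q x) < \<epsilon>) \<Longrightarrow>
       \<exists>u\<in>H. (\<lambda>n. ip_norm ip (\<lambda>x. s n x - u x)) \<longlonglongrightarrow> 0"
    and kernel_mem: "y \<in> \<Omega> \<Longrightarrow> (\<lambda>x. if x \<in> \<Omega> then K x y else 0) \<in> H"
    and reproducing: "u \<in> H \<Longrightarrow> y \<in> \<Omega> \<Longrightarrow> ip u (\<lambda>x. if x \<in> \<Omega> then K x y else 0) = u y"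

text \<open>\<open>H = H\<^sup>m(\<Omega>)\<close> with equivalent norms. Members of \<open>H\<close> are genuine functions, those of \<open>H\<^sup>m(\<Omega>)\<close>
  are classes modulo null sets; for \<open>m > d/2\<close> the latter are identified with their unique
  continuous representatives on \<open>\<Omega>\<close> (the boundary of the convex set \<open>\<Omega>\<close> is a null set).\<close>

definition equals_sobolev ::
  "(real ^ 'd::finite) set \<Rightarrow> real \<Rightarrow> (real ^ 'd \<Rightarrow> real) set \<Rightarrow>
   ((real ^ 'd \<Rightarrow> real) \<Rightarrow> (real ^ 'd \<Rightarrow> real) \<Rightarrow> real) \<Rightarrow> bool" where
  "equals_sobolev \<Omega> m H ip \<longleftrightarrow>
     H = {u. continuous_on \<Omega> u \<and> (\<forall>x. x \<notin> \<Omega> \<longrightarrow> u x = 0) \<and> in_sobolev (interior \<Omega>) m u} \<and>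
     (\<exists>c>0. \<exists>C>0. \<forall>u\<in>H. c * sobolev_norm (interior \<Omega>) m u \<le> ip_norm ip u \<and>
                        ip_norm ip u \<le> C * sobolev_norm (interior \<Omega>) m u)"

subsection \<open>Kernel ridge regression\<close>

definition krr ::
  "('a \<Rightarrow> real) set \<Rightarrow> (('a \<Rightarrow> real) \<Rightarrow> ('a \<Rightarrow> real) \<Rightarrow> real) \<Rightarrow> nat \<Rightarrow> real \<Rightarrow>
   (nat \<Rightarrow> 'a) \<Rightarrow> (nat \<Rightarrow> real) \<Rightarrow> 'a \<Rightarrow> real" where
  "krr H ip n lam x y =
     arg_min_on (\<lambda>v. 1 / real n * (\<Sum>i<n. (y i - v (x i))\<^sup>2) + lam * (ip_norm ip v)\<^sup>2) H"

definition krr_var ::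
  "(real ^ 'd::finite \<Rightarrow> real ^ 'd \<Rightarrow> real) \<Rightarrow> ('d \<Rightarrow> nat) \<Rightarrow> real \<Rightarrow> nat \<Rightarrow> real \<Rightarrow>
   (nat \<Rightarrow> real ^ 'd) \<Rightarrow> real ^ 'd \<Rightarrow> real" where
  "krr_var K \<alpha> \<sigma> n lam x x0 =
     (let k = Matrix.vec n (\<lambda>i. mi_deriv \<alpha> (\<lambda>z. K z (x i)) x0);
          A = Matrix.mat n n (\<lambda>(i, j). K (x i) (x j)) + (lam * real n) \<cdot>\<^sub>m 1\<^sub>m n;
          B = the (mat_inverse A)
      in \<sigma>\<^sup>2 * scalar_prod k ((B * B) *\<^sub>v k))"

definition emp_norm :: "nat \<Rightarrow> (nat \<Rightarrow> 'a) \<Rightarrow> ('a \<Rightarrow> real) \<Rightarrow> real" where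
  "emp_norm n x v = sqrt (1 / real n * (\<Sum>i<n. (v (x i))\<^sup>2))"

text \<open>A deterministic design is the special case in which \<open>X n i\<close> is constant; the event
  below is then sure as soon as \<open>\<epsilon> < 1\<close>.\<close>

definition norm_comparison ::
  "'w measure \<Rightarrow> (real ^ 'd::finite) set \<Rightarrow> real \<Rightarrow> (real ^ 'd \<Rightarrow> real) set \<Rightarrow>
   ((real ^ 'd \<Rightarrow> real) \<Rightarrow> (real ^ 'd \<Rightarrow> real) \<Rightarrow> real) \<Rightarrow>
   (nat \<Rightarrow> nat \<Rightarrow> 'w \<Rightarrow> real ^ 'd) \<Rightarrow> bool" where
  "norm_comparison M \<Omega> m H ip X \<longleftrightarrow>
     (\<exists>C1>0. \<forall>\<epsilon>>0. \<exists>C>0. \<forall>n\<ge>1.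
        \<P>(\<omega> in M. \<forall>v\<in>H.
           L2_norm \<Omega> v \<le> max (C1 * emp_norm n (\<lambda>i. X n i \<omega>) v)
                              (C * real n powr (- m / real CARD('d)) * ip_norm ip v) \<and>
           emp_norm n (\<lambda>i. X n i \<omega>) v \<le> max (C1 * L2_norm \<Omega> v)
                              (C * real n powr (- m / real CARD('d)) * ip_norm ip v))
        \<ge> 1 - \<epsilon>)"

definition iid_errors :: "'w measure \<Rightarrow> (nat \<Rightarrow> 'w \<Rightarrow> real) \<Rightarrow> real \<Rightarrow> bool" where
  "iid_errors M e \<sigma> \<longleftrightarrow>
     prob_space.indep_vars M (\<lambda>_. borel) e UNIV \<and>
     (\<forall>i. distr M borel (e i) = distr M borel (e 0)) \<and>
     (\<forall>i. integrable M (\<lambda>\<omega>. (e i \<omega>)\<^sup>2)) \<and>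
     (\<forall>i. prob_space.expectation M (e i) = 0) \<and>
     (\<forall>i. prob_space.variance M (e i) = \<sigma>\<^sup>2)"

text \<open>Independence of random elements, possibly of different types (\<open>prob_space.indep_var\<close> requires a
  common type).\<close>

definition indep_rv ::
  "'w measure \<Rightarrow> 'b measure \<Rightarrow> ('w \<Rightarrow> 'b) \<Rightarrow> 'c measure \<Rightarrow> ('w \<Rightarrow> 'c) \<Rightarrow> bool" where
  "indep_rv M S U T V \<longleftrightarrow> U \<in> measurable M S \<and> V \<in> measurable M T \<and>
     prob_space.indep_set M {U -` A \<inter> space M | A. A \<in> sets S} {V -` B \<inter> space M | B. B \<in> sets T}"

text \<open>The estimator for regression function \<open>f\<close>, design \<open>x\<close> and errors \<open>e\<close>.\<close>

definition krr_fit ::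
  "('a \<Rightarrow> real) set \<Rightarrow> (('a \<Rightarrow> real) \<Rightarrow> ('a \<Rightarrow> real) \<Rightarrow> real) \<Rightarrow> nat \<Rightarrow> real \<Rightarrow>
   (nat \<Rightarrow> 'a) \<Rightarrow> (nat \<Rightarrow> real) \<Rightarrow> ('a \<Rightarrow> real) \<Rightarrow> 'a \<Rightarrow> real" where
  "krr_fit H ip n lam x e f = krr H ip n lam x (\<lambda>i. f (x i) + e i)"

subsection \<open>Stochastic order\<close>

text \<open>\<open>a\<^sub>n / b\<^sub>n\<close> is bounded in probability as \<open>n \<longlonglongrightarrow> \<infinity>\<close>. The product form implements \<open>0/0 = 0\<close>
  and \<open>a/0 = \<infinity>\<close> for \<open>a \<noteq> 0\<close>, unlike HOL division.\<close>

definition lesssim_prob ::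
  "'w measure \<Rightarrow> (nat \<Rightarrow> 'w \<Rightarrow> real) \<Rightarrow> (nat \<Rightarrow> 'w \<Rightarrow> real) \<Rightarrow> bool" where
  "lesssim_prob M a b \<longleftrightarrow>
     (\<forall>\<epsilon>>0. \<exists>C. \<forall>\<^sub>F n in sequentially. \<P>(\<omega> in M. \<bar>a n \<omega>\<bar> \<le> C * \<bar>b n \<omega>\<bar>) \<ge> 1 - \<epsilon>)"

definition asymp_prob ::
  "'w measure \<Rightarrow> (nat \<Rightarrow> 'w \<Rightarrow> real) \<Rightarrow> (nat \<Rightarrow> 'w \<Rightarrow> real) \<Rightarrow> bool" where
  "asymp_prob M a b \<longleftrightarrow> lesssim_prob M a b \<and> lesssim_prob M b a"

end

theory Submission
  imports Defs "Jordan_Normal_Form.Determinant"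
begin

text \<open>The functional \<open>g \<mapsto> D\<^sup>\<alpha> g(x\<^sub>0)\<close> is bounded on \<open>H\<close>, hence represented by some \<open>l\<close>. For a fixed
  design let \<open>u\<close> represent it with respect to the empirical inner product plus \<open>\<lambda>\<close> times that of
  \<open>H\<close>. Then the estimator of \<open>D\<^sup>\<alpha> f(x\<^sub>0)\<close> is the weighted sum of the data with weights \<open>u(x\<^sub>i)/n\<close>, its
  variance is \<open>\<sigma>\<^sup>2 \<parallel>u\<parallel>\<^sub>n\<^sup>2 / n\<close>, and its largest bias over the unit ball of \<open>H\<close> is \<open>\<lambda> \<parallel>u\<parallel>\<^sub>H\<close>. So all rates
  follow from \<open>\<parallel>u\<parallel>\<^sub>n \<asymp> \<surd>\<lambda> \<parallel>u\<parallel>\<^sub>H \<asymp> s powr (- d/2 - |\<alpha>|)\<close>, where \<open>s = \<lambda> powr (1/(2m))\<close>. The upper bound is the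
  Sobolev inequality at scale \<open>s\<close>, applied to \<open>u\<close> itself; the lower bounds come from pairing \<open>u\<close> with
  bump functions concentrated at a scale proportional to \<open>s\<close> around \<open>x\<^sub>0\<close>. The norm comparison
  exchanges \<open>\<parallel>\<cdot>\<parallel>\<^sub>n\<close> and the \<open>L\<^sub>2\<close> norm, as its error term is \<open>o(\<surd>\<lambda>) \<parallel>\<cdot>\<parallel>\<^sub>H\<close>.

  The Sobolev inequality is obtained for real \<open>m\<close> by integrating the mollification of a function over
  the scale: for kernels with enough structure the derivative in the scale is a pairing with weak
  derivatives of order \<open>\<lfloor>m\<rfloor>\<close>, in which the fractional part of the smoothness gains the remaining power.

  For the central limit theorem the same inequality shows that each weight is negligible compared to
  the standard deviation, so that the Lindeberg argument applies conditionally on the design.\<close>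

subsection \<open>Partial derivatives of smooth functions\<close>

text \<open>The scale is dictated by \<open>s powr m = sqrt lam\<close>: there the two terms of the
  Sobolev inequality weigh the two parts of the energy |u|_n^2 + lam |u|_H^2 equally. This energy is
  the value of the functional at u itself, so the inequality bounds a quantity quadratic in u by one
  that is linear in it. Two obstacles shape the analysis. All norms refer to the domain and design
  points may lie on its boundary, so mollifiers have to stay inside at every scale. And for
  non-integer m the fractional gain comes from subtracting a constant, which requires kernels of
  mean zero; dilation derivatives have this property. On the probabilistic side, a set that is not
  measurable has probability 0 by convention, so orders in probability require measurable weights.
  The estimator is defined as a minimiser, and only its closed form shows how it depends on the
  design. The lower bound on lam is used twice: it makes the norm comparison effective at scale s,
  and it says that n s^d tends to infinity, which makes single weights negligible.\<close>

lemma iter_partial_Nil [simp]: "iter_partial [] f = f"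
  by (simp add: iter_partial_def)

lemma iter_partial_Cons: "iter_partial (i # is) f = partial_deriv i (iter_partial is f)"
  by (simp add: iter_partial_def)

lemma iter_partial_append: "iter_partial (is @ js) f = iter_partial is (iter_partial js f)"
  by (simp add: iter_partial_def)

lemma iter_partial_snoc: "iter_partial (is @ [i]) f = iter_partial is (partial_deriv i f)"
  by (simp add: iter_partial_append iter_partial_Cons)

lemma partial_deriv_eqI:
  assumes "((\<lambda>t. f (x + t *\<^sub>R axis i 1)) has_real_derivative D) (at 0)"
  shows "partial_deriv i f x = D"
  using assms unfolding partial_deriv_def by (rule DERIV_imp_deriv)

lemma has_derivative_along_axis:
  fixes f :: "real ^ 'd::finite \<Rightarrow> real"
  assumes "(f has_derivative f') (at (x + s *\<^sub>R axis i 1))"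
  shows "((\<lambda>t. f (x + t *\<^sub>R axis i 1)) has_real_derivative f' (axis i 1)) (at s)"
proof -
  have 1: "((\<lambda>t. x + t *\<^sub>R axis i 1) has_derivative (\<lambda>h. h *\<^sub>R axis i 1)) (at s)"
    by (auto intro!: derivative_eq_intros)
  have "(f \<circ> (\<lambda>t. x + t *\<^sub>R axis i 1) has_derivative f' \<circ> (\<lambda>h. h *\<^sub>R axis i 1)) (at s)"
    by (rule diff_chain_at[OF 1 assms])
  moreover have "f' \<circ> (\<lambda>h. h *\<^sub>R axis i 1) = (\<lambda>h. f' (axis i 1) * h)"
    using linear_cmul[OF has_derivative_linear[OF assms]] by (auto simp: fun_eq_iff)
  ultimately show ?thesis
    by (simp add: has_field_derivative_def o_def mult_commute_abs)
qed

lemma has_derivative_partial: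
  fixes f :: "real ^ 'd::finite \<Rightarrow> real"
  assumes "(f has_derivative f') (at x)"
  shows "partial_deriv i f x = f' (axis i 1)"
  by (rule partial_deriv_eqI) (use has_derivative_along_axis[of f f' x 0 i] assms in simp)

lemma differentiable_along_axis:
  fixes f :: "real ^ 'd::finite \<Rightarrow> real"
  assumes "f differentiable at (x + s *\<^sub>R axis i 1)"
  shows "((\<lambda>t. f (x + t *\<^sub>R axis i 1)) has_real_derivative
    partial_deriv i f (x + s *\<^sub>R axis i 1)) (at s)"
  using assms has_derivative_along_axis has_derivative_partial unfolding differentiable_def by metis

lemma differentiable_has_derivative_partials:
  fixes f :: "real ^ 'd::finite \<Rightarrow> real"
  assumes "f differentiable at x"
  shows "(f has_derivative (\<lambda>h. \<Sum>i\<in>UNIV. vec_nth h i * partial_deriv i f x)) (at x)"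
proof -
  obtain f' where f': "(f has_derivative f') (at x)"
    using assms by (auto simp: differentiable_def)
  interpret linear f' by (rule has_derivative_linear[OF f'])
  have "f' h = (\<Sum>i\<in>UNIV. vec_nth h i * partial_deriv i f x)" for h
  proof -
    have "f' h = f' (\<Sum>i\<in>UNIV. vec_nth h i *s axis i 1)"
      by (simp add: basis_expansion)
    also have "\<dots> = (\<Sum>i\<in>UNIV. vec_nth h i * f' (axis i 1))"
      by (simp add: sum scale scalar_mult_eq_scaleR)
    finally show ?thesis using has_derivative_partial[OF f'] by simp
  qed
  then show ?thesis using f' by (metis (no_types, lifting) ext)
qed

lemma partial_deriv_add:
  fixes f g :: "real ^ 'd::finite \<Rightarrow> real"
  assumes "f differentiable at x" "g differentiable at x"
  shows "partial_deriv i (\<lambda>y. f y + g y) x = partial_deriv i f x + partial_deriv i g x"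
  by (rule partial_deriv_eqI)
    (use assms differentiable_along_axis[of _ x 0 i] in \<open>auto intro!: derivative_eq_intros\<close>)

lemma partial_deriv_mult:
  fixes f g :: "real ^ 'd::finite \<Rightarrow> real"
  assumes "f differentiable at x" "g differentiable at x"
  shows "partial_deriv i (\<lambda>y. f y * g y) x = partial_deriv i f x * g x + f x * partial_deriv i g x"
proof (rule partial_deriv_eqI)
  have "((\<lambda>t. f (x + t *\<^sub>R axis i 1)) has_real_derivative partial_deriv i f x) (at 0)"
    "((\<lambda>t. g (x + t *\<^sub>R axis i 1)) has_real_derivative partial_deriv i g x) (at 0)"
    using assms differentiable_along_axis[of _ x 0 i] by auto
  from DERIV_mult[OF this] show "((\<lambda>t. f (x + t *\<^sub>R axis i 1) * g (x + t *\<^sub>R axis i 1)) has_real_derivative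
      partial_deriv i f x * g x + f x * partial_deriv i g x) (at 0)"
    by (simp add: mult.commute)
qed

lemma partial_deriv_const [simp]: "partial_deriv i (\<lambda>y. c) = (\<lambda>x. 0)"
  by (rule ext, rule partial_deriv_eqI) simp

lemma partial_deriv_coord: "partial_deriv i (\<lambda>y. vec_nth y j) = (\<lambda>x. if i = j then 1 else 0)"
  by (rule ext, rule partial_deriv_eqI) (auto simp: axis_def intro!: derivative_eq_intros)

lemma partial_deriv_affine:
  fixes f :: "real ^ 'd::finite \<Rightarrow> real"
  assumes "f differentiable at (a + c *\<^sub>R x)"
  shows "partial_deriv i (\<lambda>y. f (a + c *\<^sub>R y)) x = c * partial_deriv i f (a + c *\<^sub>R x)"
proof (rule partial_deriv_eqI)
  have "((\<lambda>t. f ((a + c *\<^sub>R x) + t *\<^sub>R axis i 1)) has_real_derivative partial_deriv i f (a + c *\<^sub>R x)) (at (c * 0))"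
    using assms differentiable_along_axis[of _ "a + c *\<^sub>R x" 0 i] by simp
  then have "((\<lambda>t. f ((a + c *\<^sub>R x) + (c * t) *\<^sub>R axis i 1)) has_real_derivative
      partial_deriv i f (a + c *\<^sub>R x) * c) (at 0)"
    by (rule DERIV_chain2) (auto intro!: derivative_eq_intros)
  then show "((\<lambda>t. f (a + c *\<^sub>R (x + t *\<^sub>R axis i 1))) has_real_derivative
      c * partial_deriv i f (a + c *\<^sub>R x)) (at 0)"
    by (simp add: algebra_simps)
qed

text \<open>Derivatives are local: openness keeps the difference quotients inside \<open>S\<close>,
  so equality survives each differentiation. Used for supports of derivatives and to pass from a
  kernel to its truncation to the domain.\<close>

lemma iter_partial_cong_on:
  fixes f g :: "real ^ 'd::finite \<Rightarrow> real"
  assumes S: "open S" and eq: "\<And>x. x \<in> S \<Longrightarrow> f x = g x" and "x \<in> S"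
  shows "iter_partial is f x = iter_partial is g x"
  using \<open>x \<in> S\<close>
proof (induction "is" arbitrary: x)
  case (Cons i js)
  have "\<forall>\<^sub>F t in nhds 0. x + t *\<^sub>R axis i (1::real) \<in> S"
  proof -
    have "((\<lambda>t. x + t *\<^sub>R axis i (1::real)) \<longlongrightarrow> x + 0 *\<^sub>R axis i 1) (nhds 0)"
      by (intro tendsto_intros filterlim_ident)
    then show ?thesis using topological_tendstoD[OF _ S] Cons.prems by simp
  qed
  then have "\<forall>\<^sub>F t in nhds 0. iter_partial js f (x + t *\<^sub>R axis i 1) = iter_partial js g (x + t *\<^sub>R axis i 1)"
    by eventually_elim (rule Cons.IH)
  then show ?case
    unfolding iter_partial_Cons partial_deriv_def by (rule deriv_cong_ev) simp
qed (simp add: eq)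

section \<open>Smooth functions and their closure properties\<close>

primrec differentiable_times :: "nat \<Rightarrow> (real ^ 'd::finite \<Rightarrow> real) \<Rightarrow> bool" where
  "differentiable_times 0 f \<longleftrightarrow> (\<forall>x. f differentiable at x)"
| "differentiable_times (Suc n) f \<longleftrightarrow> (\<forall>x. f differentiable at x) \<and> (\<forall>i. differentiable_times n (partial_deriv i f))"

definition smooth :: "(real ^ 'd::finite \<Rightarrow> real) \<Rightarrow> bool" where
  "smooth f \<longleftrightarrow> (\<forall>is x. iter_partial is f differentiable at x)"

text \<open>The recursion strips the innermost derivative, which is the last entry of the list.
  Closure properties are proved by induction on the recursion with the function left arbitrary, and
  then read off for \<open>smooth\<close>.\<close>

lemma differentiable_times_iff:
  "differentiable_times n f \<longleftrightarrow> (\<forall>is. length is \<le> n \<longrightarrow> (\<forall>x. iter_partial is f differentiable at x))"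
proof (induction n arbitrary: f)
  case (Suc n)
  have "(\<forall>js. length js \<le> Suc n \<longrightarrow> (\<forall>x. iter_partial js f differentiable at x)) \<longleftrightarrow>
    (\<forall>x. f differentiable at x) \<and>
    (\<forall>i js. length js \<le> n \<longrightarrow> (\<forall>x. iter_partial (js @ [i]) f differentiable at x))" (is "?A \<longleftrightarrow> ?B")
  proof
    assume ?A
    then show ?B by (force dest: spec[of _ "[]"])
  next
    assume B: ?B
    show ?A
    proof (intro allI impI)
      fix js :: "'a list" and x assume "length js \<le> Suc n"
      then show "iter_partial js f differentiable at x"
        using B by (cases js rule: rev_cases) auto
    qed
  qed
  then show ?case by (auto simp: Suc.IH iter_partial_snoc)
qed auto

lemma smooth_iff: "smooth f \<longleftrightarrow> (\<forall>n. differentiable_times n f)"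
  unfolding smooth_def differentiable_times_iff by auto

lemma differentiable_times_SucD: "differentiable_times (Suc n) f \<Longrightarrow> differentiable_times n f"
  by (auto simp: differentiable_times_iff)

lemma differentiable_times_add:
  "differentiable_times n f \<Longrightarrow> differentiable_times n g \<Longrightarrow> differentiable_times n (\<lambda>x. f x + g x)"
proof (induction n arbitrary: f g)
  case (Suc n)
  have "partial_deriv i (\<lambda>x. f x + g x) = (\<lambda>x. partial_deriv i f x + partial_deriv i g x)" for i
    using Suc.prems by (intro ext partial_deriv_add) auto
  then show ?case using Suc by auto
qed simp

lemma differentiable_times_mult:
  "differentiable_times n f \<Longrightarrow> differentiable_times n g \<Longrightarrow> differentiable_times n (\<lambda>x. f x * g x)"
proof (induction n arbitrary: f g)
  case (Suc n)
  have "partial_deriv i (\<lambda>x. f x * g x) = (\<lambda>x. partial_deriv i f x * g x + f x * partial_deriv i g x)" for i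
    using Suc.prems by (intro ext partial_deriv_mult) auto
  then show ?case
    using Suc.prems Suc.prems[THEN differentiable_times_SucD]
    by (auto intro!: differentiable_times_add Suc.IH)
qed simp

lemma differentiable_times_const [simp]: "differentiable_times n (\<lambda>x. c)"
  by (induction n arbitrary: c) auto

lemma differentiable_coord [simp]: "(\<lambda>y. vec_nth y j) differentiable at x"
  by (auto simp: differentiable_def intro!: bounded_linear.has_derivative[OF bounded_linear_vec_nth] has_derivative_ident)

lemma smooth_const [simp]: "smooth (\<lambda>x. c)"
  by (simp add: smooth_iff)

lemma smooth_coord [simp]: "smooth (\<lambda>y. vec_nth y j)"
  unfolding smooth_iff
proof
  fix n show "differentiable_times n (\<lambda>y. vec_nth y j)"
    by (cases n) (auto simp: partial_deriv_coord)
qed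

lemma smooth_add: "smooth f \<Longrightarrow> smooth g \<Longrightarrow> smooth (\<lambda>x. f x + g x)"
  by (simp add: smooth_iff differentiable_times_add)

lemma smooth_mult: "smooth f \<Longrightarrow> smooth g \<Longrightarrow> smooth (\<lambda>x. f x * g x)"
  by (simp add: smooth_iff differentiable_times_mult)

lemma smooth_cmult: "smooth f \<Longrightarrow> smooth (\<lambda>x. c * f x)"
  by (intro smooth_mult) auto

lemma smooth_diff: "smooth f \<Longrightarrow> smooth g \<Longrightarrow> smooth (\<lambda>x. f x - g x)"
  using smooth_add[of f "\<lambda>x. (-1) * g x"] smooth_cmult[of g "-1"] by simp

lemma smooth_sum: "(\<And>i. i \<in> I \<Longrightarrow> smooth (f i)) \<Longrightarrow> smooth (\<lambda>x. \<Sum>i\<in>I. f i x)"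
  by (induction I rule: infinite_finite_induct) (auto intro: smooth_add)

lemma smooth_prod: "(\<And>i. i \<in> I \<Longrightarrow> smooth (f i)) \<Longrightarrow> smooth (\<lambda>x. \<Prod>i\<in>I. f i x)"
  by (induction I rule: infinite_finite_induct) (auto intro: smooth_mult)

lemma smooth_differentiable: "smooth f \<Longrightarrow> f differentiable at x"
  unfolding smooth_def by (metis iter_partial_Nil)

lemma smooth_iter_partial: "smooth f \<Longrightarrow> smooth (iter_partial is f)"
  unfolding smooth_def by (metis iter_partial_append)

lemma smooth_partial: "smooth f \<Longrightarrow> smooth (partial_deriv i f)"
  using smooth_iter_partial[of f "[i]"] by (simp add: iter_partial_Cons)

lemma smooth_continuous_on: "smooth f \<Longrightarrow> continuous_on S f"
  by (meson continuous_at_imp_continuous_on differentiable_imp_continuous_within smooth_differentiable)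

lemma smooth_borel: "smooth f \<Longrightarrow> f \<in> borel_measurable borel"
  by (intro borel_measurable_continuous_onI smooth_continuous_on)

lemma smooth_partial_add:
  "smooth f \<Longrightarrow> smooth g \<Longrightarrow> partial_deriv i (\<lambda>x. f x + g x) = (\<lambda>x. partial_deriv i f x + partial_deriv i g x)"
  by (intro ext partial_deriv_add smooth_differentiable)

lemma smooth_partial_mult:
  "smooth f \<Longrightarrow> smooth g \<Longrightarrow> partial_deriv i (\<lambda>x. f x * g x) = (\<lambda>x. partial_deriv i f x * g x + f x * partial_deriv i g x)"
  by (intro ext partial_deriv_mult smooth_differentiable)

lemma smooth_partial_cmult:
  "smooth f \<Longrightarrow> partial_deriv i (\<lambda>x. c * f x) = (\<lambda>x. c * partial_deriv i f x)"
  by (subst smooth_partial_mult) auto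

lemma smooth_partial_sum:
  "(\<And>i. i \<in> I \<Longrightarrow> smooth (f i)) \<Longrightarrow> partial_deriv j (\<lambda>x. \<Sum>i\<in>I. f i x) = (\<lambda>x. \<Sum>i\<in>I. partial_deriv j (f i) x)"
  by (induction I rule: infinite_finite_induct) (auto simp: smooth_partial_add smooth_sum)

lemma iter_partial_add:
  "smooth f \<Longrightarrow> smooth g \<Longrightarrow> iter_partial is (\<lambda>x. f x + g x) = (\<lambda>x. iter_partial is f x + iter_partial is g x)"
  by (induction "is") (auto simp: iter_partial_Cons smooth_partial_add smooth_iter_partial)

lemma iter_partial_cmult:
  "smooth f \<Longrightarrow> iter_partial is (\<lambda>x. c * f x) = (\<lambda>x. c * iter_partial is f x)"
  by (induction "is") (auto simp: iter_partial_Cons smooth_partial_cmult smooth_iter_partial)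

lemma iter_partial_sum:
  "(\<And>i. i \<in> I \<Longrightarrow> smooth (f i)) \<Longrightarrow> iter_partial js (\<lambda>x. \<Sum>i\<in>I. f i x) = (\<lambda>x. \<Sum>i\<in>I. iter_partial js (f i) x)"
  by (induction js) (auto simp: iter_partial_Cons smooth_partial_sum smooth_iter_partial)

lemma iter_partial_zero: "iter_partial is (\<lambda>x. 0) = (\<lambda>x. 0)"
  by (induction "is") (auto simp: iter_partial_Cons)

lemma differentiable_affine:
  fixes f :: "real ^ 'd::finite \<Rightarrow> real"
  assumes "\<And>x. f differentiable at x"
  shows "(\<lambda>x. f (a + c *\<^sub>R x)) differentiable at x"
proof -
  have "(f \<circ> (\<lambda>x. a + c *\<^sub>R x)) differentiable at x"
    by (intro differentiable_chain_at assms) simp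
  then show ?thesis by (simp add: o_def)
qed

lemma differentiable_times_affine:
  "differentiable_times n f \<Longrightarrow> differentiable_times n (\<lambda>x. f (a + c *\<^sub>R x))"
proof (induction n arbitrary: f)
  case (Suc n)
  have "partial_deriv i (\<lambda>x. f (a + c *\<^sub>R x)) = (\<lambda>x. c * partial_deriv i f (a + c *\<^sub>R x))" for i
    using Suc.prems by (intro ext partial_deriv_affine) auto
  moreover have "differentiable_times n (\<lambda>x. c * partial_deriv i f (a + c *\<^sub>R x))" for i
    using Suc.prems by (intro differentiable_times_mult[OF differentiable_times_const Suc.IH]) auto
  moreover have "(\<lambda>x. f (a + c *\<^sub>R x)) differentiable at x" for x
    by (rule differentiable_affine) (use Suc.prems in auto)
  ultimately show ?case by simp
next
  case 0
  then show ?case using differentiable_affine[of f a c] by simp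
qed

lemma smooth_affine: "smooth f \<Longrightarrow> smooth (\<lambda>x. f (a + c *\<^sub>R x))"
  by (simp add: smooth_iff differentiable_times_affine)

lemma iter_partial_affine:
  "smooth f \<Longrightarrow> iter_partial is (\<lambda>x. f (a + c *\<^sub>R x)) = (\<lambda>x. c ^ length is * iter_partial is f (a + c *\<^sub>R x))"
proof (induction "is")
  case (Cons i js)
  have "partial_deriv i (\<lambda>x. iter_partial js f (a + c *\<^sub>R x)) = (\<lambda>x. c * iter_partial (i # js) f (a + c *\<^sub>R x))"
    unfolding iter_partial_Cons
    by (intro ext partial_deriv_affine smooth_differentiable smooth_iter_partial Cons.prems)
  then show ?case
    using Cons by (simp add: iter_partial_Cons smooth_partial_cmult smooth_affine smooth_iter_partial mult_ac)
qed simp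

text \<open>Both mixed partials are limits of the second difference quotient, by two applications of the
  mean value theorem.\<close>

lemma second_difference_mvt:
  fixes f :: "real ^ 'd::finite \<Rightarrow> real"
  assumes f: "smooth f" and t: "t > 0"
  obtains \<xi> \<eta> where "0 < \<xi>" "\<xi> < t" "0 < \<eta>" "\<eta> < t"
    "f (x + t *\<^sub>R axis i 1 + t *\<^sub>R axis j 1) - f (x + t *\<^sub>R axis i 1) - f (x + t *\<^sub>R axis j 1) + f x
      = t\<^sup>2 * partial_deriv j (partial_deriv i f) (x + \<xi> *\<^sub>R axis i 1 + \<eta> *\<^sub>R axis j 1)"
proof -
  define g where "g s = f ((x + t *\<^sub>R axis j 1) + s *\<^sub>R axis i 1) - f (x + s *\<^sub>R axis i 1)" for s
  define g' where "g' s = partial_deriv i f ((x + t *\<^sub>R axis j 1) + s *\<^sub>R axis i 1) - partial_deriv i f (x + s *\<^sub>R axis i 1)" for s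
  have "(g has_real_derivative g' s) (at s)" for s
    unfolding g_def g'_def
    by (intro DERIV_diff differentiable_along_axis smooth_differentiable f)
  then obtain \<xi> where \<xi>: "0 < \<xi>" "\<xi> < t" "g t - g 0 = (t - 0) * g' \<xi>"
    using MVT2[OF t, of g g'] by blast
  define k where "k s = partial_deriv i f ((x + \<xi> *\<^sub>R axis i 1) + s *\<^sub>R axis j 1)" for s
  define k' where "k' s = partial_deriv j (partial_deriv i f) ((x + \<xi> *\<^sub>R axis i 1) + s *\<^sub>R axis j 1)" for s
  have "(k has_real_derivative k' s) (at s)" for s
    unfolding k_def k'_def
    by (intro differentiable_along_axis smooth_differentiable smooth_partial f)
  then obtain \<eta> where \<eta>: "0 < \<eta>" "\<eta> < t" "k t - k 0 = (t - 0) * k' \<eta>"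
    using MVT2[OF t, of k k'] by blast
  have "g' \<xi> = k t - k 0" by (simp add: g'_def k_def add_ac)
  then have "g t - g 0 = t * (t * k' \<eta>)" using \<xi>(3) \<eta>(3) by simp
  with \<xi>(1,2) \<eta>(1,2) show thesis
    by (intro that[of \<xi> \<eta>]) (auto simp: g_def k'_def power2_eq_square add_ac)
qed

lemma smooth_partial_commute:
  fixes f :: "real ^ 'd::finite \<Rightarrow> real"
  assumes f: "smooth f"
  shows "partial_deriv i (partial_deriv j f) = partial_deriv j (partial_deriv i f)"
proof (rule ext, rule ccontr)
  fix x
  let ?P = "partial_deriv i (partial_deriv j f)" and ?Q = "partial_deriv j (partial_deriv i f)"
  assume "?P x \<noteq> ?Q x"
  then have e: "\<bar>?P x - ?Q x\<bar> / 2 > 0" (is "?e > 0") by simp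
  have "isCont ?P x" "isCont ?Q x"
    by (auto intro!: differentiable_imp_continuous_within smooth_differentiable smooth_partial f)
  then obtain d1 d2 where d: "d1 > 0" "d2 > 0"
    "\<And>y. dist y x < d1 \<Longrightarrow> dist (?P y) (?P x) < ?e" "\<And>y. dist y x < d2 \<Longrightarrow> dist (?Q y) (?Q x) < ?e"
    unfolding continuous_at_eps_delta using e by metis
  \<comment> \<open>Half the smaller radius, since both intermediate points lie within
    \<open>2 * t\<close> of \<open>x\<close>.\<close>
  define t where "t = min d1 d2 / 2"
  have t: "t > 0" using d by (simp add: t_def)
  obtain \<xi> \<eta> where 1: "0 < \<xi>" "\<xi> < t" "0 < \<eta>" "\<eta> < t"
    "f (x + t *\<^sub>R axis i 1 + t *\<^sub>R axis j 1) - f (x + t *\<^sub>R axis i 1) - f (x + t *\<^sub>R axis j 1) + f x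
      = t\<^sup>2 * ?Q (x + \<xi> *\<^sub>R axis i 1 + \<eta> *\<^sub>R axis j 1)"
    using second_difference_mvt[OF f t] by metis
  obtain \<xi>' \<eta>' where 2: "0 < \<xi>'" "\<xi>' < t" "0 < \<eta>'" "\<eta>' < t"
    "f (x + t *\<^sub>R axis j 1 + t *\<^sub>R axis i 1) - f (x + t *\<^sub>R axis j 1) - f (x + t *\<^sub>R axis i 1) + f x
      = t\<^sup>2 * ?P (x + \<xi>' *\<^sub>R axis j 1 + \<eta>' *\<^sub>R axis i 1)"
    using second_difference_mvt[OF f t] by metis
  have "t\<^sup>2 * ?Q (x + \<xi> *\<^sub>R axis i 1 + \<eta> *\<^sub>R axis j 1) = t\<^sup>2 * ?P (x + \<xi>' *\<^sub>R axis j 1 + \<eta>' *\<^sub>R axis i 1)"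
  proof -
    have "f (x + t *\<^sub>R axis j 1 + t *\<^sub>R axis i 1) = f (x + t *\<^sub>R axis i 1 + t *\<^sub>R axis j 1)"
      by (simp add: add_ac)
    then show ?thesis using 1(5) 2(5) by linarith
  qed
  then have eq: "?Q (x + \<xi> *\<^sub>R axis i 1 + \<eta> *\<^sub>R axis j 1) = ?P (x + \<xi>' *\<^sub>R axis j 1 + \<eta>' *\<^sub>R axis i 1)"
    using t by simp
  have near: "dist (x + a *\<^sub>R axis k (1::real) + b *\<^sub>R axis l 1) x < 2 * t"
    if "0 < a" "a < t" "0 < b" "b < t" for a b k l
  proof -
    have "norm (a *\<^sub>R axis k (1::real) + b *\<^sub>R axis l 1 :: real ^ 'd) \<le> a + b"
      using that norm_triangle_ineq[of "a *\<^sub>R axis k (1::real)" "b *\<^sub>R axis l 1"] by (simp add: norm_axis_1)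
    then show ?thesis using that by (simp add: dist_norm add_ac)
  qed
  have "dist (?Q (x + \<xi> *\<^sub>R axis i 1 + \<eta> *\<^sub>R axis j 1)) (?Q x) < ?e"
    "dist (?P (x + \<xi>' *\<^sub>R axis j 1 + \<eta>' *\<^sub>R axis i 1)) (?P x) < ?e"
    using near[of \<xi> \<eta> i j] near[of \<xi>' \<eta>' j i] 1 2 d by (auto simp: t_def)
  then show False using eq by (auto simp: dist_real_def abs_if split: if_splits)
qed

lemma iter_partial_commute1:
  "smooth f \<Longrightarrow> iter_partial is (partial_deriv i f) = partial_deriv i (iter_partial is f)"
  by (induction "is") (auto simp: iter_partial_Cons smooth_partial_commute smooth_iter_partial)

lemma iter_partial_commute:
  "smooth f \<Longrightarrow> iter_partial is (iter_partial js f) = iter_partial js (iter_partial is f)"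
  by (induction js) (auto simp: iter_partial_Cons iter_partial_commute1 smooth_iter_partial)

text \<open>A permutation is undone one entry at a time: commutation moves the head of the first
  list to the front of the second.\<close>

lemma iter_partial_mset:
  "smooth f \<Longrightarrow> mset is = mset js \<Longrightarrow> iter_partial is f = iter_partial js f"
proof (induction "is" arbitrary: js)
  case (Cons i ks)
  then have "i \<in> set js" by (metis list.set_intros(1) mset_eq_setD)
  then obtain a b where js: "js = a @ i # b" by (meson split_list)
  then have "mset ks = mset (a @ b)" using Cons.prems by simp
  then have "iter_partial ks f = iter_partial a (iter_partial b f)"
    using Cons by (metis iter_partial_append)
  then show ?case
    using Cons.prems by (simp add: js iter_partial_Cons iter_partial_append iter_partial_commute1 smooth_iter_partial)
qed simp

section \<open>Lists of coordinates and multi-indices\<close>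

lemma ex_count_list: "\<exists>is. \<forall>i. count_list is i = (\<beta> :: 'd::finite \<Rightarrow> nat) i"
proof -
  define A where "A = Abs_multiset \<beta>"
  have "count A = \<beta>" unfolding A_def by (intro Abs_multiset_inverse) simp
  moreover obtain xs where "mset xs = A" by (meson ex_mset)
  ultimately show ?thesis by (metis count_mset)
qed

text \<open>Names the order of differentiation chosen inside \<open>mi_deriv\<close>, so that facts
  about coordinate lists apply to multi-indices.\<close>

definition mi_list :: "('d::finite \<Rightarrow> nat) \<Rightarrow> 'd list" where
  "mi_list \<beta> = (SOME is. \<forall>i. count_list is i = \<beta> i)"

lemma count_mi_list: "count_list (mi_list \<beta>) i = \<beta> i"
  unfolding mi_list_def using someI_ex[OF ex_count_list[of \<beta>]] by blast

lemma mi_deriv_eq: "mi_deriv \<beta> f = iter_partial (mi_list \<beta>) f"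
  by (simp add: mi_deriv_def mi_list_def)

lemma mi_order_eq_length: "mi_order (\<lambda>i. count_list is i) = length (is :: 'd::finite list)"
proof -
  have "(\<Sum>i\<in>UNIV. count_list is i) = (\<Sum>i\<in>set is. count_list is i)"
    by (rule sum.mono_neutral_right) (auto simp: count_list_0_iff)
  then show ?thesis by (simp add: mi_order_def sum_count_set)
qed

lemma length_mi_list: "length (mi_list \<beta>) = mi_order \<beta>"
  using mi_order_eq_length[of "mi_list \<beta>"] by (simp add: count_mi_list)

lemma mi_deriv_count_list:
  "smooth f \<Longrightarrow> mi_deriv (count_list is) f = iter_partial is f"
  unfolding mi_deriv_eq
  by (rule iter_partial_mset) (auto intro!: multiset_eqI simp: count_mset count_mi_list)

lemma finite_mi_order: "finite {\<beta> :: 'd::finite \<Rightarrow> nat. mi_order \<beta> \<le> n}"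
proof (rule finite_subset)
  show "{\<beta>. mi_order \<beta> \<le> n} \<subseteq> (\<lambda>is. count_list is) ` {is :: 'd list. set is \<subseteq> UNIV \<and> length is \<le> n}"
    by (force simp: image_iff length_mi_list count_mi_list intro!: exI[of _ "mi_list _"])
qed (intro finite_imageI finite_lists_length_le finite)

subsection \<open>The bump function\<close>

text \<open>The polynomial is a parameter because the functions p(1/t) exp(-1/t), extended by zero,
  form a family closed under differentiation.\<close>

definition exp_inv :: "real poly \<Rightarrow> real \<Rightarrow> real" where
  "exp_inv p t = (if t > 0 then poly p (1 / t) * exp (- (1 / t)) else 0)"

lemma poly_exp_tendsto_0: "((\<lambda>u::real. poly p u * exp (- u)) \<longlongrightarrow> 0) at_top"
proof -
  have "((\<lambda>u. \<Sum>i\<le>degree p. coeff p i * (u ^ i / exp u)) \<longlongrightarrow> (\<Sum>i\<le>degree p. coeff p i * 0)) at_top"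
    by (intro tendsto_sum tendsto_mult tendsto_const tendsto_power_div_exp_0)
  moreover have "(\<lambda>u. \<Sum>i\<le>degree p. coeff p i * (u ^ i / exp u)) = (\<lambda>u. poly p u * exp (- u))"
    by (simp add: poly_altdef sum_distrib_right exp_minus divide_inverse mult.assoc)
  ultimately show ?thesis by simp
qed

lemma exp_inv_tendsto_0: "((\<lambda>t. poly p (1 / t) * exp (- (1 / t))) \<longlongrightarrow> 0) (at_right (0::real))"
  using filterlim_compose[OF poly_exp_tendsto_0[of p] filterlim_inverse_at_top_right]
  by (simp add: inverse_eq_divide)

text \<open>With u = 1/t, the derivative of p(u) exp(-u) in t is u^2 (p - p')(u) exp(-u), which
  explains the polynomial. At 0 the quotient from the right is u p(u) exp(-u), which vanishes as u
  tends to infinity.\<close>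

lemma exp_inv_deriv:
  "(exp_inv p has_real_derivative exp_inv ([:0, 0, 1:] * (p - pderiv p)) t) (at t)"
proof -
  consider "t > 0" | "t < 0" | "t = 0" by linarith
  then show ?thesis
  proof cases
    case 1
    have "((\<lambda>t. poly p (1 / t) * exp (- (1 / t))) has_real_derivative
        exp_inv ([:0, 0, 1:] * (p - pderiv p)) t) (at t)"
      using 1 by (auto intro!: derivative_eq_intros DERIV_chain2[OF poly_DERIV]
          simp: exp_inv_def field_simps power2_eq_square)
    then show ?thesis
      by (rule has_field_derivative_transform_within_open[where S = "{0<..}"]) (use 1 in \<open>auto simp: exp_inv_def\<close>)
  next
    case 2
    have "((\<lambda>t. 0) has_real_derivative exp_inv ([:0, 0, 1:] * (p - pderiv p)) t) (at t)"
      using 2 by (simp add: exp_inv_def)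
    then show ?thesis
      by (rule has_field_derivative_transform_within_open[where S = "{..<0}"]) (use 2 in \<open>auto simp: exp_inv_def\<close>)
  next
    case 3
    have "((\<lambda>h. exp_inv p h / h) \<longlongrightarrow> 0) (at_right 0)"
      using exp_inv_tendsto_0[of "[:0, 1:] * p"]
      by (rule Lim_transform_eventually) (auto simp: exp_inv_def eventually_at_right_less
          intro!: eventually_mono[OF eventually_at_right_less])
    moreover have "((\<lambda>h. exp_inv p h / h) \<longlongrightarrow> 0) (at_left 0)"
      using tendsto_const[of 0]
      by (rule Lim_transform_eventually)
        (auto simp: exp_inv_def eventually_at intro!: exI[of _ 1])
    ultimately have "((\<lambda>h. exp_inv p h / h) \<longlongrightarrow> 0) (at 0)"
      by (simp add: filterlim_split_at)
    then show ?thesis using 3 by (simp add: DERIV_def exp_inv_def[of _ 0])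
  qed
qed

text \<open>The chain rule yields a factor of the same family times a derivative of
  \<open>q\<close>, so the induction runs over all polynomials at once.\<close>

lemma smooth_exp_inv_comp:
  assumes q: "smooth q"
  shows "smooth (\<lambda>x. exp_inv p (q x))"
proof -
  have D: "((\<lambda>x. exp_inv p (q x)) has_derivative
      (\<lambda>h. exp_inv ([:0, 0, 1:] * (p - pderiv p)) (q x) * (\<Sum>i\<in>UNIV. vec_nth h i * partial_deriv i q x))) (at x)" for p x
    using DERIV_compose_FDERIV[OF exp_inv_deriv differentiable_has_derivative_partials[OF smooth_differentiable[OF q]]]
    by (simp add: mult.commute)
  have P: "partial_deriv i (\<lambda>x. exp_inv p (q x)) = (\<lambda>x. exp_inv ([:0, 0, 1:] * (p - pderiv p)) (q x) * partial_deriv i q x)" for p i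
    by (rule ext) (simp add: has_derivative_partial[OF D] axis_def if_distrib if_distribR cong: if_cong)
  have "differentiable_times n (\<lambda>x. exp_inv p (q x))" for n p
  proof (induction n arbitrary: p)
    case 0 show ?case using D by (auto simp: differentiable_def)
  next
    case (Suc n)
    have "differentiable_times n (partial_deriv i q)" for i
      using smooth_partial[OF q] by (simp add: smooth_iff)
    then show ?case using D Suc.IH by (auto simp: P differentiable_def intro!: differentiable_times_mult)
  qed
  then show ?thesis by (simp add: smooth_iff)
qed

lemma exp_inv_1: "exp_inv 1 t = (if t > 0 then exp (- (1 / t)) else 0)"
  by (simp add: exp_inv_def)

definition bump :: "real ^ 'd::finite \<Rightarrow> real" where
  "bump y = exp_inv 1 (1 - (norm y)\<^sup>2)"

lemma smooth_bump: "smooth bump"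
proof -
  have "smooth (\<lambda>y :: real ^ 'a. 1 - (\<Sum>i\<in>UNIV. vec_nth y i * vec_nth y i))"
    by (intro smooth_diff smooth_sum smooth_mult) auto
  moreover have "(norm y)\<^sup>2 = (\<Sum>i\<in>UNIV. vec_nth y i * vec_nth y i)" for y :: "real ^ 'a"
    by (simp add: power2_norm_eq_inner inner_vec_def)
  ultimately show ?thesis unfolding bump_def by (simp add: smooth_exp_inv_comp)
qed

lemma bump_nonneg: "bump y \<ge> 0"
  by (simp add: bump_def exp_inv_1)

lemma bump_pos: "norm y < 1 \<Longrightarrow> bump y > 0"
  by (simp add: bump_def exp_inv_1 power_less_one_iff)

lemma bump_zero: "norm y \<ge> 1 \<Longrightarrow> bump y = 0"
  by (simp add: bump_def exp_inv_1 power_less_one_iff)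

subsection \<open>The dilation operator\<close>

text \<open>The dilation operator is the divergence of \<open>y f(y)\<close>. Since
  \<open>t \<partial>\<^sub>t [t\<^sup>-\<^sup>d \<kappa>(y/t)] = - t\<^sup>-\<^sup>d (euler \<kappa>)(y/t)\<close>, it governs how a mollification changes with the scale.\<close>

definition euler :: "(real ^ 'd::finite \<Rightarrow> real) \<Rightarrow> real ^ 'd \<Rightarrow> real" where
  "euler f y = (\<Sum>i\<in>UNIV. partial_deriv i (\<lambda>z. vec_nth z i * f z) y)"

lemma smooth_coord_mult: "smooth f \<Longrightarrow> smooth (\<lambda>y. vec_nth y i * f y)"
  by (intro smooth_mult smooth_coord)

lemma smooth_euler: "smooth f \<Longrightarrow> smooth (euler f)"
  unfolding euler_def[abs_def] by (intro smooth_sum smooth_partial smooth_coord_mult)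

lemma partial_coord_mult:
  "smooth f \<Longrightarrow> partial_deriv j (\<lambda>y. vec_nth y i * f y) =
    (\<lambda>y. (if j = i then f y else 0) + vec_nth y i * partial_deriv j f y)"
  by (subst smooth_partial_mult) (auto simp: partial_deriv_coord fun_eq_iff)

lemma euler_eq:
  fixes f :: "real ^ 'd::finite \<Rightarrow> real"
  assumes "smooth f"
  shows "euler f = (\<lambda>y. real CARD('d) * f y + (\<Sum>i\<in>UNIV. vec_nth y i * partial_deriv i f y))"
  by (rule ext) (simp add: euler_def partial_coord_mult[OF assms] sum.distrib)

lemma euler_add: "smooth f \<Longrightarrow> smooth g \<Longrightarrow> euler (\<lambda>y. f y + g y) = (\<lambda>y. euler f y + euler g y)"
  by (auto simp: euler_eq smooth_add smooth_partial_add fun_eq_iff algebra_simps sum.distrib)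

lemma euler_cmult: "smooth f \<Longrightarrow> euler (\<lambda>y. c * f y) = (\<lambda>y. c * euler f y)"
  by (auto simp: euler_eq smooth_cmult smooth_partial_cmult fun_eq_iff algebra_simps sum_distrib_left)

lemma euler_zero: "euler (\<lambda>y. 0) = (\<lambda>y. 0)"
  by (rule ext) (simp add: euler_def)

lemma euler_sum:
  "(\<And>i. i \<in> I \<Longrightarrow> smooth (f i)) \<Longrightarrow> euler (\<lambda>y. \<Sum>i\<in>I. f i y) = (\<lambda>y. \<Sum>i\<in>I. euler (f i) y)"
  by (induction I rule: infinite_finite_induct) (auto simp: euler_add smooth_sum euler_zero)

text \<open>The commutator of a partial derivative with y . grad is that derivative, so every
  derivative shifts the dilation operator by one.\<close>

lemma partial_euler:
  fixes f :: "real ^ 'd::finite \<Rightarrow> real"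
  assumes f: "smooth f"
  shows "partial_deriv j (euler f) = (\<lambda>y. euler (partial_deriv j f) y + partial_deriv j f y)"
proof -
  have "partial_deriv j (euler f) = (\<lambda>y. real CARD('d) * partial_deriv j f y +
      (\<Sum>i\<in>UNIV. (if j = i then partial_deriv i f y else 0) + vec_nth y i * partial_deriv j (partial_deriv i f) y))"
    unfolding euler_eq[OF f]
    by (simp add: smooth_partial_add smooth_cmult smooth_sum smooth_coord_mult smooth_partial f
        smooth_partial_cmult smooth_partial_sum partial_coord_mult)
  also have "\<dots> = (\<lambda>y. euler (partial_deriv j f) y + partial_deriv j f y)"
    by (auto simp: fun_eq_iff euler_eq smooth_partial f sum.distrib smooth_partial_commute[OF f, of j])
  finally show ?thesis .
qed

lemma iter_partial_euler:
  assumes f: "smooth f"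
  shows "iter_partial is (euler f) = (\<lambda>y. euler (iter_partial is f) y + real (length is) * iter_partial is f y)"
proof (induction "is")
  case (Cons i js)
  show ?case
    by (simp add: iter_partial_Cons Cons.IH smooth_partial_add smooth_euler smooth_iter_partial f
        smooth_cmult smooth_partial_cmult partial_euler algebra_simps)
qed simp

text \<open>The operator product (E + k) ... (E + 1) with E = \<open>euler\<close>. Each shift is
  the commutator of E with the derivatives already produced, plus one to absorb a new
  divergence.\<close>

primrec kern :: "nat \<Rightarrow> (real ^ 'd::finite \<Rightarrow> real) \<Rightarrow> real ^ 'd \<Rightarrow> real" where
  "kern 0 \<phi> = \<phi>"
| "kern (Suc k) \<phi> = (\<lambda>y. euler (kern k \<phi>) y + real (Suc k) * kern k \<phi> y)"

lemma smooth_kern: "smooth \<phi> \<Longrightarrow> smooth (kern k \<phi>)"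
  by (induction k) (auto intro!: smooth_add smooth_euler smooth_mult)

definition monom_mult :: "'d::finite list \<Rightarrow> (real ^ 'd \<Rightarrow> real) \<Rightarrow> real ^ 'd \<Rightarrow> real" where
  "monom_mult js \<phi> y = prod_list (map (vec_nth y) js) * \<phi> y"

lemma monom_mult_Nil: "monom_mult [] \<phi> = \<phi>"
  by (simp add: monom_mult_def fun_eq_iff)

lemma monom_mult_Cons: "monom_mult (j # js) \<phi> = (\<lambda>y. vec_nth y j * monom_mult js \<phi> y)"
  by (simp add: monom_mult_def fun_eq_iff)

lemma smooth_monom_mult: "smooth \<phi> \<Longrightarrow> smooth (monom_mult js \<phi>)"
  by (induction js) (auto simp: monom_mult_Nil monom_mult_Cons intro: smooth_coord_mult)

lemma sum_lists_Suc:
  "(\<Sum>js | length js = Suc k. f js) = (\<Sum>j\<in>(UNIV :: 'd::finite set). \<Sum>js | length js = k. f (j # js))"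
proof -
  have eq: "{js :: 'd list. length js = Suc k} = (\<lambda>(j, js). j # js) ` (UNIV \<times> {js. length js = k})"
    by (auto simp: length_Suc_conv image_iff)
  have "inj_on (\<lambda>(j, js). j # js) (UNIV \<times> {js :: 'd list. length js = k})"
    by (auto simp: inj_on_def)
  then show ?thesis
    unfolding eq by (subst sum.reindex) (auto simp: sum.cartesian_product intro!: sum.cong)
qed

text \<open>The choice of \<open>kern k\<close> makes its dilation derivative a combination of derivatives of order \<open>k\<close>.\<close>

lemma euler_kern:
  fixes \<phi> :: "real ^ 'd::finite \<Rightarrow> real"
  assumes \<phi>: "smooth \<phi>"
  shows "euler (kern k \<phi>) = (\<lambda>y. \<Sum>js | length js = k. iter_partial js (euler (monom_mult js \<phi>)) y)"
proof (induction k)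
  case 0
  then show ?case by (simp add: monom_mult_Nil)
next
  case (Suc k)
  let ?\<chi> = "\<lambda>js. monom_mult js \<phi>"
  have s: "smooth (?\<chi> js)" for js by (rule smooth_monom_mult[OF \<phi>])
  \<comment> \<open>Of the shift \<open>Suc k\<close>, the part \<open>k\<close> lets the outer
    \<open>euler\<close> pass the \<open>k\<close> derivatives; the remaining 1 is spent on the new
    derivative.\<close>
  have step: "euler (iter_partial js (euler (?\<chi> js))) y + real (Suc k) * iter_partial js (euler (?\<chi> js)) y
      = (\<Sum>j\<in>UNIV. iter_partial (j # js) (euler (?\<chi> (j # js))) y)"
    if len: "length js = k" for js y
  proof -
    let ?e = "euler (?\<chi> js)"
    have s1: "smooth ?e" by (intro smooth_euler s)
    have "euler (iter_partial js ?e) y + real (Suc k) * iter_partial js ?e y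
        = iter_partial js (euler ?e) y + iter_partial js ?e y"
      using len by (simp add: iter_partial_euler[OF s1] algebra_simps)
    also have "\<dots> = iter_partial js (\<lambda>y. euler ?e y + ?e y) y"
      by (simp add: iter_partial_add smooth_euler s1)
    \<comment> \<open>\<open>?e\<close> is itself a divergence, and the spare 1 is the commutator of
      \<open>euler\<close> with the outer derivative of that divergence. So this derivative comes
      out and the order rises by one.\<close>
    also have "(\<lambda>y. euler ?e y + ?e y) = (\<lambda>y. \<Sum>j\<in>UNIV. partial_deriv j (euler (?\<chi> (j # js))) y)"
    proof -
      have "euler ?e = (\<lambda>y. \<Sum>j\<in>UNIV. euler (partial_deriv j (?\<chi> (j # js))) y)"
      proof -
        have "?e = (\<lambda>y. \<Sum>j\<in>UNIV. partial_deriv j (?\<chi> (j # js)) y)"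
          by (simp add: euler_def fun_eq_iff monom_mult_Cons)
        then have "euler ?e = euler (\<lambda>y. \<Sum>j\<in>UNIV. partial_deriv j (?\<chi> (j # js)) y)" by simp
        also have "\<dots> = (\<lambda>y. \<Sum>j\<in>UNIV. euler (partial_deriv j (?\<chi> (j # js))) y)"
          by (intro euler_sum smooth_partial s)
        finally show ?thesis .
      qed
      moreover have "?e = (\<lambda>y. \<Sum>j\<in>UNIV. partial_deriv j (?\<chi> (j # js)) y)"
        by (simp add: euler_def fun_eq_iff monom_mult_Cons)
      ultimately have "euler ?e y = (\<Sum>j\<in>UNIV. euler (partial_deriv j (?\<chi> (j # js))) y)"
        "?e y = (\<Sum>j\<in>UNIV. partial_deriv j (?\<chi> (j # js)) y)" for y
        by (metis (no_types, lifting))+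
      then show ?thesis
        by (intro ext) (simp only: partial_euler[OF s] sum.distrib)
    qed
    also have "iter_partial js \<dots> y = (\<Sum>j\<in>UNIV. iter_partial (j # js) (euler (?\<chi> (j # js))) y)"
      by (simp add: iter_partial_sum smooth_partial smooth_euler s iter_partial_commute1 iter_partial_Cons)
    finally show ?thesis .
  qed
  have "euler (kern (Suc k) \<phi>) y = euler (euler (kern k \<phi>)) y + real (Suc k) * euler (kern k \<phi>) y" for y
    by (simp only: kern.simps) (simp add: euler_add euler_cmult smooth_euler smooth_kern \<phi> smooth_cmult del: of_nat_Suc)
  also have "\<dots> y = (\<Sum>js | length js = k. euler (iter_partial js (euler (?\<chi> js))) y +
      real (Suc k) * iter_partial js (euler (?\<chi> js)) y)" for y
    unfolding Suc.IH
    by (simp add: euler_sum smooth_iter_partial smooth_euler s sum_distrib_left sum.distrib del: of_nat_Suc)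
  also have "\<dots> y = (\<Sum>js | length js = k. \<Sum>j\<in>UNIV. iter_partial (j # js) (euler (?\<chi> (j # js))) y)" for y
    by (intro sum.cong refl) (use step in auto)
  also have "\<dots> y = (\<Sum>js | length js = Suc k. iter_partial js (euler (?\<chi> js)) y)" for y
    by (subst sum.swap) (simp add: sum_lists_Suc)
  finally show ?case by (intro ext)
qed

subsection \<open>Supports and uniformly bounded families\<close>

definition supp_in :: "(real ^ 'd::finite) set \<Rightarrow> (real ^ 'd \<Rightarrow> real) \<Rightarrow> bool" where
  "supp_in S f \<longleftrightarrow> (\<forall>y. y \<notin> S \<longrightarrow> f y = 0)"

lemma supp_in_iter_partial:
  assumes "supp_in S f" "closed S"
  shows "supp_in S (iter_partial is f)"
  unfolding supp_in_def
proof (intro allI impI)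
  fix y assume "y \<notin> S"
  then have "iter_partial is f y = iter_partial is (\<lambda>x. 0) y"
    using assms by (intro iter_partial_cong_on[of "- S"]) (auto simp: supp_in_def)
  then show "iter_partial is f y = 0" by (simp add: iter_partial_zero)
qed

lemma supp_in_partial: "supp_in S f \<Longrightarrow> closed S \<Longrightarrow> supp_in S (partial_deriv i f)"
  using supp_in_iter_partial[of S f "[i]"] by (simp add: iter_partial_Cons)

lemma supp_in_euler: "supp_in S f \<Longrightarrow> smooth f \<Longrightarrow> closed S \<Longrightarrow> supp_in S (euler f)"
  using supp_in_partial[of S f] by (auto simp: supp_in_def euler_eq)

lemma supp_in_kern: "supp_in S \<phi> \<Longrightarrow> smooth \<phi> \<Longrightarrow> closed S \<Longrightarrow> supp_in S (kern k \<phi>)"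
proof (induction k)
  case (Suc k)
  then have "supp_in S (kern k \<phi>)" "supp_in S (euler (kern k \<phi>))"
    by (auto intro: supp_in_euler smooth_kern)
  then show ?case by (simp add: supp_in_def)
qed simp

lemma supp_in_monom_mult: "supp_in S \<phi> \<Longrightarrow> supp_in S (monom_mult js \<phi>)"
  by (simp add: supp_in_def monom_mult_def)

text \<open>The parameter will be the point at which a function is evaluated: each point gets its
  own mollifier, and the bounds must not depend on it.\<close>

definition smooth_family :: "'b set \<Rightarrow> ('b \<Rightarrow> real ^ 'd::finite \<Rightarrow> real) \<Rightarrow> bool" where
  "smooth_family T F \<longleftrightarrow> (\<forall>x\<in>T. smooth (F x)) \<and> (\<exists>R. \<forall>x\<in>T. supp_in (cball 0 R) (F x)) \<and>
     (\<forall>is. \<exists>C. \<forall>x\<in>T. \<forall>y. \<bar>iter_partial is (F x) y\<bar> \<le> C)"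

lemma smooth_familyD: "smooth_family T F \<Longrightarrow> x \<in> T \<Longrightarrow> smooth (F x)"
  by (simp add: smooth_family_def)

lemma smooth_family_bounded:
  assumes "smooth_family T F" obtains C where "C \<ge> 0" "\<And>x y. x \<in> T \<Longrightarrow> \<bar>F x y\<bar> \<le> C"
proof -
  obtain C where "\<forall>x\<in>T. \<forall>y. \<bar>iter_partial [] (F x) y\<bar> \<le> C"
    using assms unfolding smooth_family_def by blast
  then have "\<bar>F x y\<bar> \<le> \<bar>C\<bar>" if "x \<in> T" for x y
    using that by (metis abs_ge_self iter_partial_Nil order_trans)
  then show thesis by (intro that[of "\<bar>C\<bar>"]) auto
qed

lemma smooth_family_partial: "smooth_family T F \<Longrightarrow> smooth_family T (\<lambda>x. partial_deriv i (F x))"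
  unfolding smooth_family_def
  by (metis smooth_partial supp_in_partial closed_cball iter_partial_snoc)

lemma smooth_family_iter_partial: "smooth_family T F \<Longrightarrow> smooth_family T (\<lambda>x. iter_partial is (F x))"
  by (induction "is") (auto simp: iter_partial_Cons intro: smooth_family_partial)

lemma smooth_family_add:
  assumes F: "smooth_family T F" and G: "smooth_family T G"
  shows "smooth_family T (\<lambda>x y. F x y + G x y)"
  unfolding smooth_family_def
proof (intro conjI ballI allI)
  show "smooth (\<lambda>y. F x y + G x y)" if "x \<in> T" for x
    using F G that by (intro smooth_add) (auto dest: smooth_familyD)
  obtain R1 R2 where R: "\<forall>x\<in>T. supp_in (cball 0 R1) (F x)" "\<forall>x\<in>T. supp_in (cball 0 R2) (G x)"
    using F G unfolding smooth_family_def by metis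
  then show "\<exists>R. \<forall>x\<in>T. supp_in (cball 0 R) (\<lambda>y. F x y + G x y)"
    by (intro exI[of _ "max R1 R2"]) (auto simp: supp_in_def)
  fix "is"
  obtain C1 C2 where C: "\<forall>x\<in>T. \<forall>y. \<bar>iter_partial is (F x) y\<bar> \<le> C1" "\<forall>x\<in>T. \<forall>y. \<bar>iter_partial is (G x) y\<bar> \<le> C2"
    using F G unfolding smooth_family_def by metis
  have "\<bar>iter_partial is (\<lambda>y. F x y + G x y) y\<bar> \<le> C1 + C2" if "x \<in> T" for x y
    using C that F G iter_partial_add[of "F x" "G x" "is"]
    by (auto dest!: smooth_familyD intro!: order_trans[OF abs_triangle_ineq] add_mono)
  then show "\<exists>C. \<forall>x\<in>T. \<forall>y. \<bar>iter_partial is (\<lambda>y. F x y + G x y) y\<bar> \<le> C" by blast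
qed

lemma smooth_family_zero: "smooth_family T (\<lambda>x y. 0)"
  by (auto simp: smooth_family_def supp_in_def iter_partial_zero)

lemma smooth_family_cmult:
  assumes F: "smooth_family T F" shows "smooth_family T (\<lambda>x y. c * F x y)"
  unfolding smooth_family_def
proof (intro conjI ballI allI)
  show "smooth (\<lambda>y. c * F x y)" if "x \<in> T" for x
    using F that by (intro smooth_cmult) (auto dest: smooth_familyD)
  show "\<exists>R. \<forall>x\<in>T. supp_in (cball 0 R) (\<lambda>y. c * F x y)"
    using F by (fastforce simp: smooth_family_def supp_in_def)
  fix "is"
  obtain C where C: "\<forall>x\<in>T. \<forall>y. \<bar>iter_partial is (F x) y\<bar> \<le> C"
    using F unfolding smooth_family_def by metis
  have "\<bar>iter_partial is (\<lambda>y. c * F x y) y\<bar> \<le> \<bar>c\<bar> * C" if "x \<in> T" for x y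
    using C that smooth_familyD[OF F that] by (auto simp: iter_partial_cmult abs_mult intro!: mult_left_mono)
  then show "\<exists>C. \<forall>x\<in>T. \<forall>y. \<bar>iter_partial is (\<lambda>y. c * F x y) y\<bar> \<le> C" by blast
qed

lemma smooth_family_sum:
  "(\<And>i. i \<in> I \<Longrightarrow> smooth_family T (F i)) \<Longrightarrow> smooth_family T (\<lambda>x y. \<Sum>i\<in>I. F i x y)"
  by (induction I rule: infinite_finite_induct) (auto intro: smooth_family_add smooth_family_zero)

text \<open>The common support bounds the coordinate. For derivatives, the induction strips the
  innermost one; the product rule leaves \<open>F\<close> and the family of its derivatives, which
  is why \<open>F\<close> is generalised.\<close>

lemma smooth_family_coord_mult:
  fixes F :: "'b \<Rightarrow> real ^ 'd::finite \<Rightarrow> real"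
  assumes F: "smooth_family T F" shows "smooth_family T (\<lambda>x y. vec_nth y i * F x y)"
  unfolding smooth_family_def
proof (intro conjI ballI allI)
  show "smooth (\<lambda>y. vec_nth y i * F x y)" if "x \<in> T" for x
    using F that by (intro smooth_coord_mult) (auto dest: smooth_familyD)
  obtain R where R: "\<forall>x\<in>T. supp_in (cball 0 R) (F x)"
    using F unfolding smooth_family_def by metis
  then show "\<exists>R. \<forall>x\<in>T. supp_in (cball 0 R) (\<lambda>y. vec_nth y i * F x y)"
    by (intro exI[of _ R]) (auto simp: supp_in_def)
  fix "is"
  show "\<exists>C. \<forall>x\<in>T. \<forall>y. \<bar>iter_partial is (\<lambda>y. vec_nth y i * F x y) y\<bar> \<le> C"
    using F
  proof (induction "is" arbitrary: F rule: rev_induct)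
    case Nil
    obtain R where R: "\<forall>x\<in>T. supp_in (cball 0 R) (F x)"
      using Nil unfolding smooth_family_def by metis
    obtain C where C: "C \<ge> 0" "\<And>x y. x \<in> T \<Longrightarrow> \<bar>F x y\<bar> \<le> C"
      by (rule smooth_family_bounded[OF Nil]) blast
    have "\<bar>vec_nth y i * F x y\<bar> \<le> \<bar>R\<bar> * C" if "x \<in> T" for x y
    proof (cases "F x y = 0")
      case False
      then have "norm y \<le> R" using R that by (auto simp: supp_in_def)
      then have "\<bar>vec_nth y i\<bar> \<le> \<bar>R\<bar>" using component_le_norm_cart[of y i] by linarith
      then show ?thesis using C(2)[OF that, of y] by (auto simp: abs_mult intro!: mult_mono)
    qed (use C in auto)
    then show ?case by auto
  next
    case (snoc j js)
    have "smooth_family T (\<lambda>x. partial_deriv j (F x))" by (rule smooth_family_partial[OF snoc.prems])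
    from snoc.IH[OF this] obtain C1 where
      C1: "\<forall>x\<in>T. \<forall>y. \<bar>iter_partial js (\<lambda>y. vec_nth y i * partial_deriv j (F x) y) y\<bar> \<le> C1" by blast
    have "smooth_family T (\<lambda>x y. (if j = i then 1 else 0) * F x y)"
      by (rule smooth_family_cmult[OF snoc.prems])
    then obtain C2 where
      C2: "\<forall>x\<in>T. \<forall>y. \<bar>iter_partial js (\<lambda>y. (if j = i then 1 else 0) * F x y) y\<bar> \<le> C2"
      unfolding smooth_family_def by blast
    have "\<bar>iter_partial (js @ [j]) (\<lambda>y. vec_nth y i * F x y) y\<bar> \<le> C2 + C1" if x: "x \<in> T" for x y
    proof -
      have s: "smooth (F x)" by (rule smooth_familyD[OF snoc.prems x])
      have "partial_deriv j (\<lambda>y. vec_nth y i * F x y) =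
          (\<lambda>y. (if j = i then 1 else 0) * F x y + vec_nth y i * partial_deriv j (F x) y)"
        by (auto simp: partial_coord_mult[OF s])
      then have "iter_partial (js @ [j]) (\<lambda>y. vec_nth y i * F x y) y =
          iter_partial js (\<lambda>y. (if j = i then 1 else 0) * F x y) y +
          iter_partial js (\<lambda>y. vec_nth y i * partial_deriv j (F x) y) y"
        by (simp only: iter_partial_snoc)
          (simp add: iter_partial_add[OF smooth_cmult[OF s] smooth_coord_mult[OF smooth_partial[OF s]]] del: mult_if_delta)
      then show ?thesis
        using C1 C2 x by (auto intro!: order_trans[OF abs_triangle_ineq] add_mono)
    qed
    then show ?case by blast
  qed
qed

lemma smooth_family_euler: "smooth_family T F \<Longrightarrow> smooth_family T (\<lambda>x. euler (F x))"
  unfolding euler_def[abs_def]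
  by (intro smooth_family_sum smooth_family_partial smooth_family_coord_mult)

lemma smooth_family_kern: "smooth_family T F \<Longrightarrow> smooth_family T (\<lambda>x. kern k (F x))"
  by (induction k) (auto intro!: smooth_family_add smooth_family_euler smooth_family_cmult simp del: of_nat_Suc)

lemma smooth_family_monom_mult: "smooth_family T F \<Longrightarrow> smooth_family T (\<lambda>x. monom_mult js (F x))"
  by (induction js) (auto simp: monom_mult_Nil monom_mult_Cons intro: smooth_family_coord_mult)

lemma smooth_continuous_bounded:
  assumes "smooth f" "supp_in (cball c R) f"
  obtains C where "C \<ge> 0" "\<And>y. \<bar>f y\<bar> \<le> C"
proof -
  have "bounded (f ` cball c R)"
    by (intro compact_imp_bounded compact_continuous_image smooth_continuous_on assms compact_cball)
  then obtain C where "\<forall>x\<in>f ` cball c R. norm x \<le> C"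
    unfolding bounded_iff by blast
  then have C: "\<And>y. y \<in> cball c R \<Longrightarrow> \<bar>f y\<bar> \<le> C"
    by auto
  show thesis
  proof (rule that[of "\<bar>C\<bar>"])
    fix y show "\<bar>f y\<bar> \<le> \<bar>C\<bar>"
      using C[of y] assms(2) by (cases "y \<in> cball c R") (auto simp: supp_in_def)
  qed simp
qed

text \<open>Translation preserves all bounds on derivatives; boundedness of the shifts serves the
  common support.\<close>

lemma smooth_family_translates:
  assumes f: "smooth f" "supp_in (cball c R) f" and p: "bounded (p ` T)"
  shows "smooth_family T (\<lambda>x y. f (p x + y))"
  unfolding smooth_family_def
proof (intro conjI ballI allI)
  show "smooth (\<lambda>y. f (p x + y))" for x
    using smooth_affine[OF f(1), of "p x" 1] by simp
  obtain B where B: "\<And>x. x \<in> T \<Longrightarrow> norm (p x) \<le> B" using p by (auto simp: bounded_iff)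
  have "norm y \<le> norm c + R + B" if x: "x \<in> T" and nz: "f (p x + y) \<noteq> 0" for x y
  proof -
    have "dist c (p x + y) \<le> R" using f(2) nz by (auto simp: supp_in_def)
    moreover have "y = c - (c - (p x + y)) - p x" by simp
    then have "norm y \<le> norm c + norm (c - (p x + y)) + norm (p x)"
      by (metis norm_triangle_ineq4 order_trans add_right_mono)
    ultimately show ?thesis using B[OF x] by (simp add: dist_norm)
  qed
  then show "\<exists>R. \<forall>x\<in>T. supp_in (cball 0 R) (\<lambda>y. f (p x + y))"
    by (intro exI[of _ "norm c + R + B"]) (auto simp: supp_in_def)
  fix "is"
  obtain C where C: "\<And>y. \<bar>iter_partial is f y\<bar> \<le> C"
    by (rule smooth_continuous_bounded[OF smooth_iter_partial[OF f(1)] supp_in_iter_partial[OF f(2)]]) auto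
  moreover have "iter_partial is (\<lambda>y. f (p x + y)) = (\<lambda>y. iter_partial is f (p x + y))" for x
    using iter_partial_affine[OF f(1), of "is" "p x" 1] by simp
  ultimately show "\<exists>C. \<forall>x\<in>T. \<forall>y. \<bar>iter_partial is (\<lambda>y. f (p x + y)) y\<bar> \<le> C"
    by auto
qed

subsection \<open>Integration\<close>

lemma smooth_integrable:
  assumes "smooth f" "supp_in (cball c R) f"
  shows "integrable lborel f"
proof -
  have "integrable lborel (\<lambda>x. indicator (cball c R) x *\<^sub>R f x)"
    by (intro borel_integrable_compact smooth_continuous_on assms compact_cball)
  moreover have "(\<lambda>x. indicator (cball c R) x *\<^sub>R f x) = f"
    using assms(2) by (auto simp: supp_in_def indicator_def fun_eq_iff)
  ultimately show ?thesis by simp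
qed

text \<open>Dominated convergence for the difference quotients: by the mean value inequality they
  obey the same bound \<open>D\<close> as the derivatives.\<close>

lemma has_real_derivative_lebesgue_integral:
  fixes g :: "real \<Rightarrow> 'a \<Rightarrow> real"
  assumes e: "e > 0"
    and int: "\<And>t. \<bar>t - t0\<bar> < e \<Longrightarrow> integrable M (g t)"
    and der: "\<And>t z. \<bar>t - t0\<bar> < e \<Longrightarrow> z \<in> space M \<Longrightarrow> ((\<lambda>t. g t z) has_real_derivative g' t z) (at t)"
    and bound: "\<And>t z. \<bar>t - t0\<bar> < e \<Longrightarrow> z \<in> space M \<Longrightarrow> \<bar>g' t z\<bar> \<le> D z"
    and D: "integrable M D" and meas: "g' t0 \<in> borel_measurable M"
  shows "((\<lambda>t. \<integral>z. g t z \<partial>M) has_real_derivative (\<integral>z. g' t0 z \<partial>M)) (at t0)"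
  unfolding has_field_derivative_iff tendsto_at_iff_sequentially
proof (intro allI impI)
  fix X :: "nat \<Rightarrow> real" assume X: "\<forall>i. X i \<in> UNIV - {t0}" "X \<longlonglongrightarrow> t0"
  have "\<forall>\<^sub>F n in sequentially. \<bar>X n - t0\<bar> < e"
    using tendstoD[OF X(2) e] by (simp add: dist_real_def)
  then obtain N where N: "\<And>n. n \<ge> N \<Longrightarrow> \<bar>X n - t0\<bar> < e" by (auto simp: eventually_sequentially)
  define q where "q n z = (g (X (n + N)) z - g t0 z) / (X (n + N) - t0)" for n z
  have i: "integrable M (g (X (n + N)))" "integrable M (g t0)" for n
    using int N e by auto
  have "(\<lambda>n. \<integral>z. q n z \<partial>M) \<longlonglongrightarrow> (\<integral>z. g' t0 z \<partial>M)"
  proof (rule integral_dominated_convergence[where w = D])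
    show "q n \<in> borel_measurable M" for n
      unfolding q_def using i by (intro borel_measurable_divide borel_measurable_diff) auto
    show "AE z in M. (\<lambda>n. q n z) \<longlonglongrightarrow> g' t0 z"
    proof (rule AE_I2)
      fix z assume "z \<in> space M"
      then have "((\<lambda>t. g t z) has_real_derivative g' t0 z) (at t0)" using der e by auto
      then have "((\<lambda>t. (g t z - g t0 z) / (t - t0)) \<circ> X) \<longlonglongrightarrow> g' t0 z"
        using X unfolding has_field_derivative_iff tendsto_at_iff_sequentially by blast
      from LIMSEQ_ignore_initial_segment[OF this, of N]
      show "(\<lambda>n. q n z) \<longlonglongrightarrow> g' t0 z" by (simp add: q_def o_def)
    qed
    show "AE z in M. norm (q n z) \<le> D z" for n
    proof (rule AE_I2)
      fix z assume z: "z \<in> space M"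
      let ?S = "{t0 - e<..<t0 + e}"
      have "norm (g (X (n + N)) z - g t0 z) \<le> D z * norm (X (n + N) - t0)"
      proof (rule field_differentiable_bound[where S = ?S])
        fix t assume "t \<in> ?S"
        then show "((\<lambda>t. g t z) has_field_derivative g' t z) (at t within ?S)" "norm (g' t z) \<le> D z"
          using der[OF _ z] bound[OF _ z] by (auto simp: abs_less_iff intro: has_field_derivative_at_within)
      qed (use N[of "n + N"] e in \<open>auto simp: abs_less_iff\<close>)
      then show "norm (q n z) \<le> D z"
        using X(1) by (simp add: q_def field_simps)
    qed
  qed (use D meas in auto)
  moreover have "(\<integral>z. q n z \<partial>M) = ((\<integral>z. g (X (n + N)) z \<partial>M) - (\<integral>z. g t0 z \<partial>M)) / (X (n + N) - t0)" for n
    unfolding q_def using i by simp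
  ultimately have "(\<lambda>n. ((\<integral>z. g (X (n + N)) z \<partial>M) - (\<integral>z. g t0 z \<partial>M)) / (X (n + N) - t0))
      \<longlonglongrightarrow> (\<integral>z. g' t0 z \<partial>M)" by simp
  from LIMSEQ_offset[OF this]
  show "((\<lambda>y. ((\<integral>z. g y z \<partial>M) - (\<integral>z. g t0 z \<partial>M)) / (y - t0)) \<circ> X) \<longlonglongrightarrow> (\<integral>z. g' t0 z \<partial>M)"
    by (simp add: o_def)
qed

text \<open>If \<open>f\<close> is not measurable, neither is its translate, and both integrals have
  the default value 0.\<close>

lemma integral_translate:
  fixes f :: "real ^ 'd::finite \<Rightarrow> real"
  shows "(\<integral>x. f (c + x) \<partial>lborel) = (\<integral>x. f x \<partial>lborel)"
proof cases
  assume "f \<in> borel_measurable borel"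
  then show ?thesis
    using integral_distr[of "(+) c" lborel borel f] by (simp add: lborel_distr_plus)
next
  assume n: "f \<notin> borel_measurable borel"
  have "(\<lambda>x. f (c + x)) \<notin> borel_measurable borel"
  proof
    assume "(\<lambda>x. f (c + x)) \<in> borel_measurable borel"
    then have "(\<lambda>x. f (c + x)) \<circ> (+) (- c) \<in> borel_measurable borel" by (rule measurable_comp[rotated]) simp
    then show False using n by (simp add: o_def)
  qed
  then have "\<not> integrable lborel f" "\<not> integrable lborel (\<lambda>x. f (c + x))"
    using n by (auto dest: borel_measurable_integrable)
  then show ?thesis by (simp add: not_integrable_integral_eq)
qed

text \<open>The integral of the translate f(x + t e) does not depend on t, and its derivative at t =
  0 is the integral of the partial derivative.\<close>

lemma integral_partial_zero:
  fixes f :: "real ^ 'd::finite \<Rightarrow> real"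
  assumes f: "smooth f" "supp_in (cball c R) f"
  shows "(\<integral>x. partial_deriv i f x \<partial>lborel) = 0"
proof -
  let ?e = "axis i (1::real) :: real ^ 'd"
  obtain C where C: "C \<ge> 0" "\<And>y. \<bar>partial_deriv i f y\<bar> \<le> C"
    by (rule smooth_continuous_bounded[OF smooth_partial[OF f(1)] supp_in_partial[OF f(2)]]) auto
  have sm: "smooth (\<lambda>x. f (x + t *\<^sub>R ?e))" "smooth (\<lambda>x. partial_deriv i f (x + t *\<^sub>R ?e))" for t
    using smooth_affine[OF f(1), of "t *\<^sub>R ?e" 1] smooth_affine[OF smooth_partial[OF f(1), of i], where a = "t *\<^sub>R ?e" and c = 1]
    by (simp_all add: add.commute)
  have "((\<lambda>t. \<integral>x. f (x + t *\<^sub>R ?e) \<partial>lborel) has_real_derivative (\<integral>x. partial_deriv i f (x + 0 *\<^sub>R ?e) \<partial>lborel)) (at 0)"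
  proof (rule has_real_derivative_lebesgue_integral[where e = 1 and D = "\<lambda>x. C * indicator (cball c (R + 1)) x"])
    fix t :: real assume t: "\<bar>t - 0\<bar> < 1"
    have near: "x \<in> cball c (R + 1)" if "x + t *\<^sub>R ?e \<in> cball c R" for x
    proof -
      have "norm (x - c) = norm ((x + t *\<^sub>R ?e - c) - t *\<^sub>R ?e)" by simp
      also have "\<dots> \<le> norm (x + t *\<^sub>R ?e - c) + norm (t *\<^sub>R ?e)" by (rule norm_triangle_ineq4)
      finally show ?thesis using that t by (simp add: dist_norm norm_minus_commute norm_axis_1)
    qed
    have "supp_in (cball c (R + 1)) (\<lambda>x. f (x + t *\<^sub>R ?e))"
      using near f(2) by (auto simp: supp_in_def)
    then show "integrable lborel (\<lambda>x. f (x + t *\<^sub>R ?e))" by (intro smooth_integrable sm)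
    fix x
    show "((\<lambda>t. f (x + t *\<^sub>R ?e)) has_real_derivative partial_deriv i f (x + t *\<^sub>R ?e)) (at t)"
      by (intro differentiable_along_axis smooth_differentiable f)
    show "\<bar>partial_deriv i f (x + t *\<^sub>R ?e)\<bar> \<le> C * indicator (cball c (R + 1)) x"
      using C near[of x] supp_in_partial[OF f(2), of i]
      by (cases "x \<in> cball c (R + 1)") (auto simp: supp_in_def)
  next
    show "integrable lborel (\<lambda>x. C * indicator (cball c (R + 1)) x :: real)"
      by (intro integrable_mult_right integrable_real_indicator)
        (use emeasure_lborel_cball_finite[of c "R + 1"] in simp_all)
    show "(\<lambda>x. partial_deriv i f (x + 0 *\<^sub>R ?e)) \<in> borel_measurable lborel"
      using smooth_borel[OF sm(2)[of 0]] by simp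
  qed simp
  moreover have "(\<integral>x. f (x + t *\<^sub>R ?e) \<partial>lborel) = (\<integral>x. f x \<partial>lborel)" for t
    using integral_translate[of f "t *\<^sub>R ?e"] by (simp add: add.commute)
  ultimately have "((\<lambda>t::real. \<integral>x. f x \<partial>lborel) has_real_derivative (\<integral>x. partial_deriv i f x \<partial>lborel)) (at 0)"
    by simp
  then show ?thesis using DERIV_unique[OF _ DERIV_const] by metis
qed

lemma integral_euler_zero:
  assumes f: "smooth f" "supp_in (cball c R) f"
  shows "(\<integral>x. euler f x \<partial>lborel) = 0"
proof -
  have s: "smooth (\<lambda>z. vec_nth z i * f z)" "supp_in (cball c R) (\<lambda>z. vec_nth z i * f z)" for i
    using f by (auto intro: smooth_coord_mult simp: supp_in_def)
  have "integrable lborel (partial_deriv i (\<lambda>z. vec_nth z i * f z))" for i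
    by (intro smooth_integrable[of _ c R] smooth_partial supp_in_partial s) auto
  then show ?thesis
    unfolding euler_def by (subst Bochner_Integration.integral_sum) (auto simp: integral_partial_zero[OF s])
qed

text \<open>The \<open>euler\<close> part of each factor integrates to zero, so only the shifts 1,
  ..., k survive. In particular a nonzero mean stays nonzero.\<close>

lemma integral_kern:
  assumes f: "smooth f" "supp_in (cball c R) f"
  shows "(\<integral>x. kern k f x \<partial>lborel) = fact k * (\<integral>x. f x \<partial>lborel)"
proof (induction k)
  case (Suc k)
  have s: "smooth (kern k f)" "supp_in (cball c R) (kern k f)"
    using f by (auto intro: smooth_kern supp_in_kern)
  have "integrable lborel (kern k f)" "integrable lborel (euler (kern k f))"
    using s by (auto intro!: smooth_integrable[of _ c R] smooth_euler supp_in_euler)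
  then show ?case using Suc by (simp add: integral_euler_zero[OF s])
qed simp

text \<open>The function is constant along lines in direction \<open>i\<close>, and every such line
  leaves the support.\<close>

lemma smooth_const_on_axis_zero:
  fixes f :: "real ^ 'd::finite \<Rightarrow> real"
  assumes f: "smooth f" "supp_in (cball c R) f" and z: "partial_deriv i f = (\<lambda>x. 0)"
  shows "f = (\<lambda>x. 0)"
proof
  fix x
  let ?e = "axis i (1::real) :: real ^ 'd"
  have "((\<lambda>t. f (x + t *\<^sub>R ?e)) has_real_derivative 0) (at t)" for t
    using differentiable_along_axis[OF smooth_differentiable[OF f(1)], where x = x and s = t and i = i] z by simp
  then have const: "f (x + t *\<^sub>R ?e) = f (x + 0 *\<^sub>R ?e)" for t
    using DERIV_isconst_all[of "\<lambda>t. f (x + t *\<^sub>R ?e)"] by blast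
  define t where "t = \<bar>R\<bar> + norm (x - c) + 1"
  have "norm (t *\<^sub>R ?e) \<le> norm (x + t *\<^sub>R ?e - c) + norm (x - c)"
    using norm_triangle_ineq4[of "x + t *\<^sub>R ?e - c" "x - c"] by simp
  moreover have "norm (t *\<^sub>R ?e) = t" by (simp add: t_def norm_axis_1)
  ultimately have "norm (x + t *\<^sub>R ?e - c) > R" by (simp add: t_def)
  then have "f (x + t *\<^sub>R ?e) = 0"
    using f(2) by (simp add: supp_in_def dist_norm norm_minus_commute)
  then show "f x = 0" using const[of t] by simp
qed

text \<open>Derivatives of a symmetric bump may vanish at its centre. This supplies a point where a
  prescribed derivative does not vanish; rescaling will put that point at \<open>x0\<close>.\<close>

lemma iter_partial_nonzero:
  assumes f: "smooth f" "supp_in (cball c R) f" and "f x \<noteq> 0"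
  obtains y where "y \<in> cball c R" "iter_partial is f y \<noteq> 0"
proof -
  have "iter_partial is f \<noteq> (\<lambda>x. 0)"
  proof (induction "is")
    case Nil then show ?case using assms(3) by (auto simp: fun_eq_iff)
  next
    case (Cons i js)
    then show ?case
      using smooth_const_on_axis_zero[OF smooth_iter_partial[OF f(1), of js] supp_in_iter_partial[OF f(2) closed_cball, of js], of i]
      by (auto simp: iter_partial_Cons)
  qed
  then obtain y where "iter_partial is f y \<noteq> 0" by auto
  moreover have "supp_in (cball c R) (iter_partial is f)" by (intro supp_in_iter_partial f) auto
  ultimately show thesis using that by (auto simp: supp_in_def)
qed

subsection \<open>Pairings with square integrable functions\<close>

lemma integral_cauchy_schwarz:
  fixes f g :: "'a \<Rightarrow> real"
  assumes [measurable]: "f \<in> borel_measurable M" "g \<in> borel_measurable M"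
    and f2: "integrable M (\<lambda>x. (f x)\<^sup>2)" and g2: "integrable M (\<lambda>x. (g x)\<^sup>2)"
  shows "integrable M (\<lambda>x. f x * g x)"
    and "\<bar>\<integral>x. f x * g x \<partial>M\<bar> \<le> sqrt (\<integral>x. (f x)\<^sup>2 \<partial>M) * sqrt (\<integral>x. (g x)\<^sup>2 \<partial>M)"
proof -
  show int: "integrable M (\<lambda>x. f x * g x)"
  proof (rule Bochner_Integration.integrable_bound[OF Bochner_Integration.integrable_add[OF f2 g2]])
    show "AE x in M. norm (f x * g x) \<le> norm ((f x)\<^sup>2 + (g x)\<^sup>2)"
    proof (rule AE_I2)
      fix x
      have "2 * (\<bar>f x\<bar> * \<bar>g x\<bar>) \<le> (f x)\<^sup>2 + (g x)\<^sup>2"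
        using sum_squares_bound[of "\<bar>f x\<bar>" "\<bar>g x\<bar>"] by simp
      moreover have "0 \<le> \<bar>f x\<bar> * \<bar>g x\<bar>" by simp
      ultimately show "norm (f x * g x) \<le> norm ((f x)\<^sup>2 + (g x)\<^sup>2)"
        unfolding real_norm_def abs_mult by linarith
    qed
  qed simp
  let ?A = "\<integral>x. (f x)\<^sup>2 \<partial>M" and ?B = "\<integral>x. (g x)\<^sup>2 \<partial>M"
  have "ennreal (\<bar>\<integral>x. f x * g x \<partial>M\<bar>) \<le> (\<integral>\<^sup>+x. ennreal \<bar>f x\<bar> * ennreal \<bar>g x\<bar> \<partial>M)"
    using integral_norm_bound_ennreal[OF int] by (simp add: abs_mult ennreal_mult)
  then have "ennreal (\<bar>\<integral>x. f x * g x \<partial>M\<bar>) ^ 2 \<le> (\<integral>\<^sup>+x. ennreal \<bar>f x\<bar> * ennreal \<bar>g x\<bar> \<partial>M)\<^sup>2"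
    by (intro power_mono) auto
  also have "\<dots> \<le> (\<integral>\<^sup>+x. ennreal \<bar>f x\<bar> ^ 2 \<partial>M) * (\<integral>\<^sup>+x. ennreal \<bar>g x\<bar> ^ 2 \<partial>M)"
    by (rule Cauchy_Schwarz_nn_integral) auto
  also have "(\<integral>\<^sup>+x. ennreal \<bar>f x\<bar> ^ 2 \<partial>M) = ennreal ?A"
    using nn_integral_eq_integral[OF f2] by (simp add: ennreal_power)
  also have "(\<integral>\<^sup>+x. ennreal \<bar>g x\<bar> ^ 2 \<partial>M) = ennreal ?B"
    using nn_integral_eq_integral[OF g2] by (simp add: ennreal_power)
  finally have "(\<integral>x. f x * g x \<partial>M)\<^sup>2 \<le> ?A * ?B"
    by (simp add: ennreal_power ennreal_mult[symmetric] integral_nonneg_AE)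
  then have "sqrt ((\<integral>x. f x * g x \<partial>M)\<^sup>2) \<le> sqrt (?A * ?B)"
    by (rule real_sqrt_le_mono)
  then show "\<bar>\<integral>x. f x * g x \<partial>M\<bar> \<le> sqrt ?A * sqrt ?B"
    by (simp add: real_sqrt_mult)
qed

lemma L2_onD:
  assumes "L2_on U g"
  shows "(\<lambda>x. indicator U x * g x) \<in> borel_measurable borel"
    and "integrable lborel (\<lambda>x. (indicator U x * g x)\<^sup>2)"
    and "(\<integral>x. (indicator U x * g x)\<^sup>2 \<partial>lborel) = (L2_norm U g)\<^sup>2"
proof -
  have eq: "(indicator U x * g x)\<^sup>2 = indicator U x *\<^sub>R (g x)\<^sup>2" for x
    by (simp add: indicator_def)
  show "(\<lambda>x. indicator U x * g x) \<in> borel_measurable borel"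
    "integrable lborel (\<lambda>x. (indicator U x * g x)\<^sup>2)"
    using assms unfolding eq by (auto simp: L2_on_def set_borel_measurable_def set_integrable_def)
  have "(LINT x:U|lborel. (g x)\<^sup>2) \<ge> 0"
    unfolding set_lebesgue_integral_def by (rule integral_nonneg_AE) simp
  then show "(\<integral>x. (indicator U x * g x)\<^sup>2 \<partial>lborel) = (L2_norm U g)\<^sup>2"
    unfolding eq by (simp add: L2_norm_def set_lebesgue_integral_def)
qed

lemma L2_norm_nonneg [simp]: "L2_norm U g \<ge> 0"
proof -
  have "(LINT x:U|lborel. (g x)\<^sup>2) \<ge> 0"
    unfolding set_lebesgue_integral_def by (rule integral_nonneg_AE) simp
  then show ?thesis by (simp add: L2_norm_def)
qed

lemma lint_pairing:
  fixes v k :: "real ^ 'd::finite \<Rightarrow> real"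
  shows "(LINT z:U|lborel. v z * k z) = (\<integral>z. (indicator U z * v z) * k z \<partial>lborel)"
  by (simp add: set_lebesgue_integral_def mult.assoc[symmetric])

text \<open>Cauchy-Schwarz; the constant is the largest \<open>L2\<close> norm of a function of
  height \<open>B\<close> on the ball, that is, \<open>B\<close> times the root of the
  volume.\<close>

lemma L2_pairing:
  fixes G :: "real ^ 'd::finite \<Rightarrow> real"
  assumes [measurable]: "G \<in> borel_measurable borel" and G2: "integrable lborel (\<lambda>x. (G x)\<^sup>2)"
    and [measurable]: "\<xi> \<in> borel_measurable borel" and \<xi>: "\<And>z. \<bar>\<xi> z\<bar> \<le> B * indicator (cball p \<rho>) z"
    and B: "B \<ge> 0" "\<rho> \<ge> 0"
  shows "integrable lborel (\<lambda>z. G z * \<xi> z)"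
    and "\<bar>\<integral>z. G z * \<xi> z \<partial>lborel\<bar> \<le> B * sqrt (unit_ball_vol (real CARD('d)) * \<rho> ^ CARD('d)) * sqrt (\<integral>x. (G x)\<^sup>2 \<partial>lborel)"
proof -
  let ?V = "unit_ball_vol (real CARD('d)) * \<rho> ^ CARD('d)"
  have ind: "integrable lborel (indicat_real (cball p \<rho>))"
    by (intro integrable_real_indicator) (use emeasure_lborel_cball_finite[of p \<rho>] in simp_all)
  have vol: "(\<integral>x. indicat_real (cball p \<rho>) x \<partial>lborel) = ?V"
    using content_cball[of \<rho> p] B by simp
  have le: "(\<xi> z)\<^sup>2 \<le> B\<^sup>2 * indicator (cball p \<rho>) z" for z
    using power_mono[OF \<xi>[of z], of 2] by (auto simp: indicator_def)
  have \<xi>2: "integrable lborel (\<lambda>z. (\<xi> z)\<^sup>2)"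
    by (rule Bochner_Integration.integrable_bound[OF integrable_mult_right[OF ind, of "B\<^sup>2"]])
      (use le in \<open>auto simp: abs_mult\<close>)
  show "integrable lborel (\<lambda>z. G z * \<xi> z)"
    by (rule integral_cauchy_schwarz(1)) (use G2 \<xi>2 in auto)
  have "(\<integral>z. (\<xi> z)\<^sup>2 \<partial>lborel) \<le> (\<integral>z. B\<^sup>2 * indicat_real (cball p \<rho>) z \<partial>lborel)"
    by (intro integral_mono \<xi>2 integrable_mult_right ind le)
  then have "sqrt (\<integral>z. (\<xi> z)\<^sup>2 \<partial>lborel) \<le> sqrt (B\<^sup>2 * ?V)"
    using vol by (intro real_sqrt_le_mono) simp
  then have s: "sqrt (\<integral>z. (\<xi> z)\<^sup>2 \<partial>lborel) \<le> B * sqrt ?V"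
    using B by (simp add: real_sqrt_mult)
  have "\<bar>\<integral>z. G z * \<xi> z \<partial>lborel\<bar> \<le> sqrt (\<integral>x. (G x)\<^sup>2 \<partial>lborel) * sqrt (\<integral>z. (\<xi> z)\<^sup>2 \<partial>lborel)"
    by (rule integral_cauchy_schwarz(2)) (use G2 \<xi>2 in auto)
  also have "\<dots> \<le> sqrt (\<integral>x. (G x)\<^sup>2 \<partial>lborel) * (B * sqrt ?V)"
    by (intro mult_left_mono s) (simp add: integral_nonneg_AE)
  finally show "\<bar>\<integral>z. G z * \<xi> z \<partial>lborel\<bar> \<le> B * sqrt ?V * sqrt (\<integral>x. (G x)\<^sup>2 \<partial>lborel)"
    by (simp add: mult_ac)
qed

lemma gagliardo_indicator: "gagliardo U s (\<lambda>x. indicator U x * g x) = gagliardo U s g"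
  unfolding gagliardo_def
  by (intro nn_integral_cong) (auto simp: indicator_def intro!: nn_integral_cong)

text \<open>As \<open>\<xi>\<close> has mean zero, G(x) may be subtracted for any x without changing
  the pairing. Averaging the square over x in the ball produces the double integral of |G(x) -
  G(y)|^2, and since distances there are at most 2 \<rho> it is bounded by the Gagliardo integral.
  Compared with the plain pairing this gains the power s of the radius.\<close>

lemma gagliardo_pairing:
  fixes G :: "real ^ 'd::finite \<Rightarrow> real"
  assumes U: "open U" and [measurable]: "G \<in> borel_measurable borel" and G2: "integrable lborel (\<lambda>x. (G x)\<^sup>2)"
    and [measurable]: "\<xi> \<in> borel_measurable borel" and \<xi>: "\<And>z. \<bar>\<xi> z\<bar> \<le> B * indicator (cball p \<rho>) z"
    and B: "B \<ge> 0" "\<rho> > 0" and mean: "(\<integral>z. \<xi> z \<partial>lborel) = 0" and sub: "cball p \<rho> \<subseteq> U"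
    and s: "s > 0" and fin: "gagliardo U s G < \<infinity>"
  shows "\<bar>\<integral>z. G z * \<xi> z \<partial>lborel\<bar> \<le> B * (2 * \<rho>) powr (real CARD('d) / 2 + s) * sqrt (enn2real (gagliardo U s G))"
proof -
  define I where "I = (\<integral>z. G z * \<xi> z \<partial>lborel)"
  define b where "b = cball p \<rho>"
  have [measurable]: "b \<in> sets borel" "U \<in> sets borel" using U by (auto simp: b_def)
  define V where "V = unit_ball_vol (real CARD('d)) * \<rho> ^ CARD('d)"
  have V: "V > 0" using B by (simp add: V_def)
  have emV: "emeasure lborel b = ennreal V"
    unfolding b_def V_def using emeasure_cball[of \<rho> p] B by simp
  define w where "w = real CARD('d) + 2 * s"
  define P where "P x y = ennreal ((G x - G y)\<^sup>2)" for x y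
  have [measurable]: "(\<lambda>(x, y). P x y) \<in> borel_measurable (borel \<Otimes>\<^sub>M borel)"
    unfolding P_def by measurable
  have intG\<xi>: "integrable lborel (\<lambda>z. G z * \<xi> z)"
    by (rule L2_pairing[where B = B and p = p and \<rho> = \<rho>]) (use B \<xi> G2 in auto)
  have int\<xi>: "integrable lborel \<xi>"
  proof (rule Bochner_Integration.integrable_bound)
    show "integrable lborel (\<lambda>z. B * indicat_real (cball p \<rho>) z)"
      by (intro integrable_mult_right integrable_real_indicator)
        (use emeasure_lborel_cball_finite[of p \<rho>] in simp_all)
  qed (use \<xi> B in \<open>auto simp: abs_mult\<close>)
  \<comment> \<open>Cauchy-Schwarz for a fixed reference point \<open>x\<close>. The left side is
    constant in \<open>x\<close>, so integrating over the ball multiplies it by the volume, which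
    cancels at the end.\<close>
  have one: "ennreal (I\<^sup>2) \<le> ennreal (B\<^sup>2 * V) * (\<integral>\<^sup>+ y\<in>b. P x y \<partial>lborel)" for x
  proof -
    have "I = (\<integral>z. G z * \<xi> z - G x * \<xi> z \<partial>lborel)"
      using intG\<xi> int\<xi> mean by (simp add: I_def)
    also have "\<dots> = (\<integral>z. (G z - G x) * \<xi> z \<partial>lborel)" by (simp add: left_diff_distrib)
    finally have I: "I = (\<integral>z. (G z - G x) * \<xi> z \<partial>lborel)" .
    have "integrable lborel (\<lambda>z. (G z - G x) * \<xi> z)"
      using intG\<xi> int\<xi> by (simp add: left_diff_distrib)
    from integral_norm_bound_ennreal[OF this]
    have "ennreal \<bar>I\<bar> \<le> (\<integral>\<^sup>+z. ennreal \<bar>(G z - G x) * \<xi> z\<bar> \<partial>lborel)" using I by simp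
    also have "\<dots> \<le> (\<integral>\<^sup>+z. ennreal (\<bar>G x - G z\<bar> * indicator b z) * ennreal (B * indicator b z) \<partial>lborel)"
    proof (rule nn_integral_mono)
      fix z
      have "\<bar>(G z - G x) * \<xi> z\<bar> \<le> \<bar>G x - G z\<bar> * (B * indicator b z)"
        unfolding abs_mult abs_minus_commute[of "G z"] by (intro mult_left_mono \<xi>[folded b_def]) simp
      also have "\<dots> = (\<bar>G x - G z\<bar> * indicator b z) * (B * indicator b z)"
        by (simp add: indicator_def)
      finally show "ennreal \<bar>(G z - G x) * \<xi> z\<bar> \<le> ennreal (\<bar>G x - G z\<bar> * indicator b z) * ennreal (B * indicator b z)"
        using B by (simp add: ennreal_mult[symmetric] ennreal_leI)
    qed
    finally have "ennreal \<bar>I\<bar> ^ 2 \<le> (\<integral>\<^sup>+z. ennreal (\<bar>G x - G z\<bar> * indicator b z) * ennreal (B * indicator b z) \<partial>lborel)\<^sup>2"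
      by (intro power_mono) auto
    also have "\<dots> \<le> (\<integral>\<^sup>+z. ennreal (\<bar>G x - G z\<bar> * indicator b z) ^ 2 \<partial>lborel) * (\<integral>\<^sup>+z. ennreal (B * indicator b z) ^ 2 \<partial>lborel)"
      by (rule Cauchy_Schwarz_nn_integral) auto
    also have "(\<integral>\<^sup>+z. ennreal (B * indicator b z) ^ 2 \<partial>lborel) = (\<integral>\<^sup>+z. ennreal (B\<^sup>2) * indicator b z \<partial>lborel)"
      using B by (intro nn_integral_cong) (auto simp: indicator_def ennreal_power)
    also have "\<dots> = ennreal (B\<^sup>2 * V)"
      using V by (simp add: nn_integral_cmult_indicator emV ennreal_mult)
    also have "(\<integral>\<^sup>+z. ennreal (\<bar>G x - G z\<bar> * indicator b z) ^ 2 \<partial>lborel) = (\<integral>\<^sup>+ y\<in>b. P x y \<partial>lborel)"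
      by (intro nn_integral_cong) (auto simp: indicator_def ennreal_power P_def)
    finally show ?thesis by (simp add: ennreal_power mult.commute)
  qed
  have "ennreal (I\<^sup>2 * V) = (\<integral>\<^sup>+ x\<in>b. ennreal (I\<^sup>2) \<partial>lborel)"
    using V by (simp add: nn_integral_cmult_indicator emV ennreal_mult)
  also have "\<dots> \<le> (\<integral>\<^sup>+ x\<in>b. ennreal (B\<^sup>2 * V) * (\<integral>\<^sup>+ y\<in>b. P x y \<partial>lborel) \<partial>lborel)"
    by (intro nn_integral_mono mult_right_mono one) auto
  also have "\<dots> = (\<integral>\<^sup>+ x. ennreal (B\<^sup>2 * V) * ((\<integral>\<^sup>+ y\<in>b. P x y \<partial>lborel) * indicator b x) \<partial>lborel)"
    by (simp add: mult.assoc)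
  also have "\<dots> = ennreal (B\<^sup>2 * V) * (\<integral>\<^sup>+ x\<in>b. (\<integral>\<^sup>+ y\<in>b. P x y \<partial>lborel) \<partial>lborel)"
    by (intro nn_integral_cmult) simp
  also have "(\<integral>\<^sup>+ x\<in>b. (\<integral>\<^sup>+ y\<in>b. P x y \<partial>lborel) \<partial>lborel) \<le>
      (\<integral>\<^sup>+ x\<in>b. (\<integral>\<^sup>+ y\<in>b. ennreal ((2 * \<rho>) powr w) * ennreal ((G x - G y)\<^sup>2 / norm (x - y) powr w) \<partial>lborel) \<partial>lborel)"
  proof -
    have "P x y \<le> ennreal ((2 * \<rho>) powr w) * ennreal ((G x - G y)\<^sup>2 / norm (x - y) powr w)"
      if "x \<in> b" "y \<in> b" for x y
    proof (cases "x = y")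
      case True then show ?thesis by (simp add: P_def)
    next
      case False
      have "norm (x - y) \<le> 2 * \<rho>"
        using that dist_triangle2[of x y p] by (simp add: b_def dist_norm norm_minus_commute[of p])
      then have "norm (x - y) powr w \<le> (2 * \<rho>) powr w"
        using s by (intro powr_mono2) (auto simp: w_def)
      then have "(G x - G y)\<^sup>2 * norm (x - y) powr w \<le> (G x - G y)\<^sup>2 * (2 * \<rho>) powr w"
        by (intro mult_left_mono) auto
      then have "(G x - G y)\<^sup>2 \<le> (2 * \<rho>) powr w * ((G x - G y)\<^sup>2 / norm (x - y) powr w)"
        using False by (simp add: field_simps)
      then show ?thesis unfolding P_def by (simp add: ennreal_mult[symmetric] ennreal_leI)
    qed
    then show ?thesis
      by (intro nn_integral_mono) (auto simp: indicator_def intro!: nn_integral_mono)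
  qed
  also have "\<dots> \<le> (\<integral>\<^sup>+ x\<in>U. (\<integral>\<^sup>+ y\<in>U. ennreal ((2 * \<rho>) powr w) * ennreal ((G x - G y)\<^sup>2 / norm (x - y) powr w) \<partial>lborel) \<partial>lborel)"
  proof -
    have bU: "b \<subseteq> U" using sub by (simp add: b_def)
    show ?thesis
      by (intro nn_integral_mono mult_mono) (use bU in \<open>auto simp: indicator_def\<close>)
  qed
  also have "\<dots> = ennreal ((2 * \<rho>) powr w) * gagliardo U s G"
  proof -
    have "(\<integral>\<^sup>+ y\<in>U. ennreal ((2 * \<rho>) powr w) * ennreal ((G x - G y)\<^sup>2 / norm (x - y) powr w) \<partial>lborel)
        = ennreal ((2 * \<rho>) powr w) * (\<integral>\<^sup>+ y\<in>U. ennreal ((G x - G y)\<^sup>2 / norm (x - y) powr w) \<partial>lborel)" for x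
      by (subst nn_integral_cmult[symmetric]) (auto simp: mult.assoc)
    then have "(\<integral>\<^sup>+ x\<in>U. (\<integral>\<^sup>+ y\<in>U. ennreal ((2 * \<rho>) powr w) * ennreal ((G x - G y)\<^sup>2 / norm (x - y) powr w) \<partial>lborel) \<partial>lborel)
        = (\<integral>\<^sup>+ x. ennreal ((2 * \<rho>) powr w) * ((\<integral>\<^sup>+ y\<in>U. ennreal ((G x - G y)\<^sup>2 / norm (x - y) powr w) \<partial>lborel) * indicator U x) \<partial>lborel)"
      by (simp add: mult.assoc)
    also have "\<dots> = ennreal ((2 * \<rho>) powr w) * gagliardo U s G"
      unfolding gagliardo_def w_def by (intro nn_integral_cmult) measurable
    finally show ?thesis .
  qed
  also have "gagliardo U s G = ennreal (enn2real (gagliardo U s G))"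
    using fin by simp
  finally have "ennreal (I\<^sup>2 * V) \<le> ennreal ((B\<^sup>2 * V) * ((2 * \<rho>) powr w * enn2real (gagliardo U s G)))"
    using V by (simp add: ennreal_mult mult_left_mono)
  then have "I\<^sup>2 * V \<le> (B\<^sup>2 * V) * ((2 * \<rho>) powr w * enn2real (gagliardo U s G))"
    using V by (subst (asm) ennreal_le_iff) auto
  then have "V * I\<^sup>2 \<le> V * (B\<^sup>2 * ((2 * \<rho>) powr w * enn2real (gagliardo U s G)))"
    by (simp add: mult_ac)
  then have "I\<^sup>2 \<le> B\<^sup>2 * ((2 * \<rho>) powr w * enn2real (gagliardo U s G))"
    using V by simp
  then have "sqrt (I\<^sup>2) \<le> sqrt (B\<^sup>2 * ((2 * \<rho>) powr w * enn2real (gagliardo U s G)))"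
    by (rule real_sqrt_le_mono)
  moreover have "sqrt ((2 * \<rho>) powr w) = (2 * \<rho>) powr (real CARD('d) / 2 + s)"
    using B by (simp add: w_def powr_half_sqrt[symmetric] powr_powr add_divide_distrib)
  ultimately show ?thesis using B by (simp add: I_def real_sqrt_mult mult.assoc)
qed

subsection \<open>Dilated pairings\<close>

text \<open>Without the factor t^-d, so that pairings with weak derivatives carry no normalisation;
  it enters in \<open>mollified\<close>.\<close>

definition dilated :: "(real ^ 'd::finite \<Rightarrow> real) \<Rightarrow> (real ^ 'd \<Rightarrow> real) \<Rightarrow> real \<Rightarrow> real ^ 'd \<Rightarrow> real" where
  "dilated V \<kappa> t x = (\<integral>z. V z * \<kappa> ((1 / t) *\<^sub>R (z - x)) \<partial>lborel)"

lemma dilate_arg: "(1 / t) *\<^sub>R (z - x) = - (1 / t) *\<^sub>R x + (1 / t) *\<^sub>R z" for x z :: "real ^ 'd::finite"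
  by (simp add: algebra_simps)

lemma smooth_dilate: "smooth \<kappa> \<Longrightarrow> smooth (\<lambda>z. \<kappa> ((1 / t) *\<^sub>R (z - x)))"
  unfolding dilate_arg by (rule smooth_affine)

lemma iter_partial_dilate:
  "smooth \<kappa> \<Longrightarrow> iter_partial js (\<lambda>z. \<kappa> ((1 / t) *\<^sub>R (z - x))) = (\<lambda>z. (1 / t) ^ length js * iter_partial js \<kappa> ((1 / t) *\<^sub>R (z - x)))"
  unfolding dilate_arg by (rule iter_partial_affine)

lemma dilate_mem:
  fixes x z :: "real ^ 'd::finite"
  assumes "t > 0" shows "(1 / t) *\<^sub>R (z - x) \<in> cball c r \<longleftrightarrow> z \<in> cball (x + t *\<^sub>R c) (t * r)"
proof -
  have "z - (x + t *\<^sub>R c) = t *\<^sub>R ((1 / t) *\<^sub>R (z - x) - c)"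
    using assms by (simp add: algebra_simps)
  then have "norm (z - (x + t *\<^sub>R c)) = t * norm ((1 / t) *\<^sub>R (z - x) - c)"
    using assms by simp
  then show ?thesis using assms by (simp add: dist_norm norm_minus_commute)
qed

lemma cball_image_affine:
  fixes x c :: "real ^ 'd::finite"
  assumes "t > 0" shows "(\<lambda>y. x + t *\<^sub>R y) ` cball c r = cball (x + t *\<^sub>R c) (t * r)"
proof (intro equalityI subsetI)
  fix z assume "z \<in> (\<lambda>y. x + t *\<^sub>R y) ` cball c r"
  then obtain y where "y \<in> cball c r" "z = x + t *\<^sub>R y" by auto
  then show "z \<in> cball (x + t *\<^sub>R c) (t * r)"
    using dilate_mem[OF assms, of z x c r] assms by simp
next
  fix z assume "z \<in> cball (x + t *\<^sub>R c) (t * r)"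
  then have "(1 / t) *\<^sub>R (z - x) \<in> cball c r" using dilate_mem[OF assms] by blast
  moreover have "z = x + t *\<^sub>R ((1 / t) *\<^sub>R (z - x))" using assms by simp
  ultimately show "z \<in> (\<lambda>y. x + t *\<^sub>R y) ` cball c r" by blast
qed

lemma integrable_mult_bounded:
  fixes V k :: "real ^ 'd::finite \<Rightarrow> real"
  assumes V: "integrable lborel V" and k: "k \<in> borel_measurable borel" "\<And>z. \<bar>k z\<bar> \<le> B"
  shows "integrable lborel (\<lambda>z. V z * k z)"
proof (rule Bochner_Integration.integrable_bound[OF integrable_mult_right[OF V, of "\<bar>B\<bar>"]])
  show "(\<lambda>z. V z * k z) \<in> borel_measurable lborel"
    using V k(1) by measurable
  have "\<bar>V z * k z\<bar> \<le> \<bar>B\<bar> * \<bar>V z\<bar>" for z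
  proof -
    have "\<bar>k z\<bar> \<le> \<bar>B\<bar>" using k(2)[of z] by linarith
    then show ?thesis
      using mult_left_mono[of "\<bar>k z\<bar>" "\<bar>B\<bar>" "\<bar>V z\<bar>"] by (simp add: abs_mult mult.commute)
  qed
  then show "AE z in lborel. norm (V z * k z) \<le> norm (\<bar>B\<bar> * V z)" by (simp add: abs_mult)
qed

lemma dilated_integrable:
  assumes "integrable lborel V" "smooth \<kappa>" "supp_in (cball c R) \<kappa>"
  shows "integrable lborel (\<lambda>z. V z * \<kappa> ((1 / t) *\<^sub>R (z - x)))"
proof -
  obtain C where "\<And>y. \<bar>\<kappa> y\<bar> \<le> C" by (rule smooth_continuous_bounded[OF assms(2,3)]) blast
  then show ?thesis
    by (intro integrable_mult_bounded[where B = C] smooth_borel smooth_dilate assms)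
qed

lemma dilated_add:
  assumes "integrable lborel V" "smooth \<kappa>" "supp_in (cball c R) \<kappa>" "smooth \<kappa>'" "supp_in (cball c R) \<kappa>'"
  shows "dilated V (\<lambda>y. \<kappa> y + \<kappa>' y) t x = dilated V \<kappa> t x + dilated V \<kappa>' t x"
  unfolding dilated_def distrib_left
  by (intro Bochner_Integration.integral_add dilated_integrable[of _ _ c R] assms)

lemma dilated_cmult: "dilated V (\<lambda>y. a * \<kappa> y) t x = a * dilated V \<kappa> t x"
  by (simp add: dilated_def mult.left_commute)

lemma dilated_sum:
  assumes "integrable lborel V" "\<And>i. i \<in> I \<Longrightarrow> smooth (\<kappa> i)" "\<And>i. i \<in> I \<Longrightarrow> supp_in (cball c R) (\<kappa> i)"
  shows "dilated V (\<lambda>y. \<Sum>i\<in>I. \<kappa> i y) t x = (\<Sum>i\<in>I. dilated V (\<kappa> i) t x)"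
  unfolding dilated_def sum_distrib_left
  by (intro Bochner_Integration.integral_sum dilated_integrable[of _ _ c R] assms)

text \<open>The derivative in t of \<kappa>(w/t) is -1/t times the radial derivative y . grad
  \<kappa> at w/t. For t > t0/2 it is uniformly bounded, so the integrable \<open>V\<close>
  dominates.\<close>

lemma dilated_deriv_scale:
  fixes \<kappa> :: "real ^ 'd::finite \<Rightarrow> real"
  assumes V: "integrable lborel V" and k: "smooth \<kappa>" "supp_in (cball c R) \<kappa>" and t0: "t0 > 0"
  shows "((\<lambda>t. dilated V \<kappa> t x) has_real_derivative
    - (1 / t0) * dilated V (\<lambda>y. \<Sum>i\<in>UNIV. vec_nth y i * partial_deriv i \<kappa> y) t0 x) (at t0)"
proof -
  define \<eta> where "\<eta> y = (\<Sum>i\<in>UNIV. vec_nth y i * partial_deriv i \<kappa> y)" for y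
  have s\<eta>: "smooth \<eta>" unfolding \<eta>_def[abs_def] by (intro smooth_sum smooth_coord_mult smooth_partial k)
  have supp: "supp_in (cball c R) \<eta>"
    using supp_in_partial[OF k(2)] by (auto simp: \<eta>_def supp_in_def)
  obtain C where C: "C \<ge> 0" "\<And>y. \<bar>\<eta> y\<bar> \<le> C" by (rule smooth_continuous_bounded[OF s\<eta> supp]) blast
  have der: "((\<lambda>t. \<kappa> ((1 / t) *\<^sub>R w)) has_real_derivative - (1 / t) * \<eta> ((1 / t) *\<^sub>R w)) (at t)" if "t > 0" for t w
  proof -
    have 1: "((\<lambda>t. (1 / t) *\<^sub>R w) has_derivative (\<lambda>h. (- h / t\<^sup>2) *\<^sub>R w)) (at t)"
      using that by (auto intro!: derivative_eq_intros simp: power2_eq_square field_simps)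
    have "(\<kappa> \<circ> (\<lambda>t. (1 / t) *\<^sub>R w) has_derivative
        (\<lambda>h. \<Sum>i\<in>UNIV. vec_nth h i * partial_deriv i \<kappa> ((1 / t) *\<^sub>R w)) \<circ> (\<lambda>h. (- h / t\<^sup>2) *\<^sub>R w)) (at t)"
      by (rule diff_chain_at[OF 1 differentiable_has_derivative_partials[OF smooth_differentiable[OF k(1)]]])
    moreover have "(\<lambda>h. \<Sum>i\<in>UNIV. vec_nth h i * partial_deriv i \<kappa> ((1 / t) *\<^sub>R w)) \<circ> (\<lambda>h. (- h / t\<^sup>2) *\<^sub>R w)
        = (*) (- (1 / t) * \<eta> ((1 / t) *\<^sub>R w))"
      using that by (auto simp: fun_eq_iff \<eta>_def sum_distrib_left sum_distrib_right power2_eq_square field_simps sum_negf intro!: sum.cong)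
    ultimately show ?thesis by (simp add: has_field_derivative_def o_def)
  qed
  have "((\<lambda>t. \<integral>z. V z * \<kappa> ((1 / t) *\<^sub>R (z - x)) \<partial>lborel) has_real_derivative
      (\<integral>z. V z * (- (1 / t0) * \<eta> ((1 / t0) *\<^sub>R (z - x))) \<partial>lborel)) (at t0)"
  proof (rule has_real_derivative_lebesgue_integral[where e = "t0 / 2" and D = "\<lambda>z. \<bar>V z\<bar> * (2 / t0 * C)"])
    fix t assume "\<bar>t - t0\<bar> < t0 / 2"
    then have t: "t > t0 / 2" "t > 0" using t0 by (auto simp: abs_if split: if_splits)
    show "integrable lborel (\<lambda>z. V z * \<kappa> ((1 / t) *\<^sub>R (z - x)))"
      by (rule dilated_integrable[OF V k])
    fix z
    show "((\<lambda>t. V z * \<kappa> ((1 / t) *\<^sub>R (z - x))) has_real_derivative V z * (- (1 / t) * \<eta> ((1 / t) *\<^sub>R (z - x)))) (at t)"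
      by (intro DERIV_cmult der t)
    have "\<bar>- (1 / t) * \<eta> ((1 / t) *\<^sub>R (z - x))\<bar> \<le> 2 / t0 * C"
    proof -
      have "1 / t \<le> 2 / t0" using t t0 by (simp add: field_simps)
      then have "1 / t * \<bar>\<eta> ((1 / t) *\<^sub>R (z - x))\<bar> \<le> 2 / t0 * C"
        using C t t0 by (intro mult_mono) auto
      then show ?thesis using t by (simp add: abs_mult)
    qed
    then show "\<bar>V z * (- (1 / t) * \<eta> ((1 / t) *\<^sub>R (z - x)))\<bar> \<le> \<bar>V z\<bar> * (2 / t0 * C)"
      unfolding abs_mult[of "V z"] by (intro mult_left_mono) auto
  next
    show "(\<lambda>z. V z * (- (1 / t0) * \<eta> ((1 / t0) *\<^sub>R (z - x)))) \<in> borel_measurable lborel"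
      using V smooth_borel[OF smooth_dilate[OF s\<eta>, of t0 x]] by measurable
  qed (use V t0 in auto)
  then show ?thesis
    unfolding dilated_def \<eta>_def[symmetric] by (simp add: mult.left_commute)
qed

lemma dilated_deriv_shift:
  fixes \<kappa> :: "real ^ 'd::finite \<Rightarrow> real"
  assumes V: "integrable lborel V" and k: "smooth \<kappa>" "supp_in (cball c R) \<kappa>" and t: "t > 0"
  shows "((\<lambda>s. dilated V \<kappa> t (x + s *\<^sub>R axis i 1)) has_real_derivative
    - (1 / t) * dilated V (partial_deriv i \<kappa>) t (x + s *\<^sub>R axis i 1)) (at s)"
proof -
  let ?e = "axis i (1::real) :: real ^ 'd"
  obtain C where C: "C \<ge> 0" "\<And>y. \<bar>partial_deriv i \<kappa> y\<bar> \<le> C"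
    by (rule smooth_continuous_bounded[OF smooth_partial[OF k(1)] supp_in_partial[OF k(2)]]) auto
  have der: "((\<lambda>s. \<kappa> ((1 / t) *\<^sub>R (z - (x + s *\<^sub>R ?e)))) has_real_derivative
      - (1 / t) * partial_deriv i \<kappa> ((1 / t) *\<^sub>R (z - (x + s *\<^sub>R ?e)))) (at s)" for s z
  proof -
    have arg: "(1 / t) *\<^sub>R (z - (x + s *\<^sub>R ?e)) = (1 / t) *\<^sub>R (z - x) + (- (1 / t) * s) *\<^sub>R ?e" for s
      using t by (simp add: scaleR_diff_right scaleR_add_right)
    have "((\<lambda>u. \<kappa> ((1 / t) *\<^sub>R (z - x) + u *\<^sub>R ?e)) has_real_derivative
        partial_deriv i \<kappa> ((1 / t) *\<^sub>R (z - x) + (- (1 / t) * s) *\<^sub>R ?e)) (at (- (1 / t) * s))"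
      by (intro differentiable_along_axis smooth_differentiable k)
    then have "((\<lambda>s. \<kappa> ((1 / t) *\<^sub>R (z - x) + (- (1 / t) * s) *\<^sub>R ?e)) has_real_derivative
        partial_deriv i \<kappa> ((1 / t) *\<^sub>R (z - x) + (- (1 / t) * s) *\<^sub>R ?e) * (- (1 / t))) (at s)"
    proof (rule DERIV_chain2)
      show "((\<lambda>s. - (1 / t) * s) has_real_derivative - (1 / t)) (at s)"
        using DERIV_cmult[OF DERIV_ident, of "- (1 / t)" s UNIV] by simp
    qed
    then show ?thesis unfolding arg by (simp add: mult.commute)
  qed
  have "((\<lambda>s. \<integral>z. V z * \<kappa> ((1 / t) *\<^sub>R (z - (x + s *\<^sub>R ?e))) \<partial>lborel) has_real_derivative
      (\<integral>z. V z * (- (1 / t) * partial_deriv i \<kappa> ((1 / t) *\<^sub>R (z - (x + s *\<^sub>R ?e)))) \<partial>lborel)) (at s)"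
  proof (rule has_real_derivative_lebesgue_integral[where e = 1 and D = "\<lambda>z. \<bar>V z\<bar> * (1 / t * C)"])
    fix s
    show "integrable lborel (\<lambda>z. V z * \<kappa> ((1 / t) *\<^sub>R (z - (x + s *\<^sub>R ?e))))"
      by (rule dilated_integrable[OF V k])
    fix z
    show "((\<lambda>s. V z * \<kappa> ((1 / t) *\<^sub>R (z - (x + s *\<^sub>R ?e)))) has_real_derivative
        V z * (- (1 / t) * partial_deriv i \<kappa> ((1 / t) *\<^sub>R (z - (x + s *\<^sub>R ?e))))) (at s)"
      by (intro DERIV_cmult der)
    have "\<bar>- (1 / t) * partial_deriv i \<kappa> ((1 / t) *\<^sub>R (z - (x + s *\<^sub>R ?e)))\<bar> \<le> 1 / t * C"
      using C t by (auto simp: abs_mult intro!: mult_mono divide_right_mono)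
    then show "\<bar>V z * (- (1 / t) * partial_deriv i \<kappa> ((1 / t) *\<^sub>R (z - (x + s *\<^sub>R ?e))))\<bar> \<le> \<bar>V z\<bar> * (1 / t * C)"
      unfolding abs_mult[of "V z"] by (intro mult_left_mono) auto
  next
    show "(\<lambda>z. V z * (- (1 / t) * partial_deriv i \<kappa> ((1 / t) *\<^sub>R (z - (x + s *\<^sub>R ?e))))) \<in> borel_measurable lborel"
      using V smooth_borel[OF smooth_dilate[OF smooth_partial[OF k(1)], where t = t and x = "x + s *\<^sub>R ?e" and i1 = i]] by measurable
  qed (use V in auto)
  then show ?thesis
    unfolding dilated_def by (simp add: mult.left_commute)
qed

lemma dilated_subst:
  fixes V \<kappa> :: "real ^ 'd::finite \<Rightarrow> real"
  assumes [measurable]: "V \<in> borel_measurable borel" "\<kappa> \<in> borel_measurable borel" and t: "t > 0"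
  shows "dilated V \<kappa> t x = t ^ CARD('d) * (\<integral>y. V (x + t *\<^sub>R y) * \<kappa> y \<partial>lborel)"
proof -
  let ?g = "\<lambda>z. V z * \<kappa> ((1 / t) *\<^sub>R (z - x))"
  have "(\<integral>z. ?g z \<partial>lborel) = (\<integral>z. ?g z \<partial>(density (distr lborel borel (\<lambda>y. x + t *\<^sub>R y)) (\<lambda>_. ennreal (\<bar>t\<bar> ^ DIM(real ^ 'd)))))"
    using lborel_affine[of t x] t by simp
  also have "\<dots> = (\<integral>z. (\<bar>t\<bar> ^ DIM(real ^ 'd)) *\<^sub>R ?g z \<partial>(distr lborel borel (\<lambda>y. x + t *\<^sub>R y)))"
    by (intro integral_density) auto
  also have "\<dots> = (\<integral>y. (\<bar>t\<bar> ^ DIM(real ^ 'd)) *\<^sub>R ?g (x + t *\<^sub>R y) \<partial>lborel)"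
    by (intro integral_distr) auto
  also have "\<dots> = t ^ CARD('d) * (\<integral>y. V (x + t *\<^sub>R y) * \<kappa> y \<partial>lborel)"
    using t by simp
  finally show ?thesis by (simp add: dilated_def)
qed

subsection \<open>Pointwise bounds for Sobolev functions\<close>

lemma in_sobolev_weak_deriv:
  assumes "in_sobolev U m v" "mi_order \<beta> \<le> nat \<lfloor>m\<rfloor>"
  shows "has_weak_deriv U \<beta> v (weak_deriv U \<beta> v)"
  using assms unfolding in_sobolev_def weak_deriv_def by (metis someI_ex)

lemma sobolev_norm_nonneg [simp]: "sobolev_norm U m v \<ge> 0"
  by (auto simp: sobolev_norm_def intro!: add_nonneg_nonneg sum_nonneg)

lemma L2_norm_weak_deriv_le:
  fixes U :: "(real ^ 'd::finite) set"
  assumes "mi_order \<beta> \<le> nat \<lfloor>m\<rfloor>"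
  shows "L2_norm U (weak_deriv U \<beta> v) \<le> sobolev_norm U m v"
proof -
  have "(L2_norm U (weak_deriv U \<beta> v))\<^sup>2 \<le> (\<Sum>\<beta> | mi_order \<beta> \<le> nat \<lfloor>m\<rfloor>. (L2_norm U (weak_deriv U \<beta> v))\<^sup>2)"
    using assms by (intro member_le_sum finite_mi_order) auto
  also have "\<dots> \<le> \<dots> + (if m \<in> \<int> then 0 else (\<Sum>\<beta> | mi_order \<beta> = nat \<lfloor>m\<rfloor>. enn2real (gagliardo U (frac m) (weak_deriv U \<beta> v))))"
    by (auto intro!: sum_nonneg)
  finally show ?thesis
    unfolding sobolev_norm_def by (intro real_le_rsqrt)
qed

lemma gagliardo_weak_deriv_le:
  fixes U :: "(real ^ 'd::finite) set"
  assumes "mi_order \<beta> = nat \<lfloor>m\<rfloor>" "m \<notin> \<int>"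
  shows "sqrt (enn2real (gagliardo U (frac m) (weak_deriv U \<beta> v))) \<le> sobolev_norm U m v"
proof -
  have "finite {\<beta> :: 'd \<Rightarrow> nat. mi_order \<beta> = nat \<lfloor>m\<rfloor>}"
    by (rule finite_subset[OF _ finite_mi_order[of "nat \<lfloor>m\<rfloor>"]]) auto
  then have "enn2real (gagliardo U (frac m) (weak_deriv U \<beta> v)) \<le>
      (\<Sum>\<beta> | mi_order \<beta> = nat \<lfloor>m\<rfloor>. enn2real (gagliardo U (frac m) (weak_deriv U \<beta> v)))"
    using assms by (intro member_le_sum) auto
  also have "\<dots> \<le> (\<Sum>\<beta> | mi_order \<beta> \<le> nat \<lfloor>m\<rfloor>. (L2_norm U (weak_deriv U \<beta> v))\<^sup>2) + \<dots>"
    by (auto intro!: sum_nonneg)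
  finally show ?thesis
    unfolding sobolev_norm_def using assms by (intro real_sqrt_le_mono) simp
qed

section \<open>Pairing weak derivatives with dilated kernels\<close>

lemma test_function_dilate:
  fixes \<zeta> :: "real ^ 'd::finite \<Rightarrow> real"
  assumes \<zeta>: "smooth \<zeta>" "supp_in (cball c r) \<zeta>" and t: "t > 0"
    and sub: "cball (x + t *\<^sub>R c) (t * r) \<subseteq> U"
  shows "test_function U (\<lambda>z. \<zeta> ((1 / t) *\<^sub>R (z - x)))"
proof -
  let ?\<xi> = "\<lambda>z. \<zeta> ((1 / t) *\<^sub>R (z - x))"
  have cl: "closure {z. ?\<xi> z \<noteq> 0} \<subseteq> cball (x + t *\<^sub>R c) (t * r)"
  proof (rule closure_minimal)
    show "{z. ?\<xi> z \<noteq> 0} \<subseteq> cball (x + t *\<^sub>R c) (t * r)"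
      using \<zeta>(2) dilate_mem[OF t, of _ x c r] unfolding supp_in_def by blast
  qed simp
  moreover have "compact (closure {z. ?\<xi> z \<noteq> 0})"
    using cl by (meson bounded_cball bounded_subset closed_closure compact_eq_bounded_closed)
  ultimately show ?thesis
    using smooth_dilate[OF \<zeta>(1), of t x] sub by (auto simp: test_function_def smooth_def)
qed

text \<open>The weak derivative moves the derivatives \<open>js\<close> from the kernel to
  \<open>v\<close>, which contributes t^k with k the integer part of m. For integer m,
  Cauchy-Schwarz on a ball of radius t r contributes t^(d/2); otherwise the mean-zero pairing also
  gains the missing t^(frac m). The constant is the sum of the constants of the two cases.\<close>

lemma sobolev_top_bound:
  fixes \<zeta> v :: "real ^ 'd::finite \<Rightarrow> real"
  assumes U: "open U" and m: "m > 0" and v: "in_sobolev U m v" and js: "length js = nat \<lfloor>m\<rfloor>"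
    and \<zeta>: "smooth \<zeta>" "supp_in (cball c r) \<zeta>" "\<And>y. \<bar>\<zeta> y\<bar> \<le> B" and mean: "(\<integral>y. \<zeta> y \<partial>lborel) = 0"
    and r: "r > 0" and t: "t > 0" and sub: "(\<lambda>y. x + t *\<^sub>R y) ` cball c r \<subseteq> U"
  shows "\<bar>dilated (\<lambda>z. indicator U z * v z) (iter_partial js \<zeta>) t x\<bar> \<le>
    B * (sqrt (unit_ball_vol (real CARD('d)) * r ^ CARD('d)) + (2 * r) powr (real CARD('d) / 2 + frac m)) *
      t powr (m + real CARD('d) / 2) * sobolev_norm U m v"
proof -
  let ?d = "real CARD('d)" and ?k = "nat \<lfloor>m\<rfloor>"
  let ?p = "x + t *\<^sub>R c" and ?\<rho> = "t * r"
  let ?\<beta> = "\<lambda>i. count_list js i"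
  define \<xi> where "\<xi> z = \<zeta> ((1 / t) *\<^sub>R (z - x))" for z
  define g where "g = weak_deriv U ?\<beta> v"
  define G where "G z = indicator U z * g z" for z
  have sub': "cball ?p ?\<rho> \<subseteq> U" using sub unfolding cball_image_affine[OF t] .
  have ord: "mi_order ?\<beta> = ?k" using mi_order_eq_length[of js] js by simp
  have wd: "has_weak_deriv U ?\<beta> v g"
    unfolding g_def using in_sobolev_weak_deriv[OF v] ord by simp
  then have L2g: "L2_on U g" by (simp add: has_weak_deriv_def)
  note G = L2_onD[OF L2g, folded G_def]
  have s\<xi>: "smooth \<xi>" unfolding \<xi>_def[abs_def] by (rule smooth_dilate[OF \<zeta>(1)])
  have test: "test_function U \<xi>"
    unfolding \<xi>_def[abs_def] by (rule test_function_dilate[OF \<zeta>(1,2) t sub'])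
  have B: "B \<ge> 0" using \<zeta>(3)[of undefined] by linarith
  have \<xi>b: "\<bar>\<xi> z\<bar> \<le> B * indicator (cball ?p ?\<rho>) z" for z
    using \<zeta>(2,3) dilate_mem[OF t, of z x c r] by (cases "z \<in> cball ?p ?\<rho>") (auto simp: \<xi>_def supp_in_def)
  define I where "I = (\<integral>z. G z * \<xi> z \<partial>lborel)"
  have "(LINT z:U|lborel. v z * mi_deriv ?\<beta> \<xi> z) = (-1) ^ ?k * (LINT z:U|lborel. g z * \<xi> z)"
    using wd test ord unfolding has_weak_deriv_def by simp
  then have "(\<integral>z. (indicator U z * v z) * iter_partial js \<xi> z \<partial>lborel) = (-1) ^ ?k * I"
    unfolding mi_deriv_count_list[OF s\<xi>] lint_pairing I_def G_def .
  moreover have "iter_partial js \<xi> = (\<lambda>z. (1 / t) ^ ?k * iter_partial js \<zeta> ((1 / t) *\<^sub>R (z - x)))"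
    unfolding \<xi>_def[abs_def] using iter_partial_dilate[OF \<zeta>(1)] js by simp
  moreover have "indicator U z * v z * ((1 / t) ^ ?k * iter_partial js \<zeta> ((1 / t) *\<^sub>R (z - x))) =
      (1 / t) ^ ?k * (indicator U z * v z * iter_partial js \<zeta> ((1 / t) *\<^sub>R (z - x)))" for z
    by (simp only: mult_ac)
  ultimately have "(1 / t) ^ ?k * dilated (\<lambda>z. indicator U z * v z) (iter_partial js \<zeta>) t x = (-1) ^ ?k * I"
    unfolding dilated_def by (simp only: integral_mult_right_zero)
  then have "dilated (\<lambda>z. indicator U z * v z) (iter_partial js \<zeta>) t x = t ^ ?k * ((-1) ^ ?k * I)"
    using t by (simp add: field_simps power_divide)
  then have J: "\<bar>dilated (\<lambda>z. indicator U z * v z) (iter_partial js \<zeta>) t x\<bar> = t ^ ?k * \<bar>I\<bar>"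
    using t by (simp add: abs_mult power_abs)
  have tk: "t ^ ?k = t powr (real ?k)" using t by (simp add: powr_realpow)
  have \<xi>m: "\<xi> \<in> borel_measurable borel" by (rule smooth_borel[OF s\<xi>])
  define A1 where "A1 = sqrt (unit_ball_vol ?d * r ^ CARD('d))"
  define A2 where "A2 = (2 * r) powr (?d / 2 + frac m)"
  have A: "A1 \<ge> 0" "A2 \<ge> 0" using r by (auto simp: A1_def A2_def)
  have "t ^ ?k * \<bar>I\<bar> \<le> B * (A1 + A2) * t powr (m + ?d / 2) * sobolev_norm U m v"
  proof (cases "m \<in> \<int>")
    case True
    then have mk: "m = real ?k" using m by (auto elim!: Ints_cases)
    have "\<bar>I\<bar> \<le> B * sqrt (unit_ball_vol ?d * ?\<rho> ^ CARD('d)) * sqrt ((L2_norm U g)\<^sup>2)"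
      unfolding I_def G(3)[symmetric] by (rule L2_pairing(2)) (use G \<xi>m \<xi>b B r t in auto)
    also have "sqrt (unit_ball_vol ?d * ?\<rho> ^ CARD('d)) = A1 * t powr (?d / 2)"
      using t by (simp add: A1_def power_mult_distrib real_sqrt_mult powr_half_sqrt[symmetric]
          powr_powr powr_realpow[symmetric] mult_ac)
    also have "sqrt ((L2_norm U g)\<^sup>2) \<le> sobolev_norm U m v"
      using L2_norm_weak_deriv_le[of ?\<beta> m U v] ord by (simp add: g_def)
    finally have "\<bar>I\<bar> \<le> B * (A1 * t powr (?d / 2)) * sobolev_norm U m v"
      using A B by (simp add: mult_left_mono)
    then have "t ^ ?k * \<bar>I\<bar> \<le> t powr real ?k * (B * (A1 * t powr (?d / 2)) * sobolev_norm U m v)"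
      unfolding tk by (intro mult_left_mono) auto
    also have "\<dots> = B * A1 * t powr (m + ?d / 2) * sobolev_norm U m v"
      by (subst (3) mk) (simp add: powr_add mult_ac)
    also have "\<dots> \<le> B * (A1 + A2) * t powr (m + ?d / 2) * sobolev_norm U m v"
      using A B by (intro mult_right_mono mult_left_mono) auto
    finally show ?thesis .
  next
    case False
    let ?s = "frac m"
    have s: "?s > 0" using False by (simp add: frac_gt_0_iff)
    have mk: "m = real ?k + ?s" using m by (simp add: frac_def)
    have "gagliardo U ?s g < \<infinity>"
      using v False ord unfolding in_sobolev_def g_def by auto
    then have fin: "gagliardo U ?s G < \<infinity>" unfolding G_def[abs_def] gagliardo_indicator .
    \<comment> \<open>Dilation preserves mean zero: this is the substitution rule with the constant
      function 1.\<close>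
    have mean': "(\<integral>z. \<xi> z \<partial>lborel) = 0"
      using dilated_subst[of "\<lambda>_. 1" \<zeta> t x] smooth_borel[OF \<zeta>(1)] t mean
      by (simp add: dilated_def \<xi>_def[abs_def])
    have "\<bar>I\<bar> \<le> B * (2 * ?\<rho>) powr (?d / 2 + ?s) * sqrt (enn2real (gagliardo U ?s G))"
      unfolding I_def
      by (rule gagliardo_pairing[OF U G(1,2) \<xi>m \<xi>b B _ mean' sub' s fin]) (use r t in simp)
    also have "(2 * ?\<rho>) powr (?d / 2 + ?s) = A2 * t powr (?d / 2 + ?s)"
      using r t by (simp add: A2_def powr_mult[symmetric] mult_ac)
    also have "sqrt (enn2real (gagliardo U ?s G)) \<le> sobolev_norm U m v"
      unfolding G_def[abs_def] gagliardo_indicator g_def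
      by (rule gagliardo_weak_deriv_le) (use ord False in auto)
    finally have "\<bar>I\<bar> \<le> B * (A2 * t powr (?d / 2 + ?s)) * sobolev_norm U m v"
      using A B by (simp add: mult_left_mono)
    then have "t ^ ?k * \<bar>I\<bar> \<le> t powr real ?k * (B * (A2 * t powr (?d / 2 + ?s)) * sobolev_norm U m v)"
      unfolding tk by (intro mult_left_mono) auto
    also have "\<dots> = B * A2 * t powr (real ?k + (?d / 2 + ?s)) * sobolev_norm U m v"
      by (simp only: powr_add) (simp only: mult_ac)
    also have "real ?k + (?d / 2 + ?s) = m + ?d / 2" using mk by linarith
    also have "B * A2 * t powr (m + ?d / 2) * sobolev_norm U m v \<le> B * (A1 + A2) * t powr (m + ?d / 2) * sobolev_norm U m v"
      using A B by (intro mult_right_mono mult_left_mono) auto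
    finally show ?thesis .
  qed
  then show ?thesis using J by (simp add: A1_def A2_def)
qed

text \<open>Both g - f and g + f are nondecreasing; this takes the place of integrating the
  derivative of f.\<close>

lemma abs_diff_le_of_deriv_bound:
  fixes f g :: "real \<Rightarrow> real"
  assumes "s \<le> t" and f: "\<And>u. s \<le> u \<Longrightarrow> u \<le> t \<Longrightarrow> (f has_real_derivative f' u) (at u)"
    and g: "\<And>u. s \<le> u \<Longrightarrow> u \<le> t \<Longrightarrow> (g has_real_derivative g' u) (at u)"
    and le: "\<And>u. s \<le> u \<Longrightarrow> u \<le> t \<Longrightarrow> \<bar>f' u\<bar> \<le> g' u"
  shows "\<bar>f t - f s\<bar> \<le> g t - g s"
proof -
  have "g s - f s \<le> g t - f t"
  proof (rule DERIV_nonneg_imp_nondecreasing[OF \<open>s \<le> t\<close>])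
    fix u assume u: "s \<le> u" "u \<le> t"
    then show "\<exists>y. ((\<lambda>u. g u - f u) has_real_derivative y) (at u) \<and> 0 \<le> y"
      using le[OF u] by (intro exI[of _ "g' u - f' u"] conjI DERIV_diff f g) auto
  qed
  moreover have "g s + f s \<le> g t + f t"
  proof (rule DERIV_nonneg_imp_nondecreasing[OF \<open>s \<le> t\<close>])
    fix u assume u: "s \<le> u" "u \<le> t"
    then show "\<exists>y. ((\<lambda>u. g u + f u) has_real_derivative y) (at u) \<and> 0 \<le> y"
      using le[OF u] by (intro exI[of _ "g' u + f' u"] conjI DERIV_add f g) auto
  qed
  ultimately show ?thesis by linarith
qed

text \<open>Cauchy-Schwarz against the indicator of \<open>U\<close>, which has finite
  measure.\<close>

lemma L2_on_integrable:
  fixes v :: "real ^ 'd::finite \<Rightarrow> real"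
  assumes "L2_on U v" "bounded U" "open U"
  shows "integrable lborel (\<lambda>z. indicator U z * v z)"
proof -
  obtain R where R: "U \<subseteq> cball 0 R" using assms(2) using bounded_subset_ballD ball_subset_cball by (metis order_trans)
  note v = L2_onD[OF assms(1)]
  have [measurable]: "U \<in> sets borel" using assms(3) by simp
  have "emeasure lborel U \<le> emeasure lborel (cball (0 :: real ^ 'd) R)" by (intro emeasure_mono R) simp
  from le_less_trans[OF this emeasure_lborel_cball_finite] have "emeasure lborel U < \<infinity>" .
  then have "integrable lborel (indicat_real U)" by (intro integrable_real_indicator) auto
  moreover have "(\<lambda>z. (indicat_real U z)\<^sup>2) = indicat_real U" by (auto simp: indicator_def)
  ultimately have "integrable lborel (\<lambda>z. (indicat_real U z)\<^sup>2)" by simp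
  from integral_cauchy_schwarz(1)[of _ lborel, OF _ _ v(2) this] v(1)
  have "integrable lborel (\<lambda>x. indicator U x * v x * indicator U x)" by simp
  moreover have "(\<lambda>x. indicator U x * v x * indicator U x) = (\<lambda>z. indicator U z * v z)"
    by (auto simp: indicator_def)
  ultimately show ?thesis by simp
qed

text \<open>Up to the constant \<open>\<plusminus> \<integral>\<psi>\<close>, \<open>mollified U \<psi> is v t x\<close> is the derivative \<open>is\<close> at \<open>x\<close> of the
  mollification of \<open>v\<close> at scale \<open>t\<close>.\<close>

definition mollified :: "(real ^ 'd::finite) set \<Rightarrow> (real ^ 'd \<Rightarrow> real) \<Rightarrow> 'd list \<Rightarrow> (real ^ 'd \<Rightarrow> real) \<Rightarrow> real \<Rightarrow> real ^ 'd \<Rightarrow> real" where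
  "mollified U \<psi> is v t x = (-1) ^ length is * t powr (- (real CARD('d) + real (length is))) *
     dilated (\<lambda>z. indicator U z * v z) (iter_partial is \<psi>) t x"

text \<open>The power of t contributes -(d + a)/t and the kernel -1/t times its radial derivative.
  By the commutation rule the two combine into the dilation operator applied before the derivatives
  \<open>is\<close>.\<close>

lemma mollified_deriv_scale:
  fixes \<psi> v :: "real ^ 'd::finite \<Rightarrow> real"
  assumes V: "integrable lborel (\<lambda>z. indicator U z * v z)" and \<psi>: "smooth \<psi>" "supp_in (cball c R) \<psi>" and t: "t > 0"
  shows "((\<lambda>t. mollified U \<psi> is v t x) has_real_derivative
    - ((-1) ^ length is * t powr (- (real CARD('d) + real (length is)) - 1) *
      dilated (\<lambda>z. indicator U z * v z) (iter_partial is (euler \<psi>)) t x)) (at t)"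
proof -
  let ?V = "\<lambda>z. indicator U z * v z" and ?\<kappa> = "iter_partial is \<psi>" and ?a = "real (length is)" and ?d = "real CARD('d)"
  let ?\<eta> = "\<lambda>y. \<Sum>i\<in>UNIV. vec_nth y i * partial_deriv i ?\<kappa> y"
  have k: "smooth ?\<kappa>" "supp_in (cball c R) ?\<kappa>"
    by (auto intro: smooth_iter_partial supp_in_iter_partial \<psi>)
  have \<eta>: "smooth ?\<eta>" "supp_in (cball c R) ?\<eta>"
    using supp_in_partial[OF k(2)] by (auto intro!: smooth_sum smooth_coord_mult smooth_partial k(1) simp: supp_in_def)
  have "iter_partial is (euler \<psi>) = (\<lambda>y. (?d + ?a) * ?\<kappa> y + ?\<eta> y)"
    by (auto simp: iter_partial_euler[OF \<psi>(1)] euler_eq[OF k(1)] algebra_simps)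
  then have dil: "dilated ?V (iter_partial is (euler \<psi>)) t x = (?d + ?a) * dilated ?V ?\<kappa> t x + dilated ?V ?\<eta> t x"
    using dilated_add[OF V, of "\<lambda>y. (?d + ?a) * ?\<kappa> y" c R ?\<eta>] \<eta> k
    by (simp add: smooth_cmult dilated_cmult supp_in_def)
  have "((\<lambda>t. t powr (- (?d + ?a)) * dilated ?V ?\<kappa> t x) has_real_derivative
      (- (?d + ?a) * t powr (- (?d + ?a) - 1)) * dilated ?V ?\<kappa> t x +
      (- (1 / t) * dilated ?V ?\<eta> t x) * t powr (- (?d + ?a))) (at t)"
    by (intro DERIV_mult has_real_derivative_powr dilated_deriv_scale[OF V k t] t)
  also have "(- (?d + ?a) * t powr (- (?d + ?a) - 1)) * dilated ?V ?\<kappa> t x +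
      (- (1 / t) * dilated ?V ?\<eta> t x) * t powr (- (?d + ?a)) =
      - (t powr (- (?d + ?a) - 1) * dilated ?V (iter_partial is (euler \<psi>)) t x)"
    using t unfolding dil powr_diff by (simp add: field_simps)
  finally have "((\<lambda>t. (-1) ^ length is * (t powr (- (?d + ?a)) * dilated ?V ?\<kappa> t x)) has_real_derivative
      (-1) ^ length is * - (t powr (- (?d + ?a) - 1) * dilated ?V (iter_partial is (euler \<psi>)) t x)) (at t)"
    by (rule DERIV_cmult)
  then show ?thesis by (simp add: mollified_def mult.assoc)
qed

text \<open>Each derivative in the point brings out -1/t, which is exactly the change of sign and
  power of t in \<open>mollified\<close>.\<close>

lemma mollified_deriv_shift:
  fixes \<psi> v :: "real ^ 'd::finite \<Rightarrow> real"
  assumes V: "integrable lborel (\<lambda>z. indicator U z * v z)" and \<psi>: "smooth \<psi>" "supp_in (cball c R) \<psi>" and t: "t > 0"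
  shows "((\<lambda>s. mollified U \<psi> is v t (x + s *\<^sub>R axis i 1)) has_real_derivative
    mollified U \<psi> (i # is) v t (x + s *\<^sub>R axis i 1)) (at s)"
proof -
  let ?V = "\<lambda>z. indicator U z * v z" and ?\<kappa> = "iter_partial is \<psi>" and ?a = "real (length is)" and ?d = "real CARD('d)"
  have k: "smooth ?\<kappa>" "supp_in (cball c R) ?\<kappa>"
    by (auto intro: smooth_iter_partial supp_in_iter_partial \<psi>)
  have "((\<lambda>s. (-1) ^ length is * t powr (- (?d + ?a)) * dilated ?V ?\<kappa> t (x + s *\<^sub>R axis i 1)) has_real_derivative
      (-1) ^ length is * t powr (- (?d + ?a)) * (- (1 / t) * dilated ?V (partial_deriv i ?\<kappa>) t (x + s *\<^sub>R axis i 1))) (at s)"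
    by (intro DERIV_cmult dilated_deriv_shift[OF V k t])
  moreover have "t powr (- (?d + ?a)) * (1 / t) = t powr (- (?d + real (length (i # is))))"
  proof -
    have "t powr (- (?d + real (length (i # is)))) = t powr (- (?d + ?a) - 1)"
      by (rule arg_cong[where f = "\<lambda>e. t powr e"]) simp
    also have "\<dots> = t powr (- (?d + ?a)) / t" using t by (subst powr_diff) simp
    finally show ?thesis by simp
  qed
  then have "(-1) ^ length is * t powr (- (?d + ?a)) * (- (1 / t) * Y) =
      (-1) ^ length (i # is) * t powr (- (?d + real (length (i # is)))) * Y" for Y
  proof -
    assume E: "t powr (- (?d + ?a)) * (1 / t) = t powr (- (?d + real (length (i # is))))"
    have "(-1) ^ length is * t powr (- (?d + ?a)) * (- (1 / t) * Y) = - ((-1) ^ length is * (t powr (- (?d + ?a)) * (1 / t)) * Y)"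
      by simp
    also have "\<dots> = (-1) ^ length (i # is) * t powr (- (?d + real (length (i # is)))) * Y"
      unfolding E by simp
    finally show ?thesis .
  qed
  ultimately show ?thesis
    unfolding mollified_def iter_partial_Cons by (simp only:)
qed

lemma mollified_linear:
  fixes \<psi> v w :: "real ^ 'd::finite \<Rightarrow> real"
  assumes V: "integrable lborel (\<lambda>z. indicator U z * v z)" "integrable lborel (\<lambda>z. indicator U z * w z)"
    and \<psi>: "smooth \<psi>" "supp_in (cball c R) \<psi>"
  shows "mollified U \<psi> is (\<lambda>x. p * v x + q * w x) t x = p * mollified U \<psi> is v t x + q * mollified U \<psi> is w t x"
proof -
  let ?K = "\<lambda>z. iter_partial is \<psi> ((1 / t) *\<^sub>R (z - x))"
  have "integrable lborel (\<lambda>z. indicator U z * v z * ?K z)" "integrable lborel (\<lambda>z. indicator U z * w z * ?K z)"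
    by (intro dilated_integrable[of _ _ c R] V smooth_iter_partial supp_in_iter_partial \<psi> closed_cball)+
  then have "(\<integral>z. p * (indicator U z * v z * ?K z) + q * (indicator U z * w z * ?K z) \<partial>lborel) =
      p * (\<integral>z. indicator U z * v z * ?K z \<partial>lborel) + q * (\<integral>z. indicator U z * w z * ?K z \<partial>lborel)"
    by simp
  moreover have "p * (indicator U z * v z * ?K z) + q * (indicator U z * w z * ?K z) = indicator U z * (p * v z + q * w z) * ?K z" for z
    by (simp add: algebra_simps)
  ultimately have "dilated (\<lambda>z. indicator U z * (p * v z + q * w z)) (iter_partial is \<psi>) t x =
      p * dilated (\<lambda>z. indicator U z * v z) (iter_partial is \<psi>) t x + q * dilated (\<lambda>z. indicator U z * w z) (iter_partial is \<psi>) t x"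
    by (simp add: dilated_def)
  then show ?thesis by (simp add: mollified_def algebra_simps)
qed

text \<open>The derivative in the scale u is at most a multiple of u^(-d-a-1) u^(m+d/2) =
  u^(\<gamma>-1) and is compared with that of u^\<gamma>/\<gamma>. Positivity of \<gamma> makes this
  bound integrable down to scale 0: here the smoothness must exceed d/2 plus the number of
  derivatives.\<close>

lemma mollified_growth:
  fixes \<phi> :: "'b \<Rightarrow> real ^ 'd::finite \<Rightarrow> real" and P :: "'b \<Rightarrow> real ^ 'd"
  assumes U: "open U" "bounded U" and fam: "smooth_family T \<phi>" and r: "r > 0"
    and supp: "\<And>x. x \<in> T \<Longrightarrow> supp_in (cball (c x) r) (\<phi> x)"
    and sub: "\<And>x t. x \<in> T \<Longrightarrow> 0 < t \<Longrightarrow> t \<le> 1 \<Longrightarrow> (\<lambda>y. P x + t *\<^sub>R y) ` cball (c x) r \<subseteq> U"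
    and m: "m > 0" and \<gamma>: "m - real CARD('d) / 2 - real (length ks) > 0"
  shows "\<exists>C\<ge>0. \<forall>x\<in>T. \<forall>v. in_sobolev U m v \<longrightarrow> (\<forall>s t. 0 < s \<longrightarrow> s \<le> t \<longrightarrow> t \<le> 1 \<longrightarrow>
    \<bar>mollified U (kern (nat \<lfloor>m\<rfloor>) (\<phi> x)) ks v t (P x) - mollified U (kern (nat \<lfloor>m\<rfloor>) (\<phi> x)) ks v s (P x)\<bar>
      \<le> C * t powr (m - real CARD('d) / 2 - real (length ks)) * sobolev_norm U m v)"
proof -
  let ?k = "nat \<lfloor>m\<rfloor>" and ?d = "real CARD('d)" and ?a = "real (length ks)"
  define \<gamma> where "\<gamma> = m - ?d / 2 - ?a"
  have \<gamma>0: "\<gamma> > 0" using \<gamma> by (simp add: \<gamma>_def)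
  \<comment> \<open>The extra derivatives \<open>ks\<close> stay on the kernel, so that only the
    derivatives \<open>js\<close>, whose number is the integer part of m, are moved to
    \<open>v\<close>.\<close>
  define \<zeta> where "\<zeta> js x = iter_partial ks (euler (monom_mult js (\<phi> x)))" for js x
  have famX: "smooth_family T (\<zeta> js)" for js
    unfolding \<zeta>_def by (intro smooth_family_iter_partial smooth_family_euler smooth_family_monom_mult fam)
  have "\<forall>js. \<exists>B\<ge>0. \<forall>x\<in>T. \<forall>y. \<bar>\<zeta> js x y\<bar> \<le> B"
  proof
    fix js obtain B where "B \<ge> 0" "\<And>x y. x \<in> T \<Longrightarrow> \<bar>\<zeta> js x y\<bar> \<le> B"
      by (rule smooth_family_bounded[OF famX]) blast
    then show "\<exists>B\<ge>0. \<forall>x\<in>T. \<forall>y. \<bar>\<zeta> js x y\<bar> \<le> B" by blast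
  qed
  then obtain B where B: "\<And>js. B js \<ge> 0" "\<And>js x y. x \<in> T \<Longrightarrow> \<bar>\<zeta> js x y\<bar> \<le> B js" by metis
  define A where "A = sqrt (unit_ball_vol ?d * r ^ CARD('d)) + (2 * r) powr (?d / 2 + frac m)"
  have A: "A \<ge> 0" using r by (simp add: A_def)
  define D where "D = (\<Sum>js | length js = ?k. B js) * A"
  have D: "D \<ge> 0" unfolding D_def by (intro mult_nonneg_nonneg sum_nonneg A) (auto simp: B)
  have "\<bar>mollified U (kern ?k (\<phi> x)) ks v t (P x) - mollified U (kern ?k (\<phi> x)) ks v s (P x)\<bar>
      \<le> D / \<gamma> * t powr \<gamma> * sobolev_norm U m v"
    if x: "x \<in> T" and v: "in_sobolev U m v" and st: "0 < s" "s \<le> t" "t \<le> 1" for x v s t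
  proof -
    let ?\<psi> = "kern ?k (\<phi> x)" and ?V = "\<lambda>z. indicator U z * v z" and ?N = "sobolev_norm U m v"
    have \<phi>: "smooth (\<phi> x)" "supp_in (cball (c x) r) (\<phi> x)" using x fam supp by (auto dest: smooth_familyD)
    have \<psi>: "smooth ?\<psi>" "supp_in (cball (c x) r) ?\<psi>" by (auto intro: smooth_kern supp_in_kern \<phi>)
    have V: "integrable lborel ?V" using v U by (intro L2_on_integrable) (auto simp: in_sobolev_def)
    have m\<phi>: "smooth (monom_mult js (\<phi> x))" "supp_in (cball (c x) r) (monom_mult js (\<phi> x))" for js
      by (auto intro: smooth_monom_mult supp_in_monom_mult \<phi>)
    have e\<phi>: "smooth (euler (monom_mult js (\<phi> x)))" "supp_in (cball (c x) r) (euler (monom_mult js (\<phi> x)))" for js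
      by (auto intro: smooth_euler supp_in_euler m\<phi>)
    have \<zeta>: "smooth (\<zeta> js x)" "supp_in (cball (c x) r) (\<zeta> js x)" for js
      unfolding \<zeta>_def by (auto intro: smooth_iter_partial supp_in_iter_partial e\<phi>)
    \<comment> \<open>Mean zero comes from an outer partial derivative if \<open>ks\<close> is
      nonempty, and from the divergence form of \<open>euler\<close> otherwise.\<close>
    have mean: "(\<integral>y. \<zeta> js x y \<partial>lborel) = 0" for js
    proof (cases ks)
      case Nil then show ?thesis by (simp add: \<zeta>_def integral_euler_zero[OF m\<phi>])
    next
      case (Cons i ls)
      then show ?thesis
        using integral_partial_zero[of "iter_partial ls (euler (monom_mult js (\<phi> x)))" "c x" r i]
        by (simp add: \<zeta>_def iter_partial_Cons smooth_iter_partial supp_in_iter_partial e\<phi>)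
    qed
    have eq: "iter_partial ks (euler ?\<psi>) = (\<lambda>y. \<Sum>js | length js = ?k. iter_partial js (\<zeta> js x) y)"
      unfolding euler_kern[OF \<phi>(1)] \<zeta>_def
      by (simp add: iter_partial_sum smooth_iter_partial e\<phi> iter_partial_commute[of "euler (monom_mult _ (\<phi> x))" ks])
    have bound: "\<bar>dilated ?V (iter_partial ks (euler ?\<psi>)) u (P x)\<bar> \<le> D * u powr (m + ?d / 2) * ?N"
      if u: "0 < u" "u \<le> 1" for u
    proof -
      have "dilated ?V (iter_partial ks (euler ?\<psi>)) u (P x) = (\<Sum>js | length js = ?k. dilated ?V (iter_partial js (\<zeta> js x)) u (P x))"
        unfolding eq by (intro dilated_sum[OF V, of _ _ "c x" r] smooth_iter_partial supp_in_iter_partial \<zeta> closed_cball)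
      also have "\<bar>\<dots>\<bar> \<le> (\<Sum>js | length js = ?k. B js * A * u powr (m + ?d / 2) * ?N)"
        unfolding A_def
        by (intro order_trans[OF sum_abs] sum_mono sobolev_top_bound[OF U(1) m v _ \<zeta> B(2)[OF x] mean r u(1) sub[OF x u]]) simp
      also have "\<dots> = D * u powr (m + ?d / 2) * ?N"
        by (simp add: D_def sum_distrib_right)
      finally show ?thesis .
    qed
    have "\<bar>mollified U ?\<psi> ks v t (P x) - mollified U ?\<psi> ks v s (P x)\<bar> \<le> D * ?N / \<gamma> * t powr \<gamma> - D * ?N / \<gamma> * s powr \<gamma>"
    proof (rule abs_diff_le_of_deriv_bound[OF st(2)])
      fix u assume "s \<le> u" "u \<le> t"
      then have u: "0 < u" "u \<le> 1" using st by auto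
      show "((\<lambda>t. mollified U ?\<psi> ks v t (P x)) has_real_derivative
          - ((-1) ^ length ks * u powr (- (?d + ?a) - 1) * dilated ?V (iter_partial ks (euler ?\<psi>)) u (P x))) (at u)"
        by (rule mollified_deriv_scale[OF V \<psi> u(1)])
      show "((\<lambda>t. D * ?N / \<gamma> * t powr \<gamma>) has_real_derivative D * ?N * u powr (\<gamma> - 1)) (at u)"
        using \<gamma>0 u by (auto intro!: derivative_eq_intros)
      have "\<bar>- ((-1) ^ length ks * u powr (- (?d + ?a) - 1) * dilated ?V (iter_partial ks (euler ?\<psi>)) u (P x))\<bar>
          = u powr (- (?d + ?a) - 1) * \<bar>dilated ?V (iter_partial ks (euler ?\<psi>)) u (P x)\<bar>"
        by (simp add: abs_mult power_abs)
      also have "\<dots> \<le> u powr (- (?d + ?a) - 1) * (D * u powr (m + ?d / 2) * ?N)"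
        by (intro mult_left_mono bound u) simp
      also have "\<dots> = D * ?N * (u powr (- (?d + ?a) - 1) * u powr (m + ?d / 2))" by simp
      also have "u powr (- (?d + ?a) - 1) * u powr (m + ?d / 2) = u powr (\<gamma> - 1)"
          unfolding powr_add[symmetric] by (rule arg_cong[where f = "\<lambda>e. u powr e"]) (simp add: \<gamma>_def)
      finally show "\<bar>- ((-1) ^ length ks * u powr (- (?d + ?a) - 1) * dilated ?V (iter_partial ks (euler ?\<psi>)) u (P x))\<bar> \<le> D * ?N * u powr (\<gamma> - 1)" .
    qed
    also have "\<dots> \<le> D * ?N / \<gamma> * t powr \<gamma>" using D \<gamma>0 by simp
    also have "\<dots> = D / \<gamma> * t powr \<gamma> * ?N" by simp
    finally show ?thesis .
  qed
  then show ?thesis using D \<gamma>0 by (intro exI[of _ "D / \<gamma>"]) (auto simp: \<gamma>_def)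
qed

text \<open>Cauchy-Schwarz at a single scale, without derivatives of \<open>v\<close>: the part of
  the Sobolev inequality that loses the power -d/2-a of t.\<close>

lemma mollified_L2_bound:
  fixes \<psi> :: "'b \<Rightarrow> real ^ 'd::finite \<Rightarrow> real" and P :: "'b \<Rightarrow> real ^ 'd"
  assumes fam: "smooth_family T \<psi>" and r: "r > 0"
    and supp: "\<And>x. x \<in> T \<Longrightarrow> supp_in (cball (c x) r) (\<psi> x)"
  shows "\<exists>C\<ge>0. \<forall>x\<in>T. \<forall>v. L2_on U v \<longrightarrow> (\<forall>t>0.
    \<bar>mollified U (\<psi> x) ks v t (P x)\<bar> \<le> C * t powr (- real CARD('d) / 2 - real (length ks)) * L2_norm U v)"
proof -
  let ?d = "real CARD('d)" and ?a = "real (length ks)"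
  have fam': "smooth_family T (\<lambda>x. iter_partial ks (\<psi> x))" by (rule smooth_family_iter_partial[OF fam])
  obtain B where B: "B \<ge> 0" "\<And>x y. x \<in> T \<Longrightarrow> \<bar>iter_partial ks (\<psi> x) y\<bar> \<le> B"
    by (rule smooth_family_bounded[OF fam']) blast
  define A where "A = sqrt (unit_ball_vol ?d * r ^ CARD('d))"
  have "\<bar>mollified U (\<psi> x) ks v t (P x)\<bar> \<le> (B * A) * t powr (- ?d / 2 - ?a) * L2_norm U v"
    if x: "x \<in> T" and v: "L2_on U v" and t: "t > 0" for x v t
  proof -
    let ?K = "\<lambda>z. iter_partial ks (\<psi> x) ((1 / t) *\<^sub>R (z - P x))" and ?p = "P x + t *\<^sub>R c x"
    have k: "smooth (iter_partial ks (\<psi> x))" "supp_in (cball (c x) r) (iter_partial ks (\<psi> x))"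
      using fam supp x by (auto intro: smooth_iter_partial supp_in_iter_partial dest: smooth_familyD)
    have Kb: "\<bar>?K z\<bar> \<le> B * indicator (cball ?p (t * r)) z" for z
      using k(2) B(2)[OF x] dilate_mem[OF t, of z "P x" "c x" r]
      by (cases "z \<in> cball ?p (t * r)") (auto simp: supp_in_def)
    have "\<bar>dilated (\<lambda>z. indicator U z * v z) (iter_partial ks (\<psi> x)) t (P x)\<bar> \<le>
        B * sqrt (unit_ball_vol ?d * (t * r) ^ CARD('d)) * sqrt ((L2_norm U v)\<^sup>2)"
      unfolding dilated_def L2_onD(3)[OF v, symmetric]
      by (rule L2_pairing(2)) (use L2_onD[OF v] smooth_borel[OF smooth_dilate[OF k(1)]] Kb B t r in auto)
    also have "sqrt (unit_ball_vol ?d * (t * r) ^ CARD('d)) = A * t powr (?d / 2)"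
      using t by (simp add: A_def power_mult_distrib real_sqrt_mult powr_half_sqrt[symmetric]
          powr_powr powr_realpow[symmetric] mult_ac)
    finally have dl: "\<bar>dilated (\<lambda>z. indicator U z * v z) (iter_partial ks (\<psi> x)) t (P x)\<bar> \<le> B * (A * t powr (?d / 2)) * L2_norm U v"
      by simp
    have "\<bar>mollified U (\<psi> x) ks v t (P x)\<bar> = t powr (- (?d + ?a)) * \<bar>dilated (\<lambda>z. indicator U z * v z) (iter_partial ks (\<psi> x)) t (P x)\<bar>"
      by (simp add: mollified_def abs_mult power_abs)
    also have "\<dots> \<le> t powr (- (?d + ?a)) * (B * (A * t powr (?d / 2)) * L2_norm U v)"
      by (intro mult_left_mono dl) simp
    also have "\<dots> = (B * A) * (t powr (- (?d + ?a)) * t powr (?d / 2)) * L2_norm U v" by simp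
    also have "t powr (- (?d + ?a)) * t powr (?d / 2) = t powr (- ?d / 2 - ?a)"
      unfolding powr_add[symmetric] by simp
    finally show ?thesis .
  qed
  moreover have "B * A \<ge> 0" using B r by (simp add: A_def)
  ultimately show ?thesis by blast
qed

text \<open>Substitution turns the mollification into an average of values v(x + t y). By
  \<open>sub\<close> these points stay in the interior even for \<open>x\<close> on the boundary, so
  continuity relative to \<open>\<Omega>\<close> gives pointwise convergence, and dominated
  convergence finishes.\<close>

lemma mollified_tendsto:
  fixes \<psi> v :: "real ^ 'd::finite \<Rightarrow> real"
  assumes \<Omega>: "compact \<Omega>" "U = interior \<Omega>" and v: "continuous_on \<Omega> v" and x: "x \<in> \<Omega>"
    and \<psi>: "smooth \<psi>" "supp_in (cball c r) \<psi>"
    and sub: "\<And>t. 0 < t \<Longrightarrow> t \<le> 1 \<Longrightarrow> (\<lambda>y. x + t *\<^sub>R y) ` cball c r \<subseteq> U"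
  shows "(\<lambda>n. mollified U \<psi> [] v (1 / real (Suc n)) x) \<longlonglongrightarrow> v x * (\<integral>y. \<psi> y \<partial>lborel)"
proof -
  let ?t = "\<lambda>n. 1 / real (Suc n)" and ?V = "\<lambda>z. indicator U z * v z"
  have t: "?t n > 0" "?t n \<le> 1" for n by auto
  have [measurable]: "U \<in> sets borel" using \<Omega> by simp
  have Vm: "?V \<in> borel_measurable borel"
  proof -
    have "(\<lambda>z. indicator U z *\<^sub>R v z) \<in> borel_measurable borel"
      by (rule borel_measurable_continuous_on_indicator) (use \<Omega> v interior_subset in \<open>auto intro: continuous_on_subset\<close>)
    then show ?thesis by simp
  qed
  note [measurable] = smooth_borel[OF \<psi>(1)] Vm
  obtain C where C: "C \<ge> 0" "\<And>y. \<bar>\<psi> y\<bar> \<le> C" by (rule smooth_continuous_bounded[OF \<psi>]) blast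
  have "bounded (v ` \<Omega>)" by (intro compact_imp_bounded compact_continuous_image v \<Omega>)
  then obtain B where "\<forall>a\<in>v ` \<Omega>. norm a \<le> B" unfolding bounded_iff by blast
  then have B: "\<And>z. z \<in> \<Omega> \<Longrightarrow> \<bar>v z\<bar> \<le> B" by auto
  then have B0: "B \<ge> 0" using x by force
  have Vb: "\<bar>?V z\<bar> \<le> B" for z
    using B[of z] B0 \<Omega> interior_subset by (cases "z \<in> U") auto
  have U\<Omega>: "U \<subseteq> \<Omega>" using \<Omega> interior_subset by simp
  have eq: "mollified U \<psi> [] v (?t n) x = (\<integral>y. ?V (x + ?t n *\<^sub>R y) * \<psi> y \<partial>lborel)" for n
  proof -
    have "?t n powr (- real CARD('d)) * ?t n ^ CARD('d) = 1"
      using t(1)[of n] by (simp add: powr_minus powr_realpow)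
    then show ?thesis
      using dilated_subst[of ?V \<psi> "?t n" x] t(1)[of n] by (simp add: mollified_def mult.assoc[symmetric])
  qed
  have "(\<lambda>n. \<integral>y. ?V (x + ?t n *\<^sub>R y) * \<psi> y \<partial>lborel) \<longlonglongrightarrow> (\<integral>y. v x * \<psi> y \<partial>lborel)"
  proof (rule integral_dominated_convergence[where w = "\<lambda>y. B * C * indicator (cball c r) y"])
    show "integrable lborel (\<lambda>y. B * C * indicator (cball c r) y :: real)"
      by (intro integrable_mult_right integrable_real_indicator)
        (use emeasure_lborel_cball_finite[of c r] in simp_all)
    show "AE y in lborel. norm (?V (x + ?t n *\<^sub>R y) * \<psi> y) \<le> B * C * indicator (cball c r) y" for n
    proof (rule AE_I2)
      fix y
      show "norm (?V (x + ?t n *\<^sub>R y) * \<psi> y) \<le> B * C * indicator (cball c r) y"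
      proof (cases "y \<in> cball c r")
        case True
        have "\<bar>?V (x + ?t n *\<^sub>R y)\<bar> * \<bar>\<psi> y\<bar> \<le> B * C"
          by (intro mult_mono Vb C B0) auto
        then show ?thesis using True by (simp add: abs_mult)
      next
        case False then show ?thesis using \<psi>(2) by (simp add: supp_in_def)
      qed
    qed
    show "AE y in lborel. (\<lambda>n. ?V (x + ?t n *\<^sub>R y) * \<psi> y) \<longlonglongrightarrow> v x * \<psi> y"
    proof (rule AE_I2)
      fix y
      show "(\<lambda>n. ?V (x + ?t n *\<^sub>R y) * \<psi> y) \<longlonglongrightarrow> v x * \<psi> y"
      proof (cases "y \<in> cball c r")
        case True
        then have inU: "x + ?t n *\<^sub>R y \<in> U" for n using sub[OF t] by blast
        have "(\<lambda>n. x + ?t n *\<^sub>R y) \<longlonglongrightarrow> x + 0 *\<^sub>R y"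
          by (intro tendsto_intros lim_inverse_n'[THEN LIMSEQ_Suc])
        then have "(\<lambda>n. x + ?t n *\<^sub>R y) \<longlonglongrightarrow> x" by simp
        then have "(\<lambda>n. v (x + ?t n *\<^sub>R y)) \<longlonglongrightarrow> v x"
          by (rule continuous_on_tendsto_compose[OF v _ x]) (use inU U\<Omega> in \<open>auto intro!: always_eventually\<close>)
        then have "(\<lambda>n. v (x + ?t n *\<^sub>R y) * \<psi> y) \<longlonglongrightarrow> v x * \<psi> y" by (intro tendsto_intros)
        then show ?thesis using inU by simp
      next
        case False then show ?thesis using \<psi>(2) by (simp add: supp_in_def)
      qed
    qed
  qed auto
  then show ?thesis using eq by simp
qed

text \<open>The values at the scales \<open>1 / Suc n\<close> form a Cauchy sequence, since the
  modulus vanishes at 0; letting \<open>s\<close> run through these scales carries the modulus over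
  to the limit.\<close>

lemma power_modulus_limit:
  fixes F :: "real \<Rightarrow> real"
  assumes \<gamma>: "\<gamma> > 0" and K: "\<And>s t. 0 < s \<Longrightarrow> s \<le> t \<Longrightarrow> t \<le> 1 \<Longrightarrow> \<bar>F t - F s\<bar> \<le> K * t powr \<gamma>"
  obtains L where "(\<lambda>n. F (1 / real (Suc n))) \<longlonglongrightarrow> L" "\<And>t. 0 < t \<Longrightarrow> t \<le> 1 \<Longrightarrow> \<bar>F t - L\<bar> \<le> K * t powr \<gamma>"
proof -
  let ?t = "\<lambda>n. 1 / real (Suc n)"
  have t: "?t n > 0" "?t n \<le> 1" for n by auto
  have mono: "?t n \<le> ?t k" if "k \<le> n" for k n using that by (simp add: field_simps)
  have lim0: "(\<lambda>n. K * ?t n powr \<gamma>) \<longlonglongrightarrow> 0"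
  proof -
    have "(\<lambda>n. ?t n powr \<gamma>) \<longlonglongrightarrow> 0"
      by (rule tendsto_zero_powrI[OF LIMSEQ_Suc[OF lim_inverse_n'] tendsto_const _ \<gamma>]) auto
    from tendsto_mult_right_zero[OF this] show ?thesis .
  qed
  have "Cauchy (\<lambda>n. F (?t n))"
  proof (rule metric_CauchyI)
    fix e :: real assume "e > 0"
    then have "\<forall>\<^sub>F n in sequentially. \<bar>K * ?t n powr \<gamma> - 0\<bar> < e / 2"
      using lim0[THEN tendstoD, of "e / 2"] by (simp add: dist_real_def)
    then obtain N where "\<forall>n\<ge>N. \<bar>K * ?t n powr \<gamma> - 0\<bar> < e / 2"
      unfolding eventually_sequentially by blast
    then have N: "K * ?t N powr \<gamma> < e / 2" by (metis abs_less_iff diff_0_right order_refl)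
    have "dist (F (?t i)) (F (?t j)) < e" if "i \<ge> N" "j \<ge> N" for i j
      using K[OF t(1)[of i] mono[OF that(1)] t(2)] K[OF t(1)[of j] mono[OF that(2)] t(2)] N
      by (simp add: dist_real_def)
    then show "\<exists>M. \<forall>m\<ge>M. \<forall>n\<ge>M. dist (F (?t m)) (F (?t n)) < e" by blast
  qed
  then obtain L where L: "(\<lambda>n. F (?t n)) \<longlonglongrightarrow> L" by (meson Cauchy_convergent convergent_def)
  have "\<bar>F u - L\<bar> \<le> K * u powr \<gamma>" if u: "0 < u" "u \<le> 1" for u
  proof (rule tendsto_upperbound)
    show "(\<lambda>n. \<bar>F u - F (?t n)\<bar>) \<longlonglongrightarrow> \<bar>F u - L\<bar>" by (intro tendsto_intros L)
    have "\<forall>\<^sub>F n in sequentially. ?t n < u"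
      using order_tendstoD(2)[OF LIMSEQ_Suc[OF lim_inverse_n'] u(1)] by simp
    then show "\<forall>\<^sub>F n in sequentially. \<bar>F u - F (?t n)\<bar> \<le> K * u powr \<gamma>"
      by eventually_elim (use K u t in auto)
  qed simp
  with L that show thesis by blast
qed

section \<open>Sobolev inequalities for values and derivatives\<close>

definition scaled_bump :: "real \<Rightarrow> real ^ 'd::finite \<Rightarrow> real" where
  "scaled_bump r y = bump ((1 / r) *\<^sub>R y)"

lemma scaled_bump:
  assumes "r > 0"
  shows "smooth (scaled_bump r :: real ^ 'd::finite \<Rightarrow> real)"
    and "supp_in (cball 0 r) (scaled_bump r :: real ^ 'd \<Rightarrow> real)"
    and "(\<integral>y. scaled_bump r (y :: real ^ 'd) \<partial>lborel) > 0"
proof -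
  show s: "smooth (scaled_bump r :: real ^ 'd \<Rightarrow> real)"
    unfolding scaled_bump_def[abs_def] using smooth_affine[OF smooth_bump, of 0 "1 / r"] by simp
  show supp: "supp_in (cball 0 r) (scaled_bump r :: real ^ 'd \<Rightarrow> real)"
    using assms by (auto simp: supp_in_def scaled_bump_def field_simps intro!: bump_zero)
  have ind: "integrable lborel (indicat_real (cball (0 :: real ^ 'd) (r / 2)))"
    by (intro integrable_real_indicator) (use emeasure_lborel_cball_finite[of "0 :: real ^ 'd" "r / 2"] in simp_all)
  \<comment> \<open>On the half ball 1 - |y/r|^2 is at least 3/4, so the bump is at least exp(-4/3)
    there.\<close>
  have le: "exp (- (4 / 3)) * indicat_real (cball 0 (r / 2)) y \<le> scaled_bump r y" for y :: "real ^ 'd"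
  proof (cases "y \<in> cball 0 (r / 2)")
    case True
    then have "norm ((1 / r) *\<^sub>R y) \<le> 1 / 2" using assms by (simp add: field_simps)
    then have "(norm ((1 / r) *\<^sub>R y))\<^sup>2 \<le> (1 / 2)\<^sup>2" by (intro power_mono) auto
    then have q: "1 - (norm ((1 / r) *\<^sub>R y))\<^sup>2 \<ge> 3 / 4" by (simp add: power2_eq_square)
    then have "1 / (1 - (norm ((1 / r) *\<^sub>R y))\<^sup>2) \<le> 1 / (3 / 4)" by (intro divide_left_mono) auto
    then show ?thesis using True q by (simp add: scaled_bump_def bump_def exp_inv_1)
  next
    case False then show ?thesis by (simp add: scaled_bump_def bump_nonneg)
  qed
  have "0 < exp (- (4 / 3)) * (unit_ball_vol (real CARD('d)) * (r / 2) ^ CARD('d))" using assms by simp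
  also have "\<dots> = (\<integral>y. exp (- (4 / 3)) * indicat_real (cball (0 :: real ^ 'd) (r / 2)) y \<partial>lborel)"
    using content_cball[of "r / 2" "0 :: real ^ 'd"] assms by simp
  also have "\<dots> \<le> (\<integral>y. scaled_bump r (y :: real ^ 'd) \<partial>lborel)"
    by (intro integral_mono le integrable_mult_right ind smooth_integrable[OF s supp])
  finally show "(\<integral>y. scaled_bump r (y :: real ^ 'd) \<partial>lborel) > 0" .
qed

text \<open>The scale invariant form of Sobolev's inequality. Convexity supplies at every point of \<open>\<Omega>\<close>,
  boundary included, a cone in \<open>\<Omega>\<close> on which to mollify.\<close>

lemma sobolev_sup_bound:
  fixes \<Omega> :: "(real ^ 'd::finite) set"
  assumes \<Omega>: "convex \<Omega>" "compact \<Omega>" "interior \<Omega> \<noteq> {}" and m: "m > real CARD('d) / 2"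
  shows "\<exists>C\<ge>0. \<forall>x\<in>\<Omega>. \<forall>v. continuous_on \<Omega> v \<longrightarrow> in_sobolev (interior \<Omega>) m v \<longrightarrow> (\<forall>t. 0 < t \<longrightarrow> t \<le> 1 \<longrightarrow>
    \<bar>v x\<bar> \<le> C * (t powr (- real CARD('d) / 2) * L2_norm (interior \<Omega>) v +
      t powr (m - real CARD('d) / 2) * sobolev_norm (interior \<Omega>) m v))"
proof -
  let ?U = "interior \<Omega>" and ?d = "real CARD('d)" and ?k = "nat \<lfloor>m\<rfloor>"
  obtain c0 r where r: "r > 0" "cball c0 r \<subseteq> ?U"
    using \<Omega>(3) open_interior[of \<Omega>] by (metis ex_in_conv open_contains_cball)
  \<comment> \<open>Centred at \<open>c0 - x\<close>, so that x + t y runs through the ball around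
    \<open>c0\<close> contracted towards \<open>x\<close> by the factor t. By convexity the
    contracted ball lies in the interior.\<close>
  define \<phi> where "\<phi> x y = scaled_bump r ((x - c0) + y)" for x y :: "real ^ 'd"
  note b = scaled_bump[OF r(1), where 'd = 'd]
  have bdU: "bounded ?U" using \<Omega>(2) by (meson bounded_interior compact_imp_bounded)
  have fam: "smooth_family \<Omega> \<phi>"
    unfolding \<phi>_def
  proof (rule smooth_family_translates[OF b(1,2)])
    have "bounded \<Omega>" using \<Omega>(2) by (rule compact_imp_bounded)
    then show "bounded ((\<lambda>x. x - c0) ` \<Omega>)"
      using bounded_translation[of \<Omega> "- c0"] by (simp add: add.commute[of "- c0"])
  qed
  have supp: "supp_in (cball (c0 - x) r) (\<phi> x)" for x
    unfolding supp_in_def \<phi>_def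
  proof (intro allI impI)
    fix y assume "y \<notin> cball (c0 - x) r"
    then have "x - c0 + y \<notin> cball 0 r" by (simp add: dist_norm norm_minus_commute algebra_simps)
    then show "scaled_bump r (x - c0 + y) = 0" using b(2) by (simp add: supp_in_def)
  qed
  have sub: "(\<lambda>y. x + t *\<^sub>R y) ` cball (c0 - x) r \<subseteq> ?U" if x: "x \<in> \<Omega>" and t: "0 < t" "t \<le> 1" for x t
  proof
    fix z assume "z \<in> (\<lambda>y. x + t *\<^sub>R y) ` cball (c0 - x) r"
    then obtain y where y: "y \<in> cball (c0 - x) r" "z = x + t *\<^sub>R y" by auto
    then have "x + y \<in> cball c0 r" by (simp add: dist_norm algebra_simps)
    then have "x - t *\<^sub>R (x - (x + y)) \<in> ?U"
      using r x t \<Omega>(1) by (intro mem_interior_convex_shrink) auto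
    then show "z \<in> ?U" using y by simp
  qed
  have m0: "m > 0" using m by (rule le_less_trans[rotated]) simp
  have "\<exists>C\<ge>0. \<forall>x\<in>\<Omega>. \<forall>v. in_sobolev ?U m v \<longrightarrow> (\<forall>s t. 0 < s \<longrightarrow> s \<le> t \<longrightarrow> t \<le> 1 \<longrightarrow>
      \<bar>mollified ?U (kern ?k (\<phi> x)) [] v t x - mollified ?U (kern ?k (\<phi> x)) [] v s x\<bar>
      \<le> C * t powr (m - ?d / 2 - real (length ([] :: 'd list))) * sobolev_norm ?U m v)"
    by (rule mollified_growth[OF open_interior bdU fam r(1), where c = "\<lambda>x. c0 - x"]) (use supp sub m0 m in auto)
  then obtain C1 where C1: "C1 \<ge> 0" "\<And>x v s t. x \<in> \<Omega> \<Longrightarrow> in_sobolev ?U m v \<Longrightarrow> 0 < s \<Longrightarrow> s \<le> t \<Longrightarrow> t \<le> 1 \<Longrightarrow>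
      \<bar>mollified ?U (kern ?k (\<phi> x)) [] v t x - mollified ?U (kern ?k (\<phi> x)) [] v s x\<bar>
      \<le> C1 * t powr (m - ?d / 2) * sobolev_norm ?U m v"
    by auto
  have "\<exists>C\<ge>0. \<forall>x\<in>\<Omega>. \<forall>v. L2_on ?U v \<longrightarrow> (\<forall>t>0. \<bar>mollified ?U (kern ?k (\<phi> x)) [] v t x\<bar>
      \<le> C * t powr (- ?d / 2 - real (length ([] :: 'd list))) * L2_norm ?U v)"
    by (rule mollified_L2_bound[OF smooth_family_kern[OF fam] r(1), where c = "\<lambda>x. c0 - x"])
      (use supp_in_kern[OF supp smooth_familyD[OF fam]] in auto)
  then obtain C2 where C2: "C2 \<ge> 0" "\<And>x v t. x \<in> \<Omega> \<Longrightarrow> L2_on ?U v \<Longrightarrow> 0 < t \<Longrightarrow>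
      \<bar>mollified ?U (kern ?k (\<phi> x)) [] v t x\<bar> \<le> C2 * t powr (- ?d / 2) * L2_norm ?U v"
    by auto
  define I where "I = fact ?k * (\<integral>y. scaled_bump r (y :: real ^ 'd) \<partial>lborel)"
  have I: "I > 0" using b(3) by (simp add: I_def)
  have "\<bar>v x\<bar> \<le> (C1 + C2) / I * (t powr (- ?d / 2) * L2_norm ?U v + t powr (m - ?d / 2) * sobolev_norm ?U m v)"
    if x: "x \<in> \<Omega>" and v: "continuous_on \<Omega> v" "in_sobolev ?U m v" and t: "0 < t" "t \<le> 1" for x v t
  proof -
    let ?F = "\<lambda>t. mollified ?U (kern ?k (\<phi> x)) [] v t x" and ?N = "sobolev_norm ?U m v" and ?L = "L2_norm ?U v"
    have sx: "smooth (\<phi> x)" by (rule smooth_familyD[OF fam x])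
    have int: "(\<integral>y. kern ?k (\<phi> x) y \<partial>lborel) = I"
      unfolding integral_kern[OF sx supp] I_def \<phi>_def by (simp add: integral_translate)
    obtain L where L: "(\<lambda>n. ?F (1 / real (Suc n))) \<longlonglongrightarrow> L" "\<And>t. 0 < t \<Longrightarrow> t \<le> 1 \<Longrightarrow> \<bar>?F t - L\<bar> \<le> (C1 * ?N) * t powr (m - ?d / 2)"
    proof (rule power_modulus_limit[of "m - ?d / 2" ?F "C1 * ?N"])
      show "\<bar>?F t - ?F s\<bar> \<le> (C1 * ?N) * t powr (m - ?d / 2)" if "0 < s" "s \<le> t" "t \<le> 1" for s t
        using C1(2)[OF x v(2) that] by (simp add: mult_ac)
    qed (use m in auto)
    have "(\<lambda>n. ?F (1 / real (Suc n))) \<longlonglongrightarrow> v x * I"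
      unfolding int[symmetric]
      by (rule mollified_tendsto[OF \<Omega>(2) refl v(1) x smooth_kern[OF sx] supp_in_kern[OF supp sx]])
        (use sub[OF x] in auto)
    then have "L = v x * I" using L(1) LIMSEQ_unique by blast
    then have "\<bar>v x\<bar> * I = \<bar>L\<bar>" using I by (simp add: abs_mult)
    \<comment> \<open>The value at scale t is controlled by the \<open>L2\<close> norm, its distance
      to the limit by the Sobolev norm.\<close>
    also have "\<dots> \<le> \<bar>?F t\<bar> + \<bar>?F t - L\<bar>" by linarith
    also have "\<dots> \<le> C2 * t powr (- ?d / 2) * ?L + (C1 * ?N) * t powr (m - ?d / 2)"
      using v(2) by (intro add_mono C2(2) L(2) x t) (simp add: in_sobolev_def)
    also have "\<dots> \<le> (C1 + C2) * (t powr (- ?d / 2) * ?L) + (C1 + C2) * (t powr (m - ?d / 2) * ?N)"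
    proof (rule add_mono)
      have "C2 * (t powr (- ?d / 2) * ?L) \<le> (C1 + C2) * (t powr (- ?d / 2) * ?L)"
        using C1 C2 by (intro mult_right_mono) auto
      then show "C2 * t powr (- ?d / 2) * ?L \<le> (C1 + C2) * (t powr (- ?d / 2) * ?L)" by (simp add: mult.assoc)
      have "C1 * (t powr (m - ?d / 2) * ?N) \<le> (C1 + C2) * (t powr (m - ?d / 2) * ?N)"
        using C1 C2 by (intro mult_right_mono) auto
      then show "C1 * ?N * t powr (m - ?d / 2) \<le> (C1 + C2) * (t powr (m - ?d / 2) * ?N)" by (simp add: mult_ac)
    qed
    finally show ?thesis using I by (simp add: field_simps)
  qed
  moreover have "(C1 + C2) / I \<ge> 0" using I C1 C2 by simp
  ultimately show ?thesis by blast
qed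

text \<open>Mollified derivatives of every order up to \<open>length is\<close> converge uniformly
  near \<open>x0\<close>, so the limits are derivatives of one another, and the limit of order 0 is
  a multiple of \<open>v\<close>. Thus the classical derivative exists and is a limit of integral
  pairings, from which both the bound and linearity follow.\<close>

lemma sobolev_deriv:
  fixes \<Omega> :: "(real ^ 'd::finite) set"
  assumes \<Omega>: "compact \<Omega>" and x0: "x0 \<in> interior \<Omega>" and m: "m > real CARD('d) / 2 + real (length is)"
  shows "\<exists>C\<ge>0. \<forall>v. continuous_on \<Omega> v \<longrightarrow> in_sobolev (interior \<Omega>) m v \<longrightarrow> (\<forall>t. 0 < t \<longrightarrow> t \<le> 1 \<longrightarrow>
      \<bar>iter_partial is v x0\<bar> \<le> C * (t powr (- real CARD('d) / 2 - real (length is)) * L2_norm (interior \<Omega>) v +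
      t powr (m - real CARD('d) / 2 - real (length is)) * sobolev_norm (interior \<Omega>) m v))" (is ?bound)
    and "\<And>v w p q. continuous_on \<Omega> v \<Longrightarrow> in_sobolev (interior \<Omega>) m v \<Longrightarrow> continuous_on \<Omega> w \<Longrightarrow> in_sobolev (interior \<Omega>) m w \<Longrightarrow>
      in_sobolev (interior \<Omega>) m (\<lambda>x. p * v x + q * w x) \<Longrightarrow>
      iter_partial is (\<lambda>x. p * v x + q * w x) x0 = p * iter_partial is v x0 + q * iter_partial is w x0"
proof -
  let ?U = "interior \<Omega>" and ?d = "real CARD('d)" and ?k = "nat \<lfloor>m\<rfloor>"
  obtain R where R: "R > 0" "cball x0 R \<subseteq> ?U"
    using x0 open_interior[of \<Omega>] by (metis open_contains_cball)
  define r where "r = R / 2"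
  have r: "r > 0" using R by (simp add: r_def)
  define \<phi> :: "real ^ 'd \<Rightarrow> real" where "\<phi> = scaled_bump r"
  define \<psi> where "\<psi> = kern ?k \<phi>"
  \<comment> \<open>A whole ball, since iterated partial derivatives at \<open>x0\<close> depend on
    values around it. Half the radius \<open>R\<close> is left for the kernels, which reach at most
    \<open>r\<close> further.\<close>
  define T where "T = ball x0 r"
  note b = scaled_bump[OF r, where 'd = 'd, folded \<phi>_def]
  have \<psi>: "smooth \<psi>" "supp_in (cball 0 r) \<psi>"
    unfolding \<psi>_def by (auto intro: smooth_kern supp_in_kern b)
  have bdU: "bounded ?U" using \<Omega> by (meson bounded_interior compact_imp_bounded)
  have fam: "smooth_family T (\<lambda>x. \<phi>)"
    using smooth_family_translates[OF b(1,2), of "\<lambda>x. 0" T] by (auto simp: image_constant_conv)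
  have TU: "T \<subseteq> ?U" using R by (auto simp: T_def r_def)
  have T\<Omega>: "T \<subseteq> \<Omega>" using TU interior_subset by blast
  have sub: "(\<lambda>y. x + t *\<^sub>R y) ` cball 0 r \<subseteq> ?U" if x: "x \<in> T" and t: "0 < t" "t \<le> 1" for x t
  proof
    fix z assume "z \<in> (\<lambda>y. x + t *\<^sub>R y) ` cball 0 r"
    then obtain y where y: "norm y \<le> r" "z = x + t *\<^sub>R y" by auto
    have "norm (t *\<^sub>R y) \<le> 1 * r" using y t unfolding norm_scaleR by (intro mult_mono) auto
    then have "dist x z \<le> r" using y by (simp add: dist_norm)
    then have "dist x0 z \<le> R" using x dist_triangle[of x0 z x] by (simp add: T_def r_def)
    then show "z \<in> ?U" using R by auto
  qed
  have m0: "m > 0" using m by (rule le_less_trans[rotated]) simp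
  let ?F = "\<lambda>js v t x. mollified ?U \<psi> js v t x"
  let ?\<gamma> = "\<lambda>js :: 'd list. m - ?d / 2 - real (length js)"
  let ?t = "\<lambda>n. 1 / real (Suc n)"
  have \<gamma>: "?\<gamma> js > 0" if "length js \<le> length is" for js using m that by simp
  have "\<exists>C1\<ge>0. \<forall>x\<in>T. \<forall>v. in_sobolev ?U m v \<longrightarrow> (\<forall>s t. 0 < s \<longrightarrow> s \<le> t \<longrightarrow> t \<le> 1 \<longrightarrow>
      \<bar>?F js v t x - ?F js v s x\<bar> \<le> C1 * t powr ?\<gamma> js * sobolev_norm ?U m v)" if "length js \<le> length is" for js
    unfolding \<psi>_def
    by (rule mollified_growth[OF open_interior bdU fam r, where c = "\<lambda>x. 0"]) (use b sub m0 \<gamma>[OF that] in auto)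
  then have "\<forall>js. \<exists>C1\<ge>0. length js \<le> length is \<longrightarrow> (\<forall>x\<in>T. \<forall>v. in_sobolev ?U m v \<longrightarrow> (\<forall>s t. 0 < s \<longrightarrow> s \<le> t \<longrightarrow> t \<le> 1 \<longrightarrow>
      \<bar>?F js v t x - ?F js v s x\<bar> \<le> C1 * t powr ?\<gamma> js * sobolev_norm ?U m v))" by (meson order_refl)
  then obtain C1 where C1: "\<And>js. C1 js \<ge> 0" "\<And>js x v s t. length js \<le> length is \<Longrightarrow> x \<in> T \<Longrightarrow> in_sobolev ?U m v \<Longrightarrow>
      0 < s \<Longrightarrow> s \<le> t \<Longrightarrow> t \<le> 1 \<Longrightarrow> \<bar>?F js v t x - ?F js v s x\<bar> \<le> C1 js * t powr ?\<gamma> js * sobolev_norm ?U m v"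
    by metis
  \<comment> \<open>One limit for each list of derivatives. The second estimate below does not
    depend on \<open>x\<close> and so gives uniform convergence on \<open>T\<close>.\<close>
  define D where "D js v x = lim (\<lambda>n. ?F js v (?t n) x)" for js v x
  have D: "(\<lambda>n. ?F js v (?t n) x) \<longlonglongrightarrow> D js v x"
    "\<And>t. 0 < t \<Longrightarrow> t \<le> 1 \<Longrightarrow> \<bar>?F js v t x - D js v x\<bar> \<le> (C1 js * sobolev_norm ?U m v) * t powr ?\<gamma> js"
    if js: "length js \<le> length is" and x: "x \<in> T" and v: "in_sobolev ?U m v" for js x v
  proof -
    obtain L where L: "(\<lambda>n. ?F js v (?t n) x) \<longlonglongrightarrow> L"
      "\<And>t. 0 < t \<Longrightarrow> t \<le> 1 \<Longrightarrow> \<bar>?F js v t x - L\<bar> \<le> (C1 js * sobolev_norm ?U m v) * t powr ?\<gamma> js"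
    proof (rule power_modulus_limit[of "?\<gamma> js" "\<lambda>t. ?F js v t x" "C1 js * sobolev_norm ?U m v"])
      show "\<bar>?F js v t x - ?F js v s x\<bar> \<le> (C1 js * sobolev_norm ?U m v) * t powr ?\<gamma> js" if "0 < s" "s \<le> t" "t \<le> 1" for s t
        using C1(2)[OF js x v that] by (simp add: mult_ac)
    qed (use \<gamma>[OF js] in auto)
    moreover have "D js v x = L" unfolding D_def using L(1) by (rule limI)
    ultimately show "(\<lambda>n. ?F js v (?t n) x) \<longlonglongrightarrow> D js v x"
      "\<And>t. 0 < t \<Longrightarrow> t \<le> 1 \<Longrightarrow> \<bar>?F js v t x - D js v x\<bar> \<le> (C1 js * sobolev_norm ?U m v) * t powr ?\<gamma> js"
      by auto
  qed
  have V: "integrable lborel (\<lambda>z. indicator ?U z * v z)" if "in_sobolev ?U m v" for v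
    using that bdU by (intro L2_on_integrable) (auto simp: in_sobolev_def)
  have der: "((\<lambda>s. D js v (x + s *\<^sub>R axis i 1)) has_real_derivative D (i # js) v x) (at 0)"
    if js: "length (i # js) \<le> length is" and x: "x \<in> T" and v: "in_sobolev ?U m v" for i js x v
  proof -
    let ?e = "axis i (1::real) :: real ^ 'd"
    obtain \<delta> where \<delta>: "\<delta> > 0" "ball x \<delta> \<subseteq> T" using x by (metis T_def open_ball open_contains_ball)
    define S where "S = {- \<delta><..<\<delta>}"
    have S: "convex S" "open S" "0 \<in> S" using \<delta> by (auto simp: S_def)
    have inT: "x + s *\<^sub>R ?e \<in> T" if "s \<in> S" for s
    proof -
      have "dist x (x + s *\<^sub>R ?e) < \<delta>" using that by (simp add: dist_norm norm_axis_1 S_def abs_less_iff)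
      then show ?thesis using \<delta> by auto
    qed
    have js': "length js \<le> length is" using js by simp
    \<comment> \<open>Termwise differentiation of a sequence whose derivatives converge uniformly,
      on a segment in direction \<open>i\<close> that stays in \<open>T\<close>.\<close>
    have "\<exists>g. \<forall>s\<in>S. (\<lambda>n. ?F js v (?t n) (x + s *\<^sub>R ?e)) \<longlonglongrightarrow> g s \<and>
        (g has_derivative (\<lambda>h. D (i # js) v (x + s *\<^sub>R ?e) * h)) (at s within S)"
    proof (rule has_derivative_sequence[OF S(1), where f' = "\<lambda>n s h. ?F (i # js) v (?t n) (x + s *\<^sub>R ?e) * h"])
      show "((\<lambda>s. ?F js v (?t n) (x + s *\<^sub>R ?e)) has_derivative (\<lambda>h. ?F (i # js) v (?t n) (x + s *\<^sub>R ?e) * h)) (at s within S)" for n s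
      proof -
        have "((\<lambda>s. ?F js v (?t n) (x + s *\<^sub>R ?e)) has_real_derivative ?F (i # js) v (?t n) (x + s *\<^sub>R ?e)) (at s)"
          by (rule mollified_deriv_shift[OF V[OF v] \<psi>]) simp
        then show ?thesis by (simp add: has_field_derivative_def has_derivative_at_withinI)
      qed
      fix e :: real assume e: "e > 0"
      let ?K = "C1 (i # js) * sobolev_norm ?U m v"
      have "(\<lambda>n. ?t n powr ?\<gamma> (i # js)) \<longlonglongrightarrow> 0"
        by (rule tendsto_zero_powrI[OF LIMSEQ_Suc[OF lim_inverse_n'] tendsto_const _ \<gamma>[OF js]]) auto
      from tendsto_mult_right_zero[OF this, of ?K]
      have "(\<lambda>n. ?K * ?t n powr ?\<gamma> (i # js)) \<longlonglongrightarrow> 0" .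
      from order_tendstoD(2)[OF this e]
      show "\<forall>\<^sub>F n in sequentially. \<forall>s\<in>S. \<forall>h. norm (?F (i # js) v (?t n) (x + s *\<^sub>R ?e) * h - D (i # js) v (x + s *\<^sub>R ?e) * h) \<le> e * norm h"
      proof eventually_elim
        case (elim n)
        show ?case
        proof (intro ballI allI)
          fix s h assume s: "s \<in> S"
          have "\<bar>?F (i # js) v (?t n) (x + s *\<^sub>R ?e) - D (i # js) v (x + s *\<^sub>R ?e)\<bar> \<le> ?K * ?t n powr ?\<gamma> (i # js)"
            by (rule D(2)[OF js inT[OF s] v]) auto
          then have "\<bar>?F (i # js) v (?t n) (x + s *\<^sub>R ?e) - D (i # js) v (x + s *\<^sub>R ?e)\<bar> * \<bar>h\<bar> \<le> e * \<bar>h\<bar>"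
            using elim by (intro mult_right_mono) linarith+
          then show "norm (?F (i # js) v (?t n) (x + s *\<^sub>R ?e) * h - D (i # js) v (x + s *\<^sub>R ?e) * h) \<le> e * norm h"
            by (simp only: left_diff_distrib[symmetric] real_norm_def abs_mult)
        qed
      qed
    next
      show "(\<lambda>n. ?F js v (?t n) (x + 0 *\<^sub>R ?e)) \<longlonglongrightarrow> D js v (x + 0 *\<^sub>R ?e)"
        by (rule D(1)[OF js' _ v]) (use x in simp)
    qed (use S in auto)
    then obtain g where g: "\<And>s. s \<in> S \<Longrightarrow> (\<lambda>n. ?F js v (?t n) (x + s *\<^sub>R ?e)) \<longlonglongrightarrow> g s"
      "\<And>s. s \<in> S \<Longrightarrow> (g has_derivative (\<lambda>h. D (i # js) v (x + s *\<^sub>R ?e) * h)) (at s within S)" by blast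
    have gD: "g s = D js v (x + s *\<^sub>R ?e)" if "s \<in> S" for s
      using g(1)[OF that] D(1)[OF js' inT[OF that] v] LIMSEQ_unique by blast
    have "(g has_real_derivative D (i # js) v x) (at 0)"
      using g(2)[OF S(3)] S(2,3) by (simp add: has_field_derivative_def at_within_open[of 0 S])
    then show ?thesis
      by (rule has_field_derivative_transform_within_open[OF _ S(2,3)]) (rule gD)
  qed
  define I where "I = (\<integral>y. \<psi> y \<partial>lborel)"
  have I: "I > 0" unfolding I_def \<psi>_def integral_kern[OF b(1,2)] using b(3) by simp
  have key: "iter_partial js v x = D js v x / I"
    if "length js \<le> length is" "x \<in> T" and v: "continuous_on \<Omega> v" "in_sobolev ?U m v" for js v x
    using that(1,2)
  proof (induction js arbitrary: x)
    case Nil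
    have "(\<lambda>n. ?F [] v (?t n) x) \<longlonglongrightarrow> v x * I"
      unfolding I_def
      by (rule mollified_tendsto[OF \<Omega> refl v(1) _ \<psi>]) (use sub Nil T\<Omega> in auto)
    then have "D [] v x = v x * I" using D(1)[OF _ Nil(2) v(2), of "[]"] LIMSEQ_unique by auto
    then show ?case using I by simp
  next
    case (Cons i js)
    let ?e = "axis i (1::real) :: real ^ 'd"
    obtain \<delta> where \<delta>: "\<delta> > 0" "ball x \<delta> \<subseteq> T" using Cons.prems by (metis T_def open_ball open_contains_ball)
    have "((\<lambda>s. D js v (x + s *\<^sub>R ?e) / I) has_real_derivative D (i # js) v x / I) (at 0)"
      by (intro DERIV_cdivide der Cons.prems v)
    then have "((\<lambda>s. iter_partial js v (x + s *\<^sub>R ?e)) has_real_derivative D (i # js) v x / I) (at 0)"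
    proof (rule has_field_derivative_transform_within_open[where S = "{- \<delta><..<\<delta>}"])
      fix s assume "s \<in> {- \<delta><..<\<delta>}"
      then have "dist x (x + s *\<^sub>R ?e) < \<delta>" by (simp add: dist_norm norm_axis_1 abs_less_iff)
      then have "x + s *\<^sub>R ?e \<in> T" using \<delta> by auto
      then show "D js v (x + s *\<^sub>R ?e) / I = iter_partial js v (x + s *\<^sub>R ?e)"
        using Cons.IH Cons.prems by simp
    qed (use \<delta> in auto)
    then show ?case unfolding iter_partial_Cons by (rule partial_deriv_eqI)
  qed
  have x0T: "x0 \<in> T" using r by (simp add: T_def)
  show ?bound
  proof -
    have "smooth_family {x0} (\<lambda>x. \<psi>)"
      using smooth_family_translates[OF \<psi>, of "\<lambda>x. 0" "{x0}"] by auto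
    from mollified_L2_bound[OF this r, where c = "\<lambda>x. 0" and P = "\<lambda>x. x" and U = ?U and ks = "is"]
    obtain C2 where C2: "C2 \<ge> 0" "\<And>v t. L2_on ?U v \<Longrightarrow> 0 < t \<Longrightarrow>
        \<bar>?F is v t x0\<bar> \<le> C2 * t powr (- ?d / 2 - real (length is)) * L2_norm ?U v"
      using \<psi> by auto
    let ?C1 = "C1 is"
    have "\<bar>iter_partial is v x0\<bar> \<le> (?C1 + C2) / I * (t powr (- ?d / 2 - real (length is)) * L2_norm ?U v + t powr ?\<gamma> is * sobolev_norm ?U m v)"
      if v: "continuous_on \<Omega> v" "in_sobolev ?U m v" and t: "0 < t" "t \<le> 1" for v t
    proof -
      let ?N = "sobolev_norm ?U m v" and ?L = "L2_norm ?U v" and ?q = "t powr (- ?d / 2 - real (length is))"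
      have "\<bar>iter_partial is v x0\<bar> * I = \<bar>D is v x0\<bar>" using I key[OF order_refl x0T v] by simp
      also have "\<dots> \<le> \<bar>?F is v t x0\<bar> + \<bar>?F is v t x0 - D is v x0\<bar>" by linarith
      also have "\<dots> \<le> C2 * ?q * ?L + (?C1 * ?N) * t powr ?\<gamma> is"
        using v(2) by (intro add_mono C2(2) D(2) x0T t) (simp_all add: in_sobolev_def)
      also have "\<dots> \<le> (?C1 + C2) * (?q * ?L) + (?C1 + C2) * (t powr ?\<gamma> is * ?N)"
      proof (rule add_mono)
        have "C2 * (?q * ?L) \<le> (?C1 + C2) * (?q * ?L)"
          using C1(1)[of "is"] C2 by (intro mult_right_mono) auto
        then show "C2 * ?q * ?L \<le> (?C1 + C2) * (?q * ?L)" by (simp add: mult.assoc)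
        have "?C1 * (t powr ?\<gamma> is * ?N) \<le> (?C1 + C2) * (t powr ?\<gamma> is * ?N)"
          using C1 C2 by (intro mult_right_mono) auto
        then show "?C1 * ?N * t powr ?\<gamma> is \<le> (?C1 + C2) * (t powr ?\<gamma> is * ?N)" by (simp add: mult_ac)
      qed
      finally show ?thesis using I by (simp add: field_simps)
    qed
    moreover have "(?C1 + C2) / I \<ge> 0" using I C1(1)[of "is"] C2 by simp
    ultimately show ?thesis by blast
  qed
  fix v w p q
  assume v: "continuous_on \<Omega> v" "in_sobolev ?U m v" and w: "continuous_on \<Omega> w" "in_sobolev ?U m w"
    and vw: "in_sobolev ?U m (\<lambda>x. p * v x + q * w x)"
  have "(\<lambda>n. ?F is (\<lambda>x. p * v x + q * w x) (?t n) x0) \<longlonglongrightarrow> p * D is v x0 + q * D is w x0"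
    unfolding mollified_linear[OF V[OF v(2)] V[OF w(2)] \<psi>]
    by (intro tendsto_intros D(1) x0T v w order_refl)
  then have "D is (\<lambda>x. p * v x + q * w x) x0 = p * D is v x0 + q * D is w x0"
    using D(1)[OF order_refl x0T vw] LIMSEQ_unique by blast
  then show "iter_partial is (\<lambda>x. p * v x + q * w x) x0 = p * iter_partial is v x0 + q * iter_partial is w x0"
    using key[OF order_refl x0T v] key[OF order_refl x0T w] key[OF order_refl x0T _ vw] v w
    by (simp add: continuous_on_add continuous_on_mult_left add_divide_distrib)
qed

subsection \<open>Uniqueness of weak derivatives\<close>

text \<open>Products of one-dimensional smooth steps: a factor vanishes until its coordinate is
  1/(n+1) inside the box and tends to 1 at every coordinate strictly inside. Approximating from
  within keeps the supports compact in the box.\<close>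

lemma smooth_step_product:
  fixes a b :: "real ^ 'd::finite"
  defines "\<theta> \<equiv> \<lambda>n y. \<Prod>i\<in>UNIV. exp_inv 1 (real (Suc n) * (vec_nth y i - vec_nth a i) - 1) *
    exp_inv 1 (real (Suc n) * (vec_nth b i - vec_nth y i) - 1)"
  assumes sub: "box a b \<subseteq> U"
  shows "test_function U (\<theta> n)"
    and "\<bar>\<theta> n y\<bar> \<le> 1"
    and "(\<lambda>n. \<theta> n y) \<longlonglongrightarrow> indicator (box a b) y"
proof -
  have "smooth (\<theta> n)"
    unfolding \<theta>_def
    by (intro smooth_prod smooth_mult smooth_exp_inv_comp smooth_diff smooth_const smooth_coord)
  moreover have cl: "closure {y. \<theta> n y \<noteq> 0} \<subseteq> {y. \<forall>i. vec_nth a i + 1 / real (Suc n) \<le> vec_nth y i \<and> vec_nth y i \<le> vec_nth b i - 1 / real (Suc n)}"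
    (is "_ \<subseteq> ?S")
  proof (rule closure_minimal)
    show "{y. \<theta> n y \<noteq> 0} \<subseteq> ?S"
    proof safe
      fix y i assume "\<theta> n y \<noteq> 0"
      then have "exp_inv 1 (real (Suc n) * (vec_nth y i - vec_nth a i) - 1) \<noteq> 0"
        "exp_inv 1 (real (Suc n) * (vec_nth b i - vec_nth y i) - 1) \<noteq> 0"
        by (auto simp: \<theta>_def prod_zero_iff)
      then have "real (Suc n) * (vec_nth y i - vec_nth a i) > 1" "real (Suc n) * (vec_nth b i - vec_nth y i) > 1"
        by (auto simp: exp_inv_1 split: if_splits simp del: of_nat_Suc)
      then show "vec_nth a i + 1 / real (Suc n) \<le> vec_nth y i" "vec_nth y i \<le> vec_nth b i - 1 / real (Suc n)"
        by (auto simp: field_simps simp del: of_nat_Suc)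
    qed
    have "?S = cbox (vec_lambda (\<lambda>i. vec_nth a i + 1 / real (Suc n))) (vec_lambda (\<lambda>i. vec_nth b i - 1 / real (Suc n)))"
      by (auto simp: mem_box_cart)
    then show "closed ?S" by (metis closed_cbox)
  qed
  moreover have Sbox: "?S \<subseteq> box a b"
  proof
    fix y assume y: "y \<in> ?S"
    have "vec_nth a i < vec_nth y i \<and> vec_nth y i < vec_nth b i" for i
    proof -
      have "vec_nth a i + 1 / real (Suc n) \<le> vec_nth y i" "vec_nth y i \<le> vec_nth b i - 1 / real (Suc n)" using y by auto
      moreover have "1 / real (Suc n) > 0" by simp
      ultimately show ?thesis by linarith
    qed
    then show "y \<in> box a b" by (simp add: mem_box_cart)
  qed
  moreover have "compact (closure {y. \<theta> n y \<noteq> 0})"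
    using cl Sbox bounded_box[of a b] by (meson bounded_subset closed_closure compact_eq_bounded_closed)
  ultimately show "test_function U (\<theta> n)"
    using sub by (auto simp: test_function_def smooth_def)
  have e1: "0 \<le> exp_inv 1 t" "exp_inv 1 t \<le> 1" for t by (auto simp: exp_inv_1)
  have "0 \<le> \<theta> n y" "\<theta> n y \<le> 1"
    unfolding \<theta>_def by (auto intro!: prod_nonneg prod_le_1 mult_le_one mult_nonneg_nonneg e1)
  then show "\<bar>\<theta> n y\<bar> \<le> 1" by simp
  have lim: "(\<lambda>n. exp_inv 1 (real (Suc n) * u - 1)) \<longlonglongrightarrow> (if u > 0 then 1 else 0)" for u :: real
  proof (cases "u > 0")
    case True
    have "filterlim (\<lambda>n. -1 + real (Suc n) * u) at_top sequentially"
      by (intro filterlim_tendsto_add_at_top[OF tendsto_const]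
          filterlim_at_top_mult_tendsto_pos[OF tendsto_const True] filterlim_compose[OF filterlim_real_sequentially filterlim_Suc])
    then have top: "filterlim (\<lambda>n. real (Suc n) * u - 1) at_top sequentially" by simp
    have "(\<lambda>n. exp (- (1 / (real (Suc n) * u - 1)))) \<longlonglongrightarrow> exp (- 0)"
      by (intro tendsto_exp tendsto_minus tendsto_divide_0[OF tendsto_const] filterlim_at_top_imp_at_infinity top)
    then have "(\<lambda>n. exp (- (1 / (real (Suc n) * u - 1)))) \<longlonglongrightarrow> 1" by simp
    moreover have "\<forall>\<^sub>F n in sequentially. real (Suc n) * u - 1 > 0"
      using top unfolding filterlim_at_top_dense by (rule spec)
    then have "\<forall>\<^sub>F n in sequentially. exp (- (1 / (real (Suc n) * u - 1))) = exp_inv 1 (real (Suc n) * u - 1)"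
      by eventually_elim (simp add: exp_inv_1)
    ultimately show ?thesis using True by (simp add: Lim_transform_eventually)
  next
    case False
    then have "real (Suc n) * u \<le> 0" for n by (intro mult_nonneg_nonpos) auto
    then have "real (Suc n) * u - 1 \<le> 0" for n using order_trans[of "real (Suc n) * u" 0 1] by simp
    then have "exp_inv 1 (real (Suc n) * u - 1) = 0" for n
      by (simp add: exp_inv_1 not_less del: of_nat_Suc)
    then show ?thesis using False by simp
  qed
  have "(\<lambda>n. \<theta> n y) \<longlonglongrightarrow> (\<Prod>i\<in>UNIV. (if vec_nth y i - vec_nth a i > 0 then 1 else 0) * (if vec_nth b i - vec_nth y i > 0 then 1 else 0))"
    unfolding \<theta>_def by (intro tendsto_prod tendsto_mult lim)
  also have "(\<Prod>i\<in>UNIV. (if vec_nth y i - vec_nth a i > 0 then 1 else 0) * (if vec_nth b i - vec_nth y i > 0 then 1 else 0))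
      = (indicator (box a b) y :: real)"
  proof (cases "y \<in> box a b")
    case True then show ?thesis by (simp add: mem_box_cart)
  next
    case False
    then obtain i where "\<not> (vec_nth a i < vec_nth y i \<and> vec_nth y i < vec_nth b i)" by (auto simp: mem_box_cart)
    then have "(if vec_nth y i - vec_nth a i > 0 then 1 else 0) * (if vec_nth b i - vec_nth y i > 0 then 1 else 0) = (0 :: real)" by auto
    then have "(\<Prod>i\<in>UNIV. (if vec_nth y i - vec_nth a i > 0 then 1 else 0) * (if vec_nth b i - vec_nth y i > 0 then 1 else 0)) = (0 :: real)"
      by (intro prod_zero finite_class.finite_UNIV bexI[of _ i] UNIV_I)
    then show ?thesis using False by simp
  qed
  finally show "(\<lambda>n. \<theta> n y) \<longlonglongrightarrow> indicator (box a b) y" .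
qed

text \<open>The positive and negative parts of \<open>w\<close>, taken as densities, define finite
  measures that agree on boxes. Boxes are stable under intersection and generate the Borel sets, so
  the measures agree, and hence the densities almost everywhere.\<close>

lemma AE_zero_of_box_integrals:
  fixes w :: "real ^ 'd::finite \<Rightarrow> real"
  assumes w: "integrable lborel w" and zero: "\<And>a b. (\<integral>x. w x * indicator (box a b) x \<partial>lborel) = 0"
  shows "AE x in lborel. w x = 0"
proof -
  have [measurable]: "w \<in> borel_measurable borel" using w by simp
  define wp wm where "wp x = max 0 (w x)" and "wm x = max 0 (- w x)" for x
  have int: "integrable lborel wp" "integrable lborel wm"
    unfolding wp_def wm_def using w by (auto intro!: integrable_max)
  have [measurable]: "wp \<in> borel_measurable borel" "wm \<in> borel_measurable borel" using int by auto
  have nn: "wp x \<ge> 0" "wm x \<ge> 0" "wp x - wm x = w x" for x by (auto simp: wp_def wm_def)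
  have intb: "integrable lborel (\<lambda>x. wp x * indicator (box a b) x)" "integrable lborel (\<lambda>x. wm x * indicator (box a b) x)" for a b
    by (auto intro!: integrable_mult_indicator[where f = wp, simplified mult.commute] integrable_real_mult_indicator int)
  have box: "emeasure (density lborel (\<lambda>x. ennreal (wp x))) (box a b) = emeasure (density lborel (\<lambda>x. ennreal (wm x))) (box a b)" for a b
  proof -
    have e: "emeasure (density lborel (\<lambda>x. ennreal (f x))) (box a b) = ennreal (\<integral>x. f x * indicator (box a b) x \<partial>lborel)"
      if "\<And>x. f x \<ge> 0" "integrable lborel (\<lambda>x. f x * indicator (box a b) x)" "f \<in> borel_measurable borel" for f
    proof -
      have "emeasure (density lborel (\<lambda>x. ennreal (f x))) (box a b) = (\<integral>\<^sup>+x. ennreal (f x * indicator (box a b) x) \<partial>lborel)"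
        using that by (subst emeasure_density) (auto intro!: nn_integral_cong simp: indicator_def)
      also have "\<dots> = ennreal (\<integral>x. f x * indicator (box a b) x \<partial>lborel)"
        using that by (intro nn_integral_eq_integral) auto
      finally show ?thesis .
    qed
    have "(\<integral>x. wp x * indicator (box a b) x \<partial>lborel) - (\<integral>x. wm x * indicator (box a b) x \<partial>lborel) =
        (\<integral>x. wp x * indicator (box a b) x - wm x * indicator (box a b) x \<partial>lborel)"
      using intb by simp
    also have "\<dots> = (\<integral>x. w x * indicator (box a b) x \<partial>lborel)"
      by (simp add: nn(3) flip: left_diff_distrib)
    finally have "(\<integral>x. wp x * indicator (box a b) x \<partial>lborel) = (\<integral>x. wm x * indicator (box a b) x \<partial>lborel)"
      using zero by simp
    then show ?thesis using e[OF nn(1) intb(1)] e[OF nn(2) intb(2)] by simp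
  qed
  have "density lborel (\<lambda>x. ennreal (wp x)) = density lborel (\<lambda>x. ennreal (wm x))"
  proof (rule measure_eqI_generator_eq)
    let ?E = "range (\<lambda>(a, b). box a b :: (real ^ 'd) set)"
    show "Int_stable ?E" by (auto simp: Int_stable_def box_Int_box)
    show "?E \<subseteq> Pow UNIV" by simp
    show "sets (density lborel (\<lambda>x. ennreal (wp x))) = sigma_sets UNIV ?E"
      "sets (density lborel (\<lambda>x. ennreal (wm x))) = sigma_sets UNIV ?E"
      by (simp_all add: borel_eq_box)
    let ?A = "\<lambda>n::nat. box (- (real n *\<^sub>R One)) (real n *\<^sub>R One) :: (real ^ 'd) set"
    show "range ?A \<subseteq> ?E" by auto
    show "(\<Union>i. ?A i) = UNIV" by (rule UN_box_eq_UNIV)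
    show "emeasure (density lborel (\<lambda>x. ennreal (wp x))) (?A i) \<noteq> \<infinity>" for i
    proof -
      have "emeasure (density lborel (\<lambda>x. ennreal (wp x))) (?A i) \<le> (\<integral>\<^sup>+x. ennreal (wp x) \<partial>lborel)"
        by (subst emeasure_density) (auto intro!: nn_integral_mono simp: indicator_def)
      also have "\<dots> < \<infinity>" using int(1) nn(1) by (simp add: nn_integral_eq_integral)
      finally show ?thesis by simp
    qed
    show "emeasure (density lborel (\<lambda>x. ennreal (wp x))) X = emeasure (density lborel (\<lambda>x. ennreal (wm x))) X"
      if "X \<in> ?E" for X
      using that box by auto
  qed
  then have "AE x in lborel. ennreal (wp x) = ennreal (wm x)"
    by (subst (asm) sigma_finite_measure.density_unique_iff[OF sigma_finite_lborel]) auto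
  then show ?thesis
  proof eventually_elim
    case (elim x)
    then have "wp x = wm x" using nn by simp
    then show ?case using nn(3)[of x] by simp
  qed
qed

text \<open>The fundamental lemma of the calculus of variations. Indicators of boxes inside
  \<open>U\<close> are bounded limits of test functions, and \<open>U\<close> is a countable union
  of such boxes, to each of which the criterion on box integrals applies.\<close>

lemma AE_zero_of_test_functions:
  fixes w :: "real ^ 'd::finite \<Rightarrow> real"
  assumes U: "open U" and w: "integrable lborel w" and off: "\<And>x. x \<notin> U \<Longrightarrow> w x = 0"
    and test: "\<And>\<phi>. test_function U \<phi> \<Longrightarrow> (\<integral>x. w x * \<phi> x \<partial>lborel) = 0"
  shows "AE x in lborel. w x = 0"
proof -
  have [measurable]: "w \<in> borel_measurable borel" using w by simp
  have box0: "(\<integral>x. w x * indicator (box a b) x \<partial>lborel) = 0" if sub: "box a b \<subseteq> U" for a b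
  proof -
    define \<theta> where "\<theta> n y = (\<Prod>i\<in>UNIV. exp_inv 1 (real (Suc n) * (vec_nth y i - vec_nth a i) - 1) *
        exp_inv 1 (real (Suc n) * (vec_nth b i - vec_nth y i) - 1))" for n y
    note \<theta> = smooth_step_product[OF sub, folded \<theta>_def]
    have [measurable]: "\<theta> n \<in> borel_measurable borel" for n
      using \<theta>(1)[of n] by (intro smooth_borel) (auto simp: test_function_def smooth_def)
    have "(\<lambda>n. \<integral>x. w x * \<theta> n x \<partial>lborel) \<longlonglongrightarrow> (\<integral>x. w x * indicator (box a b) x \<partial>lborel)"
    proof (rule integral_dominated_convergence[where w = "\<lambda>x. \<bar>w x\<bar>"])
      show "AE x in lborel. (\<lambda>n. w x * \<theta> n x) \<longlonglongrightarrow> w x * indicator (box a b) x"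
        by (intro AE_I2 tendsto_intros \<theta>)
      show "AE x in lborel. norm (w x * \<theta> n x) \<le> \<bar>w x\<bar>" for n
      proof (rule AE_I2)
        fix x show "norm (w x * \<theta> n x) \<le> \<bar>w x\<bar>"
          using mult_left_mono[OF \<theta>(2)[of n x], of "\<bar>w x\<bar>"] by (simp add: abs_mult)
      qed
    qed (use w in auto)
    then have "(\<lambda>n. 0) \<longlonglongrightarrow> (\<integral>x. w x * indicator (box a b) x \<partial>lborel)"
      using test[OF \<theta>(1)] by simp
    then show ?thesis using LIMSEQ_unique tendsto_const by blast
  qed
  have AE_box: "AE x in lborel. x \<in> box a b \<longrightarrow> w x = 0" if sub: "box a b \<subseteq> U" for a b
  proof -
    have "AE x in lborel. w x * indicator (box a b) x = 0"
    proof (rule AE_zero_of_box_integrals)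
      show "integrable lborel (\<lambda>x. w x * indicator (box a b) x)"
        by (intro integrable_real_mult_indicator w) simp
      fix c d :: "real ^ 'd"
      obtain p q where pq: "box a b \<inter> box c d = box p q" by (simp add: box_Int_box)
      have "(\<integral>x. w x * indicator (box a b) x * indicator (box c d) x \<partial>lborel) = (\<integral>x. w x * indicator (box p q) x \<partial>lborel)"
        by (simp add: mult.assoc pq flip: indicator_inter_arith)
      also have "\<dots> = 0" using sub pq by (intro box0) blast
      finally show "(\<integral>x. w x * indicator (box a b) x * indicator (box c d) x \<partial>lborel) = 0" .
    qed
    then show ?thesis by eventually_elim (auto simp: indicator_def)
  qed
  obtain \<D> where \<D>: "countable \<D>" "\<And>X. X \<in> \<D> \<Longrightarrow> X \<subseteq> U" "\<And>X. X \<in> \<D> \<Longrightarrow> \<exists>a b. X = box a b" "\<Union>\<D> = U"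
    by (rule open_countable_Union_open_box[OF U]) blast
  have "AE x in lborel. \<forall>X\<in>\<D>. x \<in> X \<longrightarrow> w x = 0"
  proof (subst AE_ball_countable[OF \<D>(1)], intro ballI)
    fix X assume X: "X \<in> \<D>"
    then obtain a b where "X = box a b" using \<D>(3) by blast
    then show "AE x in lborel. x \<in> X \<longrightarrow> w x = 0" using AE_box[of a b] \<D>(2)[OF X] by simp
  qed
  then show ?thesis
    by eventually_elim (use \<D>(4) off in blast)
qed

section \<open>Weak derivatives of smooth functions\<close>

lemma integration_by_parts:
  fixes u \<phi> :: "real ^ 'd::finite \<Rightarrow> real"
  assumes u: "smooth u" and \<phi>: "smooth \<phi>" "supp_in (cball c R) \<phi>"
  shows "(\<integral>x. u x * iter_partial js \<phi> x \<partial>lborel) = (-1) ^ length js * (\<integral>x. iter_partial js u x * \<phi> x \<partial>lborel)"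
  using \<phi>
proof (induction js arbitrary: \<phi> rule: rev_induct)
  case (snoc j js)
  let ?u = "iter_partial js u"
  have su: "smooth ?u" by (rule smooth_iter_partial[OF u])
  have p: "smooth (partial_deriv j \<phi>)" "supp_in (cball c R) (partial_deriv j \<phi>)"
    using snoc.prems by (auto intro: smooth_partial supp_in_partial)
  have i: "integrable lborel (\<lambda>x. partial_deriv j ?u x * \<phi> x)" "integrable lborel (\<lambda>x. ?u x * partial_deriv j \<phi> x)"
    using snoc.prems p su by (auto intro!: smooth_integrable[of _ c R] smooth_mult smooth_partial simp: supp_in_def)
  have "(\<integral>x. partial_deriv j (\<lambda>x. ?u x * \<phi> x) x \<partial>lborel) = 0"
    using snoc.prems su by (intro integral_partial_zero[of _ c R] smooth_mult) (auto simp: supp_in_def)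
  then have "(\<integral>x. partial_deriv j ?u x * \<phi> x \<partial>lborel) + (\<integral>x. ?u x * partial_deriv j \<phi> x \<partial>lborel) = 0"
    using i by (simp add: smooth_partial_mult su snoc.prems)
  moreover have "(\<integral>x. u x * iter_partial (js @ [j]) \<phi> x \<partial>lborel) = (-1) ^ length js * (\<integral>x. ?u x * partial_deriv j \<phi> x \<partial>lborel)"
    unfolding iter_partial_snoc by (rule snoc.IH[OF p])
  moreover have "iter_partial (js @ [j]) u = partial_deriv j ?u"
    by (simp add: iter_partial_snoc iter_partial_commute1 u)
  ultimately show ?case by (simp add: add_eq_0_iff)
qed simp

lemma smooth_L2_on:
  fixes u :: "real ^ 'd::finite \<Rightarrow> real"
  assumes "smooth u" "supp_in (cball c R) u" "U \<in> sets borel"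
  shows "L2_on U u"
proof -
  have [measurable]: "u \<in> borel_measurable borel" "U \<in> sets borel" using assms by (auto intro: smooth_borel)
  have "integrable lborel (\<lambda>x. u x * u x)"
    using assms by (intro smooth_integrable[of _ c R] smooth_mult) (auto simp: supp_in_def)
  then have "integrable lborel (\<lambda>x. indicator U x *\<^sub>R (u x)\<^sup>2)"
    by (intro integrable_mult_indicator) (auto simp: power2_eq_square)
  then show ?thesis by (auto simp: L2_on_def set_borel_measurable_def set_integrable_def)
qed

lemma has_weak_deriv_smooth:
  fixes u :: "real ^ 'd::finite \<Rightarrow> real"
  assumes u: "smooth u" "supp_in (cball c R) u" and U: "cball c R \<subseteq> U" "open U"
  shows "has_weak_deriv U \<beta> u (mi_deriv \<beta> u)"
  unfolding has_weak_deriv_def mi_deriv_eq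
proof (intro conjI allI impI)
  let ?js = "mi_list \<beta>"
  have u': "smooth (iter_partial ?js u)" "supp_in (cball c R) (iter_partial ?js u)"
    using u by (auto intro: smooth_iter_partial supp_in_iter_partial)
  show "L2_on U (iter_partial ?js u)" using u' U by (intro smooth_L2_on) auto
  fix \<phi> assume test: "test_function U \<phi>"
  then have s\<phi>: "smooth \<phi>" by (simp add: test_function_def smooth_def)
  have "bounded (closure {x. \<phi> x \<noteq> 0})" using test by (auto simp: test_function_def compact_imp_bounded)
  then obtain B where "\<forall>x\<in>closure {x. \<phi> x \<noteq> 0}. norm x \<le> B" unfolding bounded_iff by blast
  then have B: "supp_in (cball 0 B) \<phi>"
    unfolding supp_in_def using closure_subset[of "{x. \<phi> x \<noteq> 0}"] by force
  have pw: "indicator U z * f z = f z" if "supp_in (cball c R) f" for f :: "real ^ 'd \<Rightarrow> real" and z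
    using that U(1) by (cases "z \<in> U") (auto simp: supp_in_def subset_eq)
  show "(LINT x:U|lborel. u x * iter_partial ?js \<phi> x) = (-1) ^ mi_order \<beta> * (LINT x:U|lborel. iter_partial ?js u x * \<phi> x)"
    unfolding lint_pairing
    by (simp only: pw[OF u(2)] pw[OF u'(2)] integration_by_parts[OF u(1) s\<phi> B] length_mi_list)
qed

text \<open>\<open>weak_deriv\<close> is an arbitrary choice among the weak derivatives; uniqueness
  up to null sets makes Sobolev norms computable from any of them.\<close>

lemma weak_deriv_unique:
  fixes g h :: "real ^ 'd::finite \<Rightarrow> real"
  assumes U: "open U" "bounded U" and int: "\<And>g. L2_on U g \<Longrightarrow> integrable lborel (\<lambda>z. indicator U z * g z)"
    and g: "has_weak_deriv U \<beta> u g" "has_weak_deriv U \<beta> u h"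
  shows "AE x in lborel. indicator U x * g x = indicator U x * h x"
proof -
  let ?w = "\<lambda>x. indicator U x * g x - indicator U x * h x"
  have i: "integrable lborel (\<lambda>z. indicator U z * g z)" "integrable lborel (\<lambda>z. indicator U z * h z)"
    using g by (auto intro!: int simp: has_weak_deriv_def)
  have "AE x in lborel. ?w x = 0"
  proof (rule AE_zero_of_test_functions[OF U(1)])
    show "integrable lborel ?w" using i by auto
    fix \<phi> assume test: "test_function U \<phi>"
    then have s\<phi>: "smooth \<phi>" by (simp add: test_function_def smooth_def)
    have "bounded (closure {x. \<phi> x \<noteq> 0})" using test by (auto simp: test_function_def compact_imp_bounded)
    then obtain B where "\<forall>x\<in>closure {x. \<phi> x \<noteq> 0}. norm x \<le> B" unfolding bounded_iff by blast
    then have "supp_in (cball 0 B) \<phi>"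
      unfolding supp_in_def using closure_subset[of "{x. \<phi> x \<noteq> 0}"] by force
    then obtain C where C: "\<And>x. \<bar>\<phi> x\<bar> \<le> C" using smooth_continuous_bounded[OF s\<phi>] by blast
    have j: "integrable lborel (\<lambda>z. indicator U z * g z * \<phi> z)" "integrable lborel (\<lambda>z. indicator U z * h z * \<phi> z)"
      using i by (auto intro!: integrable_mult_bounded[where B = C] smooth_borel s\<phi> C)
    have "(-1) ^ mi_order \<beta> * (LINT x:U|lborel. g x * \<phi> x) = (-1) ^ mi_order \<beta> * (LINT x:U|lborel. h x * \<phi> x)"
      using g test unfolding has_weak_deriv_def by metis
    then have "(LINT x:U|lborel. g x * \<phi> x) = (LINT x:U|lborel. h x * \<phi> x)" by simp
    then show "(\<integral>x. ?w x * \<phi> x \<partial>lborel) = 0"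
      using j unfolding lint_pairing by (simp add: left_diff_distrib)
  qed auto
  then show ?thesis by eventually_elim simp
qed

subsection \<open>The Gagliardo seminorm of smooth functions\<close>

lemma nn_integral_affine:
  fixes f :: "real ^ 'd::finite \<Rightarrow> ennreal"
  assumes [measurable]: "f \<in> borel_measurable borel" and c: "c \<noteq> 0"
  shows "(\<integral>\<^sup>+x. f x \<partial>lborel) = ennreal (\<bar>c\<bar> ^ CARD('d)) * (\<integral>\<^sup>+x. f (a + c *\<^sub>R x) \<partial>lborel)"
  by (subst lborel_affine[OF c, of a])
    (simp add: nn_integral_density nn_integral_distr nn_integral_cmult)

text \<open>A decomposition into layers in place of polar coordinates: each positive value is
  dominated by one layer, so the function is dominated by the sum of all layers.\<close>

lemma nn_integral_dyadic_le:
  fixes f :: "real ^ 'd::finite \<Rightarrow> real"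
  assumes le: "\<And>z. f z > 0 \<Longrightarrow> \<exists>j. f z \<le> c j \<and> norm z \<le> r j" and nn: "\<And>j. c j \<ge> 0" "\<And>j. r j \<ge> 0"
    and sum: "summable (\<lambda>j :: nat. c j * r j ^ CARD('d))"
  shows "(\<integral>\<^sup>+z. ennreal (f z) \<partial>lborel) < \<infinity>"
proof -
  let ?v = "unit_ball_vol (real CARD('d))"
  have "(\<integral>\<^sup>+z. ennreal (f z) \<partial>lborel) \<le> (\<integral>\<^sup>+z. (\<Sum>j. ennreal (c j) * indicator (cball (0 :: real ^ 'd) (r j)) z) \<partial>lborel)"
  proof (rule nn_integral_mono)
    fix z
    show "ennreal (f z) \<le> (\<Sum>j. ennreal (c j) * indicator (cball (0 :: real ^ 'd) (r j)) z)"
    proof (cases "f z > 0")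
      case True
      then obtain j where j: "f z \<le> c j" "norm z \<le> r j" using le by blast
      define F where "F i = ennreal (c i) * indicator (cball (0 :: real ^ 'd) (r i)) z" for i
      have "ennreal (f z) \<le> F j" using j by (simp add: F_def ennreal_leI)
      also have "F j \<le> (\<Sum>j. F j)" using sum_le_suminf[of F "{j}"] by simp
      also have "\<dots> = (\<Sum>j. ennreal (c j) * indicator (cball (0 :: real ^ 'd) (r j)) z)" by (simp add: F_def)
      finally show ?thesis .
    qed (simp add: ennreal_neg)
  qed
  also have "\<dots> = (\<Sum>j. \<integral>\<^sup>+z. ennreal (c j) * indicator (cball (0 :: real ^ 'd) (r j)) z \<partial>lborel)"
    by (intro nn_integral_suminf borel_measurable_times_ennreal borel_measurable_const borel_measurable_indicator) simp
  also have "\<dots> = (\<Sum>j. ennreal (?v * (c j * r j ^ CARD('d))))"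
    using nn by (simp add: nn_integral_cmult_indicator emeasure_cball ennreal_mult[symmetric] mult_ac)
  also have "\<dots> = ennreal (\<Sum>j. ?v * (c j * r j ^ CARD('d)))"
    using nn sum by (intro suminf_ennreal2 summable_mult) auto
  finally show ?thesis by (simp add: le_less_trans)
qed

text \<open>Near 0 the integrand is |z|^(2-d-2s), integrable as s < 1; far out it is |z|^(-d-2s),
  integrable as s > 0.\<close>

lemma fractional_kernel_finite:
  assumes s: "0 < s" "s < 1"
  shows "(\<integral>\<^sup>+z. ennreal (min 1 ((norm (z :: real ^ 'd::finite))\<^sup>2) / norm z powr (real CARD('d) + 2 * s)) \<partial>lborel) < \<infinity>"
proof -
  let ?d = "real CARD('d)"
  define f1 where "f1 z = (if norm z \<le> 1 then (norm z)\<^sup>2 / norm z powr (?d + 2 * s) else 0)" for z :: "real ^ 'd"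
  define f2 where "f2 z = (if norm z > 1 then 1 / norm z powr (?d + 2 * s) else 0)" for z :: "real ^ 'd"
  have [measurable]: "f1 \<in> borel_measurable borel" "f2 \<in> borel_measurable borel"
    unfolding f1_def f2_def by measurable
  \<comment> \<open>The exponent 2-2s-d may have either sign. On the shell between 2^-(j+1) and 2^-j
    the factor |z|^(2-2s) is therefore bounded at the outer radius and |z|^-d at the inner one,
    hence the additional 2^d in the layer constant.\<close>
  have "(\<integral>\<^sup>+z. ennreal (f1 z) \<partial>lborel) < \<infinity>"
  proof (rule nn_integral_dyadic_le[where c = "\<lambda>j. 2 powr (?d - real j * (2 - 2 * s - ?d))" and r = "\<lambda>j. 2 powr (- real j)"])
    fix z :: "real ^ 'd" assume "f1 z > 0"
    then have z: "norm z \<le> 1" "norm z > 0" by (auto simp: f1_def split: if_splits)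
    define l where "l = - log 2 (norm z)"
    have nz: "norm z = 2 powr (- l)" using z by (simp add: l_def)
    have l0: "l \<ge> 0" using z by (simp add: l_def)
    define j where "j = nat \<lfloor>l\<rfloor>"
    have j: "real j \<le> l" "l < real j + 1" using l0 by (auto simp: j_def)
    have "f1 z = norm z powr 2 / norm z powr (?d + 2 * s)" using z by (simp add: f1_def)
    also have "\<dots> = norm z powr (2 - (?d + 2 * s))" by (rule powr_diff[symmetric])
    also have "2 - (?d + 2 * s) = (2 - 2 * s) + (- ?d)" by simp
    also have "norm z powr \<dots> = norm z powr (2 - 2 * s) * norm z powr (- ?d)" by (rule powr_add)
    also have "\<dots> = 2 powr (- l * (2 - 2 * s)) * 2 powr (l * ?d)" unfolding nz powr_powr by simp
    also have "\<dots> \<le> 2 powr (- real j * (2 - 2 * s)) * 2 powr ((real j + 1) * ?d)"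
      using j s by (intro mult_mono powr_mono mult_right_mono) auto
    also have "\<dots> = 2 powr (?d - real j * (2 - 2 * s - ?d))"
      unfolding powr_add[symmetric] by (rule arg_cong[where f = "\<lambda>x. 2 powr x"]) (simp add: algebra_simps)
    finally have "f1 z \<le> 2 powr (?d - real j * (2 - 2 * s - ?d))" .
    moreover have "norm z \<le> 2 powr (- real j)" unfolding nz using j by simp
    ultimately show "\<exists>j. f1 z \<le> 2 powr (?d - real j * (2 - 2 * s - ?d)) \<and> norm z \<le> 2 powr (- real j)" by blast
  next
    have "2 powr (?d - real j * (2 - 2 * s - ?d)) * (2 powr (- real j)) ^ CARD('d) = 2 powr ?d * (2 powr (- (2 - 2 * s))) ^ j" for j
    proof -
      have "2 powr (?d - real j * (2 - 2 * s - ?d)) * (2 powr (- real j)) ^ CARD('d) =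
          2 powr ((?d - real j * (2 - 2 * s - ?d)) + ?d * (- real j))"
        unfolding powr_add by (simp add: powr_power)
      also have "(?d - real j * (2 - 2 * s - ?d)) + ?d * (- real j) = ?d + real j * (- (2 - 2 * s))"
        by (simp add: algebra_simps)
      also have "2 powr (?d + real j * (- (2 - 2 * s))) = 2 powr ?d * (2 powr (- (2 - 2 * s))) ^ j"
        unfolding powr_add by (simp add: powr_power)
      finally show ?thesis .
    qed
    moreover have "2 powr (- (2 - 2 * s)) < (1 :: real)" using s powr_less_mono[of "- (2 - 2 * s)" 0 2] by simp
    ultimately show "summable (\<lambda>j. 2 powr (?d - real j * (2 - 2 * s - ?d)) * (2 powr (- real j)) ^ CARD('d))"
      by (auto intro!: summable_mult summable_geometric)
  qed auto
  moreover have "(\<integral>\<^sup>+z. ennreal (f2 z) \<partial>lborel) < \<infinity>"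
  proof (rule nn_integral_dyadic_le[where c = "\<lambda>j. 2 powr (- real j * (?d + 2 * s))" and r = "\<lambda>j. 2 powr (real j + 1)"])
    fix z :: "real ^ 'd" assume "f2 z > 0"
    then have z: "norm z > 1" by (auto simp: f2_def split: if_splits)
    define l where "l = log 2 (norm z)"
    have "norm z > 0" using z by linarith
    then have nz: "norm z = 2 powr l" using powr_log_cancel[of 2 "norm z"] by (simp add: l_def)
    have l0: "l \<ge> 0" unfolding l_def using z by (subst zero_le_log_cancel_iff) linarith+
    define j where "j = nat \<lfloor>l\<rfloor>"
    have j: "real j \<le> l" "l < real j + 1" using l0 by (auto simp: j_def)
    have "f2 z = 2 powr (- l * (?d + 2 * s))" using z by (simp add: f2_def nz powr_powr powr_minus_divide)
    also have "\<dots> \<le> 2 powr (- real j * (?d + 2 * s))" using j s by (intro powr_mono mult_right_mono) auto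
    finally have "f2 z \<le> 2 powr (- real j * (?d + 2 * s))" .
    moreover have "norm z \<le> 2 powr (real j + 1)" unfolding nz using j by simp
    ultimately show "\<exists>j. f2 z \<le> 2 powr (- real j * (?d + 2 * s)) \<and> norm z \<le> 2 powr (real j + 1)" by blast
  next
    have "2 powr (- real j * (?d + 2 * s)) * (2 powr (real j + 1)) ^ CARD('d) = 2 powr ?d * (2 powr (- (2 * s))) ^ j" for j
    proof -
      have "2 powr (- real j * (?d + 2 * s)) * (2 powr (real j + 1)) ^ CARD('d) =
          2 powr ((- real j * (?d + 2 * s)) + ?d * (real j + 1))"
        unfolding powr_add[of 2 "- real j * (?d + 2 * s)"] by (simp add: powr_power)
      also have "(- real j * (?d + 2 * s)) + ?d * (real j + 1) = ?d + real j * (- (2 * s))"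
        by (simp add: algebra_simps)
      also have "2 powr (?d + real j * (- (2 * s))) = 2 powr ?d * (2 powr (- (2 * s))) ^ j"
        unfolding powr_add by (simp add: powr_power)
      finally show ?thesis .
    qed
    moreover have "2 powr (- (2 * s)) < (1 :: real)" using s powr_less_mono[of "- (2 * s)" 0 2] by simp
    ultimately show "summable (\<lambda>j. 2 powr (- real j * (?d + 2 * s)) * (2 powr (real j + 1)) ^ CARD('d))"
      by (auto intro!: summable_mult summable_geometric)
  qed auto
  ultimately have "(\<integral>\<^sup>+z. ennreal (f1 z) + ennreal (f2 z) \<partial>lborel) < \<infinity>"
    by (subst nn_integral_add) auto
  moreover have "ennreal (min 1 ((norm z)\<^sup>2) / norm z powr (?d + 2 * s)) \<le> ennreal (f1 z) + ennreal (f2 z)" for z :: "real ^ 'd"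
  proof (cases "norm z \<le> 1")
    case True
    then have "min 1 ((norm z)\<^sup>2) / norm z powr (?d + 2 * s) = f1 z"
      using power_le_one[of "norm z" 2] by (simp add: f1_def min_def)
    then show ?thesis by simp
  next
    case False
    then have "min 1 ((norm z)\<^sup>2) / norm z powr (?d + 2 * s) \<le> f2 z"
      by (simp add: f2_def divide_right_mono)
    then show ?thesis by (simp add: ennreal_leI add_increasing)
  qed
  then have "(\<integral>\<^sup>+z. ennreal (min 1 ((norm (z :: real ^ 'd))\<^sup>2) / norm z powr (?d + 2 * s)) \<partial>lborel)
      \<le> (\<integral>\<^sup>+z. ennreal (f1 z) + ennreal (f2 z) \<partial>lborel)"
    by (intro nn_integral_mono)
  ultimately show ?thesis using le_less_trans by blast
qed

lemma smooth_lipschitz: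
  fixes f :: "real ^ 'd::finite \<Rightarrow> real"
  assumes f: "smooth f" "supp_in (cball c R) f"
  obtains L where "L \<ge> 0" "\<And>x y. \<bar>f x - f y\<bar> \<le> L * norm (x - y)"
proof -
  have "\<forall>i. \<exists>C\<ge>0. \<forall>y. \<bar>partial_deriv i f y\<bar> \<le> C"
  proof
    fix i obtain C where "C \<ge> 0" "\<And>y. \<bar>partial_deriv i f y\<bar> \<le> C"
      by (rule smooth_continuous_bounded[OF smooth_partial[OF f(1)] supp_in_partial[OF f(2)]]) auto
    then show "\<exists>C\<ge>0. \<forall>y. \<bar>partial_deriv i f y\<bar> \<le> C" by blast
  qed
  then obtain C where C: "\<And>i. C i \<ge> 0" "\<And>i y. \<bar>partial_deriv i f y\<bar> \<le> C i" by metis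
  have "norm (f x - f y) \<le> (\<Sum>i\<in>UNIV. C i) * norm (x - y)" for x y
  proof (rule differentiable_bound[where S = UNIV and f' = "\<lambda>x h. \<Sum>i\<in>UNIV. vec_nth h i * partial_deriv i f x"])
    show "(f has_derivative (\<lambda>h. \<Sum>i\<in>UNIV. vec_nth h i * partial_deriv i f x)) (at x within UNIV)" for x
      by (rule differentiable_has_derivative_partials[OF smooth_differentiable[OF f(1)]])
    show "onorm (\<lambda>h. \<Sum>i\<in>UNIV. vec_nth h i * partial_deriv i f x) \<le> (\<Sum>i\<in>UNIV. C i)" for x
    proof (rule onorm_bound)
      fix h :: "real ^ 'd"
      have "\<bar>\<Sum>i\<in>UNIV. vec_nth h i * partial_deriv i f x\<bar> \<le> (\<Sum>i\<in>UNIV. C i * norm h)"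
      proof (intro order_trans[OF sum_abs] sum_mono)
        fix i show "\<bar>vec_nth h i * partial_deriv i f x\<bar> \<le> C i * norm h"
          using mult_mono[OF component_le_norm_cart[of h i] C(2)[of i x]] by (simp add: abs_mult mult.commute)
      qed
      then show "norm (\<Sum>i\<in>UNIV. vec_nth h i * partial_deriv i f x) \<le> (\<Sum>i\<in>UNIV. C i) * norm h"
        by (simp add: sum_distrib_right)
    qed (auto intro: sum_nonneg C)
  qed auto
  then show thesis by (intro that[of "\<Sum>i\<in>UNIV. C i"]) (auto intro: sum_nonneg C)
qed

text \<open>The Lipschitz bound near the diagonal and the sup bound away from it give C min(1,
  |x-y|^2). The numerator vanishes unless one of the points lies in the support, so one variable is
  integrated over a bounded set and the other against the integrable kernel.\<close>

lemma gagliardo_smooth_finite: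
  fixes f :: "real ^ 'd::finite \<Rightarrow> real"
  assumes s: "0 < s" "s < 1" and f: "smooth f" "supp_in (cball c R) f"
  shows "gagliardo UNIV s f < \<infinity>"
proof -
  let ?d = "real CARD('d)"
  define S where "S = cball c R"
  have [measurable]: "S \<in> sets borel" by (simp add: S_def)
  define \<rho> where "\<rho> z = min 1 ((norm z)\<^sup>2) / norm z powr (?d + 2 * s)" for z :: "real ^ 'd"
  have [measurable]: "\<rho> \<in> borel_measurable borel" unfolding \<rho>_def by measurable
  define Q where "Q = (\<integral>\<^sup>+z. ennreal (\<rho> z) \<partial>lborel)"
  have Q: "Q < \<infinity>" unfolding Q_def \<rho>_def by (rule fractional_kernel_finite[OF s])
  obtain L where L: "L \<ge> 0" "\<And>x y. \<bar>f x - f y\<bar> \<le> L * norm (x - y)" by (rule smooth_lipschitz[OF f]) blast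
  obtain B where B: "B \<ge> 0" "\<And>x. \<bar>f x\<bar> \<le> B" by (rule smooth_continuous_bounded[OF f]) blast
  define C where "C = L\<^sup>2 + (2 * B)\<^sup>2"
  have C: "C \<ge> 0" by (simp add: C_def)
  have le: "ennreal ((f x - f y)\<^sup>2 / norm (x - y) powr (?d + 2 * s)) \<le>
      ennreal C * ennreal (\<rho> (x - y)) * indicator S x + ennreal C * ennreal (\<rho> (x - y)) * indicator S y" for x y
  proof (cases "x \<in> S \<or> y \<in> S")
    case True
    have "(f x - f y)\<^sup>2 \<le> (L * norm (x - y))\<^sup>2" using L(2)[of x y] by (intro abs_le_square_iff[THEN iffD1]) auto
    moreover have "\<bar>f x - f y\<bar> \<le> \<bar>2 * B\<bar>" using B(2)[of x] B(2)[of y] by linarith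
    then have "(f x - f y)\<^sup>2 \<le> (2 * B)\<^sup>2" by (rule abs_le_square_iff[THEN iffD1])
    moreover have "(2 * B)\<^sup>2 \<le> C" "L\<^sup>2 * (norm (x - y))\<^sup>2 \<le> C * (norm (x - y))\<^sup>2"
      by (auto simp: C_def intro!: mult_right_mono)
    ultimately have "(f x - f y)\<^sup>2 \<le> C * min 1 ((norm (x - y))\<^sup>2)"
      by (simp add: min_def power_mult_distrib)
    then have "(f x - f y)\<^sup>2 / norm (x - y) powr (?d + 2 * s) \<le> C * \<rho> (x - y)"
      unfolding \<rho>_def times_divide_eq_right by (intro divide_right_mono) auto
    then have "ennreal ((f x - f y)\<^sup>2 / norm (x - y) powr (?d + 2 * s)) \<le> ennreal C * ennreal (\<rho> (x - y))"
      using C by (simp add: ennreal_mult'[symmetric] ennreal_leI)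
    also have "\<dots> \<le> ennreal C * ennreal (\<rho> (x - y)) * indicator S x + ennreal C * ennreal (\<rho> (x - y)) * indicator S y"
      using True by (auto simp: indicator_def)
    finally show ?thesis .
  next
    case False then show ?thesis using f(2) by (simp add: supp_in_def S_def)
  qed
  have Qx: "(\<integral>\<^sup>+y. ennreal (\<rho> (x - y)) \<partial>lborel) = Q" for x
    using nn_integral_affine[of "\<lambda>z. ennreal (\<rho> z)" "-1" x] by (simp add: Q_def)
  have Qy: "(\<integral>\<^sup>+x. ennreal (\<rho> (x - y)) \<partial>lborel) = Q" for y
    using nn_integral_affine[of "\<lambda>z. ennreal (\<rho> z)" 1 "- y"] by (simp add: Q_def)
  have "gagliardo UNIV s f = (\<integral>\<^sup>+x. (\<integral>\<^sup>+y. ennreal ((f x - f y)\<^sup>2 / norm (x - y) powr (?d + 2 * s)) \<partial>lborel) \<partial>lborel)"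
    by (simp add: gagliardo_def)
  also have "\<dots> \<le> (\<integral>\<^sup>+x. (\<integral>\<^sup>+y. ennreal C * ennreal (\<rho> (x - y)) * indicator S x + ennreal C * ennreal (\<rho> (x - y)) * indicator S y \<partial>lborel) \<partial>lborel)"
    by (intro nn_integral_mono le)
  also have "\<dots> = (\<integral>\<^sup>+x. (\<integral>\<^sup>+y. ennreal C * ennreal (\<rho> (x - y)) * indicator S x \<partial>lborel) \<partial>lborel) +
      (\<integral>\<^sup>+x. (\<integral>\<^sup>+y. ennreal C * ennreal (\<rho> (x - y)) * indicator S y \<partial>lborel) \<partial>lborel)"
    by (simp add: nn_integral_add)
  also have "(\<integral>\<^sup>+x. (\<integral>\<^sup>+y. ennreal C * ennreal (\<rho> (x - y)) * indicator S x \<partial>lborel) \<partial>lborel) = ennreal C * Q * emeasure lborel S"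
    by (simp add: nn_integral_multc nn_integral_cmult nn_integral_cmult_indicator Qx)
  also have "(\<integral>\<^sup>+x. (\<integral>\<^sup>+y. ennreal C * ennreal (\<rho> (x - y)) * indicator S y \<partial>lborel) \<partial>lborel) =
      (\<integral>\<^sup>+y. (\<integral>\<^sup>+x. ennreal C * ennreal (\<rho> (x - y)) * indicator S y \<partial>lborel) \<partial>lborel)"
    by (rule lborel_pair.Fubini') measurable
  also have "\<dots> = ennreal C * Q * emeasure lborel S"
    by (simp add: nn_integral_multc nn_integral_cmult nn_integral_cmult_indicator Qy)
  also have "ennreal C * Q * emeasure lborel S + ennreal C * Q * emeasure lborel S < \<infinity>"
    using Q emeasure_lborel_cball_finite[of c R] by (simp add: S_def ennreal_mult_less_top) 
  finally show ?thesis .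
qed

text \<open>The weight contributes b^(d+2s) and each of the two substitutions b^-d.\<close>

lemma gagliardo_affine:
  fixes f :: "real ^ 'd::finite \<Rightarrow> real"
  assumes [measurable]: "f \<in> borel_measurable borel" and b: "b > 0"
  shows "gagliardo UNIV s (\<lambda>x. k * f (a + b *\<^sub>R x)) = ennreal (k\<^sup>2 * b powr (2 * s - real CARD('d))) * gagliardo UNIV s f"
proof -
  let ?d = "real CARD('d)" and ?D = "CARD('d)"
  define q where "q x y = ennreal ((f x - f y)\<^sup>2 / norm (x - y) powr (?d + 2 * s))" for x y
  have [measurable]: "(\<lambda>(x, y). q x y) \<in> borel_measurable (borel \<Otimes>\<^sub>M borel)" unfolding q_def by measurable
  have eq: "ennreal ((k * f (a + b *\<^sub>R x) - k * f (a + b *\<^sub>R y))\<^sup>2 / norm (x - y) powr (?d + 2 * s)) =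
      ennreal (k\<^sup>2 * b powr (?d + 2 * s)) * q (a + b *\<^sub>R x) (a + b *\<^sub>R y)" for x y
  proof -
    have "norm ((a + b *\<^sub>R x) - (a + b *\<^sub>R y)) = b * norm (x - y)"
      using b by (simp flip: scaleR_diff_right)
    then have n: "norm ((a + b *\<^sub>R x) - (a + b *\<^sub>R y)) powr (?d + 2 * s) = b powr (?d + 2 * s) * norm (x - y) powr (?d + 2 * s)"
      using b by (simp add: powr_mult)
    have "(k * f (a + b *\<^sub>R x) - k * f (a + b *\<^sub>R y))\<^sup>2 = k\<^sup>2 * (f (a + b *\<^sub>R x) - f (a + b *\<^sub>R y))\<^sup>2"
      by (simp add: power_mult_distrib flip: right_diff_distrib)
    then show ?thesis
      using b unfolding q_def n by (simp add: ennreal_mult'[symmetric])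
  qed
  have inner: "(\<integral>\<^sup>+y. q u (a + b *\<^sub>R y) \<partial>lborel) = ennreal (b powr (- ?d)) * (\<integral>\<^sup>+y. q u y \<partial>lborel)" for u
  proof -
    have "(\<integral>\<^sup>+y. q u y \<partial>lborel) = ennreal (b ^ ?D) * (\<integral>\<^sup>+y. q u (a + b *\<^sub>R y) \<partial>lborel)"
      using nn_integral_affine[of "q u" b a] b by simp
    then have "ennreal (b powr (- ?d)) * (\<integral>\<^sup>+y. q u y \<partial>lborel) = ennreal (b powr (- ?d) * b ^ ?D) * (\<integral>\<^sup>+y. q u (a + b *\<^sub>R y) \<partial>lborel)"
      using b by (simp add: ennreal_mult mult.assoc)
    also have "b powr (- ?d) * b ^ ?D = 1" using b by (simp add: powr_minus powr_realpow)
    finally show ?thesis by simp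
  qed
  define g where "g u = (\<integral>\<^sup>+y. q u y \<partial>lborel)" for u
  have [measurable]: "g \<in> borel_measurable borel" unfolding g_def by measurable
  have outer: "(\<integral>\<^sup>+x. g (a + b *\<^sub>R x) \<partial>lborel) = ennreal (b powr (- ?d)) * (\<integral>\<^sup>+x. g x \<partial>lborel)"
  proof -
    have "(\<integral>\<^sup>+y. g y \<partial>lborel) = ennreal (b ^ ?D) * (\<integral>\<^sup>+y. g (a + b *\<^sub>R y) \<partial>lborel)"
      using nn_integral_affine[of g b a] b by simp
    then have "ennreal (b powr (- ?d)) * (\<integral>\<^sup>+y. g y \<partial>lborel) = ennreal (b powr (- ?d) * b ^ ?D) * (\<integral>\<^sup>+y. g (a + b *\<^sub>R y) \<partial>lborel)"
      using b by (simp add: ennreal_mult mult.assoc)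
    also have "b powr (- ?d) * b ^ ?D = 1" using b by (simp add: powr_minus powr_realpow)
    finally show ?thesis by simp
  qed
  have "gagliardo UNIV s (\<lambda>x. k * f (a + b *\<^sub>R x)) =
      (\<integral>\<^sup>+x. (\<integral>\<^sup>+y. ennreal (k\<^sup>2 * b powr (?d + 2 * s)) * q (a + b *\<^sub>R x) (a + b *\<^sub>R y) \<partial>lborel) \<partial>lborel)"
    by (simp add: gagliardo_def eq)
  also have "\<dots> = ennreal (k\<^sup>2 * b powr (?d + 2 * s)) * (ennreal (b powr (- ?d)) * (ennreal (b powr (- ?d)) * (\<integral>\<^sup>+x. g x \<partial>lborel)))"
    by (simp add: nn_integral_cmult inner flip: g_def outer)
  also have "\<dots> = ennreal (k\<^sup>2 * b powr (?d + 2 * s) * (b powr (- ?d) * b powr (- ?d))) * gagliardo UNIV s f"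
    by (simp add: gagliardo_def g_def q_def ennreal_mult mult.assoc)
  also have "k\<^sup>2 * b powr (?d + 2 * s) * (b powr (- ?d) * b powr (- ?d)) = k\<^sup>2 * b powr (2 * s - ?d)"
    by (simp add: mult.assoc flip: powr_add)
  finally show ?thesis .
qed

lemma gagliardo_mono: "gagliardo U s f \<le> gagliardo UNIV s f"
  unfolding gagliardo_def
  by (intro nn_integral_mono) (auto simp: indicator_def intro!: nn_integral_mono)

lemma gagliardo_cong_AE:
  assumes "AE x in lborel. indicator U x * f x = indicator U x * g x"
  shows "gagliardo U s f = gagliardo U s g"
proof -
  have "gagliardo U s (\<lambda>x. indicator U x * f x) = gagliardo U s (\<lambda>x. indicator U x * g x)"
    unfolding gagliardo_def
    by (intro nn_integral_cong_AE; use assms in eventually_elim)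
       (auto intro!: arg_cong2[where f = "(*)"] nn_integral_cong_AE eventually_mono[OF assms])
  then show ?thesis by (simp add: gagliardo_indicator)
qed

subsection \<open>Localised test functions\<close>

lemma integral_affine:
  fixes f :: "real ^ 'd::finite \<Rightarrow> real"
  assumes [measurable]: "f \<in> borel_measurable borel" and b: "b > 0"
  shows "(\<integral>x. f (a + b *\<^sub>R x) \<partial>lborel) = b powr (- real CARD('d)) * (\<integral>x. f x \<partial>lborel)"
proof -
  have "(\<integral>z. f z \<partial>lborel) = (\<integral>z. f z \<partial>(density (distr lborel borel (\<lambda>y. a + b *\<^sub>R y)) (\<lambda>_. ennreal (\<bar>b\<bar> ^ DIM(real ^ 'd)))))"
    using lborel_affine[of b a] b by simp
  also have "\<dots> = (\<integral>z. (\<bar>b\<bar> ^ DIM(real ^ 'd)) *\<^sub>R f z \<partial>(distr lborel borel (\<lambda>y. a + b *\<^sub>R y)))"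
    by (intro integral_density) auto
  also have "\<dots> = (\<integral>y. (\<bar>b\<bar> ^ DIM(real ^ 'd)) *\<^sub>R f (a + b *\<^sub>R y) \<partial>lborel)"
    by (intro integral_distr) auto
  also have "\<dots> = b powr real CARD('d) * (\<integral>y. f (a + b *\<^sub>R y) \<partial>lborel)"
    using b by (simp add: powr_realpow)
  finally show ?thesis using b by (simp add: powr_minus)
qed

lemma L2_norm_affine_le:
  fixes f :: "real ^ 'd::finite \<Rightarrow> real"
  assumes f: "smooth f" "supp_in (cball c R) f" and b: "b > 0" and V: "V \<in> sets borel"
  shows "(L2_norm V (\<lambda>x. k * f (a + b *\<^sub>R x)))\<^sup>2 \<le> k\<^sup>2 * b powr (- real CARD('d)) * (\<integral>x. (f x)\<^sup>2 \<partial>lborel)"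
proof -
  let ?g = "\<lambda>x. k * f (a + b *\<^sub>R x)"
  have [measurable]: "f \<in> borel_measurable borel" "V \<in> sets borel" using f V by (auto intro: smooth_borel)
  have f2: "smooth (\<lambda>x. (f x)\<^sup>2)" "supp_in (cball c R) (\<lambda>x. (f x)\<^sup>2)"
    using f by (auto simp: power2_eq_square supp_in_def intro: smooth_mult)
  have eq: "(1 / (1 / b)) *\<^sub>R (x - (- (1 / b) *\<^sub>R a)) = a + b *\<^sub>R x" for x :: "real ^ 'd"
    using b by (simp add: scaleR_add_right)
  have "supp_in (cball (- (1 / b) *\<^sub>R a + (1 / b) *\<^sub>R c) (1 / b * R)) (\<lambda>x. (f (a + b *\<^sub>R x))\<^sup>2)"
    using f2(2) dilate_mem[of "1 / b" _ "- (1 / b) *\<^sub>R a" c R] b unfolding supp_in_def eq by auto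
  then have int: "integrable lborel (\<lambda>x. (f (a + b *\<^sub>R x))\<^sup>2)"
    by (rule smooth_integrable[OF smooth_affine[OF f2(1)]])
  have g2: "integrable lborel (\<lambda>x. (?g x)\<^sup>2)" using int by (simp add: power_mult_distrib)
  have "0 \<le> (LINT x:V|lborel. (?g x)\<^sup>2)"
    unfolding set_lebesgue_integral_def by (rule integral_nonneg_AE) simp
  then have "(L2_norm V ?g)\<^sup>2 = (LINT x:V|lborel. (?g x)\<^sup>2)" by (simp add: L2_norm_def)
  also have "\<dots> \<le> (\<integral>x. (?g x)\<^sup>2 \<partial>lborel)"
    unfolding set_lebesgue_integral_def
  proof (rule integral_mono)
    show "integrable lborel (\<lambda>x. indicator V x *\<^sub>R (?g x)\<^sup>2)"
      by (intro integrable_mult_indicator g2) simp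
  qed (auto simp: g2 indicator_def)
  also have "\<dots> = k\<^sup>2 * (\<integral>x. (f (a + b *\<^sub>R x))\<^sup>2 \<partial>lborel)" by (simp add: power_mult_distrib)
  also have "\<dots> = k\<^sup>2 * b powr (- real CARD('d)) * (\<integral>x. (f x)\<^sup>2 \<partial>lborel)"
    using integral_affine[of "\<lambda>x. (f x)\<^sup>2" b a] b by simp
  finally show ?thesis .
qed

lemma L2_norm_cong_AE:
  assumes "L2_on U g" "L2_on U h" "AE x in lborel. indicator U x * g x = indicator U x * h x"
  shows "L2_norm U g = L2_norm U h"
proof -
  have "(\<integral>x. (indicator U x * g x)\<^sup>2 \<partial>lborel) = (\<integral>x. (indicator U x * h x)\<^sup>2 \<partial>lborel)"
    using L2_onD(2)[OF assms(1)] L2_onD(2)[OF assms(2)] assms(3)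
    by (intro integral_cong_AE) auto
  then have "(L2_norm U g)\<^sup>2 = (L2_norm U h)\<^sup>2"
    using L2_onD(3)[OF assms(1)] L2_onD(3)[OF assms(2)] by simp
  then show ?thesis by (simp add: power2_eq_iff_nonneg)
qed

text \<open>The chosen weak derivatives agree almost everywhere with the classical ones, and neither
  norm sees null sets.\<close>

lemma smooth_sobolev:
  fixes u :: "real ^ 'd::finite \<Rightarrow> real"
  assumes U: "open U" "bounded U" and m: "m > 0" and u: "smooth u" "supp_in (cball c R) u" "cball c R \<subseteq> U"
  shows "in_sobolev U m u"
    and "L2_norm U (weak_deriv U \<beta> u) = L2_norm U (mi_deriv \<beta> u)"
    and "gagliardo U s (weak_deriv U \<beta> u) = gagliardo U s (mi_deriv \<beta> u)"
proof -
  have wd: "has_weak_deriv U \<beta> u (mi_deriv \<beta> u)" for \<beta>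
    by (rule has_weak_deriv_smooth[OF u U(1)])
  have wd': "has_weak_deriv U \<beta> u (weak_deriv U \<beta> u)" for \<beta>
    using someI_ex[of "has_weak_deriv U \<beta> u"] wd unfolding weak_deriv_def by blast
  have ae: "AE x in lborel. indicator U x * weak_deriv U \<beta> u x = indicator U x * mi_deriv \<beta> u x" for \<beta>
    by (rule weak_deriv_unique[OF U L2_on_integrable[OF _ U(2,1)] wd' wd])
  show "L2_norm U (weak_deriv U \<beta> u) = L2_norm U (mi_deriv \<beta> u)"
    using wd wd' by (intro L2_norm_cong_AE ae) (auto simp: has_weak_deriv_def)
  have gag: "gagliardo U s (weak_deriv U \<beta> u) = gagliardo U s (mi_deriv \<beta> u)" for \<beta> s
    by (rule gagliardo_cong_AE[OF ae])
  then show "gagliardo U s (weak_deriv U \<beta> u) = gagliardo U s (mi_deriv \<beta> u)" .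
  have "gagliardo U (frac m) (mi_deriv \<beta> u) < \<infinity>" if "m \<notin> \<int>" for \<beta>
  proof -
    have "gagliardo UNIV (frac m) (mi_deriv \<beta> u) < \<infinity>"
      unfolding mi_deriv_eq
      by (rule gagliardo_smooth_finite[of _ _ c R])
        (use that u in \<open>auto simp: frac_gt_0_iff frac_lt_1 intro: smooth_iter_partial supp_in_iter_partial\<close>)
    then show ?thesis using gagliardo_mono le_less_trans by blast
  qed
  moreover have "L2_on U u" using u U by (intro smooth_L2_on) auto
  ultimately show "in_sobolev U m u"
    unfolding in_sobolev_def gag using wd by blast
qed

text \<open>Rescaled bumps: each derivative contributes a factor 1/h and the volume contributes
  h^(d/2); the fractional seminorm scales like a derivative of fractional order.\<close>

lemma sobolev_test_functions:
  fixes \<Omega> :: "(real ^ 'd::finite) set"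
  assumes \<Omega>: "compact \<Omega>" and x0: "x0 \<in> interior \<Omega>" and m: "m > 0"
  shows "\<exists>h0 C c. 0 < h0 \<and> h0 \<le> 1 \<and> C \<ge> 0 \<and> c > 0 \<and> (\<forall>h. 0 < h \<longrightarrow> h \<le> h0 \<longrightarrow>
    (\<exists>u. continuous_on \<Omega> u \<and> (\<forall>x. x \<notin> \<Omega> \<longrightarrow> u x = 0) \<and> in_sobolev (interior \<Omega>) m u \<and>
      sobolev_norm (interior \<Omega>) m u \<le> C * h powr (real CARD('d) / 2 - m) \<and>
      L2_norm \<Omega> u \<le> C * h powr (real CARD('d) / 2) \<and>
      \<bar>iter_partial is u x0\<bar> = c * h powr (- real (length is))))"
proof -
  let ?U = "interior \<Omega>" and ?d = "real CARD('d)" and ?k = "nat \<lfloor>m\<rfloor>"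
  let ?\<phi> = "bump :: real ^ 'd \<Rightarrow> real"
  have bd: "bounded ?U" using \<Omega> by (meson bounded_interior compact_imp_bounded)
  have \<phi>: "smooth ?\<phi>" "supp_in (cball 0 1) ?\<phi>"
    using smooth_bump by (auto simp: supp_in_def intro!: bump_zero)
  have "?\<phi> 0 \<noteq> 0" using bump_pos[of "0 :: real ^ 'd"] by simp
  then obtain y0 where y0: "y0 \<in> cball 0 1" "iter_partial is ?\<phi> y0 \<noteq> 0"
    using iter_partial_nonzero[OF \<phi>] by blast
  obtain R where R: "R > 0" "cball x0 R \<subseteq> ?U"
    using x0 open_interior[of \<Omega>] by (metis open_contains_cball)
  define A where "A \<beta> = (\<integral>x. (mi_deriv \<beta> ?\<phi> x)\<^sup>2 \<partial>lborel)" for \<beta>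
  define G where "G \<beta> = enn2real (gagliardo UNIV (frac m) (mi_deriv \<beta> ?\<phi>))" for \<beta>
  define C2 where "C2 = (\<Sum>\<beta> | mi_order \<beta> \<le> ?k. A \<beta>) + (\<Sum>\<beta> | mi_order \<beta> = ?k. G \<beta>)"
  have A0: "A \<beta> \<ge> 0" for \<beta> unfolding A_def by (rule integral_nonneg_AE) simp
  have G0: "G \<beta> \<ge> 0" for \<beta> by (simp add: G_def)
  have C20: "C2 \<ge> 0" unfolding C2_def by (intro add_nonneg_nonneg sum_nonneg A0 G0)
  define C where "C = sqrt C2 + sqrt (\<integral>x. (?\<phi> x)\<^sup>2 \<partial>lborel)"
  have i0: "(\<integral>x. (?\<phi> x)\<^sup>2 \<partial>lborel) \<ge> 0" by (rule integral_nonneg_AE) simp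
  have C: "sqrt C2 \<le> C" "sqrt (\<integral>x. (?\<phi> x)\<^sup>2 \<partial>lborel) \<le> C" "C \<ge> 0" using C20 i0 by (auto simp: C_def)
  have "\<exists>u. continuous_on \<Omega> u \<and> (\<forall>x. x \<notin> \<Omega> \<longrightarrow> u x = 0) \<and> in_sobolev ?U m u \<and>
      sobolev_norm ?U m u \<le> C * h powr (?d / 2 - m) \<and> L2_norm \<Omega> u \<le> C * h powr (?d / 2) \<and>
      \<bar>iter_partial is u x0\<bar> = \<bar>iter_partial is ?\<phi> y0\<bar> * h powr (- real (length is))"
    if h: "0 < h" "h \<le> min 1 (R / 2)" for h
  proof (intro exI conjI allI impI)
    define b where "b = 1 / h"
    have b: "b \<ge> 1" "b > 0" using h by (auto simp: b_def)
    have bh: "b powr e = h powr (- e)" for e using h by (simp add: b_def powr_divide powr_minus_divide)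
    \<comment> \<open>The affine map sends \<open>x0\<close> to \<open>y0\<close>, where the
      derivative of the bump does not vanish.\<close>
    define a where "a = y0 - b *\<^sub>R x0"
    define u where "u x = ?\<phi> (a + b *\<^sub>R x)" for x
    have su: "smooth u" unfolding u_def[abs_def] by (rule smooth_affine[OF \<phi>(1)])
    \<comment> \<open>The rescaled bump has radius h and its centre is within h of
      \<open>x0\<close>, as \<open>y0\<close> has norm at most 1; so \<open>h \<le> R / 2\<close>
      suffices.\<close>
    have supp: "supp_in (cball x0 R) u"
      unfolding supp_in_def
    proof (intro allI impI)
      fix x assume x: "x \<notin> cball x0 R"
      have eq: "a + b *\<^sub>R x = b *\<^sub>R (x - x0) - (- y0)" by (simp add: a_def algebra_simps)
      have "b * norm (x - x0) > b * R" using x b by (simp add: dist_norm norm_minus_commute)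
      moreover have "b * R \<ge> 2" using h by (simp add: b_def field_simps)
      moreover have "norm (b *\<^sub>R (x - x0)) - norm (- y0) \<le> norm (a + b *\<^sub>R x)"
        unfolding eq by (rule norm_triangle_ineq2)
      moreover have "norm (b *\<^sub>R (x - x0)) = b * norm (x - x0)" using b by simp
      moreover have "norm (- y0) \<le> 1" using y0(1) by simp
      ultimately have "norm (a + b *\<^sub>R x) \<ge> 1" by linarith
      then show "u x = 0" by (simp add: u_def bump_zero)
    qed
    note sob = smooth_sobolev[OF open_interior bd m su supp R(2)]
    show "continuous_on \<Omega> u" by (rule smooth_continuous_on[OF su])
    show "u x = 0" if "x \<notin> \<Omega>" for x
    proof -
      have "cball x0 R \<subseteq> \<Omega>" using R(2) interior_subset by blast
      then have "x \<notin> cball x0 R" using that by blast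
      then show ?thesis using supp unfolding supp_in_def by blast
    qed
    show "in_sobolev ?U m u" by (rule sob)
    have der: "iter_partial js u = (\<lambda>x. b ^ length js * iter_partial js ?\<phi> (a + b *\<^sub>R x))" for js
      unfolding u_def[abs_def] by (rule iter_partial_affine[OF \<phi>(1)])
    have mder: "mi_deriv \<beta> u = (\<lambda>x. b ^ mi_order \<beta> * mi_deriv \<beta> ?\<phi> (a + b *\<^sub>R x))" for \<beta>
      unfolding mi_deriv_eq der length_mi_list ..
    have m\<phi>: "smooth (mi_deriv \<beta> ?\<phi>)" "supp_in (cball 0 1) (mi_deriv \<beta> ?\<phi>)" for \<beta>
      unfolding mi_deriv_eq by (auto intro: smooth_iter_partial supp_in_iter_partial \<phi>)
    show "\<bar>iter_partial is u x0\<bar> = \<bar>iter_partial is ?\<phi> y0\<bar> * h powr (- real (length is))"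
    proof -
      have "iter_partial is u x0 = b ^ length is * iter_partial is ?\<phi> y0" by (simp add: der a_def)
      moreover have "b ^ length is = h powr (- real (length is))"
        using bh[of "real (length is)"] b by (simp add: powr_realpow)
      ultimately show ?thesis by (simp add: abs_mult)
    qed
    show "L2_norm \<Omega> u \<le> C * h powr (?d / 2)"
    proof -
      have "(L2_norm \<Omega> u)\<^sup>2 \<le> b powr (- ?d) * (\<integral>x. (?\<phi> x)\<^sup>2 \<partial>lborel)"
        using L2_norm_affine_le[OF \<phi> b(2), of \<Omega> 1 a] \<Omega> by (simp add: u_def[abs_def] borel_compact)
      then have "sqrt ((L2_norm \<Omega> u)\<^sup>2) \<le> sqrt (b powr (- ?d) * (\<integral>x. (?\<phi> x)\<^sup>2 \<partial>lborel))"
        by (rule real_sqrt_le_mono)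
      also have "\<dots> = h powr (?d / 2) * sqrt (\<integral>x. (?\<phi> x)\<^sup>2 \<partial>lborel)"
        by (simp add: bh real_sqrt_mult powr_half_sqrt[symmetric] powr_powr)
      also have "\<dots> \<le> h powr (?d / 2) * C" by (intro mult_left_mono C) simp
      finally show ?thesis by (simp add: mult.commute)
    qed
    let ?bb = "b powr (2 * m - ?d)"
    have L2: "(L2_norm ?U (weak_deriv ?U \<beta> u))\<^sup>2 \<le> ?bb * A \<beta>" if ord: "mi_order \<beta> \<le> ?k" for \<beta>
    proof -
      have "(L2_norm ?U (weak_deriv ?U \<beta> u))\<^sup>2 \<le> (b ^ mi_order \<beta>)\<^sup>2 * b powr (- ?d) * A \<beta>"
        unfolding sob(2) mder A_def by (rule L2_norm_affine_le[OF m\<phi> b(2)]) simp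
      also have "\<dots> \<le> b powr (2 * m) * b powr (- ?d) * A \<beta>"
      proof (intro mult_right_mono A0)
        have "(b ^ mi_order \<beta>)\<^sup>2 = b powr (2 * real (mi_order \<beta>))"
          using b by (simp add: powr_realpow[symmetric] powr_powr mult.commute flip: power_mult)
        \<comment> \<open>Here \<open>b \<ge> 1\<close> lets the lower orders be absorbed by the top
          one.\<close>
        also have "\<dots> \<le> b powr (2 * m)"
        proof (rule powr_mono)
          have "real (mi_order \<beta>) \<le> real ?k" using ord by simp
          also have "\<dots> \<le> m" using m by simp
          finally show "2 * real (mi_order \<beta>) \<le> 2 * m" by simp
        qed (use b in simp)
        finally show "(b ^ mi_order \<beta>)\<^sup>2 \<le> b powr (2 * m)" .
      qed simp
      also have "b powr (2 * m) * b powr (- ?d) = ?bb" by (simp flip: powr_add)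
      finally show ?thesis .
    qed
    have gag: "enn2real (gagliardo ?U (frac m) (weak_deriv ?U \<beta> u)) \<le> ?bb * G \<beta>"
      if ord: "mi_order \<beta> = ?k" and mZ: "m \<notin> \<int>" for \<beta>
    proof -
      have fin: "gagliardo UNIV (frac m) (mi_deriv \<beta> ?\<phi>) < \<infinity>"
        by (rule gagliardo_smooth_finite[OF _ _ m\<phi>]) (use mZ in \<open>auto simp: frac_gt_0_iff frac_lt_1\<close>)
      have "gagliardo ?U (frac m) (weak_deriv ?U \<beta> u) \<le> gagliardo UNIV (frac m) (mi_deriv \<beta> u)"
        unfolding sob(3) by (rule gagliardo_mono)
      also have "\<dots> = ennreal ((b ^ mi_order \<beta>)\<^sup>2 * b powr (2 * frac m - ?d)) * gagliardo UNIV (frac m) (mi_deriv \<beta> ?\<phi>)"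
        unfolding mder by (rule gagliardo_affine[OF smooth_borel[OF m\<phi>(1)] b(2)])
      also have "(b ^ mi_order \<beta>)\<^sup>2 * b powr (2 * frac m - ?d) = ?bb"
      proof -
        have "(b ^ mi_order \<beta>)\<^sup>2 = b powr (2 * real ?k)"
          using b ord by (simp add: powr_realpow[symmetric] powr_powr mult.commute flip: power_mult)
        then have "(b ^ mi_order \<beta>)\<^sup>2 * b powr (2 * frac m - ?d) = b powr (2 * real ?k + (2 * frac m - ?d))"
          by (simp flip: powr_add)
        also have "2 * real ?k + (2 * frac m - ?d) = 2 * m - ?d" using m by (simp add: frac_def)
        finally show ?thesis .
      qed
      also have "ennreal ?bb * gagliardo UNIV (frac m) (mi_deriv \<beta> ?\<phi>) = ennreal (?bb * G \<beta>)"
        using fin by (simp add: G_def ennreal_mult)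
      finally have "enn2real (gagliardo ?U (frac m) (weak_deriv ?U \<beta> u)) \<le> enn2real (ennreal (?bb * G \<beta>))"
        by (intro enn2real_mono) auto
      then show ?thesis using G0[of \<beta>] by simp
    qed
    have "sobolev_norm ?U m u \<le> sqrt (?bb * C2)"
      unfolding sobolev_norm_def
    proof (rule real_sqrt_le_mono)
      have "(\<Sum>\<beta> | mi_order \<beta> \<le> ?k. (L2_norm ?U (weak_deriv ?U \<beta> u))\<^sup>2) \<le> (\<Sum>\<beta> | mi_order \<beta> \<le> ?k. ?bb * A \<beta>)"
        by (intro sum_mono L2) simp
      moreover have "(if m \<in> \<int> then 0 else (\<Sum>\<beta> | mi_order \<beta> = ?k. enn2real (gagliardo ?U (frac m) (weak_deriv ?U \<beta> u))))
          \<le> (\<Sum>\<beta> | mi_order \<beta> = ?k. ?bb * G \<beta>)"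
        by (auto intro!: sum_mono gag sum_nonneg mult_nonneg_nonneg G0)
      ultimately show "(\<Sum>\<beta> | mi_order \<beta> \<le> ?k. (L2_norm ?U (weak_deriv ?U \<beta> u))\<^sup>2) +
          (if m \<in> \<int> then 0 else (\<Sum>\<beta> | mi_order \<beta> = ?k. enn2real (gagliardo ?U (frac m) (weak_deriv ?U \<beta> u)))) \<le> ?bb * C2"
        by (simp add: C2_def distrib_left sum_distrib_left)
    qed
    also have "\<dots> = b powr (m - ?d / 2) * sqrt C2"
      by (simp add: real_sqrt_mult powr_half_sqrt[symmetric] powr_powr diff_divide_distrib)
    also have "\<dots> \<le> b powr (m - ?d / 2) * C" by (intro mult_left_mono C) simp
    also have "b powr (m - ?d / 2) = h powr (?d / 2 - m)" using bh[of "m - ?d / 2"] by simp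
    finally show "sobolev_norm ?U m u \<le> C * h powr (?d / 2 - m)" by (simp add: mult.commute)
  qed
  then show ?thesis
    using R y0(2) C(3) by (intro exI[of _ "min 1 (R / 2)"] exI[of _ C] exI[of _ "\<bar>iter_partial is ?\<phi> y0\<bar>"]) auto
qed

subsection \<open>Reproducing kernel Hilbert spaces\<close>

lemma (in rkhs) ip_add_right: "u \<in> H \<Longrightarrow> v \<in> H \<Longrightarrow> w \<in> H \<Longrightarrow> ip w (\<lambda>x. u x + v x) = ip w u + ip w v"
  by (simp add: ip_sym[of w] add_mem ip_add)

lemma (in rkhs) ip_scale_right: "u \<in> H \<Longrightarrow> v \<in> H \<Longrightarrow> ip v (\<lambda>x. c * u x) = c * ip v u"
  by (simp add: ip_sym[of v] scale_mem ip_scale)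

lemma (in rkhs) diff_mem: "u \<in> H \<Longrightarrow> v \<in> H \<Longrightarrow> (\<lambda>x. u x - v x) \<in> H"
  using add_mem[of u "\<lambda>x. (-1) * v x"] scale_mem[of v "-1"] by simp

lemma (in rkhs) ip_diff: "u \<in> H \<Longrightarrow> v \<in> H \<Longrightarrow> w \<in> H \<Longrightarrow> ip (\<lambda>x. u x - v x) w = ip u w - ip v w"
  using ip_add[of u "\<lambda>x. (-1) * v x" w] ip_scale[of v w "-1"] scale_mem[of v "-1"] by simp

lemma (in rkhs) ip_diff_right: "u \<in> H \<Longrightarrow> v \<in> H \<Longrightarrow> w \<in> H \<Longrightarrow> ip w (\<lambda>x. u x - v x) = ip w u - ip w v"
  by (simp add: ip_sym[of w] diff_mem ip_diff)

lemma (in rkhs) ip_zero: "w \<in> H \<Longrightarrow> ip (\<lambda>x. 0) w = 0"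
  using ip_scale[of w w 0] by simp

lemma (in rkhs) ip_nonneg: "u \<in> H \<Longrightarrow> ip u u \<ge> 0"
  using ip_pos[of u] ip_zero[OF zero_mem] by (cases "u = (\<lambda>x. 0)") auto

lemma (in rkhs) ip_norm_sq: "u \<in> H \<Longrightarrow> (ip_norm ip u)\<^sup>2 = ip u u"
  by (simp add: ip_norm_def ip_nonneg)

lemma (in rkhs) ip_norm_nonneg: "u \<in> H \<Longrightarrow> ip_norm ip u \<ge> 0"
  by (simp add: ip_norm_def ip_nonneg)

lemma (in rkhs) ip_norm_scale: "u \<in> H \<Longrightarrow> ip_norm ip (\<lambda>x. c * u x) = \<bar>c\<bar> * ip_norm ip u"
  by (simp add: ip_norm_def ip_scale ip_scale_right scale_mem real_sqrt_mult flip: mult.assoc)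

lemma (in rkhs) sum_mem: "(\<And>i. i \<in> I \<Longrightarrow> u i \<in> H) \<Longrightarrow> (\<lambda>x. \<Sum>i\<in>I. c i * u i x) \<in> H"
proof (induction I rule: infinite_finite_induct)
  case (insert i I)
  then have "(\<lambda>x. c i * u i x) \<in> H" "(\<lambda>x. \<Sum>i\<in>I. c i * u i x) \<in> H" by (auto intro: scale_mem)
  from add_mem[OF this] show ?case using insert by simp
qed (auto intro: zero_mem)

lemma (in rkhs) ip_sum:
  "(\<And>i. i \<in> I \<Longrightarrow> u i \<in> H) \<Longrightarrow> w \<in> H \<Longrightarrow> ip (\<lambda>x. \<Sum>i\<in>I. c i * u i x) w = (\<Sum>i\<in>I. c i * ip (u i) w)"
  by (induction I rule: infinite_finite_induct) (auto simp: ip_zero ip_add ip_scale scale_mem sum_mem)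

lemma (in rkhs) ip_cauchy_schwarz:
  assumes u: "u \<in> H" and v: "v \<in> H"
  shows "\<bar>ip u v\<bar> \<le> ip_norm ip u * ip_norm ip v"
proof -
  let ?w = "\<lambda>x. ip v v * u x - ip u v * v x"
  have m: "(\<lambda>x. ip v v * u x) \<in> H" "(\<lambda>x. ip u v * v x) \<in> H" "?w \<in> H"
    using u v by (auto intro: scale_mem diff_mem)
  have "0 \<le> ip ?w ?w" by (rule ip_nonneg[OF m(3)])
  also have "\<dots> = ip v v * (ip v v * ip u u - (ip u v)\<^sup>2)"
    unfolding ip_diff[OF m] ip_scale[OF u m(3)] ip_scale[OF v m(3)] ip_diff_right[OF m(1,2) u] ip_diff_right[OF m(1,2) v]
      ip_scale_right[OF u u] ip_scale_right[OF v u] ip_scale_right[OF u v] ip_scale_right[OF v v] ip_sym[OF v u]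
    by (simp add: power2_eq_square algebra_simps)
  finally have *: "0 \<le> ip v v * (ip v v * ip u u - (ip u v)\<^sup>2)" .
  have "(ip u v)\<^sup>2 \<le> ip u u * ip v v"
  proof (cases "v = (\<lambda>x. 0)")
    case True then show ?thesis using ip_sym[OF u zero_mem] ip_zero[OF u] ip_zero[OF zero_mem] by simp
  next
    case False
    then have "ip v v > 0" by (rule ip_pos[OF v])
    then have "0 \<le> ip v v * ip u u - (ip u v)\<^sup>2" using * by (simp add: zero_le_mult_iff)
    then show ?thesis by (simp add: mult.commute)
  qed
  then have "sqrt ((ip u v)\<^sup>2) \<le> sqrt (ip u u * ip v v)" by (rule real_sqrt_le_mono)
  then show ?thesis by (simp add: ip_norm_def real_sqrt_mult)
qed

text \<open>The representer minimises \<open>\<parallel>v\<parallel>\<^sup>2 - 2 L v\<close>; minimising sequences are Cauchy by the parallelogram law.\<close>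

lemma (in rkhs) riesz:
  assumes lin: "\<And>u v p q. u \<in> H \<Longrightarrow> v \<in> H \<Longrightarrow> L (\<lambda>x. p * u x + q * v x) = p * L u + q * L v"
    and bound: "\<And>u. u \<in> H \<Longrightarrow> \<bar>L u\<bar> \<le> B * ip_norm ip u"
  obtains l where "l \<in> H" "\<And>v. v \<in> H \<Longrightarrow> L v = ip v l"
proof -
  define J where "J v = ip v v - 2 * L v" for v
  have lin1: "L (\<lambda>x. u x + t * v x) = L u + t * L v" if "u \<in> H" "v \<in> H" for u v t
    using lin[OF that, of 1 t] by simp
  have Jlow: "J v \<ge> - B\<^sup>2" if "v \<in> H" for v
  proof -
    have "L v \<le> B * ip_norm ip v" using bound[OF that] by linarith
    moreover have "0 \<le> (ip_norm ip v - B)\<^sup>2" by simp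
    ultimately show ?thesis using ip_norm_sq[OF that] by (simp add: J_def power2_eq_square algebra_simps)
  qed
  define j where "j = Inf (J ` H)"
  have bdd: "bdd_below (J ` H)" using Jlow by (auto simp: bdd_below_def)
  have jle: "j \<le> J v" if "v \<in> H" for v unfolding j_def using bdd that by (intro cInf_lower) auto
  have "\<exists>v\<in>H. J v < j + 1 / real (Suc n)" for n
  proof -
    have "Inf (J ` H) < j + 1 / real (Suc n)" by (simp add: j_def)
    then show ?thesis using cInf_lessD[of "J ` H"] zero_mem by auto
  qed
  then obtain s where s: "\<And>n. s n \<in> H" "\<And>n. J (s n) < j + 1 / real (Suc n)" by metis
  \<comment> \<open>The midpoint of \<open>u\<close> and \<open>v\<close> lies in \<open>H\<close>,
    so the value of \<open>J\<close> there is at least the infimum \<open>j\<close>.\<close>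
  have par: "ip (\<lambda>x. u x - v x) (\<lambda>x. u x - v x) \<le> 2 * (J u - j) + 2 * (J v - j)" if u: "u \<in> H" and v: "v \<in> H" for u v
  proof -
    let ?c = "\<lambda>x. (1 / 2) * u x + (1 / 2) * v x"
    have mem: "(\<lambda>x. (1 / 2) * u x) \<in> H" "(\<lambda>x. (1 / 2) * v x) \<in> H" "?c \<in> H"
      by (rule scale_mem[OF u] scale_mem[OF v] add_mem[OF scale_mem[OF u] scale_mem[OF v]])+
    have "ip ?c ?c = (1 / 4) * (ip u u + 2 * ip u v + ip v v)"
      using u v mem by (simp only: ip_add ip_add_right ip_scale ip_scale_right ip_sym[of v u]) (simp add: algebra_simps)
    moreover have "L ?c = (1 / 2) * L u + (1 / 2) * L v" by (rule lin[OF u v])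
    moreover have "ip (\<lambda>x. u x - v x) (\<lambda>x. u x - v x) = ip u u - 2 * ip u v + ip v v"
      using u v by (simp add: ip_diff ip_diff_right diff_mem ip_sym[of v u])
    ultimately show ?thesis using jle[OF mem(3)] by (simp add: J_def field_simps)
  qed
  have "\<exists>l\<in>H. (\<lambda>n. ip_norm ip (\<lambda>x. s n x - l x)) \<longlonglongrightarrow> 0"
  proof (rule complete[OF s(1)], intro allI impI)
    fix e :: real assume e: "e > 0"
    then obtain N where N: "1 / real (Suc N) < e\<^sup>2 / 4" using nat_approx_posE[of "e\<^sup>2 / 4"] by auto
    have "ip_norm ip (\<lambda>x. s p x - s q x) < e" if "p \<ge> N" "q \<ge> N" for p q
    proof -
      have "1 / real (Suc p) \<le> 1 / real (Suc N)" "1 / real (Suc q) \<le> 1 / real (Suc N)"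
        using that by (auto intro!: divide_left_mono)
      then have "ip (\<lambda>x. s p x - s q x) (\<lambda>x. s p x - s q x) < e\<^sup>2"
      proof -
        have gen: "D < E" if "D \<le> 2 * (P - j) + 2 * (Q - j)" "P < j + a" "Q < j + b" "a \<le> c" "b \<le> c" "c < E / 4"
          for D E P Q a b c :: real using that by (simp add: field_simps)
        show ?thesis
          by (rule gen[OF par[OF s(1)[of p] s(1)[of q]] s(2)[of p] s(2)[of q] _ _ N]) fact+
      qed
      then have "sqrt (ip (\<lambda>x. s p x - s q x) (\<lambda>x. s p x - s q x)) < sqrt (e\<^sup>2)" by (rule real_sqrt_less_mono)
      then show ?thesis using e by (simp add: ip_norm_def)
    qed
    then show "\<exists>N. \<forall>p\<ge>N. \<forall>q\<ge>N. ip_norm ip (\<lambda>x. s p x - s q x) < e" by blast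
  qed
  then obtain l where l: "l \<in> H" "(\<lambda>n. ip_norm ip (\<lambda>x. s n x - l x)) \<longlonglongrightarrow> 0" by blast
  have "L v = ip v l" if v: "v \<in> H" for v
  proof -
    define N where "N = ip v v"
    have N: "N \<ge> 0" unfolding N_def by (rule ip_nonneg[OF v])
    \<comment> \<open>Approximate stationarity: \<open>J\<close> cannot drop below its infimum along
      the direction \<open>v\<close>, so the defect of the linear equation is of the order of the
      root of the remaining excess.\<close>
    have near: "\<bar>ip (s n) v - L v\<bar> \<le> sqrt (1 / real (Suc n)) * ((1 + N) / 2)" for n
    proof -
      define \<epsilon> where "\<epsilon> = 1 / real (Suc n)"
      have \<epsilon>: "\<epsilon> > 0" by (simp add: \<epsilon>_def)
      have q: "- \<epsilon> \<le> 2 * t * (ip (s n) v - L v) + t\<^sup>2 * N" for t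
      proof -
        let ?w = "\<lambda>x. s n x + t * v x"
        have mem: "(\<lambda>x. t * v x) \<in> H" "?w \<in> H" using v s(1) by (auto intro: add_mem scale_mem)
        have "ip ?w ?w = ip (s n) (s n) + 2 * t * ip (s n) v + t\<^sup>2 * N"
          using s(1)[of n] v mem by (simp add: ip_add ip_add_right ip_scale ip_scale_right N_def ip_sym[of v "s n"] power2_eq_square algebra_simps)
        then have "J ?w = J (s n) + 2 * t * (ip (s n) v - L v) + t\<^sup>2 * N"
          using lin1[OF s(1)[of n] v] by (simp add: J_def algebra_simps)
        then show ?thesis using jle[OF mem(2)] s(2)[of n] by (simp add: \<epsilon>_def)
      qed
      \<comment> \<open>Steps of size plus or minus sqrt \<epsilon> balance the excess against the
        quadratic term.\<close>
      define r where "r = sqrt \<epsilon>"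
      have r: "r > 0" "r\<^sup>2 = \<epsilon>" using \<epsilon> by (auto simp: r_def)
      have "\<bar>2 * r * (ip (s n) v - L v)\<bar> \<le> r\<^sup>2 * (1 + N)"
        using q[of r] q[of "- r"] r(2) by (simp add: abs_le_iff algebra_simps)
      moreover have "\<bar>2 * r * X\<bar> = r * (2 * \<bar>X\<bar>)" for X using r(1) by (simp add: abs_mult)
      ultimately have "r * (2 * \<bar>ip (s n) v - L v\<bar>) \<le> r * (r * (1 + N))"
        by (simp only: power2_eq_square mult.assoc)
      then have "2 * \<bar>ip (s n) v - L v\<bar> \<le> r * (1 + N)" using r(1) by simp
      then show ?thesis by (simp add: r_def \<epsilon>_def)
    qed
    have "(\<lambda>n. sqrt (1 / real (Suc n)) * ((1 + N) / 2)) \<longlonglongrightarrow> sqrt 0 * ((1 + N) / 2)"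
      by (rule tendsto_mult[OF tendsto_real_sqrt[OF LIMSEQ_Suc[OF lim_inverse_n']] tendsto_const])
    then have "(\<lambda>n. sqrt (1 / real (Suc n)) * ((1 + N) / 2)) \<longlonglongrightarrow> 0" by simp
    then have "(\<lambda>n. ip (s n) v - L v) \<longlonglongrightarrow> 0"
      by (rule Lim_null_comparison[rotated]) (simp only: real_norm_def near eventually_True)
    then have 1: "(\<lambda>n. ip (s n) v) \<longlonglongrightarrow> L v" by (simp add: LIM_zero_iff)
    have "(\<lambda>n. ip_norm ip (\<lambda>x. s n x - l x) * ip_norm ip v) \<longlonglongrightarrow> 0 * ip_norm ip v"
      by (intro tendsto_mult l tendsto_const)
    then have lim: "(\<lambda>n. ip_norm ip (\<lambda>x. s n x - l x) * ip_norm ip v) \<longlonglongrightarrow> 0" by simp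
    have nb: "norm (ip (s n) v - ip l v) \<le> ip_norm ip (\<lambda>x. s n x - l x) * ip_norm ip v" for n
      using ip_cauchy_schwarz[OF diff_mem[OF s(1)[of n] l(1)] v] ip_diff[OF s(1)[of n] l(1) v] by simp
    have "(\<lambda>n. ip (s n) v - ip l v) \<longlonglongrightarrow> 0"
      by (rule Lim_null_comparison[OF _ lim]) (simp only: nb eventually_True)
    then have "(\<lambda>n. ip (s n) v) \<longlonglongrightarrow> ip l v" by (simp add: LIM_zero_iff)
    then show ?thesis using 1 LIMSEQ_unique ip_sym[OF l(1) v] by metis
  qed
  then show thesis using l(1) that by blast
qed

section \<open>Kernel sections and positive semidefiniteness\<close>

definition kernel_section :: "'a set \<Rightarrow> ('a \<Rightarrow> 'a \<Rightarrow> real) \<Rightarrow> 'a \<Rightarrow> 'a \<Rightarrow> real" where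
  "kernel_section \<Omega> K y = (\<lambda>x. if x \<in> \<Omega> then K x y else 0)"

lemma (in rkhs) kernel_section: "y \<in> \<Omega> \<Longrightarrow> kernel_section \<Omega> K y \<in> H"
  "u \<in> H \<Longrightarrow> y \<in> \<Omega> \<Longrightarrow> ip u (kernel_section \<Omega> K y) = u y"
  using kernel_mem reproducing by (auto simp: kernel_section_def)

lemma (in rkhs) ip_kernel_section:
  assumes "x \<in> \<Omega>" "y \<in> \<Omega>" shows "ip (kernel_section \<Omega> K x) (kernel_section \<Omega> K y) = K y x"
  using kernel_section(2)[OF kernel_section(1)[OF assms(1)] assms(2)] assms(2) by (simp add: kernel_section_def)

lemma (in rkhs) kernel_sym: "x \<in> \<Omega> \<Longrightarrow> y \<in> \<Omega> \<Longrightarrow> K x y = K y x"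
  using ip_kernel_section[of x y] ip_kernel_section[of y x] ip_sym[of "kernel_section \<Omega> K x" "kernel_section \<Omega> K y"]
  by (simp add: kernel_section)

text \<open>By the reproducing property the form is the squared norm of a combination of kernel
  sections.\<close>

lemma (in rkhs) kernel_quadratic_form:
  assumes x: "\<And>i. i < n \<Longrightarrow> x i \<in> \<Omega>"
  shows "(\<Sum>i<n. \<Sum>j<n. c i * c j * K (x i) (x j)) \<ge> 0"
proof -
  let ?u = "\<lambda>z. \<Sum>i<n. c i * kernel_section \<Omega> K (x i) z"
  have mem: "?u \<in> H" using x by (intro sum_mem) (auto intro: kernel_section)
  have "ip ?u ?u = (\<Sum>i<n. c i * ip (kernel_section \<Omega> K (x i)) ?u)"
    using x mem by (intro ip_sum) (auto intro: kernel_section)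
  also have "\<dots> = (\<Sum>i<n. c i * ?u (x i))"
    using x mem by (intro sum.cong refl) (auto simp: kernel_section ip_sym[of "kernel_section \<Omega> K (x _)" ?u])
  also have "\<dots> = (\<Sum>i<n. \<Sum>j<n. c i * c j * K (x i) (x j))"
    using x by (intro sum.cong refl) (auto simp: sum_distrib_left kernel_section_def mult.assoc)
  finally show ?thesis using ip_nonneg[OF mem] by simp
qed

subsection \<open>Kernel ridge regression in closed form\<close>

text \<open>Completing the square: the linear system makes the residuals proportional to the
  coefficients, so the cross terms of fit and penalty cancel, and the objective exceeds its value at
  the candidate by a positive definite form. Hence the minimiser is unique and the choice behind
  \<open>arg_min_on\<close> is determined.\<close>

lemma (in rkhs) krr_closed_form:
  assumes x: "\<And>i. i < n \<Longrightarrow> x i \<in> \<Omega>" and lam: "lam > 0"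
    and c: "\<And>i. i < n \<Longrightarrow> (\<Sum>j<n. K (x i) (x j) * c j) + lam * real n * c i = y i"
  shows "krr H ip n lam x y = (\<lambda>z. \<Sum>j<n. c j * kernel_section \<Omega> K (x j) z)"
proof -
  let ?f = "\<lambda>z. \<Sum>j<n. c j * kernel_section \<Omega> K (x j) z"
  let ?obj = "\<lambda>v. 1 / real n * (\<Sum>i<n. (y i - v (x i))\<^sup>2) + lam * (ip_norm ip v)\<^sup>2"
  have mem: "?f \<in> H" using x by (intro sum_mem) (auto intro: kernel_section)
  have fx: "y i - ?f (x i) = lam * real n * c i" if "i < n" for i
    using c[OF that] x[OF that] by (simp add: kernel_section_def mult.commute)
  have key: "?obj v = ?obj ?f + (1 / real n * (\<Sum>i<n. (v (x i) - ?f (x i))\<^sup>2) + lam * ip (\<lambda>z. v z - ?f z) (\<lambda>z. v z - ?f z))"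
    if v: "v \<in> H" for v
  proof -
    define w where "w z = v z - ?f z" for z
    have w: "w \<in> H" unfolding w_def by (rule diff_mem[OF v mem])
    have vw: "v = (\<lambda>z. ?f z + w z)" by (simp add: w_def)
    have weq: "w = (\<lambda>z. v z - ?f z)" by (simp add: w_def fun_eq_iff)
    have "ip ?f w = (\<Sum>j<n. c j * ip (kernel_section \<Omega> K (x j)) w)"
      using x w by (intro ip_sum) (auto intro: kernel_section)
    also have "\<dots> = (\<Sum>j<n. c j * w (x j))"
      using x w by (intro sum.cong refl) (auto simp: kernel_section ip_sym[of "kernel_section \<Omega> K (x _)" w])
    finally have fw: "ip ?f w = (\<Sum>j<n. c j * w (x j))" .
    have "ip v v = ip ?f ?f + 2 * ip ?f w + ip w w"
      unfolding vw using mem w by (simp add: ip_add ip_add_right add_mem ip_sym[of w ?f])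
    then have n2: "lam * (ip_norm ip v)\<^sup>2 = lam * (ip_norm ip ?f)\<^sup>2 + 2 * lam * (\<Sum>j<n. c j * w (x j)) + lam * ip w w"
      using ip_norm_sq[OF v] ip_norm_sq[OF mem] fw by (simp add: algebra_simps)
    have "(y i - v (x i))\<^sup>2 = (y i - ?f (x i))\<^sup>2 - 2 * (lam * real n * c i * w (x i)) + (w (x i))\<^sup>2" if "i < n" for i
      using fx[OF that] by (simp add: w_def power2_eq_square algebra_simps)
    then have "(\<Sum>i<n. (y i - v (x i))\<^sup>2) = (\<Sum>i<n. (y i - ?f (x i))\<^sup>2 - 2 * (lam * real n * c i * w (x i)) + (w (x i))\<^sup>2)"
      by (intro sum.cong) auto
    also have "\<dots> = (\<Sum>i<n. (y i - ?f (x i))\<^sup>2) - 2 * lam * real n * (\<Sum>i<n. c i * w (x i)) + (\<Sum>i<n. (w (x i))\<^sup>2)"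
      by (simp add: sum.distrib sum_subtractf sum_distrib_left mult_ac)
    finally have s2: "(\<Sum>i<n. (y i - v (x i))\<^sup>2) = (\<Sum>i<n. (y i - ?f (x i))\<^sup>2) - 2 * lam * real n * (\<Sum>i<n. c i * w (x i)) + (\<Sum>i<n. (w (x i))\<^sup>2)" .
    \<comment> \<open>For \<open>n = 0\<close> the factor \<open>1 / real n\<close> has the default
      value 0 and only the penalty remains.\<close>
    show ?thesis
    proof (cases "n = 0")
      case True
      then show ?thesis using n2 by (simp add: weq)
    next
      case False
      then have "1 / real n * (\<Sum>i<n. (y i - v (x i))\<^sup>2) = 1 / real n * (\<Sum>i<n. (y i - ?f (x i))\<^sup>2)
          - 2 * lam * (\<Sum>i<n. c i * w (x i)) + 1 / real n * (\<Sum>i<n. (w (x i))\<^sup>2)"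
        unfolding s2 by (simp add: field_simps)
      then show ?thesis using n2 by (simp add: weq)
    qed
  qed
  have ge: "?obj ?f \<le> ?obj v" if "v \<in> H" for v
  proof -
    have "0 \<le> 1 / real n * (\<Sum>i<n. (v (x i) - ?f (x i))\<^sup>2)" by (intro mult_nonneg_nonneg sum_nonneg) auto
    moreover have "0 \<le> lam * ip (\<lambda>z. v z - ?f z) (\<lambda>z. v z - ?f z)"
      using lam ip_nonneg[OF diff_mem[OF that mem]] by simp
    ultimately show ?thesis using key[OF that] by linarith
  qed
  have uniq: "v = ?f" if v: "v \<in> H" and le: "?obj v \<le> ?obj ?f" for v
  proof (rule ccontr)
    assume "v \<noteq> ?f"
    then have "(\<lambda>z. v z - ?f z) \<noteq> (\<lambda>z. 0)" by (auto simp: fun_eq_iff)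
    then have "0 < lam * ip (\<lambda>z. v z - ?f z) (\<lambda>z. v z - ?f z)"
      using ip_pos[OF diff_mem[OF v mem]] lam by simp
    moreover have "0 \<le> 1 / real n * (\<Sum>i<n. (v (x i) - ?f (x i))\<^sup>2)" by (intro mult_nonneg_nonneg sum_nonneg) auto
    ultimately show False using key[OF v] le by linarith
  qed
  have "is_arg_min ?obj (\<lambda>v. v \<in> H) ?f"
    using mem ge by (auto simp: is_arg_min_def not_less)
  then have "is_arg_min ?obj (\<lambda>v. v \<in> H) (krr H ip n lam x y)"
    unfolding krr_def arg_min_on_def arg_min_def by (rule someI[where P = "is_arg_min ?obj (\<lambda>v. v \<in> H)"])
  then show ?thesis
    using uniq[of "krr H ip n lam x y"] mem by (auto simp: is_arg_min_def not_less)
qed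

section \<open>The regularised Gram matrix\<close>

definition regularized_gram :: "('a \<Rightarrow> 'a \<Rightarrow> real) \<Rightarrow> nat \<Rightarrow> real \<Rightarrow> (nat \<Rightarrow> 'a) \<Rightarrow> real mat" where
  "regularized_gram K n lam x = Matrix.mat n n (\<lambda>(i, j). K (x i) (x j)) + (lam * real n) \<cdot>\<^sub>m 1\<^sub>m n"

definition krr_solve :: "('a \<Rightarrow> 'a \<Rightarrow> real) \<Rightarrow> nat \<Rightarrow> real \<Rightarrow> (nat \<Rightarrow> 'a) \<Rightarrow> (nat \<Rightarrow> real) \<Rightarrow> nat \<Rightarrow> real" where
  "krr_solve K n lam x b i = vec_index (the (mat_inverse (regularized_gram K n lam x)) *\<^sub>v Matrix.vec n b) i"

lemma regularized_gram_carrier: "regularized_gram K n lam x \<in> carrier_mat n n"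
  by (simp add: regularized_gram_def)

lemma regularized_gram_mult:
  assumes "i < n" "v \<in> carrier_vec n"
  shows "vec_index (regularized_gram K n lam x *\<^sub>v v) i = (\<Sum>j<n. K (x i) (x j) * vec_index v j) + lam * real n * vec_index v i"
proof -
  have "vec_index (regularized_gram K n lam x *\<^sub>v v) i = (\<Sum>j<n. (K (x i) (x j) + (if i = j then lam * real n else 0)) * vec_index v j)"
    using assms by (auto simp: regularized_gram_def scalar_prod_def lessThan_atLeast0 intro!: sum.cong)
  also have "\<dots> = (\<Sum>j<n. K (x i) (x j) * vec_index v j) + (\<Sum>j<n. (if i = j then lam * real n else 0) * vec_index v j)"
    by (simp add: sum.distrib distrib_right)
  also have "(\<Sum>j<n. (if i = j then lam * real n else 0) * vec_index v j) = (\<Sum>j<n. if i = j then lam * real n * vec_index v j else 0)"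
    by (intro sum.cong) auto
  finally show ?thesis using assms by simp
qed

text \<open>A nonzero vector c in the null space would satisfy c'Kc + lam n |c|^2 = 0, although the
  first term is nonnegative and the second positive.\<close>

lemma (in rkhs) det_regularized_gram:
  assumes x: "\<And>i. i < n \<Longrightarrow> x i \<in> \<Omega>" and lam: "lam > 0"
  shows "Determinant.det (regularized_gram K n lam x) \<noteq> 0"
proof
  let ?A = "regularized_gram K n lam x"
  assume "Determinant.det ?A = 0"
  then obtain v where v: "v \<in> carrier_vec n" "v \<noteq> 0\<^sub>v n" "?A *\<^sub>v v = 0\<^sub>v n"
    using det_0_iff_vec_prod_zero_field[OF regularized_gram_carrier] by blast
  define c where "c i = vec_index v i" for i
  have row: "(\<Sum>j<n. K (x i) (x j) * c j) + lam * real n * c i = 0" if "i < n" for i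
    using regularized_gram_mult[OF that v(1), of K lam x] v(3) that by (simp add: c_def)
  have "(\<Sum>i<n. c i * ((\<Sum>j<n. K (x i) (x j) * c j) + lam * real n * c i)) = 0"
    using row by (intro sum.neutral) auto
  moreover have "(\<Sum>i<n. c i * ((\<Sum>j<n. K (x i) (x j) * c j) + lam * real n * c i)) =
      (\<Sum>i<n. \<Sum>j<n. c i * c j * K (x i) (x j)) + lam * real n * (\<Sum>i<n. (c i)\<^sup>2)"
    by (simp add: distrib_left sum.distrib sum_distrib_left power2_eq_square mult_ac)
  ultimately have "lam * real n * (\<Sum>i<n. (c i)\<^sup>2) \<le> 0" using kernel_quadratic_form[of n x c, OF x] by simp
  obtain i where i: "i < n" "vec_index v i \<noteq> 0" using v(1,2) by (metis carrier_vecD eq_vecI index_zero_vec)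
  have "(\<Sum>i<n. (c i)\<^sup>2) > 0"
    using i by (intro sum_pos2[of _ i]) (auto simp: c_def)
  moreover have "lam * real n > 0" using lam i by simp
  ultimately show False using \<open>lam * real n * (\<Sum>i<n. (c i)\<^sup>2) \<le> 0\<close> by (simp add: not_le mult_pos_pos flip: not_less)
qed

lemma (in rkhs) mat_inverse_regularized_gram:
  assumes x: "\<And>i. i < n \<Longrightarrow> x i \<in> \<Omega>" and lam: "lam > 0"
  obtains B where "mat_inverse (regularized_gram K n lam x) = Some B" "B \<in> carrier_mat n n"
    "regularized_gram K n lam x * B = 1\<^sub>m n"
proof -
  let ?A = "regularized_gram K n lam x"
  have det: "Determinant.det ?A \<noteq> 0" using det_regularized_gram[of n x lam] x lam by blast
  have unit: "?A \<in> Units (ring_mat TYPE(real) n ())"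
    by (rule det_non_zero_imp_unit[OF regularized_gram_carrier det])
  obtain B where B: "mat_inverse ?A = Some B"
  proof (cases "mat_inverse ?A")
    case None
    from mat_inverse(1)[OF regularized_gram_carrier None, where b = "()"] unit show ?thesis by blast
  qed
  from mat_inverse(2)[OF regularized_gram_carrier this] show thesis using B that by blast
qed

lemma (in rkhs) krr_solve:
  assumes x: "\<And>i. i < n \<Longrightarrow> x i \<in> \<Omega>" and lam: "lam > 0" and i: "i < n"
  shows "(\<Sum>j<n. K (x i) (x j) * krr_solve K n lam x b j) + lam * real n * krr_solve K n lam x b i = b i"
proof -
  let ?A = "regularized_gram K n lam x"
  obtain B where B: "mat_inverse ?A = Some B" "B \<in> carrier_mat n n" "?A * B = 1\<^sub>m n"
    by (rule mat_inverse_regularized_gram[OF x lam])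
  let ?w = "B *\<^sub>v Matrix.vec n b"
  have w: "?w \<in> carrier_vec n" using B(2) by simp
  have "?A *\<^sub>v ?w = (?A * B) *\<^sub>v Matrix.vec n b"
    using B(2) regularized_gram_carrier by (intro assoc_mult_mat_vec[symmetric]) auto
  then have "?A *\<^sub>v ?w = Matrix.vec n b" using B(3) by simp
  then show ?thesis
    using regularized_gram_mult[OF i w, of K lam x] i B(1) by (simp add: krr_solve_def)
qed

text \<open>Symmetry of the inverse, derived from symmetry of the kernel by inserting each of the
  two linear systems into the other sum.\<close>

lemma (in rkhs) krr_solve_adjoint:
  assumes x: "\<And>i. i < n \<Longrightarrow> x i \<in> \<Omega>" and lam: "lam > 0"
  shows "(\<Sum>j<n. krr_solve K n lam x b j * k j) = (\<Sum>i<n. krr_solve K n lam x k i * b i)"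
proof -
  let ?c = "krr_solve K n lam x b" and ?w = "krr_solve K n lam x k"
  have e: "(\<Sum>j<n. K (x i) (x j) * krr_solve K n lam x g j) + lam * real n * krr_solve K n lam x g i = g i" if "i < n" for g i
    by (rule krr_solve[OF x lam that])
  have "(\<Sum>j<n. ?c j * k j) = (\<Sum>j<n. ?c j * ((\<Sum>i<n. K (x j) (x i) * ?w i) + lam * real n * ?w j))"
    by (intro sum.cong refl) (simp add: e)
  also have "\<dots> = (\<Sum>j<n. \<Sum>i<n. ?c j * K (x j) (x i) * ?w i) + lam * real n * (\<Sum>j<n. ?c j * ?w j)"
    by (simp add: distrib_left sum.distrib sum_distrib_left mult_ac)
  also have "(\<Sum>j<n. \<Sum>i<n. ?c j * K (x j) (x i) * ?w i) = (\<Sum>i<n. \<Sum>j<n. ?c j * K (x j) (x i) * ?w i)"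
    by (rule sum.swap)
  also have "\<dots> = (\<Sum>i<n. \<Sum>j<n. ?w i * (K (x i) (x j) * ?c j))"
    using x by (intro sum.cong refl) (auto simp: kernel_sym[of "x _" "x _"] mult_ac)
  also have "\<dots> + lam * real n * (\<Sum>j<n. ?c j * ?w j) = (\<Sum>i<n. ?w i * ((\<Sum>j<n. K (x i) (x j) * ?c j) + lam * real n * ?c i))"
    by (simp add: distrib_left sum.distrib sum_distrib_left mult_ac)
  also have "\<dots> = (\<Sum>i<n. ?w i * b i)"
    by (intro sum.cong refl) (simp add: e)
  finally show ?thesis .
qed

lemma (in rkhs) krr_eq:
  assumes x: "\<And>i. i < n \<Longrightarrow> x i \<in> \<Omega>" and lam: "lam > 0"
  shows "krr H ip n lam x y = (\<lambda>z. \<Sum>j<n. krr_solve K n lam x y j * kernel_section \<Omega> K (x j) z)"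
  by (rule krr_closed_form[OF x lam krr_solve[OF x lam]])

text \<open>By symmetry of the inverse, k'A^-2 k is the squared length of A^-1 k. This identifies
  the variance formula with a sum of squared weights.\<close>

lemma (in rkhs) quadratic_form_inverse_square:
  assumes x: "\<And>i. i < n \<Longrightarrow> x i \<in> \<Omega>" and lam: "lam > 0"
  shows "scalar_prod (Matrix.vec n k) ((the (mat_inverse (regularized_gram K n lam x)) * the (mat_inverse (regularized_gram K n lam x))) *\<^sub>v Matrix.vec n k)
    = (\<Sum>i<n. (krr_solve K n lam x k i)\<^sup>2)"
proof -
  let ?A = "regularized_gram K n lam x"
  obtain B where B: "mat_inverse ?A = Some B" "B \<in> carrier_mat n n" "?A * B = 1\<^sub>m n"
    by (rule mat_inverse_regularized_gram[OF x lam])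
  let ?w = "krr_solve K n lam x k"
  have w: "B *\<^sub>v Matrix.vec n k = Matrix.vec n ?w"
    using B by (intro eq_vecI) (auto simp: krr_solve_def)
  have z: "B *\<^sub>v Matrix.vec n ?w = Matrix.vec n (krr_solve K n lam x ?w)"
    using B by (intro eq_vecI) (auto simp: krr_solve_def[of K n lam x ?w])
  have "(B * B) *\<^sub>v Matrix.vec n k = B *\<^sub>v (B *\<^sub>v Matrix.vec n k)"
    using B(2) by (intro assoc_mult_mat_vec) auto
  then have "scalar_prod (Matrix.vec n k) ((B * B) *\<^sub>v Matrix.vec n k) = (\<Sum>j<n. krr_solve K n lam x ?w j * k j)"
    by (simp add: w z scalar_prod_def lessThan_atLeast0 mult.commute)
  also have "\<dots> = (\<Sum>i<n. ?w i * ?w i)" by (rule krr_solve_adjoint[OF x lam])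
  finally show ?thesis using B(1) by (simp add: power2_eq_square)
qed

lemma (in rkhs) krr_var_eq:
  assumes x: "\<And>i. i < n \<Longrightarrow> x i \<in> \<Omega>" and lam: "lam > 0"
  shows "(let k = Matrix.vec n k0; A = Matrix.mat n n (\<lambda>(i, j). K (x i) (x j)) + (lam * real n) \<cdot>\<^sub>m 1\<^sub>m n;
      B = the (mat_inverse A) in s * scalar_prod k ((B * B) *\<^sub>v k)) = s * (\<Sum>i<n. (krr_solve K n lam x k0 i)\<^sup>2)"
  using quadratic_form_inverse_square[OF x lam, where k = k0] by (simp add: Let_def regularized_gram_def)

subsection \<open>The representer of the regularised functional\<close>

text \<open>The reproducing property evaluates \<open>l\<close> at the design points, and symmetry
  moves the inverse from the data to these values. The resulting weights do not depend on the
  data.\<close>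

lemma (in rkhs) krr_functional:
  assumes x: "\<And>i. i < n \<Longrightarrow> x i \<in> \<Omega>" and lam: "lam > 0" and l: "l \<in> H"
  shows "ip (krr H ip n lam x y) l = (\<Sum>i<n. krr_solve K n lam x (\<lambda>i. l (x i)) i * y i)"
proof -
  have "ip (krr H ip n lam x y) l = (\<Sum>j<n. krr_solve K n lam x y j * ip (kernel_section \<Omega> K (x j)) l)"
  proof -
    have e: "krr H ip n lam x y = (\<lambda>z. \<Sum>j<n. krr_solve K n lam x y j * kernel_section \<Omega> K (x j) z)"
      by (rule krr_eq[OF x lam])
    show ?thesis unfolding e using x l by (intro ip_sum) (auto intro: kernel_section)
  qed
  also have "\<dots> = (\<Sum>j<n. krr_solve K n lam x y j * l (x j))"
    using x l by (intro sum.cong refl) (simp add: ip_sym[OF kernel_section(1) l] kernel_section(2))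
  also have "\<dots> = (\<Sum>i<n. krr_solve K n lam x (\<lambda>i. l (x i)) i * y i)"
    by (rule krr_solve_adjoint[OF x lam])
  finally show ?thesis .
qed

lemma (in rkhs) krr_mem:
  assumes "\<And>i. i < n \<Longrightarrow> x i \<in> \<Omega>" "lam > 0"
  shows "krr H ip n lam x y \<in> H"
proof -
  have e: "krr H ip n lam x y = (\<lambda>z. \<Sum>j<n. krr_solve K n lam x y j * kernel_section \<Omega> K (x j) z)"
    by (rule krr_eq[OF assms])
  show ?thesis unfolding e using assms by (intro sum_mem) (auto intro: kernel_section)
qed

text \<open>The solution u of T u + lam u = l, where T v is the mean of v(x_i) K(., x_i) over the
  design; the subtracted sum is T u.\<close>

definition krr_representer ::
  "'a set \<Rightarrow> ('a \<Rightarrow> 'a \<Rightarrow> real) \<Rightarrow> nat \<Rightarrow> real \<Rightarrow> (nat \<Rightarrow> 'a) \<Rightarrow> ('a \<Rightarrow> real) \<Rightarrow> 'a \<Rightarrow> real" where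
  "krr_representer \<Omega> K n lam x l z =
    (1 / lam) * (l z - (\<Sum>i<n. krr_solve K n lam x (\<lambda>i. l (x i)) i * kernel_section \<Omega> K (x i) z))"

text \<open>The second claim is the linear system read at a design point, the third the defining
  equation tested with \<open>v\<close>. The last one expresses the norm through weights, values of
  \<open>l\<close> and kernel values, in preparation for its measurability.\<close>

lemma (in rkhs) krr_representer:
  assumes x: "\<And>i. i < n \<Longrightarrow> x i \<in> \<Omega>" and lam: "lam > 0" and l: "l \<in> H"
  defines "w \<equiv> krr_solve K n lam x (\<lambda>i. l (x i))" and "u \<equiv> krr_representer \<Omega> K n lam x l"
  shows "u \<in> H"
    and "\<And>i. i < n \<Longrightarrow> u (x i) = real n * w i"
    and "\<And>v. v \<in> H \<Longrightarrow> ip v l = (\<Sum>i<n. w i * v (x i)) + lam * ip u v"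
    and "lam\<^sup>2 * (ip_norm ip u)\<^sup>2 = ip l l - 2 * (\<Sum>i<n. w i * l (x i)) + (\<Sum>i<n. \<Sum>j<n. w i * w j * K (x j) (x i))"
proof -
  let ?s = "\<lambda>z. \<Sum>i<n. w i * kernel_section \<Omega> K (x i) z"
  have s: "?s \<in> H" using x by (intro sum_mem) (auto intro: kernel_section)
  have ls: "(\<lambda>z. l z - ?s z) \<in> H" by (rule diff_mem[OF l s])
  have u: "u = (\<lambda>z. (1 / lam) * (l z - ?s z))" by (simp add: u_def krr_representer_def w_def fun_eq_iff)
  show uH: "u \<in> H" unfolding u by (rule scale_mem[OF ls])
  have ips: "ip ?s v = (\<Sum>i<n. w i * v (x i))" if v: "v \<in> H" for v
  proof -
    have "ip ?s v = (\<Sum>i<n. w i * ip (kernel_section \<Omega> K (x i)) v)"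
      using x v by (intro ip_sum) (auto intro: kernel_section)
    also have "\<dots> = (\<Sum>i<n. w i * v (x i))"
      using x v by (intro sum.cong refl) (simp add: ip_sym[OF kernel_section(1) v] kernel_section(2))
    finally show ?thesis .
  qed
  show "u (x i) = real n * w i" if i: "i < n" for i
  proof -
    have "(\<Sum>j<n. K (x i) (x j) * w j) + lam * real n * w i = l (x i)"
      unfolding w_def by (rule krr_solve[OF x lam i])
    moreover have "?s (x i) = (\<Sum>j<n. K (x i) (x j) * w j)"
      using x[OF i] by (simp add: kernel_section_def mult.commute)
    ultimately have "l (x i) - ?s (x i) = lam * (real n * w i)" by simp
    then show ?thesis using lam by (simp add: u)
  qed
  show "ip v l = (\<Sum>i<n. w i * v (x i)) + lam * ip u v" if v: "v \<in> H" for v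
  proof -
    have "lam * ip u v = ip l v - ip ?s v"
      unfolding u ip_scale[OF ls v] ip_diff[OF l s v] using lam by simp
    then show ?thesis using ips[OF v] ip_sym[OF v l] by simp
  qed
  have "lam\<^sup>2 * (ip_norm ip u)\<^sup>2 = lam\<^sup>2 * ((1 / lam) * ((1 / lam) * ip (\<lambda>z. l z - ?s z) (\<lambda>z. l z - ?s z)))"
    unfolding ip_norm_sq[OF uH] by (simp only: u ip_scale[OF ls scale_mem[OF ls]] ip_scale_right[OF ls ls])
  also have "\<dots> = ip (\<lambda>z. l z - ?s z) (\<lambda>z. l z - ?s z)" using lam by (simp add: power2_eq_square)
  also have "\<dots> = ip l l - ip ?s l - (ip ?s l - ip ?s ?s)"
    unfolding ip_diff[OF l s ls] ip_diff_right[OF l s l] ip_diff_right[OF l s s] ip_sym[OF l s] ..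
  also have "\<dots> = ip l l - 2 * (\<Sum>i<n. w i * l (x i)) + (\<Sum>i<n. w i * ?s (x i))"
    by (simp add: ips[OF l] ips[OF s])
  also have "(\<Sum>i<n. w i * ?s (x i)) = (\<Sum>i<n. \<Sum>j<n. w i * w j * K (x j) (x i))"
    using x by (intro sum.cong refl) (auto simp: sum_distrib_left kernel_section_def kernel_sym[of "x _" "x _"] mult_ac)
  finally show "lam\<^sup>2 * (ip_norm ip u)\<^sup>2 = ip l l - 2 * (\<Sum>i<n. w i * l (x i)) + (\<Sum>i<n. \<Sum>j<n. w i * w j * K (x j) (x i))" .
qed

text \<open>The supremum is attained at a multiple of \<open>u\<close> whose sign is opposite to
  that of \<open>b\<close>. With \<open>b = 0\<close> it is the worst-case bias; with the noise as
  \<open>b\<close> it shows that noise and bias add up without cancellation.\<close>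

lemma (in rkhs) SUP_unit_ball:
  assumes u: "u \<in> H" and t: "t \<ge> 0"
  shows "(SUP g\<in>{g \<in> H. ip_norm ip g \<le> 1}. \<bar>b - t * ip u g\<bar>) = \<bar>b\<bar> + t * ip_norm ip u"
proof (rule cSup_eq_maximum)
  have *: "\<exists>g\<in>H. ip_norm ip g \<le> 1 \<and> ip u g = \<epsilon> * ip_norm ip u" if e: "\<bar>\<epsilon>\<bar> = 1" for \<epsilon>
  proof (cases "u = (\<lambda>x. 0)")
    case True
    then show ?thesis using zero_mem ip_zero[OF zero_mem] by (intro bexI[of _ "\<lambda>x. 0"]) (auto simp: ip_norm_def)
  next
    case False
    then have pos: "ip_norm ip u > 0" using ip_pos[OF u] by (simp add: ip_norm_def)
    let ?g = "\<lambda>x. (\<epsilon> / ip_norm ip u) * u x"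
    have "ip_norm ip ?g = 1" unfolding ip_norm_scale[OF u] using pos e by (simp add: abs_divide)
    moreover have "ip u ?g = \<epsilon> * ip_norm ip u"
      unfolding ip_scale_right[OF u u] using pos by (simp add: ip_norm_sq[OF u, symmetric] power2_eq_square)
    moreover have "?g \<in> H" by (rule scale_mem[OF u])
    ultimately show ?thesis by (intro bexI[of _ ?g] conjI eq_refl)
  qed
  define \<epsilon> where "\<epsilon> = (if b \<ge> 0 then -1 else (1::real))"
  have "\<bar>\<epsilon>\<bar> = 1" by (simp add: \<epsilon>_def)
  then obtain g where g: "g \<in> H" "ip_norm ip g \<le> 1" "ip u g = \<epsilon> * ip_norm ip u"
    using * by blast
  have "t * ip_norm ip u \<ge> 0" using t ip_norm_nonneg[OF u] by simp
  then have "\<bar>b - t * ip u g\<bar> = \<bar>b\<bar> + t * ip_norm ip u"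
    unfolding g(3) by (auto simp: \<epsilon>_def abs_if)
  then show "\<bar>b\<bar> + t * ip_norm ip u \<in> (\<lambda>g. \<bar>b - t * ip u g\<bar>) ` {g \<in> H. ip_norm ip g \<le> 1}"
    using g by (auto intro!: image_eqI[of _ _ g])
next
  fix y assume "y \<in> (\<lambda>g. \<bar>b - t * ip u g\<bar>) ` {g \<in> H. ip_norm ip g \<le> 1}"
  then obtain g where g: "g \<in> H" "ip_norm ip g \<le> 1" "y = \<bar>b - t * ip u g\<bar>" by auto
  have "\<bar>ip u g\<bar> \<le> ip_norm ip u * 1"
    by (rule order_trans[OF ip_cauchy_schwarz[OF u g(1)] mult_left_mono[OF g(2) ip_norm_nonneg[OF u]]])
  then have "t * \<bar>ip u g\<bar> \<le> t * ip_norm ip u" using t by (intro mult_left_mono) auto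
  then have "\<bar>t * ip u g\<bar> \<le> t * ip_norm ip u" using t by (simp add: abs_mult)
  then show "y \<le> \<bar>b\<bar> + t * ip_norm ip u" unfolding g(3) by linarith
qed

lemma emp_norm_nonneg: "emp_norm n x v \<ge> 0"
  by (simp add: emp_norm_def sum_nonneg)

lemma emp_norm_sq: "(emp_norm n x v)\<^sup>2 = 1 / real n * (\<Sum>i<n. (v (x i))\<^sup>2)"
  by (simp add: emp_norm_def sum_nonneg)

lemma emp_cauchy_schwarz: "\<bar>1 / real n * (\<Sum>i<n. u (x i) * v (x i))\<bar> \<le> emp_norm n x u * emp_norm n x v"
proof -
  have "(\<Sum>i<n. u (x i) * v (x i))\<^sup>2 \<le> (\<Sum>i<n. (u (x i))\<^sup>2) * (\<Sum>i<n. (v (x i))\<^sup>2)"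
    by (rule Cauchy_Schwarz_ineq_sum)
  then have "(1 / real n)\<^sup>2 * (\<Sum>i<n. u (x i) * v (x i))\<^sup>2 \<le> (1 / real n)\<^sup>2 * ((\<Sum>i<n. (u (x i))\<^sup>2) * (\<Sum>i<n. (v (x i))\<^sup>2))"
    by (intro mult_left_mono) auto
  then have "(1 / real n * (\<Sum>i<n. u (x i) * v (x i)))\<^sup>2 \<le> (emp_norm n x u * emp_norm n x v)\<^sup>2"
    unfolding power_mult_distrib emp_norm_sq by (simp add: power2_eq_square mult_ac)
  then show ?thesis
    using abs_le_square_iff[of "1 / real n * (\<Sum>i<n. u (x i) * v (x i))" "emp_norm n x u * emp_norm n x v"]
    by (simp add: abs_mult emp_norm_nonneg)
qed

text \<open>Here \<open>N2\<close> is the \<open>L\<^sub>2\<close> norm, \<open>p = d/2\<close> and \<open>a = |\<alpha>|\<close>; \<open>\<kappa>\<close> stands for \<open>C\<^sub>\<epsilon> n powr (- m/d)\<close>.\<close>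

definition (in rkhs) representer_bounded ::
  "real \<Rightarrow> real \<Rightarrow> real \<Rightarrow> (('a \<Rightarrow> real) \<Rightarrow> real) \<Rightarrow> real \<Rightarrow> ('a \<Rightarrow> real) \<Rightarrow> real \<Rightarrow> real \<Rightarrow> real \<Rightarrow> real \<Rightarrow> bool" where
  "representer_bounded m p a N2 C1 l A c1 \<eta> s0 \<longleftrightarrow> (\<forall>n x lam \<kappa> u. 0 < lam \<longrightarrow> lam powr (1 / (2 * m)) \<le> s0 \<longrightarrow> 0 \<le> \<kappa> \<longrightarrow> \<kappa> \<le> \<eta> * sqrt lam \<longrightarrow>
    (\<forall>v\<in>H. N2 v \<le> max (C1 * emp_norm n x v) (\<kappa> * ip_norm ip v) \<and> emp_norm n x v \<le> max (C1 * N2 v) (\<kappa> * ip_norm ip v)) \<longrightarrow>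
    u \<in> H \<longrightarrow> (\<forall>v\<in>H. ip v l = 1 / real n * (\<Sum>i<n. u (x i) * v (x i)) + lam * ip u v) \<longrightarrow>
    c1 * (lam powr (1 / (2 * m))) powr (- p - a) \<le> emp_norm n x u \<and> emp_norm n x u \<le> A * (lam powr (1 / (2 * m))) powr (- p - a) \<and>
    c1 * (lam powr (1 / (2 * m))) powr (- p - a) \<le> sqrt lam * ip_norm ip u \<and>
    sqrt lam * ip_norm ip u \<le> A * (lam powr (1 / (2 * m))) powr (- p - a) \<and>
    N2 u \<le> A * (lam powr (1 / (2 * m))) powr (- p - a))"

text \<open>Test functions at scale \<open>\<tau> s\<close> are paired with the representer. A large \<open>\<tau>\<close> makes the
  penalty term negligible and bounds \<open>\<parallel>u\<parallel>\<^sub>n\<close> from below, a small \<open>\<tau>\<close> makes the empirical term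
  negligible and bounds \<open>\<parallel>u\<parallel>\<^sub>H\<close> from below.\<close>

lemma (in rkhs) representer_bounds:
  fixes N2 :: "('a \<Rightarrow> real) \<Rightarrow> real"
  assumes p: "p > 0" "a \<ge> 0" "m > p + a" and l: "l \<in> H" and N2: "\<And>v. N2 v \<ge> 0"
    and CI: "CI \<ge> 0" and interp: "\<And>v t. v \<in> H \<Longrightarrow> 0 < t \<Longrightarrow> t \<le> 1 \<Longrightarrow>
      \<bar>ip v l\<bar> \<le> CI * (t powr (- p - a) * N2 v + t powr (m - p - a) * ip_norm ip v)"
    and CT: "CT > 0" "c > 0" "h0 > 0" and test: "\<And>h. 0 < h \<Longrightarrow> h \<le> h0 \<Longrightarrow>
      \<exists>u\<in>H. ip_norm ip u \<le> CT * h powr (p - m) \<and> N2 u \<le> CT * h powr p \<and> \<bar>ip u l\<bar> = c * h powr (- a)"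
    and C1: "C1 > 0"
  shows "\<exists>A>0. \<exists>c1>0. \<exists>\<eta>>0. \<exists>s0>0. representer_bounded m p a N2 C1 l A c1 \<eta> s0"
proof -
  have m: "m > 0" "m - p - a > 0" "p + a > 0" using p by auto
  \<comment> \<open>From the energy estimate below, combined with (X + Y)^2 being at most twice the
    energy; the added 1 ensures positivity.\<close>
  define A where "A = 2 * CI * (C1 + 2) + 1"
  have A: "A > 0" using CI C1 by (simp add: A_def add_nonneg_pos)
  \<comment> \<open>Chosen so that, in the pairing at scale \<open>\<tau>1 * s\<close>, the penalty
    term takes at most half of the value of the functional.\<close>
  define \<tau>1 where "\<tau>1 = (c / (2 * CT * A)) powr (- 1 / (m - p - a))"
  \<comment> \<open>At scale \<open>\<tau>2 * s\<close> the empirical term takes at most half: a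
    quarter through the \<open>L2\<close> norm, by this choice, and a quarter through the error of
    the norm comparison, by the choice of \<open>\<eta>\<close>.\<close>
  define \<tau>2 where "\<tau>2 = (c / (4 * CT * A * C1)) powr (1 / (p + a))"
  have \<tau>: "\<tau>1 > 0" "\<tau>2 > 0" using CT A C1 by (auto simp: \<tau>1_def \<tau>2_def)
  \<comment> \<open>The bound 1 keeps the comparison error for \<open>u\<close> below
    \<open>Y\<close>; the other bound secures the quarter at scale
    \<open>\<tau>2 * s\<close>.\<close>
  define \<eta> where "\<eta> = min 1 (c / (4 * CT * A) * \<tau>2 powr (m - p - a))"
  have \<eta>: "\<eta> > 0" "\<eta> \<le> 1" using CT A \<tau> by (auto simp: \<eta>_def)
  \<comment> \<open>Keeps \<open>s\<close> and both test scales in the ranges where interpolation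
    and test functions are available.\<close>
  define s0 where "s0 = min 1 (min (h0 / \<tau>1) (h0 / \<tau>2))"
  have s0: "s0 > 0" using CT \<tau> by (simp add: s0_def)
  define d1 where "d1 = c / 2 * \<tau>1 powr (- a) / (CT * (C1 * \<tau>1 powr p + \<tau>1 powr (p - m)))"
  define d2 where "d2 = c / 2 * \<tau>2 powr (- a) / (CT * \<tau>2 powr (p - m))"
  have D1: "CT * (C1 * \<tau>1 powr p + \<tau>1 powr (p - m)) > 0" using CT C1 \<tau> by (intro mult_pos_pos add_pos_pos) auto
  have D2: "CT * \<tau>2 powr (p - m) > 0" using CT \<tau> by simp
  have d: "d1 > 0" "d2 > 0" using CT \<tau> D1 D2 by (auto simp: d1_def d2_def)
  have t1: "CT * A * \<tau>1 powr (p - m) = c / 2 * \<tau>1 powr (- a)"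
  proof -
    have "\<tau>1 powr (p - m) = \<tau>1 powr (- (m - p - a)) * \<tau>1 powr (- a)" by (simp flip: powr_add)
    also have "\<tau>1 powr (- (m - p - a)) = c / (2 * CT * A)"
    proof -
      have "(- 1 / q) * (- q) = 1" if "q > 0" for q :: real using that by simp
      from this[OF m(2)] have "\<tau>1 powr (- (m - p - a)) = (c / (2 * CT * A)) powr 1"
        by (simp only: \<tau>1_def powr_powr)
      then show ?thesis using CT A by simp
    qed
    finally show ?thesis using CT A by simp
  qed
  have t2: "CT * A * (C1 * \<tau>2 powr p) = c / 4 * \<tau>2 powr (- a)"
  proof -
    have "\<tau>2 powr p = \<tau>2 powr (p + a) * \<tau>2 powr (- a)" by (simp flip: powr_add)
    also have "\<tau>2 powr (p + a) = c / (4 * CT * A * C1)"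
      using m CT A C1 by (simp add: \<tau>2_def powr_powr)
    finally show ?thesis using CT A C1 by simp
  qed
  have t3: "CT * A * (\<eta> * \<tau>2 powr (p - m)) \<le> c / 4 * \<tau>2 powr (- a)"
  proof -
    have "\<eta> * \<tau>2 powr (p - m) \<le> (c / (4 * CT * A) * \<tau>2 powr (m - p - a)) * \<tau>2 powr (p - m)"
      by (intro mult_right_mono) (auto simp: \<eta>_def)
    also have "\<dots> = c / (4 * CT * A) * \<tau>2 powr (- a)" by (simp add: mult.assoc flip: powr_add)
    finally have "CT * A * (\<eta> * \<tau>2 powr (p - m)) \<le> CT * A * (c / (4 * CT * A) * \<tau>2 powr (- a))"
      using CT A by (intro mult_left_mono) auto
    then show ?thesis using CT A by simp
  qed
  let ?A = "(C1 + 1) * A"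
  have pA: "?A > 0" using A C1 by simp
  have pd: "min d1 d2 > 0" using d by simp
  show ?thesis
    unfolding representer_bounded_def
  proof (rule exI[of _ ?A], rule conjI[OF pA], rule exI[of _ "min d1 d2"], rule conjI[OF pd],
      rule exI[of _ \<eta>], rule conjI[OF \<eta>(1)], rule exI[of _ s0], rule conjI[OF s0], intro allI impI)
    fix n x lam \<kappa> u
    define s X r N where s_def: "s = lam powr (1 / (2 * m))" and X_def: "X = emp_norm n x u" and r_def: "r = sqrt lam" and N_def: "N = ip_norm ip u"
    assume lam: "0 < lam" "lam powr (1 / (2 * m)) \<le> s0" "0 \<le> \<kappa>" "\<kappa> \<le> \<eta> * sqrt lam"
      and nc: "\<forall>v\<in>H. N2 v \<le> max (C1 * emp_norm n x v) (\<kappa> * ip_norm ip v) \<and> emp_norm n x v \<le> max (C1 * N2 v) (\<kappa> * ip_norm ip v)"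
      and u: "u \<in> H" and rep: "\<forall>v\<in>H. ip v l = 1 / real n * (\<Sum>i<n. u (x i) * v (x i)) + lam * ip u v"
    note lam = lam[folded s_def r_def]
    have s: "s > 0" "s \<le> 1" using lam by (auto simp: s_def s0_def)
    have r: "r > 0" "r\<^sup>2 = lam" "s powr m = r" using lam m by (auto simp: r_def s_def powr_powr powr_half_sqrt)
    have X: "X \<ge> 0" by (simp add: X_def emp_norm_nonneg)
    have N: "N \<ge> 0" by (simp add: N_def ip_norm_nonneg[OF u])
    define Y where "Y = r * N"
    have Y: "Y \<ge> 0" using r N by (simp add: Y_def)
    define P where "P = s powr (- p - a)"
    have P: "P > 0" using s by (simp add: P_def)
    have kN: "\<kappa> * N \<le> Y"
    proof -
      have "\<kappa> \<le> 1 * r" using lam(4) \<eta>(2) r(1) by (intro order_trans[OF lam(4)] mult_right_mono) auto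
      then show ?thesis unfolding Y_def using N by (intro mult_right_mono) auto
    qed
    have N2u: "N2 u \<le> C1 * X + Y"
    proof -
      have "N2 u \<le> max (C1 * X) (\<kappa> * N)" using nc u by (simp add: X_def N_def)
      moreover have "0 \<le> C1 * X" using C1 X by simp
      ultimately show ?thesis using kN Y by linarith
    qed
    have upper: "X + Y \<le> A * P"
    proof -
      \<comment> \<open>Pairing \<open>u\<close> with itself: the energy is the value of the
        functional at \<open>u\<close>, which interpolation at scale \<open>s\<close> bounds
        linearly in \<open>X + Y\<close>.\<close>
      have "X\<^sup>2 + Y\<^sup>2 = ip u l"
      proof -
        have su: "(\<Sum>i<n. u (x i) * u (x i)) = (\<Sum>i<n. (u (x i))\<^sup>2)" by (simp add: power2_eq_square)
        have "Y\<^sup>2 = lam * ip u u" by (simp add: Y_def power_mult_distrib r(2) N_def ip_norm_sq[OF u])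
        moreover have "ip u l = 1 / real n * (\<Sum>i<n. (u (x i))\<^sup>2) + lam * ip u u" using rep u su by simp
        ultimately show ?thesis by (simp only: X_def emp_norm_sq)
      qed
      also have "\<dots> \<le> CI * (P * N2 u + s powr (m - p - a) * N)"
        using interp[OF u s] by (simp add: P_def N_def)
      also have "s powr (m - p - a) * N = P * Y"
      proof -
        have "m - p - a = m + (- p - a)" by simp
        then have "s powr (m - p - a) = s powr m * P" by (simp only: P_def powr_add)
        then show ?thesis by (simp add: r(3) Y_def)
      qed
      also have "CI * (P * N2 u + P * Y) \<le> CI * (P * ((C1 + 2) * (X + Y)))"
      proof (intro mult_left_mono CI)
        have "0 \<le> C1 * Y" using C1 Y by simp
        then have "N2 u + Y \<le> (C1 + 2) * (X + Y)" using N2u X Y by (simp add: algebra_simps)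
        then have "P * (N2 u + Y) \<le> P * ((C1 + 2) * (X + Y))" using P by (intro mult_left_mono) auto
        then show "P * N2 u + P * Y \<le> P * ((C1 + 2) * (X + Y))" by (simp add: distrib_left)
      qed
      finally have le: "X\<^sup>2 + Y\<^sup>2 \<le> CI * (C1 + 2) * P * (X + Y)" by (simp add: mult_ac)
      have "(X + Y)\<^sup>2 \<le> 2 * (X\<^sup>2 + Y\<^sup>2)" using zero_le_power2[of "X - Y"] by (simp add: power2_eq_square algebra_simps)
      also have "\<dots> \<le> 2 * (CI * (C1 + 2) * P * (X + Y))" using le by simp
      finally have "(X + Y) * (X + Y) \<le> (2 * CI * (C1 + 2) * P) * (X + Y)" by (simp add: power2_eq_square mult_ac)
      then have "X + Y \<le> 2 * CI * (C1 + 2) * P \<or> X + Y = 0" using X Y by (cases "X + Y = 0") auto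
      moreover have "2 * CI * (C1 + 2) * P \<le> A * P" unfolding A_def using P by (intro mult_right_mono) auto
      moreover have "0 \<le> A * P" using A P by simp
      ultimately show ?thesis by linarith
    qed
    \<comment> \<open>One inequality for all relative scales, with the powers of \<open>s\<close>
      cancelled; \<open>\<tau>1\<close> and \<open>\<tau>2\<close> then give the lower bounds for
      \<open>X\<close> and \<open>Y\<close>.\<close>
    have lower: "c * \<tau> powr (- a) * P \<le> CT * ((C1 * \<tau> powr p + \<eta> * \<tau> powr (p - m)) * X + \<tau> powr (p - m) * Y)"
      if \<tau>: "\<tau> > 0" "\<tau> * s \<le> h0" for \<tau>
    proof -
      let ?h = "\<tau> * s"
      have h: "?h > 0" using \<tau> s by simp
      obtain v where v: "v \<in> H" "ip_norm ip v \<le> CT * ?h powr (p - m)" "N2 v \<le> CT * ?h powr p" "\<bar>ip v l\<bar> = c * ?h powr (- a)"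
        using test[OF h \<tau>(2)] by blast
      have hp: "?h powr e = \<tau> powr e * s powr e" for e using \<tau> s by (simp add: powr_mult)
      have rs: "r * s powr (p - m) = s powr p" unfolding r(3)[symmetric] by (simp flip: powr_add)
      have "\<kappa> * ip_norm ip v \<le> (\<eta> * r) * (CT * ?h powr (p - m))"
        using lam(3,4) v(2) ip_norm_nonneg[OF v(1)] \<eta> r by (intro mult_mono) auto
      also have "\<dots> = CT * (\<eta> * \<tau> powr (p - m)) * (r * s powr (p - m))" by (simp add: hp)
      finally have kv: "\<kappa> * ip_norm ip v \<le> CT * (\<eta> * \<tau> powr (p - m)) * s powr p" by (simp only: rs)
      have "C1 * N2 v \<le> C1 * (CT * ?h powr p)" using v(3) C1 by (intro mult_left_mono) auto
      then have c1v: "C1 * N2 v \<le> CT * (C1 * \<tau> powr p) * s powr p" by (simp add: hp mult_ac)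
      have "emp_norm n x v \<le> max (C1 * N2 v) (\<kappa> * ip_norm ip v)" using nc v(1) by blast
      moreover have "0 \<le> C1 * N2 v" "0 \<le> \<kappa> * ip_norm ip v"
        using C1 N2[of v] lam(3) ip_norm_nonneg[OF v(1)] by auto
      ultimately have "emp_norm n x v \<le> CT * (C1 * \<tau> powr p) * s powr p + CT * (\<eta> * \<tau> powr (p - m)) * s powr p"
        using c1v kv by linarith
      then have ev: "emp_norm n x v \<le> CT * (C1 * \<tau> powr p + \<eta> * \<tau> powr (p - m)) * s powr p"
        by (simp add: algebra_simps)
      have "\<bar>ip v l\<bar> \<le> \<bar>1 / real n * (\<Sum>i<n. u (x i) * v (x i))\<bar> + lam * \<bar>ip u v\<bar>"
        using rep v(1) lam(1) by (simp add: abs_mult order_trans[OF abs_triangle_ineq])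
      also have "\<dots> \<le> X * emp_norm n x v + lam * (N * ip_norm ip v)"
        unfolding X_def N_def using lam(1)
        by (intro add_mono emp_cauchy_schwarz mult_left_mono ip_cauchy_schwarz u v) auto
      also have "\<dots> \<le> X * (CT * (C1 * \<tau> powr p + \<eta> * \<tau> powr (p - m)) * s powr p) + lam * (N * (CT * ?h powr (p - m)))"
        using X N lam(1) v(2) by (intro add_mono mult_left_mono ev) auto
      also have "lam * (N * (CT * ?h powr (p - m))) = CT * \<tau> powr (p - m) * Y * (r * s powr (p - m))"
        by (simp add: hp Y_def flip: r(2)) (simp add: power2_eq_square mult_ac)
      also have "r * s powr (p - m) = s powr p" by (rule rs)
      finally have "c * ?h powr (- a) \<le> CT * ((C1 * \<tau> powr p + \<eta> * \<tau> powr (p - m)) * X + \<tau> powr (p - m) * Y) * s powr p"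
        unfolding v(4) by (simp add: algebra_simps)
      then have "c * ?h powr (- a) * s powr (- p) \<le> CT * ((C1 * \<tau> powr p + \<eta> * \<tau> powr (p - m)) * X + \<tau> powr (p - m) * Y) * s powr p * s powr (- p)"
        by (intro mult_right_mono) auto
      moreover have "s powr p * s powr (- p) = 1" using s by (simp flip: powr_add)
      moreover have "?h powr (- a) * s powr (- p) = \<tau> powr (- a) * P"
      proof -
        have "- a + - p = - p - a" by simp
        then have "s powr (- a) * s powr (- p) = P" by (simp only: P_def flip: powr_add)
        then show ?thesis unfolding hp by (simp add: mult.assoc)
      qed
      ultimately show ?thesis by (simp add: mult.assoc)
    qed
    have \<tau>s: "\<tau>1 * s \<le> h0" "\<tau>2 * s \<le> h0"
      using lam(2) \<tau> by (auto simp: s0_def field_simps)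
    have XA: "X \<le> A * P" "Y \<le> A * P" using upper X Y by linarith+
    have half1: "c / 2 * z * P \<le> CT * G * X" if "c * z * P \<le> CT * (G * X + q * Y)" "CT * q * Y \<le> c / 2 * z * P" for z G q
      using that by (simp add: distrib_left mult.assoc)
    have half2: "c / 2 * z * P \<le> CT * q * Y" if "c * z * P \<le> CT * (G * X + q * Y)" "CT * G * X \<le> c / 2 * z * P" for z G q
      using that by (simp add: distrib_left mult.assoc)
    have div: "\<alpha> / D * P \<le> Z" if "\<alpha> * P \<le> D * Z" "D > 0" for \<alpha> D Z :: real
      using that by (simp add: field_simps)
    have "d1 * P \<le> X"
    proof -
      have "CT * \<tau>1 powr (p - m) * Y \<le> CT * \<tau>1 powr (p - m) * (A * P)"
        using XA CT by (intro mult_left_mono) auto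
      also have "\<dots> = c / 2 * \<tau>1 powr (- a) * P" using t1 by (simp add: mult_ac)
      finally have y: "CT * \<tau>1 powr (p - m) * Y \<le> c / 2 * \<tau>1 powr (- a) * P" .
      have "c / 2 * \<tau>1 powr (- a) * P \<le> CT * (C1 * \<tau>1 powr p + \<eta> * \<tau>1 powr (p - m)) * X"
        by (rule half1[OF lower[OF \<tau>(1) \<tau>s(1)] y])
      also have "\<dots> \<le> CT * (C1 * \<tau>1 powr p + 1 * \<tau>1 powr (p - m)) * X"
        using CT X \<eta> by (intro mult_left_mono mult_right_mono add_left_mono) auto
      finally have "c / 2 * \<tau>1 powr (- a) * P \<le> (CT * (C1 * \<tau>1 powr p + \<tau>1 powr (p - m))) * X" by simp
      from div[OF this D1] show ?thesis by (simp only: d1_def)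
    qed
    moreover have "d2 * P \<le> Y"
    proof -
      have "CT * (C1 * \<tau>2 powr p + \<eta> * \<tau>2 powr (p - m)) * X \<le> CT * (C1 * \<tau>2 powr p + \<eta> * \<tau>2 powr (p - m)) * (A * P)"
        using XA CT C1 \<eta> by (intro mult_left_mono) auto
      also have "\<dots> = (CT * A * (C1 * \<tau>2 powr p) + CT * A * (\<eta> * \<tau>2 powr (p - m))) * P" by (simp add: algebra_simps)
      also have "\<dots> \<le> (c / 4 * \<tau>2 powr (- a) + c / 4 * \<tau>2 powr (- a)) * P"
        using t2 t3 P by (intro mult_right_mono add_mono) auto
      also have "(c / 4 * \<tau>2 powr (- a) + c / 4 * \<tau>2 powr (- a)) * P = c / 2 * \<tau>2 powr (- a) * P" by simp
      finally have "CT * (C1 * \<tau>2 powr p + \<eta> * \<tau>2 powr (p - m)) * X \<le> c / 2 * \<tau>2 powr (- a) * P" .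
      from div[OF half2[OF lower[OF \<tau>(2) \<tau>s(2)] this] D2] show ?thesis by (simp only: d2_def)
    qed
    moreover have "min d1 d2 * P \<le> d1 * P" "min d1 d2 * P \<le> d2 * P" using P by (auto intro: mult_right_mono)
    moreover have "N2 u \<le> (C1 + 1) * A * P"
    proof -
      have "C1 * X \<le> C1 * (A * P)" using XA C1 by (intro mult_left_mono) auto
      then show ?thesis using N2u XA by (simp add: algebra_simps)
    qed
    moreover have "A * P \<le> ?A * P" using C1 A P by (intro mult_right_mono) auto
    ultimately have "min d1 d2 * P \<le> X \<and> X \<le> ?A * P \<and> min d1 d2 * P \<le> Y \<and> Y \<le> ?A * P \<and> N2 u \<le> ?A * P"
      using XA by linarith
    then show "min d1 d2 * (lam powr (1 / (2 * m))) powr (- p - a) \<le> emp_norm n x u \<and> emp_norm n x u \<le> ?A * (lam powr (1 / (2 * m))) powr (- p - a) \<and>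
      min d1 d2 * (lam powr (1 / (2 * m))) powr (- p - a) \<le> sqrt lam * ip_norm ip u \<and>
      sqrt lam * ip_norm ip u \<le> ?A * (lam powr (1 / (2 * m))) powr (- p - a) \<and> N2 u \<le> ?A * (lam powr (1 / (2 * m))) powr (- p - a)"
      unfolding P_def Y_def s_def X_def r_def N_def .
  qed
qed

subsection \<open>Measurability of the weights\<close>

text \<open>The Leibniz formula is a polynomial in the entries.\<close>

lemma borel_measurable_det:
  fixes A :: "'b \<Rightarrow> real mat"
  assumes carrier: "\<And>x. A x \<in> carrier_mat n n"
    and entry: "\<And>i j. i < n \<Longrightarrow> j < n \<Longrightarrow> (\<lambda>x. index_mat (A x) (i, j)) \<in> borel_measurable N"
  shows "(\<lambda>x. Determinant.det (A x)) \<in> borel_measurable N"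
proof -
  have "Determinant.det (A x) = (\<Sum>p | p permutes {0..<n}. signof p * (\<Prod>i = 0..<n. index_mat (A x) (i, p i)))" for x
    using carrier[of x] by (auto simp: Determinant.det_def)
  moreover have "(\<lambda>x. \<Sum>p | p permutes {0..<n}. signof p * (\<Prod>i = 0..<n. index_mat (A x) (i, p i))) \<in> borel_measurable N"
  proof (intro borel_measurable_sum borel_measurable_times borel_measurable_const borel_measurable_prod)
    fix p i assume "p \<in> {p. p permutes {0..<n}}" and i: "i \<in> {0..<n}"
    then have "p i < n" using permutes_in_image[of p "{0..<n}" i] by auto
    then show "(\<lambda>x. index_mat (A x) (i, p i)) \<in> borel_measurable N" using entry i by auto
  qed
  ultimately show ?thesis by simp
qed

lemma borel_measurable_adj_mat:
  fixes A :: "'b \<Rightarrow> real mat"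
  assumes carrier: "\<And>x. A x \<in> carrier_mat n n"
    and entry: "\<And>i j. i < n \<Longrightarrow> j < n \<Longrightarrow> (\<lambda>x. index_mat (A x) (i, j)) \<in> borel_measurable N"
    and ij: "i < n" "j < n"
  shows "(\<lambda>x. index_mat (adj_mat (A x)) (i, j)) \<in> borel_measurable N"
proof -
  have dims: "dim_row (A x) = n" "dim_col (A x) = n" for x using carrier[of x] by auto
  have "index_mat (adj_mat (A x)) (i, j) = (-1) ^ (j + i) * Determinant.det (mat_delete (A x) j i)" for x
    using ij by (simp add: adj_mat_def cofactor_def dims)
  moreover have "(\<lambda>x. Determinant.det (mat_delete (A x) j i)) \<in> borel_measurable N"
  proof (rule borel_measurable_det[where n = "n - 1"])
    show "mat_delete (A x) j i \<in> carrier_mat (n - 1) (n - 1)" for x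
      by (simp add: mat_delete_def dims)
    fix k l assume kl: "k < n - 1" "l < n - 1"
    have "index_mat (mat_delete (A x) j i) (k, l) = index_mat (A x) (if k < j then k else Suc k, if l < i then l else Suc l)" for x
      using kl by (simp add: mat_delete_def dims)
    then show "(\<lambda>x. index_mat (mat_delete (A x) j i) (k, l)) \<in> borel_measurable N"
      using kl by (auto intro!: entry)
  qed
  ultimately show ?thesis by simp
qed

text \<open>Cramer's rule, with a view to measurability: determinant and adjugate are polynomials in
  the entries, whereas the inverse matrix is defined by an elimination procedure with case
  distinctions.\<close>

lemma cramer_adj:
  fixes A :: "real mat"
  assumes A: "A \<in> carrier_mat n n" and det: "Determinant.det A \<noteq> 0"
    and sys: "\<And>i. i < n \<Longrightarrow> (\<Sum>j<n. index_mat A (i, j) * w j) = b i" and i: "i < n"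
  shows "w i = (\<Sum>j<n. index_mat (adj_mat A) (i, j) * b j) / Determinant.det A"
proof -
  let ?w = "Matrix.vec n w" and ?b = "Matrix.vec n b"
  have w: "?w \<in> carrier_vec n" "?b \<in> carrier_vec n" by auto
  have "A *\<^sub>v ?w = ?b"
    using A sys by (intro eq_vecI) (auto simp: scalar_prod_def lessThan_atLeast0)
  then have "adj_mat A *\<^sub>v ?b = (adj_mat A * A) *\<^sub>v ?w"
    using assoc_mult_mat_vec[OF adj_mat(1)[OF A] A w(1)] by simp
  also have "\<dots> = (Determinant.det A \<cdot>\<^sub>m 1\<^sub>m n) *\<^sub>v ?w" by (simp only: adj_mat(3)[OF A])
  also have "\<dots> = Determinant.det A \<cdot>\<^sub>v ?w" by (intro eq_vecI) (auto simp: scalar_prod_def if_distrib if_distribR cong: if_cong)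
  finally have "vec_index (adj_mat A *\<^sub>v ?b) i = Determinant.det A * w i" using i by simp
  moreover have "vec_index (adj_mat A *\<^sub>v ?b) i = (\<Sum>j<n. index_mat (adj_mat A) (i, j) * b j)"
    using i adj_mat(1)[OF A] by (auto simp: scalar_prod_def lessThan_atLeast0)
  ultimately show ?thesis using det by simp
qed

text \<open>Outside \<open>\<Omega>\<close> the kernel is arbitrary and need not be measurable.\<close>

definition kernel_ext :: "'a set \<Rightarrow> ('a \<Rightarrow> 'a \<Rightarrow> real) \<Rightarrow> 'a \<Rightarrow> 'a \<Rightarrow> real" where
  "kernel_ext \<Omega> K x y = (if x \<in> \<Omega> \<and> y \<in> \<Omega> then K x y else 0)"

text \<open>\<open>krr_solve\<close> in the form of Cramer's rule, a quotient that is visibly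
  measurable in the design.\<close>

definition gram_weights :: "('a \<Rightarrow> 'a \<Rightarrow> real) \<Rightarrow> nat \<Rightarrow> real \<Rightarrow> ('a \<Rightarrow> real) \<Rightarrow> (nat \<Rightarrow> 'a) \<Rightarrow> nat \<Rightarrow> real" where
  "gram_weights K n lam l x i = (\<Sum>j<n. index_mat (adj_mat (regularized_gram K n lam x)) (i, j) * l (x j)) /
     Determinant.det (regularized_gram K n lam x)"

lemma regularized_gram_index:
  "i < n \<Longrightarrow> j < n \<Longrightarrow> index_mat (regularized_gram K n lam x) (i, j) = K (x i) (x j) + (if i = j then lam * real n else 0)"
  by (simp add: regularized_gram_def)

lemma (in rkhs) krr_solve_eq_gram_weights:
  assumes x: "\<And>i. i < n \<Longrightarrow> x i \<in> \<Omega>" and lam: "lam > 0" and i: "i < n"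
  shows "krr_solve K n lam x (\<lambda>i. l (x i)) i = gram_weights (kernel_ext \<Omega> K) n lam l x i"
proof -
  have eq: "regularized_gram (kernel_ext \<Omega> K) n lam x = regularized_gram K n lam x"
    using x by (intro eq_matI) (auto simp: regularized_gram_def kernel_ext_def)
  have det: "Determinant.det (regularized_gram K n lam x) \<noteq> 0"
    by (rule det_regularized_gram[OF x lam])
  have "(\<Sum>j<n. index_mat (regularized_gram K n lam x) (i, j) * krr_solve K n lam x (\<lambda>i. l (x i)) j) = l (x i)" if "i < n" for i
  proof -
    have "(\<Sum>j<n. index_mat (regularized_gram K n lam x) (i, j) * krr_solve K n lam x (\<lambda>i. l (x i)) j) =
        (\<Sum>j<n. K (x i) (x j) * krr_solve K n lam x (\<lambda>i. l (x i)) j + (if i = j then lam * real n * krr_solve K n lam x (\<lambda>i. l (x i)) j else 0))"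
      using that by (intro sum.cong refl) (auto simp: regularized_gram_index distrib_right)
    also have "\<dots> = (\<Sum>j<n. K (x i) (x j) * krr_solve K n lam x (\<lambda>i. l (x i)) j) + lam * real n * krr_solve K n lam x (\<lambda>i. l (x i)) i"
      using that by (simp add: sum.distrib)
    also have "\<dots> = l (x i)" by (rule krr_solve[OF x lam that])
    finally show ?thesis .
  qed
  then show ?thesis
    unfolding gram_weights_def eq
    by (intro cramer_adj[OF regularized_gram_carrier det _ i]) auto
qed

text \<open>A function continuous in one variable and measurable in the other is jointly measurable, being
  the limit of its values at nearby points of a countable dense set.\<close>

lemma borel_measurable_kernel_ext:
  fixes \<Omega> :: "(real ^ 'd::finite) set"
  assumes rk: "rkhs \<Omega> K H ip" and cl: "closed \<Omega>" and cont: "\<And>u. u \<in> H \<Longrightarrow> continuous_on \<Omega> u"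
  shows "(\<lambda>(x, y). kernel_ext \<Omega> K x y) \<in> borel_measurable (borel \<Otimes>\<^sub>M borel)"
proof (cases "\<Omega> = {}")
  case True
  then show ?thesis by (simp add: kernel_ext_def)
next
  case False
  interpret rkhs \<Omega> K H ip by (rule rk)
  have [measurable]: "\<Omega> \<in> sets borel" using cl by simp
  have Hm: "u \<in> borel_measurable borel" if "u \<in> H" for u
  proof -
    have "(\<lambda>z. indicator \<Omega> z *\<^sub>R u z) \<in> borel_measurable borel"
      by (rule borel_measurable_continuous_on_indicator) (use cont[OF that] in auto)
    moreover have "(\<lambda>z. indicator \<Omega> z *\<^sub>R u z) = u" using zero_outside[OF that] by (auto simp: indicator_def fun_eq_iff)
    ultimately show ?thesis by simp
  qed
  obtain T where T: "countable T" "T \<subseteq> \<Omega>" "\<Omega> \<subseteq> closure T" using separable by blast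
  then have Tne: "T \<noteq> {}" using False by auto
  define d where "d = from_nat_into T"
  have dT: "d j \<in> \<Omega>" for j using from_nat_into[OF Tne] T(2) by (auto simp: d_def)
  have ex: "\<exists>j. dist (d j) y < 1 / real (Suc k)" if "y \<in> \<Omega>" for y k
  proof -
    have "y \<in> closure T" using T that by auto
    then obtain z where "z \<in> T" "dist z y < 1 / real (Suc k)"
      unfolding closure_approachable by (metis of_nat_0_less_iff zero_less_Suc zero_less_divide_1_iff)
    moreover obtain j where "z = d j" using \<open>z \<in> T\<close> from_nat_into_surj[OF T(1)] unfolding d_def by metis
    ultimately show ?thesis by auto
  qed
  \<comment> \<open>The least index of a dense point within \<open>1 / Suc k\<close> of
    \<open>y\<close>: a measurable selection with countably many values.\<close>
  define q where "q k y = (LEAST j. dist (d j) y < 1 / real (Suc k))" for k y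
  have [measurable]: "q k \<in> measurable borel (count_space UNIV)" for k
    unfolding q_def by (intro measurable_Least) measurable
  \<comment> \<open>The second argument of the kernel is replaced by the selected dense point, so
    that for each index only a section, measurable in the first argument, occurs.\<close>
  define F where "F k p = (if snd p \<in> \<Omega> then kernel_section \<Omega> K (d (q k (snd p))) (fst p) else 0)" for k p
  have sec: "kernel_section \<Omega> K (d j) \<in> borel_measurable borel" for j
    by (rule Hm[OF kernel_section(1)[OF dT]])
  have inner: "(\<lambda>p. kernel_section \<Omega> K (d (q k (snd p))) (fst p)) \<in> borel_measurable (borel \<Otimes>\<^sub>M borel)" for k
  proof (rule measurable_compose_countable[where f = "\<lambda>j p. kernel_section \<Omega> K (d j) (fst p)" and g = "\<lambda>p. q k (snd p)"])
    show "(\<lambda>p. kernel_section \<Omega> K (d j) (fst p)) \<in> borel_measurable (borel \<Otimes>\<^sub>M borel)" for j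
      using measurable_compose[OF measurable_fst sec] .
  qed measurable
  have Fm: "F k \<in> borel_measurable (borel \<Otimes>\<^sub>M borel)" for k
    unfolding F_def using inner[of k] by measurable
  have lim: "(\<lambda>k. F k p) \<longlonglongrightarrow> kernel_ext \<Omega> K (fst p) (snd p)" for p
  proof (cases "snd p \<in> \<Omega> \<and> fst p \<in> \<Omega>")
    case True
    obtain x y where p: "p = (x, y)" by (cases p)
    have xy: "x \<in> \<Omega>" "y \<in> \<Omega>" using True p by auto
    have near: "dist (d (q k y)) y < 1 / real (Suc k)" for k
      unfolding q_def by (rule LeastI_ex[OF ex[OF xy(2)]])
    have "(\<lambda>k. d (q k y)) \<longlonglongrightarrow> y"
      by (rule metric_tendsto_imp_tendsto[OF LIMSEQ_Suc[OF lim_inverse_n']])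
        (use near in \<open>auto intro!: always_eventually less_imp_le simp: dist_real_def\<close>)
    then have "(\<lambda>k. kernel_section \<Omega> K x (d (q k y))) \<longlonglongrightarrow> kernel_section \<Omega> K x y"
      by (rule continuous_on_tendsto_compose[OF cont[OF kernel_section(1)[OF xy(1)]] _ xy(2)])
        (use dT in \<open>auto intro!: always_eventually\<close>)
    then show ?thesis
      using xy dT by (simp add: p F_def kernel_ext_def kernel_section_def kernel_sym[of _ x])
  next
    case False
    then have "F k p = 0" for k by (auto simp: F_def kernel_section_def)
    then show ?thesis using False by (auto simp: kernel_ext_def)
  qed
  have "(\<lambda>p. kernel_ext \<Omega> K (fst p) (snd p)) \<in> borel_measurable (borel \<Otimes>\<^sub>M borel)"
    by (rule borel_measurable_LIMSEQ_real[OF _ Fm]) (rule lim)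
  then show ?thesis by (simp add: case_prod_beta')
qed

lemma borel_measurable_gram_weights:
  fixes K :: "real ^ 'd::finite \<Rightarrow> real ^ 'd \<Rightarrow> real"
  assumes K: "(\<lambda>(x, y). K x y) \<in> borel_measurable (borel \<Otimes>\<^sub>M borel)" and l: "l \<in> borel_measurable borel" and i: "i < n"
  shows "(\<lambda>x. gram_weights K n lam l x i) \<in> borel_measurable (PiM {..<n} (\<lambda>_. borel))"
proof -
  have comp: "(\<lambda>x. x j) \<in> measurable (PiM {..<n} (\<lambda>_. borel)) borel" if "j < n" for j
    using that by (intro measurable_component_singleton) auto
  have Kc: "(\<lambda>x. K (x j) (x k)) \<in> borel_measurable (PiM {..<n} (\<lambda>_. borel))" if "j < n" "k < n" for j k
    using measurable_compose[OF measurable_Pair[OF comp[OF that(1)] comp[OF that(2)]] K] by simp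
  have ent: "(\<lambda>x. index_mat (regularized_gram K n lam x) (j, k)) \<in> borel_measurable (PiM {..<n} (\<lambda>_. borel))" if "j < n" "k < n" for j k
    using Kc[OF that] by (simp add: regularized_gram_index that)
  show ?thesis
    unfolding gram_weights_def
    by (intro borel_measurable_divide borel_measurable_sum borel_measurable_times borel_measurable_det[where n = n]
        borel_measurable_adj_mat[where n = n] regularized_gram_carrier ent i measurable_compose[OF comp l]) auto
qed

subsection \<open>Independence of design and errors\<close>

text \<open>Independence is agreement of the joint law with the product measure on rectangles, and
  rectangles determine it.\<close>

lemma indep_rv_joint:
  assumes "prob_space M" and ind: "indep_rv M S U T V"
  shows "distr M (S \<Otimes>\<^sub>M T) (\<lambda>\<omega>. (U \<omega>, V \<omega>)) = distr M S U \<Otimes>\<^sub>M distr M T V"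
proof -
  interpret prob_space M by fact
  have [measurable]: "U \<in> measurable M S" "V \<in> measurable M T" using ind by (auto simp: indep_rv_def)
  interpret U: prob_space "distr M S U" by (rule prob_space_distr) simp
  interpret V: prob_space "distr M T V" by (rule prob_space_distr) simp
  have "distr M S U \<Otimes>\<^sub>M distr M T V = distr M (S \<Otimes>\<^sub>M T) (\<lambda>\<omega>. (U \<omega>, V \<omega>))"
  proof (rule pair_measure_eqI)
    show "sigma_finite_measure (distr M S U)" "sigma_finite_measure (distr M T V)" by unfold_locales
    show "sets (distr M S U \<Otimes>\<^sub>M distr M T V) = sets (distr M (S \<Otimes>\<^sub>M T) (\<lambda>\<omega>. (U \<omega>, V \<omega>)))"
      by (simp cong: sets_pair_measure_cong)
    fix A B assume "A \<in> sets (distr M S U)" "B \<in> sets (distr M T V)"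
    then have A[measurable]: "A \<in> sets S" and B[measurable]: "B \<in> sets T" by auto
    have "prob ((U -` A \<inter> space M) \<inter> (V -` B \<inter> space M)) = prob (U -` A \<inter> space M) * prob (V -` B \<inter> space M)"
      by (rule indep_setD[of "{U -` A \<inter> space M | A. A \<in> sets S}" "{V -` B \<inter> space M | B. B \<in> sets T}"])
        (use ind A B in \<open>auto simp: indep_rv_def\<close>)
    moreover have "(\<lambda>\<omega>. (U \<omega>, V \<omega>)) -` (A \<times> B) \<inter> space M = (U -` A \<inter> space M) \<inter> (V -` B \<inter> space M)" by auto
    ultimately show "emeasure (distr M S U) A * emeasure (distr M T V) B = emeasure (distr M (S \<Otimes>\<^sub>M T) (\<lambda>\<omega>. (U \<omega>, V \<omega>))) (A \<times> B)"
      by (simp add: emeasure_distr emeasure_eq_measure ennreal_mult[symmetric])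
  qed
  then show ?thesis by simp
qed

section \<open>Moments and characteristic functions of weighted errors\<close>

lemma (in prob_space) iid_errors_integrable:
  assumes iid: "iid_errors M e \<sigma>"
  shows "e i \<in> borel_measurable M" "integrable M (e i)" "integrable M (\<lambda>\<omega>. e i \<omega> * e j \<omega>)"
proof -
  show m: "e i \<in> borel_measurable M" for i using iid by (auto simp: iid_errors_def indep_vars_def)
  have sq: "integrable M (\<lambda>\<omega>. (e i \<omega>)\<^sup>2)" for i using iid by (auto simp: iid_errors_def)
  show "integrable M (e i)" by (rule square_integrable_imp_integrable[OF m sq])
  show "integrable M (\<lambda>\<omega>. e i \<omega> * e j \<omega>)" by (rule integral_cauchy_schwarz(1)[OF m m sq sq])
qed

lemma (in prob_space) iid_errors_mult:
  assumes iid: "iid_errors M e \<sigma>"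
  shows "expectation (\<lambda>\<omega>. e i \<omega> * e j \<omega>) = (if i = j then \<sigma>\<^sup>2 else 0)"
proof (cases "i = j")
  case True
  have "variance (e i) = \<sigma>\<^sup>2" "expectation (e i) = 0" using iid by (auto simp: iid_errors_def)
  then show ?thesis using True by (simp add: power2_eq_square)
next
  case False
  have "indep_vars (\<lambda>_. borel) e UNIV" using iid by (simp add: iid_errors_def)
  then have "indep_vars (\<lambda>_. borel) e {i, j}" by (rule indep_vars_subset) simp
  then have "expectation (\<lambda>\<omega>. \<Prod>k\<in>{i, j}. e k \<omega>) = (\<Prod>k\<in>{i, j}. expectation (e k))"
    using iid_errors_integrable(2)[OF iid] by (intro indep_vars_lebesgue_integral) auto
  moreover have "expectation (e i) = 0" using iid by (auto simp: iid_errors_def)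
  ultimately show ?thesis using False by simp
qed

lemma (in prob_space) iid_errors_second_moment:
  assumes iid: "iid_errors M e \<sigma>"
  shows "integrable M (\<lambda>\<omega>. (\<Sum>i<n. c i * e i \<omega>)\<^sup>2)" "expectation (\<lambda>\<omega>. (\<Sum>i<n. c i * e i \<omega>)\<^sup>2) = \<sigma>\<^sup>2 * (\<Sum>i<n. (c i)\<^sup>2)"
proof -
  have eq: "(\<Sum>i<n. c i * e i \<omega>)\<^sup>2 = (\<Sum>i<n. \<Sum>j<n. (c i * c j) * (e i \<omega> * e j \<omega>))" for \<omega>
    by (simp add: power2_eq_square sum_product mult_ac)
  have int: "integrable M (\<lambda>\<omega>. (c i * c j) * (e i \<omega> * e j \<omega>))" for i j
    by (intro integrable_mult_right iid_errors_integrable(3)[OF iid])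
  show "integrable M (\<lambda>\<omega>. (\<Sum>i<n. c i * e i \<omega>)\<^sup>2)"
    unfolding eq by (intro Bochner_Integration.integrable_sum int)
  have "expectation (\<lambda>\<omega>. (\<Sum>i<n. c i * e i \<omega>)\<^sup>2) = (\<Sum>i<n. \<Sum>j<n. (c i * c j) * expectation (\<lambda>\<omega>. e i \<omega> * e j \<omega>))"
    unfolding eq using int by (simp add: Bochner_Integration.integral_sum Bochner_Integration.integrable_sum del: integrable_mult_right_iff)
  also have "\<dots> = (\<Sum>i<n. \<Sum>j<n. if i = j then (c i * c j) * \<sigma>\<^sup>2 else 0)"
    unfolding iid_errors_mult[OF iid] by (intro sum.cong refl) auto
  also have "\<dots> = \<sigma>\<^sup>2 * (\<Sum>i<n. (c i)\<^sup>2)"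
    by (simp add: power2_eq_square sum_distrib_left mult_ac)
  finally show "expectation (\<lambda>\<omega>. (\<Sum>i<n. c i * e i \<omega>)\<^sup>2) = \<sigma>\<^sup>2 * (\<Sum>i<n. (c i)\<^sup>2)" .
qed

text \<open>Fubini with the design outside: for a fixed design the weights are constants, and the
  second moment is the variance of the errors times their sum of squares. The deterministic bound
  \<open>B\<close> will come from truncated weights.\<close>

lemma (in prob_space) weighted_errors_second_moment:
  assumes iid: "iid_errors M e \<sigma>"
    and ind: "indep_rv M S U (PiM {..<n} (\<lambda>_. borel)) (\<lambda>\<omega>. \<lambda>i\<in>{..<n}. e i \<omega>)"
    and g: "\<And>i. i < n \<Longrightarrow> g i \<in> borel_measurable S" and B: "\<And>x. x \<in> space S \<Longrightarrow> (\<Sum>i<n. (g i x)\<^sup>2) \<le> B" "B \<ge> 0"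
  shows "(\<integral>\<^sup>+\<omega>. ennreal ((\<Sum>i<n. g i (U \<omega>) * e i \<omega>)\<^sup>2) \<partial>M) \<le> ennreal (\<sigma>\<^sup>2 * B)"
proof -
  let ?T = "PiM {..<n} (\<lambda>_. borel) :: (nat \<Rightarrow> real) measure" and ?V = "\<lambda>\<omega>. \<lambda>i\<in>{..<n}. e i \<omega>"
  have [measurable]: "U \<in> measurable M S" "?V \<in> measurable M ?T" using ind by (auto simp: indep_rv_def)
  interpret U: prob_space "distr M S U" by (rule prob_space_distr) simp
  interpret V: prob_space "distr M ?T ?V" by (rule prob_space_distr) simp
  define f where "f p = ennreal ((\<Sum>i<n. g i (fst p) * snd p i)\<^sup>2)" for p :: "_ \<times> (nat \<Rightarrow> real)"
  have comp: "(\<lambda>p. snd p i) \<in> borel_measurable (S \<Otimes>\<^sub>M ?T)" if "i < n" for i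
    by (rule measurable_compose[OF measurable_snd measurable_component_singleton]) (use that in simp)
  have fm: "f \<in> borel_measurable (S \<Otimes>\<^sub>M ?T)"
    unfolding f_def
    by (intro measurable_compose[OF _ measurable_ennreal] borel_measurable_power borel_measurable_sum borel_measurable_times
        measurable_compose[OF measurable_fst g] comp) auto
  have "(\<integral>\<^sup>+\<omega>. ennreal ((\<Sum>i<n. g i (U \<omega>) * e i \<omega>)\<^sup>2) \<partial>M) = (\<integral>\<^sup>+\<omega>. f (U \<omega>, ?V \<omega>) \<partial>M)"
    by (intro nn_integral_cong) (auto simp: f_def intro!: arg_cong[where f = ennreal] arg_cong[where f = "\<lambda>x. x\<^sup>2"] sum.cong)
  also have "\<dots> = (\<integral>\<^sup>+p. f p \<partial>(distr M (S \<Otimes>\<^sub>M ?T) (\<lambda>\<omega>. (U \<omega>, ?V \<omega>))))"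
    using fm by (subst nn_integral_distr) auto
  also have "\<dots> = (\<integral>\<^sup>+p. f p \<partial>(distr M S U \<Otimes>\<^sub>M distr M ?T ?V))"
    by (simp only: indep_rv_joint[OF prob_space_axioms ind])
  also have "\<dots> = (\<integral>\<^sup>+x. (\<integral>\<^sup>+v. f (x, v) \<partial>distr M ?T ?V) \<partial>distr M S U)"
  proof (rule V.nn_integral_fst[symmetric])
    have "sets (distr M S U \<Otimes>\<^sub>M distr M ?T ?V) = sets (S \<Otimes>\<^sub>M ?T)" by (intro sets_pair_measure_cong) auto
    then show "f \<in> borel_measurable (distr M S U \<Otimes>\<^sub>M distr M ?T ?V)" using fm by (simp cong: measurable_cong_sets)
  qed
  also have "\<dots> \<le> (\<integral>\<^sup>+x. ennreal (\<sigma>\<^sup>2 * B) \<partial>distr M S U)"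
  proof (rule nn_integral_mono)
    fix x assume "x \<in> space (distr M S U)"
    then have x: "x \<in> space S" by simp
    have "(\<lambda>v. f (x, v)) \<in> borel_measurable ?T"
      using measurable_compose[OF measurable_Pair1'[OF x] fm] .
    then have "(\<integral>\<^sup>+v. f (x, v) \<partial>distr M ?T ?V) = (\<integral>\<^sup>+\<omega>. f (x, ?V \<omega>) \<partial>M)"
      by (subst nn_integral_distr) auto
    also have "\<dots> = (\<integral>\<^sup>+\<omega>. ennreal ((\<Sum>i<n. g i x * e i \<omega>)\<^sup>2) \<partial>M)"
      by (intro nn_integral_cong) (auto simp: f_def intro!: arg_cong[where f = ennreal] arg_cong[where f = "\<lambda>x. x\<^sup>2"] sum.cong)
    also have "\<dots> = ennreal (\<sigma>\<^sup>2 * (\<Sum>i<n. (g i x)\<^sup>2))"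
      using iid_errors_second_moment[OF iid, where n = n and c = "\<lambda>i. g i x"] by (simp add: nn_integral_eq_integral)
    also have "\<dots> \<le> ennreal (\<sigma>\<^sup>2 * B)" using B(1)[OF x] by (intro ennreal_leI mult_left_mono) auto
    finally show "(\<integral>\<^sup>+v. f (x, v) \<partial>distr M ?T ?V) \<le> ennreal (\<sigma>\<^sup>2 * B)" .
  qed
  also have "\<dots> = ennreal (\<sigma>\<^sup>2 * B)" by (simp add: U.emeasure_space_1[simplified])
  finally show ?thesis .
qed

text \<open>For a fixed design the sum has independent terms, so the inner integral is a product of
  characteristic functions; \<open>\<rho>\<close>, which will be the conditional bias, contributes a
  phase.\<close>

lemma (in prob_space) weighted_errors_char:
  assumes iid: "iid_errors M e \<sigma>"
    and ind: "indep_rv M S U (PiM {..<n} (\<lambda>_. borel)) (\<lambda>\<omega>. \<lambda>i\<in>{..<n}. e i \<omega>)"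
    and g: "\<And>i. i < n \<Longrightarrow> g i \<in> borel_measurable S" and \<rho>: "\<rho> \<in> borel_measurable S"
  shows "(CLINT \<omega>|M. iexp (t * ((\<Sum>i<n. g i (U \<omega>) * e i \<omega>) + \<rho> (U \<omega>)))) =
    (CLINT \<omega>|M. iexp (t * \<rho> (U \<omega>)) * (\<Prod>i<n. char (distr M borel (e 0)) (t * g i (U \<omega>))))"
    and "integrable M (\<lambda>\<omega>. iexp (t * \<rho> (U \<omega>)) * (\<Prod>i<n. char (distr M borel (e 0)) (t * g i (U \<omega>))))"
proof -
  let ?T = "PiM {..<n} (\<lambda>_. borel) :: (nat \<Rightarrow> real) measure" and ?V = "\<lambda>\<omega>. \<lambda>i\<in>{..<n}. e i \<omega>"
  have em: "e i \<in> borel_measurable M" for i by (rule iid_errors_integrable(1)[OF iid])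
  have [measurable]: "U \<in> measurable M S" "?V \<in> measurable M ?T" using ind by (auto simp: indep_rv_def)
  interpret U: prob_space "distr M S U" by (rule prob_space_distr) simp
  interpret V: prob_space "distr M ?T ?V" by (rule prob_space_distr) simp
  interpret UV: pair_prob_space "distr M S U" "distr M ?T ?V" ..
  define f where "f p = iexp (t * ((\<Sum>i<n. g i (fst p) * snd p i) + \<rho> (fst p)))" for p :: "_ \<times> (nat \<Rightarrow> real)"
  define h where "h x = iexp (t * \<rho> x) * (\<Prod>i<n. char (distr M borel (e 0)) (t * g i x))" for x
  have comp: "(\<lambda>p. snd p i) \<in> borel_measurable (S \<Otimes>\<^sub>M ?T)" if "i < n" for i
    by (rule measurable_compose[OF measurable_snd measurable_component_singleton]) (use that in simp)
  have "(\<lambda>p. t * ((\<Sum>i<n. g i (fst p) * snd p i) + \<rho> (fst p))) \<in> borel_measurable (S \<Otimes>\<^sub>M ?T)"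
    by (intro borel_measurable_add borel_measurable_sum borel_measurable_times borel_measurable_const
        measurable_compose[OF measurable_fst g] measurable_compose[OF measurable_fst \<rho>] comp) auto
  then have fm: "f \<in> borel_measurable (S \<Otimes>\<^sub>M ?T)" unfolding f_def by measurable
  have setseq: "sets (distr M S U \<Otimes>\<^sub>M distr M ?T ?V) = sets (S \<Otimes>\<^sub>M ?T)" by (intro sets_pair_measure_cong) auto
  have fm': "f \<in> borel_measurable (distr M S U \<Otimes>\<^sub>M distr M ?T ?V)" using fm setseq by (simp cong: measurable_cong_sets)
  have fint: "integrable (distr M S U \<Otimes>\<^sub>M distr M ?T ?V) f"
    by (rule UV.integrable_const_bound[where B = 1]) (use fm' in \<open>auto simp: f_def\<close>)
  have inner: "(CLINT v|distr M ?T ?V. f (x, v)) = h x" if x: "x \<in> space S" for x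
  proof -
    have "(\<lambda>v. f (x, v)) \<in> borel_measurable ?T" using measurable_compose[OF measurable_Pair1'[OF x] fm] .
    then have "(CLINT v|distr M ?T ?V. f (x, v)) = (CLINT \<omega>|M. f (x, ?V \<omega>))"
      by (subst integral_distr) auto
    also have "\<dots> = (CLINT \<omega>|M. iexp (t * \<rho> x) * iexp (t * (\<Sum>i<n. g i x * e i \<omega>)))"
    proof (rule Bochner_Integration.integral_cong[OF refl])
      fix \<omega>
      have "(\<Sum>i<n. g i x * ?V \<omega> i) = (\<Sum>i<n. g i x * e i \<omega>)" by (intro sum.cong) auto
      then show "f (x, ?V \<omega>) = iexp (t * \<rho> x) * iexp (t * (\<Sum>i<n. g i x * e i \<omega>))"
        by (simp add: f_def exp_add[symmetric] algebra_simps)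
    qed
    also have "\<dots> = iexp (t * \<rho> x) * (CLINT \<omega>|M. iexp (t * (\<Sum>i<n. g i x * e i \<omega>)))" by simp
    also have "(CLINT \<omega>|M. iexp (t * (\<Sum>i<n. g i x * e i \<omega>))) = char (distr M borel (\<lambda>\<omega>. \<Sum>i<n. g i x * e i \<omega>)) t"
      unfolding char_def using em by (subst integral_distr) auto
    also have "\<dots> = (\<Prod>i<n. char (distr M borel (\<lambda>\<omega>. g i x * e i \<omega>)) t)"
    proof (rule char_distr_sum)
      have "indep_vars (\<lambda>_. borel) e {..<n}"
        by (rule indep_vars_subset[of _ _ UNIV]) (use iid in \<open>auto simp: iid_errors_def\<close>)
      then show "indep_vars (\<lambda>i. borel) (\<lambda>i \<omega>. g i x * e i \<omega>) {..<n}"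
        by (rule indep_vars_compose2[where X = e and Y = "\<lambda>i y. g i x * y"]) simp
    qed
    also have "\<dots> = (\<Prod>i<n. char (distr M borel (e 0)) (t * g i x))"
    proof (rule prod.cong[OF refl])
      fix i
      have "char (distr M borel (\<lambda>\<omega>. g i x * e i \<omega>)) t = (CLINT \<omega>|M. iexp (t * (g i x * e i \<omega>)))"
        unfolding char_def using em by (subst integral_distr) auto
      also have "\<dots> = char (distr M borel (e i)) (t * g i x)"
        unfolding char_def using em by (subst integral_distr) (auto simp: mult.assoc)
      also have "distr M borel (e i) = distr M borel (e 0)" using iid by (simp add: iid_errors_def)
      finally show "char (distr M borel (\<lambda>\<omega>. g i x * e i \<omega>)) t = char (distr M borel (e 0)) (t * g i x)" .
    qed
    finally show ?thesis unfolding h_def .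
  qed
  interpret E0: real_distribution "distr M borel (e 0)" by (rule real_distribution_distr) (simp add: em)
  have "h \<in> borel_measurable S"
    unfolding h_def
    by (intro borel_measurable_times borel_measurable_prod measurable_compose[OF _ E0.char_measurable] borel_measurable_const g)
      (use \<rho> in measurable)
  note hm = this
  have hb: "norm (h x) \<le> 1" for x
  proof -
    have "norm (\<Prod>i<n. char (distr M borel (e 0)) (t * g i x)) \<le> 1"
      unfolding prod_norm[symmetric] by (intro prod_le_1) (auto simp: E0.cmod_char_le_1)
    then show ?thesis by (simp add: h_def norm_mult)
  qed
  have hU: "(\<lambda>\<omega>. h (U \<omega>)) \<in> borel_measurable M" by (rule measurable_compose[OF _ hm]) simp
  show "integrable M (\<lambda>\<omega>. iexp (t * \<rho> (U \<omega>)) * (\<Prod>i<n. char (distr M borel (e 0)) (t * g i (U \<omega>))))"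
    unfolding h_def[symmetric] by (rule integrable_const_bound[where B = 1]) (use hb hU in auto)
  have "(CLINT \<omega>|M. iexp (t * ((\<Sum>i<n. g i (U \<omega>) * e i \<omega>) + \<rho> (U \<omega>)))) = (CLINT \<omega>|M. f (U \<omega>, ?V \<omega>))"
  proof (rule Bochner_Integration.integral_cong[OF refl])
    fix \<omega>
    have "(\<Sum>i<n. g i (U \<omega>) * ?V \<omega> i) = (\<Sum>i<n. g i (U \<omega>) * e i \<omega>)" by (intro sum.cong) auto
    then show "iexp (t * ((\<Sum>i<n. g i (U \<omega>) * e i \<omega>) + \<rho> (U \<omega>))) = f (U \<omega>, ?V \<omega>)" by (simp add: f_def)
  qed
  also have "\<dots> = (CLINT p|distr M (S \<Otimes>\<^sub>M ?T) (\<lambda>\<omega>. (U \<omega>, ?V \<omega>)). f p)"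
    using fm by (subst integral_distr) auto
  also have "\<dots> = (CLINT p|distr M S U \<Otimes>\<^sub>M distr M ?T ?V. f p)"
    by (simp only: indep_rv_joint[OF prob_space_axioms ind])
  also have "\<dots> = (CLINT x|distr M S U. (CLINT v|distr M ?T ?V. f (x, v)))"
    by (rule UV.integral_fst'[OF fint, symmetric])
  also have "\<dots> = (CLINT x|distr M S U. h x)"
    by (intro Bochner_Integration.integral_cong[OF refl] inner) simp
  also have "\<dots> = (CLINT \<omega>|M. h (U \<omega>))" using hm by (subst integral_distr) auto
  finally show "(CLINT \<omega>|M. iexp (t * ((\<Sum>i<n. g i (U \<omega>) * e i \<omega>) + \<rho> (U \<omega>)))) =
    (CLINT \<omega>|M. iexp (t * \<rho> (U \<omega>)) * (\<Prod>i<n. char (distr M borel (e 0)) (t * g i (U \<omega>))))"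
    unfolding h_def .
qed

section \<open>Lindeberg estimates for products of characteristic functions\<close>

lemma exp_minus_quadratic:
  fixes y :: real
  assumes "y \<ge> 0"
  shows "\<bar>(1 - y) - exp (- y)\<bar> \<le> y\<^sup>2 / 2"
proof -
  have lo: "1 - y \<le> exp (- y)" using exp_ge_add_one_self[of "- y"] by simp
  have hi: "1 + y + y\<^sup>2 / 2 \<le> exp y" by (rule exp_lower_Taylor_quadratic[OF assms])
  have pos: "1 - y + y\<^sup>2 / 2 > 0"
    using zero_le_power2[of "y - 1"] by (simp add: power2_eq_square algebra_simps)
  have "1 \<le> 1 + y ^ 4 / 4" by simp
  \<comment> \<open>The two quadratics multiply to exactly 1 + y^4/4, so the Taylor bound of exp(y)
    from below becomes one of exp(-y) from above.\<close>
  also have "\<dots> = (1 - y + y\<^sup>2 / 2) * (1 + y + y\<^sup>2 / 2)" by (simp add: power2_eq_square power4_eq_xxxx algebra_simps)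
  also have "\<dots> \<le> (1 - y + y\<^sup>2 / 2) * exp y" using pos hi by (intro mult_left_mono) auto
  finally have "exp (- y) * 1 \<le> exp (- y) * ((1 - y + y\<^sup>2 / 2) * exp y)" by (intro mult_left_mono) auto
  also have "\<dots> = (1 - y + y\<^sup>2 / 2) * (exp (- y) * exp y)" by simp
  also have "exp (- y) * exp y = 1" by (simp flip: exp_add)
  finally show ?thesis using lo by simp
qed

text \<open>The error moment in the second-order expansion of a characteristic function. The minimum
  with the square keeps it finite under two moments and lets it vanish as r tends to 0.\<close>

definition lindeberg_moment :: "'w measure \<Rightarrow> ('w \<Rightarrow> real) \<Rightarrow> real \<Rightarrow> real" where
  "lindeberg_moment M Y r = (LINT \<omega>|M. min (6 * (Y \<omega>)\<^sup>2) (r * \<bar>Y \<omega>\<bar> ^ 3))"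

text \<open>All factors have modulus at most 1, so the products differ by at most the sum of the
  differences of the factors. Each factor is compared with exp(-y_i) through 1 - y_i, and
  normalisation makes the y_i add up to t^2/2. Every error carries c_i^2, whose sum is fixed, times
  a quantity that is small with \<open>\<delta>\<close>.\<close>

lemma (in prob_space) char_product_bound:
  fixes n :: nat
  assumes iid: "iid_errors M e \<sigma>" and \<sigma>: "\<sigma>\<^sup>2 > 0"
    and c: "\<sigma>\<^sup>2 * (\<Sum>i<n. (c i)\<^sup>2) = 1" "\<And>i. i < n \<Longrightarrow> \<bar>c i\<bar> \<le> \<delta>"
  shows "cmod ((\<Prod>i<n. char (distr M borel (e 0)) (t * c i)) - exp (- (t\<^sup>2 / 2))) \<le>
    t\<^sup>2 / \<sigma>\<^sup>2 * (lindeberg_moment M (e 0) (\<bar>t\<bar> * \<delta>) / 6 + t\<^sup>2 * \<delta>\<^sup>2 * \<sigma> ^ 4 / 8)"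
proof -
  let ?\<phi> = "char (distr M borel (e 0))"
  have em: "e 0 \<in> borel_measurable M" by (rule iid_errors_integrable(1)[OF iid])
  have sq: "integrable M (\<lambda>\<omega>. (e 0 \<omega>)\<^sup>2)" using iid by (auto simp: iid_errors_def)
  interpret E0: real_distribution "distr M borel (e 0)" by (rule real_distribution_distr) (simp add: em)
  define y where "y i = (t * c i)\<^sup>2 * \<sigma>\<^sup>2 / 2" for i
  have y0: "y i \<ge> 0" for i by (simp add: y_def)
  have sumy: "(\<Sum>i<n. y i) = t\<^sup>2 / 2"
  proof -
    have "(\<Sum>i<n. y i) = t\<^sup>2 / 2 * (\<sigma>\<^sup>2 * (\<Sum>i<n. (c i)\<^sup>2))"
      by (simp add: y_def sum_distrib_left power_mult_distrib mult_ac sum_divide_distrib)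
    then show ?thesis using c(1) by simp
  qed
  let ?\<eta> = "lindeberg_moment M (e 0)"
  have mono: "?\<eta> r \<le> ?\<eta> r'" if "0 \<le> r" "r \<le> r'" for r r'
    unfolding lindeberg_moment_def
  proof (rule integral_mono)
    have int: "integrable M (\<lambda>\<omega>. min (6 * (e 0 \<omega>)\<^sup>2) (r * \<bar>e 0 \<omega>\<bar> ^ 3))" if "r \<ge> 0" for r
      by (rule Bochner_Integration.integrable_bound[OF integrable_mult_right[OF sq, of 6]]) (use em that in auto)
    show "integrable M (\<lambda>\<omega>. min (6 * (e 0 \<omega>)\<^sup>2) (r * \<bar>e 0 \<omega>\<bar> ^ 3))"
      "integrable M (\<lambda>\<omega>. min (6 * (e 0 \<omega>)\<^sup>2) (r' * \<bar>e 0 \<omega>\<bar> ^ 3))" using int that by auto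
    show "min (6 * (e 0 \<omega>)\<^sup>2) (r * \<bar>e 0 \<omega>\<bar> ^ 3) \<le> min (6 * (e 0 \<omega>)\<^sup>2) (r' * \<bar>e 0 \<omega>\<bar> ^ 3)" for \<omega>
      using that by (intro min.mono mult_right_mono) auto
  qed
  have factor: "cmod (?\<phi> (t * c i) - complex_of_real (exp (- y i))) \<le>
      t\<^sup>2 * (c i)\<^sup>2 * (?\<eta> (\<bar>t\<bar> * \<delta>) / 6 + t\<^sup>2 * \<delta>\<^sup>2 * \<sigma> ^ 4 / 8)" if i: "i < n" for i
  proof -
    have "cmod (?\<phi> (t * c i) - (1 - (t * c i)\<^sup>2 * \<sigma>\<^sup>2 / 2)) \<le> ((t * c i)\<^sup>2 / 6) * expectation (\<lambda>\<omega>. min (6 * (e 0 \<omega>)\<^sup>2) (\<bar>t * c i\<bar> * \<bar>e 0 \<omega>\<bar> ^ 3))"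
      by (rule char_approx3'[OF em iid_errors_integrable(2)[OF iid] sq]) (use iid in \<open>auto simp: iid_errors_def\<close>)
    then have "cmod (?\<phi> (t * c i) - complex_of_real (1 - y i)) \<le> ((t * c i)\<^sup>2 / 6) * ?\<eta> \<bar>t * c i\<bar>"
      by (simp add: lindeberg_moment_def y_def)
    also have "\<dots> \<le> ((t * c i)\<^sup>2 / 6) * ?\<eta> (\<bar>t\<bar> * \<delta>)"
      using c(2)[OF i] by (intro mult_left_mono mono) (auto simp: abs_mult intro!: mult_left_mono)
    finally have 1: "cmod (?\<phi> (t * c i) - complex_of_real (1 - y i)) \<le> ((t * c i)\<^sup>2 / 6) * ?\<eta> (\<bar>t\<bar> * \<delta>)" .
    have "cmod (complex_of_real (1 - y i) - complex_of_real (exp (- y i))) = \<bar>(1 - y i) - exp (- y i)\<bar>"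
      by (simp only: of_real_diff[symmetric] norm_of_real)
    also have "\<dots> \<le> (y i)\<^sup>2 / 2" by (rule exp_minus_quadratic[OF y0])
    also have "\<dots> = t\<^sup>2 * (c i)\<^sup>2 * (t\<^sup>2 * (c i)\<^sup>2 * \<sigma> ^ 4 / 8)"
      by (simp add: y_def power_mult_distrib power2_eq_square power4_eq_xxxx)
    also have "\<dots> \<le> t\<^sup>2 * (c i)\<^sup>2 * (t\<^sup>2 * \<delta>\<^sup>2 * \<sigma> ^ 4 / 8)"
    proof -
      have "(c i)\<^sup>2 \<le> \<delta>\<^sup>2" using c(2)[OF i] by (metis abs_ge_zero power2_abs power_mono)
      then show ?thesis by (intro mult_left_mono divide_right_mono mult_right_mono) auto
    qed
    finally have 2: "cmod (complex_of_real (1 - y i) - complex_of_real (exp (- y i))) \<le> t\<^sup>2 * (c i)\<^sup>2 * (t\<^sup>2 * \<delta>\<^sup>2 * \<sigma> ^ 4 / 8)" .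
    have "cmod (?\<phi> (t * c i) - complex_of_real (exp (- y i))) \<le>
        cmod (?\<phi> (t * c i) - complex_of_real (1 - y i)) + cmod (complex_of_real (1 - y i) - complex_of_real (exp (- y i)))"
      using norm_triangle_ineq[of "?\<phi> (t * c i) - complex_of_real (1 - y i)" "complex_of_real (1 - y i) - complex_of_real (exp (- y i))"] by simp
    then show ?thesis using 1 2 by (simp add: power_mult_distrib distrib_left)
  qed
  have "exp (\<Sum>i<n. - y i) = (\<Prod>i<n. exp (- y i))" by (rule exp_sum) simp
  then have "exp (- (t\<^sup>2 / 2)) = (\<Prod>i<n. exp (- y i))" by (simp only: sum_negf sumy)
  then have "complex_of_real (exp (- (t\<^sup>2 / 2))) = (\<Prod>i<n. complex_of_real (exp (- y i)))" by (simp only: of_real_prod)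
  then have "cmod ((\<Prod>i<n. ?\<phi> (t * c i)) - exp (- (t\<^sup>2 / 2))) = cmod ((\<Prod>i<n. ?\<phi> (t * c i)) - (\<Prod>i<n. complex_of_real (exp (- y i))))"
    by (simp add: exp_of_real[symmetric])
  also have "\<dots> \<le> (\<Sum>i<n. cmod (?\<phi> (t * c i) - complex_of_real (exp (- y i))))"
  proof (rule norm_prod_diff)
    show "cmod (?\<phi> (t * c i)) \<le> 1" for i by (rule E0.cmod_char_le_1)
    show "cmod (complex_of_real (exp (- y i))) \<le> 1" for i using y0[of i] by (simp only: norm_of_real) simp
  qed
  also have "\<dots> \<le> (\<Sum>i<n. t\<^sup>2 * (c i)\<^sup>2 * (?\<eta> (\<bar>t\<bar> * \<delta>) / 6 + t\<^sup>2 * \<delta>\<^sup>2 * \<sigma> ^ 4 / 8))"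
    by (intro sum_mono factor) simp
  also have "\<dots> = t\<^sup>2 * (\<Sum>i<n. (c i)\<^sup>2) * (?\<eta> (\<bar>t\<bar> * \<delta>) / 6 + t\<^sup>2 * \<delta>\<^sup>2 * \<sigma> ^ 4 / 8)"
    by (simp add: sum_distrib_left sum_distrib_right)
  also have "(\<Sum>i<n. (c i)\<^sup>2) = 1 / \<sigma>\<^sup>2" using c(1) \<sigma> by (simp add: field_simps)
  finally show ?thesis by simp
qed

lemma (in prob_space) lindeberg_moment_tendsto:
  assumes Y: "Y \<in> borel_measurable M" "integrable M (\<lambda>\<omega>. (Y \<omega>)\<^sup>2)" and r: "r \<longlonglongrightarrow> 0" "\<And>n. r n \<ge> 0"
  shows "(\<lambda>n. lindeberg_moment M Y (r n)) \<longlonglongrightarrow> 0"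
proof -
  have "(\<lambda>n. lindeberg_moment M Y (r n)) \<longlonglongrightarrow> (LINT \<omega>|M. (0::real))"
    unfolding lindeberg_moment_def
  proof (rule integral_dominated_convergence[where w = "\<lambda>\<omega>. 6 * (Y \<omega>)\<^sup>2"])
    show "AE \<omega> in M. (\<lambda>n. min (6 * (Y \<omega>)\<^sup>2) (r n * \<bar>Y \<omega>\<bar> ^ 3)) \<longlonglongrightarrow> 0"
    proof (rule AE_I2)
      fix \<omega>
      have "(\<lambda>n. min (6 * (Y \<omega>)\<^sup>2) (r n * \<bar>Y \<omega>\<bar> ^ 3)) \<longlonglongrightarrow> min (6 * (Y \<omega>)\<^sup>2) (0 * \<bar>Y \<omega>\<bar> ^ 3)"
        by (intro tendsto_min tendsto_mult tendsto_const r)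
      then show "(\<lambda>n. min (6 * (Y \<omega>)\<^sup>2) (r n * \<bar>Y \<omega>\<bar> ^ 3)) \<longlonglongrightarrow> 0" by simp
    qed
    show "AE \<omega> in M. norm (min (6 * (Y \<omega>)\<^sup>2) (r n * \<bar>Y \<omega>\<bar> ^ 3)) \<le> 6 * (Y \<omega>)\<^sup>2" for n
      using r(2)[of n] by (intro AE_I2) auto
  qed (use Y in auto)
  then show ?thesis by simp
qed

lemma bigtheta_powr:
  fixes lam :: "nat \<Rightarrow> real"
  assumes th: "lam \<in> \<Theta>(\<lambda>n. 1 / real n)" and pos: "\<And>n. lam n > 0"
  obtains k where "k > 0" "\<forall>\<^sub>F n in sequentially. lam n powr q \<le> k * real n powr (- q) \<and> real n powr (- q) \<le> k * lam n powr q"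
proof -
  obtain c1 c2 where c: "c1 > 0" "c2 > 0" "\<forall>\<^sub>F n in sequentially. norm (lam n) \<le> c1 * norm (1 / real n)"
    "\<forall>\<^sub>F n in sequentially. norm (1 / real n) \<le> c2 * norm (lam n)"
  proof -
    have "lam \<in> O(\<lambda>n. 1 / real n)" "(\<lambda>n. 1 / real n) \<in> O(lam)"
      using th by (auto simp: bigtheta_def bigomega_iff_bigo)
    then show thesis using that by (elim landau_o.bigE) blast
  qed
  define k where "k = c1 powr \<bar>q\<bar> + c2 powr \<bar>q\<bar>"
  have k: "k > 0" using c by (simp add: k_def add_pos_pos)
  have "\<forall>\<^sub>F n in sequentially. lam n powr q \<le> k * real n powr (- q) \<and> real n powr (- q) \<le> k * lam n powr q"
    using c(3,4) eventually_gt_at_top[of 0]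
  proof eventually_elim
    case (elim n)
    have n: "real n > 0" using elim by simp
    have le1: "lam n \<le> c1 * (1 / real n)" and le2: "1 / real n \<le> c2 * lam n"
      using elim pos[of n] by auto
    have np: "(1 / real n) powr q = real n powr (- q)" using n by (simp add: powr_divide powr_minus_divide)
    have up: "x powr q' \<le> C powr q' * y powr q'" if "x \<le> C * y" "0 < x" "0 < y" "0 < C" "q' \<ge> 0" for x y C q' :: real
    proof -
      have "x powr q' \<le> (C * y) powr q'" using that by (intro powr_mono2) auto
      then show ?thesis using that by (simp add: powr_mult)
    qed
    \<comment> \<open>A negative exponent reverses inequalities, so the opposite bound is used; the
      two bounds are therefore given one common constant, the maximum below.\<close>
    have up2: "x powr q \<le> C powr \<bar>q\<bar> * y powr q" if "x \<le> C * y" "y \<le> C' * x" "0 < x" "0 < y" "0 < C" "0 < C'" "q \<ge> 0 \<or> C = C'" for x y C C'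
    proof (cases "q \<ge> 0")
      case True then show ?thesis using up[of x C y q] that by simp
    next
      case False
      then have "y powr (- q) \<le> C powr (- q) * x powr (- q)" using up[of y C x "- q"] that by simp
      then have "(x powr q * y powr q) * y powr (- q) \<le> (x powr q * y powr q) * (C powr (- q) * x powr (- q))"
        by (intro mult_left_mono) auto
      moreover have "x powr q * y powr q * y powr (- q) = x powr q" using that by (simp add: mult.assoc flip: powr_add)
      moreover have "(x powr q * y powr q) * (C powr (- q) * x powr (- q)) = C powr (- q) * y powr q * (x powr q * x powr (- q))" by simp
      moreover have "x powr q * x powr (- q) = 1" using that by (simp flip: powr_add)
      ultimately show ?thesis using False by simp
    qed
    let ?c = "max c1 c2"
    have mx: "lam n \<le> ?c * (1 / real n)" "1 / real n \<le> ?c * lam n"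
      using le1 le2 n pos[of n] by (auto intro: order_trans[OF _ mult_right_mono] order_trans[OF _ divide_right_mono])
    have kk: "?c powr \<bar>q\<bar> \<le> k" by (auto simp: k_def max_def)
    have "lam n powr q \<le> ?c powr \<bar>q\<bar> * (1 / real n) powr q" using mx n pos[of n] c by (intro up2[of _ _ _ ?c]) auto
    also have "\<dots> \<le> k * (1 / real n) powr q" by (intro mult_right_mono kk) simp
    finally have A: "lam n powr q \<le> k * real n powr (- q)" by (simp only: np)
    have "(1 / real n) powr q \<le> ?c powr \<bar>q\<bar> * lam n powr q" using mx n pos[of n] c by (intro up2[of _ _ _ ?c]) auto
    also have "\<dots> \<le> k * lam n powr q" by (intro mult_right_mono kk) simp
    finally have "real n powr (- q) \<le> k * lam n powr q" by (simp only: np)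
    with A show ?case by blast
  qed
  with k show thesis by (rule that)
qed

subsection \<open>Kernel ridge regression in a Sobolev space\<close>

text \<open>Collects the hypotheses that do not mention a regression function: the suprema range
  over the unit ball, and a given sequence of functions occurs in the limit law alone.\<close>

locale krr_setup = rkhs \<Omega> K H ip + prob_space M
  for \<Omega> :: "(real ^ 'd::finite) set" and K :: "real ^ 'd \<Rightarrow> real ^ 'd \<Rightarrow> real"
    and H :: "(real ^ 'd \<Rightarrow> real) set" and ip :: "(real ^ 'd \<Rightarrow> real) \<Rightarrow> (real ^ 'd \<Rightarrow> real) \<Rightarrow> real"
    and M :: "'w measure" +
  fixes m \<sigma> :: real and \<alpha> :: "'d \<Rightarrow> nat" and x0 :: "real ^ 'd"
    and X :: "nat \<Rightarrow> nat \<Rightarrow> 'w \<Rightarrow> real ^ 'd" and e :: "nat \<Rightarrow> 'w \<Rightarrow> real" and lam :: "nat \<Rightarrow> real"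
  assumes convex: "convex \<Omega>" and compact: "compact \<Omega>" and interior: "interior \<Omega> \<noteq> {}"
    and sobolev: "equals_sobolev \<Omega> m H ip"
    and m_gt: "m > real CARD('d) / 2 + real (mi_order \<alpha>)"
    and design: "\<And>n i \<omega>. i < n \<Longrightarrow> \<omega> \<in> space M \<Longrightarrow> X n i \<omega> \<in> \<Omega>"
    and indep: "\<And>n. indep_rv M (PiM {..<n} (\<lambda>_. borel)) (\<lambda>\<omega>. \<lambda>i\<in>{..<n}. X n i \<omega>)
      (PiM {..<n} (\<lambda>_. borel)) (\<lambda>\<omega>. \<lambda>i\<in>{..<n}. e i \<omega>)"
    and iid: "iid_errors M e \<sigma>"
    and comparison: "norm_comparison M \<Omega> m H ip X"
    and lam_pos: "\<And>n. lam n > 0"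
    and lam_small: "lam \<in> o(\<lambda>n. 1)"
    and lam_large: "(\<lambda>n. 1 / lam n) \<in> o(\<lambda>n. real n powr (2 * m / real CARD('d)))"
    and x0: "x0 \<in> interior \<Omega>"
begin

abbreviation (input) "ord \<equiv> real (mi_order \<alpha>)"

lemma m_pos: "m > 0" using m_gt by (rule le_less_trans[rotated]) simp

lemma H_iff: "u \<in> H \<longleftrightarrow> continuous_on \<Omega> u \<and> (\<forall>x. x \<notin> \<Omega> \<longrightarrow> u x = 0) \<and> in_sobolev (interior \<Omega>) m u"
  using sobolev unfolding equals_sobolev_def by blast

lemma H_continuous: "u \<in> H \<Longrightarrow> continuous_on \<Omega> u" and H_sobolev: "u \<in> H \<Longrightarrow> in_sobolev (interior \<Omega>) m u"
  using H_iff by auto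

lemma norm_equivalence:
  obtains c C where "c > 0" "C > 0" "\<And>u. u \<in> H \<Longrightarrow> sobolev_norm (interior \<Omega>) m u \<le> c * ip_norm ip u"
    "\<And>u. u \<in> H \<Longrightarrow> ip_norm ip u \<le> C * sobolev_norm (interior \<Omega>) m u"
proof -
  obtain c C where c: "c > 0" "C > 0" "\<And>u. u \<in> H \<Longrightarrow> c * sobolev_norm (interior \<Omega>) m u \<le> ip_norm ip u"
    "\<And>u. u \<in> H \<Longrightarrow> ip_norm ip u \<le> C * sobolev_norm (interior \<Omega>) m u"
    using sobolev unfolding equals_sobolev_def by blast
  then show thesis by (intro that[of "1 / c" C]) (auto simp: field_simps)
qed

lemma bounded_interior: "bounded (interior \<Omega>)"
  using compact by (meson Elementary_Metric_Spaces.bounded_interior compact_imp_bounded)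

lemma H_borel: "u \<in> H \<Longrightarrow> u \<in> borel_measurable borel"
proof -
  assume u: "u \<in> H"
  have "(\<lambda>z. indicator \<Omega> z *\<^sub>R u z) \<in> borel_measurable borel"
    by (rule borel_measurable_continuous_on_indicator) (use H_continuous[OF u] compact in \<open>auto simp: borel_compact\<close>)
  moreover have "(\<lambda>z. indicator \<Omega> z *\<^sub>R u z) = u" using zero_outside[OF u] by (auto simp: indicator_def fun_eq_iff)
  ultimately show "u \<in> borel_measurable borel" by simp
qed

text \<open>Links the two domains of integration: the norm comparison uses \<open>\<Omega>\<close>,
  the Sobolev estimates its interior.\<close>

lemma L2_interior_le: "u \<in> H \<Longrightarrow> L2_norm (interior \<Omega>) u \<le> L2_norm \<Omega> u"
proof -
  assume u: "u \<in> H"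
  have int: "integrable lborel (\<lambda>x. indicator \<Omega> x *\<^sub>R (u x)\<^sup>2)"
    by (intro borel_integrable_compact compact continuous_on_power H_continuous u)
  have "(\<integral>x. indicator (interior \<Omega>) x *\<^sub>R (u x)\<^sup>2 \<partial>lborel) \<le> (\<integral>x. indicator \<Omega> x *\<^sub>R (u x)\<^sup>2 \<partial>lborel)"
  proof (rule integral_mono[OF _ int])
    have "integrable lborel (\<lambda>x. indicator (interior \<Omega>) x *\<^sub>R (indicator \<Omega> x *\<^sub>R (u x)\<^sup>2))"
      by (intro integrable_mult_indicator int) simp
    moreover have "(\<lambda>x. indicator (interior \<Omega>) x *\<^sub>R (indicator \<Omega> x *\<^sub>R (u x)\<^sup>2)) = (\<lambda>x. indicator (interior \<Omega>) x *\<^sub>R (u x)\<^sup>2)"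
      using interior_subset[of \<Omega>] by (auto simp: indicator_def fun_eq_iff)
    ultimately show "integrable lborel (\<lambda>x. indicator (interior \<Omega>) x *\<^sub>R (u x)\<^sup>2)" by (simp only:)
    show "indicator (interior \<Omega>) x *\<^sub>R (u x)\<^sup>2 \<le> indicator \<Omega> x *\<^sub>R (u x)\<^sup>2" for x
      using interior_subset[of \<Omega>] by (auto simp: indicator_def)
  qed
  then show ?thesis by (simp add: L2_norm_def set_lebesgue_integral_def)
qed

text \<open>The term of order 0 in the Sobolev norm is a chosen weak derivative, which agrees with
  \<open>u\<close> almost everywhere.\<close>

lemma L2_le_sobolev:
  assumes u: "u \<in> H" shows "L2_norm (interior \<Omega>) u \<le> sobolev_norm (interior \<Omega>) m u"
proof -
  let ?U = "interior \<Omega>" and ?z = "\<lambda>_ :: 'd. 0 :: nat"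
  have z: "mi_order ?z = 0" by (simp add: mi_order_def)
  then have "mi_list ?z = []" using length_mi_list[of ?z] by simp
  then have mz: "mi_deriv ?z \<phi> = \<phi>" for \<phi> by (simp add: mi_deriv_eq)
  have L2: "L2_on ?U u" using H_sobolev[OF u] by (simp add: in_sobolev_def)
  have "has_weak_deriv ?U ?z u u" using L2 by (simp add: has_weak_deriv_def mz z)
  moreover have wd: "has_weak_deriv ?U ?z u (weak_deriv ?U ?z u)"
    by (rule in_sobolev_weak_deriv[OF H_sobolev[OF u]]) (simp add: z)
  ultimately have "AE x in lborel. indicator ?U x * u x = indicator ?U x * weak_deriv ?U ?z u x"
    by (intro weak_deriv_unique[OF open_interior bounded_interior L2_on_integrable[OF _ bounded_interior open_interior]])
  then have "L2_norm ?U u = L2_norm ?U (weak_deriv ?U ?z u)"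
    using L2 wd by (intro L2_norm_cong_AE) (auto simp: has_weak_deriv_def)
  also have "\<dots> \<le> sobolev_norm ?U m u" by (rule L2_norm_weak_deriv_le) (simp add: z)
  finally show ?thesis .
qed

text \<open>\<open>deriv\<close> is not additive on arbitrary functions; on \<open>H\<close>
  linearity rests on the convergence of the mollified derivatives.\<close>

lemma mi_deriv_linear:
  assumes "u \<in> H" "v \<in> H"
  shows "mi_deriv \<alpha> (\<lambda>x. p * u x + q * v x) x0 = p * mi_deriv \<alpha> u x0 + q * mi_deriv \<alpha> v x0"
proof -
  have "(\<lambda>x. p * u x + q * v x) \<in> H" using assms by (intro add_mem scale_mem)
  then show ?thesis
    unfolding mi_deriv_eq
    by (intro sobolev_deriv(2)[OF compact x0]) (use assms m_gt H_continuous H_sobolev in \<open>auto simp: length_mi_list\<close>)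
qed

lemma sobolev_le_ip_norm:
  obtains c where "c \<ge> 1" "\<And>u a b. u \<in> H \<Longrightarrow> a \<ge> 0 \<Longrightarrow> b \<ge> 0 \<Longrightarrow>
    a * L2_norm (interior \<Omega>) u + b * sobolev_norm (interior \<Omega>) m u \<le> c * (a * L2_norm \<Omega> u + b * ip_norm ip u)"
proof -
  obtain c C where cC: "c > 0" "C > 0" "\<And>u. u \<in> H \<Longrightarrow> sobolev_norm (interior \<Omega>) m u \<le> c * ip_norm ip u"
    "\<And>u. u \<in> H \<Longrightarrow> ip_norm ip u \<le> C * sobolev_norm (interior \<Omega>) m u" by (rule norm_equivalence) blast
  have "a * L2_norm (interior \<Omega>) u + b * sobolev_norm (interior \<Omega>) m u \<le> (1 + c) * (a * L2_norm \<Omega> u + b * ip_norm ip u)"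
    if u: "u \<in> H" and ab: "a \<ge> 0" "b \<ge> 0" for u a b
  proof -
    have "0 \<le> c * (a * L2_norm \<Omega> u)" "0 \<le> b * ip_norm ip u" using ab cC(1) ip_norm_nonneg[OF u] by auto
    moreover have "a * L2_norm (interior \<Omega>) u \<le> a * L2_norm \<Omega> u" "b * sobolev_norm (interior \<Omega>) m u \<le> b * (c * ip_norm ip u)"
      using ab by (auto intro!: mult_left_mono L2_interior_le cC(3) u)
    ultimately show ?thesis by (simp add: algebra_simps)
  qed
  then show thesis using cC(1) by (intro that[of "1 + c"]) auto
qed

lemma mi_deriv_interpolation:
  obtains C where "C \<ge> 0" "\<And>v t. v \<in> H \<Longrightarrow> 0 < t \<Longrightarrow> t \<le> 1 \<Longrightarrow>
    \<bar>mi_deriv \<alpha> v x0\<bar> \<le> C * (t powr (- (real CARD('d) / 2) - ord) * L2_norm \<Omega> v + t powr (m - (real CARD('d) / 2) - ord) * ip_norm ip v)"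
proof -
  obtain C0 where C0: "C0 \<ge> 0" "\<And>v t. continuous_on \<Omega> v \<Longrightarrow> in_sobolev (interior \<Omega>) m v \<Longrightarrow> 0 < t \<Longrightarrow> t \<le> 1 \<Longrightarrow>
      \<bar>iter_partial (mi_list \<alpha>) v x0\<bar> \<le> C0 * (t powr (- (real CARD('d) / 2) - ord) * L2_norm (interior \<Omega>) v + t powr (m - (real CARD('d) / 2) - ord) * sobolev_norm (interior \<Omega>) m v)"
    using sobolev_deriv(1)[OF compact x0, of "mi_list \<alpha>" m] m_gt unfolding length_mi_list by auto
  obtain c where c: "c \<ge> 1" "\<And>u a b. u \<in> H \<Longrightarrow> a \<ge> 0 \<Longrightarrow> b \<ge> 0 \<Longrightarrow>
    a * L2_norm (interior \<Omega>) u + b * sobolev_norm (interior \<Omega>) m u \<le> c * (a * L2_norm \<Omega> u + b * ip_norm ip u)"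
    by (rule sobolev_le_ip_norm) blast
  show thesis
  proof (rule that[of "C0 * c"])
    fix v and t :: real assume v: "v \<in> H" and t: "0 < t" "t \<le> 1"
    show "\<bar>mi_deriv \<alpha> v x0\<bar> \<le> C0 * c * (t powr (- (real CARD('d) / 2) - ord) * L2_norm \<Omega> v + t powr (m - (real CARD('d) / 2) - ord) * ip_norm ip v)"
      using order_trans[OF C0(2)[OF H_continuous[OF v] H_sobolev[OF v] t] mult_left_mono[OF c(2)[OF v] C0(1)]]
      by (simp add: mi_deriv_eq mult.assoc)
  qed (use C0(1) c(1) in simp)
qed

lemma H_sup_bound:
  obtains C where "C \<ge> 0" "\<And>v x t. v \<in> H \<Longrightarrow> x \<in> \<Omega> \<Longrightarrow> 0 < t \<Longrightarrow> t \<le> 1 \<Longrightarrow>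
    \<bar>v x\<bar> \<le> C * (t powr (- (real CARD('d) / 2)) * L2_norm \<Omega> v + t powr (m - (real CARD('d) / 2)) * ip_norm ip v)"
proof -
  have "m > real CARD('d) / 2" using m_gt by (rule le_less_trans[rotated]) simp
  then obtain C0 where C0: "C0 \<ge> 0" "\<And>x v t. x \<in> \<Omega> \<Longrightarrow> continuous_on \<Omega> v \<Longrightarrow> in_sobolev (interior \<Omega>) m v \<Longrightarrow> 0 < t \<Longrightarrow> t \<le> 1 \<Longrightarrow>
      \<bar>v x\<bar> \<le> C0 * (t powr (- real CARD('d) / 2) * L2_norm (interior \<Omega>) v + t powr (m - (real CARD('d) / 2)) * sobolev_norm (interior \<Omega>) m v)"
    using sobolev_sup_bound[OF convex compact interior, of m] by blast
  obtain c where c: "c \<ge> 1" "\<And>u a b. u \<in> H \<Longrightarrow> a \<ge> 0 \<Longrightarrow> b \<ge> 0 \<Longrightarrow>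
    a * L2_norm (interior \<Omega>) u + b * sobolev_norm (interior \<Omega>) m u \<le> c * (a * L2_norm \<Omega> u + b * ip_norm ip u)"
    by (rule sobolev_le_ip_norm) blast
  show thesis
  proof (rule that[of "C0 * c"])
    fix v x and t :: real assume v: "v \<in> H" and x: "x \<in> \<Omega>" and t: "0 < t" "t \<le> 1"
    show "\<bar>v x\<bar> \<le> C0 * c * (t powr (- (real CARD('d) / 2)) * L2_norm \<Omega> v + t powr (m - (real CARD('d) / 2)) * ip_norm ip v)"
      using order_trans[OF C0(2)[OF x H_continuous[OF v] H_sobolev[OF v] t] mult_left_mono[OF c(2)[OF v] C0(1)]]
      by (simp add: mult.assoc)
  qed (use C0(1) c(1) in simp)
qed

definition ell :: "real ^ 'd \<Rightarrow> real" where
  "ell = (SOME l. l \<in> H \<and> (\<forall>v\<in>H. mi_deriv \<alpha> v x0 = ip v l))"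

text \<open>The Sobolev estimate at scale 1 bounds derivative evaluation on \<open>H\<close>, so the
  representation theorem provides a witness for the choice.\<close>

lemma ell: "ell \<in> H" "v \<in> H \<Longrightarrow> mi_deriv \<alpha> v x0 = ip v ell"
proof -
  obtain C1 where C1: "C1 \<ge> 0" "\<And>v t. continuous_on \<Omega> v \<Longrightarrow> in_sobolev (interior \<Omega>) m v \<Longrightarrow> 0 < t \<Longrightarrow> t \<le> 1 \<Longrightarrow>
      \<bar>iter_partial (mi_list \<alpha>) v x0\<bar> \<le> C1 * (t powr (- (real CARD('d) / 2) - ord) * L2_norm (interior \<Omega>) v + t powr (m - (real CARD('d) / 2) - ord) * sobolev_norm (interior \<Omega>) m v)"
    using sobolev_deriv(1)[OF compact x0, of "mi_list \<alpha>" m] m_gt unfolding length_mi_list by auto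
  obtain c C where cC: "c > 0" "C > 0" "\<And>u. u \<in> H \<Longrightarrow> sobolev_norm (interior \<Omega>) m u \<le> c * ip_norm ip u"
    "\<And>u. u \<in> H \<Longrightarrow> ip_norm ip u \<le> C * sobolev_norm (interior \<Omega>) m u" by (rule norm_equivalence) blast
  have "\<bar>mi_deriv \<alpha> v x0\<bar> \<le> (C1 * (2 * c)) * ip_norm ip v" if v: "v \<in> H" for v
  proof -
    have "\<bar>mi_deriv \<alpha> v x0\<bar> \<le> C1 * (L2_norm (interior \<Omega>) v + sobolev_norm (interior \<Omega>) m v)"
      using C1(2)[OF H_continuous[OF v] H_sobolev[OF v], of 1] by (simp add: mi_deriv_eq)
    also have "\<dots> \<le> C1 * (2 * (c * ip_norm ip v))"
      using L2_le_sobolev[OF v] cC(3)[OF v] by (intro mult_left_mono C1(1)) linarith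
    finally show ?thesis by (simp add: mult.assoc)
  qed
  then obtain l where l: "l \<in> H" "\<And>v. v \<in> H \<Longrightarrow> mi_deriv \<alpha> v x0 = ip v l"
    using riesz[of "\<lambda>v. mi_deriv \<alpha> v x0" "C1 * (2 * c)"] mi_deriv_linear by blast
  then have "ell \<in> H \<and> (\<forall>v\<in>H. mi_deriv \<alpha> v x0 = ip v ell)"
    unfolding ell_def by (intro someI[of "\<lambda>l. l \<in> H \<and> (\<forall>v\<in>H. mi_deriv \<alpha> v x0 = ip v l)" l]) auto
  then show "ell \<in> H" "v \<in> H \<Longrightarrow> mi_deriv \<alpha> v x0 = ip v ell" by auto
qed

text \<open>Near the interior point \<open>x0\<close> the kernel agrees with its section in
  \<open>H\<close>, so it has the same derivatives there. This links the matrix formula of the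
  variance to the weights.\<close>

lemma mi_deriv_kernel:
  assumes y: "y \<in> \<Omega>" shows "mi_deriv \<alpha> (\<lambda>z. K z y) x0 = ell y"
proof -
  have "mi_deriv \<alpha> (\<lambda>z. K z y) x0 = mi_deriv \<alpha> (kernel_section \<Omega> K y) x0"
    unfolding mi_deriv_eq
    by (rule iter_partial_cong_on[OF open_interior _ x0]) (use interior_subset[of \<Omega>] in \<open>auto simp: kernel_section_def\<close>)
  also have "\<dots> = ip (kernel_section \<Omega> K y) ell" by (rule ell(2)[OF kernel_section(1)[OF y]])
  also have "\<dots> = ell y"
    using ip_sym[OF kernel_section(1)[OF y] ell(1)] kernel_section(2)[OF ell(1) y] by simp
  finally show ?thesis .
qed

lemma test_functions:
  obtains h0 C c where "0 < h0" "C > 0" "c > 0" "\<And>h. 0 < h \<Longrightarrow> h \<le> h0 \<Longrightarrow>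
    \<exists>u\<in>H. ip_norm ip u \<le> C * h powr ((real CARD('d) / 2) - m) \<and> L2_norm \<Omega> u \<le> C * h powr (real CARD('d) / 2) \<and> \<bar>ip u ell\<bar> = c * h powr (- ord)"
proof -
  obtain h0 C0 c0 where *: "0 < h0" "C0 \<ge> 0" "c0 > 0" "\<And>h. 0 < h \<Longrightarrow> h \<le> h0 \<Longrightarrow>
    (\<exists>u. continuous_on \<Omega> u \<and> (\<forall>x. x \<notin> \<Omega> \<longrightarrow> u x = 0) \<and> in_sobolev (interior \<Omega>) m u \<and>
      sobolev_norm (interior \<Omega>) m u \<le> C0 * h powr ((real CARD('d) / 2) - m) \<and> L2_norm \<Omega> u \<le> C0 * h powr (real CARD('d) / 2) \<and>
      \<bar>iter_partial (mi_list \<alpha>) u x0\<bar> = c0 * h powr (- ord))"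
    using sobolev_test_functions[OF compact x0 m_pos, of "mi_list \<alpha>"] unfolding length_mi_list by blast
  obtain c C where cC: "c > 0" "C > 0" "\<And>u. u \<in> H \<Longrightarrow> sobolev_norm (interior \<Omega>) m u \<le> c * ip_norm ip u"
    "\<And>u. u \<in> H \<Longrightarrow> ip_norm ip u \<le> C * sobolev_norm (interior \<Omega>) m u" by (rule norm_equivalence) blast
  let ?C = "(C + 1) * C0 + 1"
  have "?C > 0" using *(2) cC(2) by (intro add_nonneg_pos) auto
  moreover have "\<exists>u\<in>H. ip_norm ip u \<le> ?C * h powr ((real CARD('d) / 2) - m) \<and> L2_norm \<Omega> u \<le> ?C * h powr (real CARD('d) / 2) \<and> \<bar>ip u ell\<bar> = c0 * h powr (- ord)"
    if h: "0 < h" "h \<le> h0" for h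
  proof -
    obtain u where u: "continuous_on \<Omega> u" "\<forall>x. x \<notin> \<Omega> \<longrightarrow> u x = 0" "in_sobolev (interior \<Omega>) m u"
      "sobolev_norm (interior \<Omega>) m u \<le> C0 * h powr ((real CARD('d) / 2) - m)" "L2_norm \<Omega> u \<le> C0 * h powr (real CARD('d) / 2)"
      "\<bar>iter_partial (mi_list \<alpha>) u x0\<bar> = c0 * h powr (- ord)" using *(4)[OF h] by blast
    have uH: "u \<in> H" using u H_iff by blast
    have "ip_norm ip u \<le> C * (C0 * h powr ((real CARD('d) / 2) - m))"
      using cC(4)[OF uH] mult_left_mono[OF u(4), of C] cC(2) by linarith
    also have "\<dots> = (C * C0) * h powr ((real CARD('d) / 2) - m)" by simp
    also have "\<dots> \<le> ?C * h powr ((real CARD('d) / 2) - m)" using *(2) by (intro mult_right_mono) (auto simp: distrib_right)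
    finally have 1: "ip_norm ip u \<le> ?C * h powr ((real CARD('d) / 2) - m)" .
    have "C0 \<le> ?C" using *(2) cC(2) by (simp add: distrib_right add_increasing)
    then have 2: "L2_norm \<Omega> u \<le> ?C * h powr (real CARD('d) / 2)" using u(5) by (meson mult_right_mono order_trans powr_ge_zero)
    have "\<bar>ip u ell\<bar> = c0 * h powr (- ord)" using ell(2)[OF uH] u(6) by (simp add: mi_deriv_eq)
    with 1 2 uH show ?thesis by blast
  qed
  ultimately show thesis using *(1,3) that by blast
qed

end

text \<open>Reduces the order in probability to bounds at each outcome of a likely event.
  Measurability enters since the probability of a set that is not measurable is 0.\<close>

lemma (in prob_space) asymp_probI:
  assumes meas: "\<And>n. x n \<in> borel_measurable M" "\<And>n. y n \<in> borel_measurable M" and y: "\<And>n \<omega>. y n \<omega> \<ge> 0"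
    and bounds: "\<And>\<epsilon>. \<epsilon> > 0 \<Longrightarrow> \<exists>A. \<exists>c>0. \<forall>\<^sub>F n in sequentially. \<exists>G\<in>events. prob G \<ge> 1 - \<epsilon> \<and>
      (\<forall>\<omega>\<in>G. c * y n \<omega> \<le> x n \<omega> \<and> x n \<omega> \<le> A * y n \<omega>)"
  shows "asymp_prob M x y"
proof -
  have ev: "{\<omega> \<in> space M. \<bar>x n \<omega>\<bar> \<le> C * \<bar>y n \<omega>\<bar>} \<in> events" "{\<omega> \<in> space M. \<bar>y n \<omega>\<bar> \<le> C * \<bar>x n \<omega>\<bar>} \<in> events" for n C
    using meas[of n] by measurable
  have "\<exists>C D. \<forall>\<^sub>F n in sequentially. 1 - \<epsilon> \<le> \<P>(\<omega> in M. \<bar>x n \<omega>\<bar> \<le> C * \<bar>y n \<omega>\<bar>) \<and> 1 - \<epsilon> \<le> \<P>(\<omega> in M. \<bar>y n \<omega>\<bar> \<le> D * \<bar>x n \<omega>\<bar>)"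
    if \<epsilon>: "\<epsilon> > 0" for \<epsilon>
  proof -
    obtain A c where c: "c > 0" and G: "\<forall>\<^sub>F n in sequentially. \<exists>G\<in>events. prob G \<ge> 1 - \<epsilon> \<and>
      (\<forall>\<omega>\<in>G. c * y n \<omega> \<le> x n \<omega> \<and> x n \<omega> \<le> A * y n \<omega>)" using bounds[OF \<epsilon>] by blast
    have "\<forall>\<^sub>F n in sequentially. 1 - \<epsilon> \<le> \<P>(\<omega> in M. \<bar>x n \<omega>\<bar> \<le> A * \<bar>y n \<omega>\<bar>) \<and> 1 - \<epsilon> \<le> \<P>(\<omega> in M. \<bar>y n \<omega>\<bar> \<le> (1 / c) * \<bar>x n \<omega>\<bar>)"
      using G
    proof eventually_elim
      case (elim n)
      then obtain G where G: "G \<in> events" "prob G \<ge> 1 - \<epsilon>" "\<And>\<omega>. \<omega> \<in> G \<Longrightarrow> c * y n \<omega> \<le> x n \<omega> \<and> x n \<omega> \<le> A * y n \<omega>" by blast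
      have "\<bar>x n \<omega>\<bar> \<le> A * \<bar>y n \<omega>\<bar> \<and> \<bar>y n \<omega>\<bar> \<le> (1 / c) * \<bar>x n \<omega>\<bar>" if "\<omega> \<in> G" for \<omega>
      proof -
        have "0 \<le> c * y n \<omega>" using c y by simp
        then have "x n \<omega> \<ge> 0" using G(3)[OF that] by linarith
        then show ?thesis using G(3)[OF that] c y[of n \<omega>] by (simp add: field_simps)
      qed
      then have *: "G \<subseteq> {\<omega> \<in> space M. \<bar>x n \<omega>\<bar> \<le> A * \<bar>y n \<omega>\<bar>}" "G \<subseteq> {\<omega> \<in> space M. \<bar>y n \<omega>\<bar> \<le> (1 / c) * \<bar>x n \<omega>\<bar>}"
        using sets.sets_into_space[OF G(1)] by blast+
      show ?case using finite_measure_mono[OF *(1) ev(1)] finite_measure_mono[OF *(2) ev(2)] G(2) by linarith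
    qed
    then show ?thesis by blast
  qed
  then show ?thesis unfolding asymp_prob_def lesssim_prob_def eventually_conj_iff by blast
qed

text \<open>Independence concerns the design as a tuple restricted to the first \<open>n\<close>
  indices, so the weights must be functions of that tuple.\<close>

lemma gram_weights_restrict: "gram_weights K n lam l (restrict x {..<n}) i = gram_weights K n lam l x i"
proof -
  have "regularized_gram K n lam (restrict x {..<n}) = regularized_gram K n lam x"
    by (intro eq_matI) (auto simp: regularized_gram_def)
  then show ?thesis by (simp add: gram_weights_def)
qed

context krr_setup
begin

definition weight :: "nat \<Rightarrow> (nat \<Rightarrow> real ^ 'd) \<Rightarrow> nat \<Rightarrow> real" where
  "weight n = gram_weights (kernel_ext \<Omega> K) n (lam n) ell"

definition tuple :: "nat \<Rightarrow> 'w \<Rightarrow> nat \<Rightarrow> real ^ 'd" where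
  "tuple n \<omega> = (\<lambda>i\<in>{..<n}. X n i \<omega>)"

text \<open>The function called u in the overview, at one outcome of the random design.\<close>

definition rep :: "nat \<Rightarrow> 'w \<Rightarrow> real ^ 'd \<Rightarrow> real" where
  "rep n \<omega> = krr_representer \<Omega> K n (lam n) (\<lambda>i. X n i \<omega>) ell"

definition rate :: "nat \<Rightarrow> real" where
  "rate n = (lam n powr (1 / (2 * m))) powr (- (real CARD('d) / 2) - ord)"

lemma krr_solve_weight:
  assumes "\<omega> \<in> space M" "i < n"
  shows "krr_solve K n (lam n) (\<lambda>i. X n i \<omega>) (\<lambda>i. ell (X n i \<omega>)) i = weight n (tuple n \<omega>) i"
  using krr_solve_eq_gram_weights[of n "\<lambda>i. X n i \<omega>" "lam n" i ell] design[OF _ assms(1)] lam_pos assms(2)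
  by (simp add: weight_def tuple_def gram_weights_restrict)

text \<open>The last claim is phrased with \<open>tuple\<close> and \<open>kernel_ext\<close>, in
  which all terms are known to be measurable in the design.\<close>

lemma rep:
  assumes \<omega>: "\<omega> \<in> space M"
  shows "rep n \<omega> \<in> H" "i < n \<Longrightarrow> rep n \<omega> (X n i \<omega>) = real n * weight n (tuple n \<omega>) i"
    "v \<in> H \<Longrightarrow> ip v ell = (\<Sum>i<n. weight n (tuple n \<omega>) i * v (X n i \<omega>)) + lam n * ip (rep n \<omega>) v"
    "(lam n * ip_norm ip (rep n \<omega>))\<^sup>2 = ip ell ell - 2 * (\<Sum>i<n. weight n (tuple n \<omega>) i * ell (tuple n \<omega> i)) +
      (\<Sum>i<n. \<Sum>j<n. weight n (tuple n \<omega>) i * weight n (tuple n \<omega>) j * kernel_ext \<Omega> K (tuple n \<omega> j) (tuple n \<omega> i))"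
proof -
  note r = krr_representer[where n = n and x = "\<lambda>i. X n i \<omega>" and lam = "lam n" and l = ell,
      OF design[OF _ \<omega>] lam_pos ell(1)]
  show "rep n \<omega> \<in> H" using r(1) by (simp add: rep_def)
  show "i < n \<Longrightarrow> rep n \<omega> (X n i \<omega>) = real n * weight n (tuple n \<omega>) i"
    using r(2) by (simp add: rep_def krr_solve_weight[OF \<omega>])
  show "v \<in> H \<Longrightarrow> ip v ell = (\<Sum>i<n. weight n (tuple n \<omega>) i * v (X n i \<omega>)) + lam n * ip (rep n \<omega>) v"
    using r(3) by (simp add: rep_def krr_solve_weight[OF \<omega>])
  show "(lam n * ip_norm ip (rep n \<omega>))\<^sup>2 = ip ell ell - 2 * (\<Sum>i<n. weight n (tuple n \<omega>) i * ell (tuple n \<omega> i)) +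
      (\<Sum>i<n. \<Sum>j<n. weight n (tuple n \<omega>) i * weight n (tuple n \<omega>) j * kernel_ext \<Omega> K (tuple n \<omega> j) (tuple n \<omega> i))"
    using r(4) design[OF _ \<omega>] by (simp add: rep_def krr_solve_weight[OF \<omega>] power_mult_distrib tuple_def kernel_ext_def)
qed

text \<open>The weighted sum of the values of \<open>g\<close> is its derivative minus the penalty
  pairing, by the representer equation. So the error splits into noise and bias.\<close>

lemma mi_deriv_fit:
  assumes \<omega>: "\<omega> \<in> space M" and g: "g \<in> H"
  shows "mi_deriv \<alpha> (krr_fit H ip n (lam n) (\<lambda>i. X n i \<omega>) y g) x0 =
    mi_deriv \<alpha> g x0 + ((\<Sum>i<n. weight n (tuple n \<omega>) i * y i) - lam n * ip (rep n \<omega>) g)"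
proof -
  have x: "\<And>i. i < n \<Longrightarrow> X n i \<omega> \<in> \<Omega>" using design[OF _ \<omega>] by simp
  have "mi_deriv \<alpha> (krr_fit H ip n (lam n) (\<lambda>i. X n i \<omega>) y g) x0 = ip (krr_fit H ip n (lam n) (\<lambda>i. X n i \<omega>) y g) ell"
    unfolding krr_fit_def by (rule ell(2)[OF krr_mem[OF x lam_pos]])
  also have "\<dots> = (\<Sum>i<n. krr_solve K n (lam n) (\<lambda>i. X n i \<omega>) (\<lambda>i. ell (X n i \<omega>)) i * (g (X n i \<omega>) + y i))"
    unfolding krr_fit_def by (rule krr_functional[OF x lam_pos ell(1)])
  also have "\<dots> = (\<Sum>i<n. weight n (tuple n \<omega>) i * g (X n i \<omega>)) + (\<Sum>i<n. weight n (tuple n \<omega>) i * y i)"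
    by (simp add: krr_solve_weight[OF \<omega>] distrib_left sum.distrib)
  also have "(\<Sum>i<n. weight n (tuple n \<omega>) i * g (X n i \<omega>)) = ip g ell - lam n * ip (rep n \<omega>) g"
    using rep(3)[OF \<omega> g, of n] by simp
  finally show ?thesis by (simp add: ell(2)[OF g])
qed

lemma krr_var_weight:
  assumes \<omega>: "\<omega> \<in> space M"
  shows "krr_var K \<alpha> \<sigma> n (lam n) (\<lambda>i. X n i \<omega>) x0 = \<sigma>\<^sup>2 * (\<Sum>i<n. (weight n (tuple n \<omega>) i)\<^sup>2)"
proof -
  have x: "\<And>i. i < n \<Longrightarrow> X n i \<omega> \<in> \<Omega>" using design[OF _ \<omega>] by simp
  have "Matrix.vec n (\<lambda>i. mi_deriv \<alpha> (\<lambda>z. K z (X n i \<omega>)) x0) = Matrix.vec n (\<lambda>i. ell (X n i \<omega>))"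
    using x by (intro eq_vecI) (auto simp: mi_deriv_kernel)
  then show ?thesis
    using krr_var_eq[OF x lam_pos, where ?k0.0 = "\<lambda>i. ell (X n i \<omega>)" and s = "\<sigma>\<^sup>2"]
    unfolding krr_var_def by (simp add: krr_solve_weight[OF \<omega>])
qed

lemma borel_measurable_weight:
  assumes "i < n"
  shows "(\<lambda>x. weight n x i) \<in> borel_measurable (PiM {..<n} (\<lambda>_. borel))"
  unfolding weight_def
  by (rule borel_measurable_gram_weights[OF borel_measurable_kernel_ext H_borel[OF ell(1)] assms])
    (use compact rkhs_axioms H_continuous in \<open>auto simp: compact_imp_closed\<close>)

lemma tuple_measurable: "tuple n \<in> measurable M (PiM {..<n} (\<lambda>_. borel))"
  using indep[of n] by (simp add: indep_rv_def tuple_def[abs_def])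

lemma weight_tuple_measurable:
  assumes "i < n" shows "(\<lambda>\<omega>. weight n (tuple n \<omega>) i) \<in> borel_measurable M"
  by (rule measurable_compose[OF tuple_measurable borel_measurable_weight[OF assms]])

text \<open>The norm is the root of a polynomial in weights, values of \<open>ell\<close> and kernel
  values at the design.\<close>

lemma rep_norm_measurable: "(\<lambda>\<omega>. lam n * ip_norm ip (rep n \<omega>)) \<in> borel_measurable M"
proof -
  have comp: "(\<lambda>\<omega>. tuple n \<omega> i) \<in> borel_measurable M" if "i < n" for i
    by (rule measurable_compose[OF tuple_measurable measurable_component_singleton]) (use that in simp)
  have kern: "(\<lambda>\<omega>. kernel_ext \<Omega> K (tuple n \<omega> i) (tuple n \<omega> j)) \<in> borel_measurable M" if "i < n" "j < n" for i j
    using measurable_compose[OF measurable_Pair[OF comp[OF that(1)] comp[OF that(2)]] borel_measurable_kernel_ext[OF rkhs_axioms]]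
      compact_imp_closed[OF compact] H_continuous by simp
  have l: "(\<lambda>\<omega>. ell (tuple n \<omega> i)) \<in> borel_measurable M" if "i < n" for i
    by (rule measurable_compose[OF comp[OF that] H_borel[OF ell(1)]])
  let ?q = "\<lambda>\<omega>. ip ell ell - 2 * (\<Sum>i<n. weight n (tuple n \<omega>) i * ell (tuple n \<omega> i)) +
      (\<Sum>i<n. \<Sum>j<n. weight n (tuple n \<omega>) i * weight n (tuple n \<omega>) j * kernel_ext \<Omega> K (tuple n \<omega> j) (tuple n \<omega> i))"
  have "?q \<in> borel_measurable M"
    by (intro borel_measurable_add borel_measurable_diff borel_measurable_times borel_measurable_const
        borel_measurable_sum weight_tuple_measurable kern l) auto
  then have "(\<lambda>\<omega>. sqrt (?q \<omega>)) \<in> borel_measurable M" by (rule measurable_compose[OF _ borel_measurable_sqrt])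
  moreover have "sqrt (?q \<omega>) = lam n * ip_norm ip (rep n \<omega>)" if "\<omega> \<in> space M" for \<omega>
    using rep(4)[OF that, of n] ip_norm_nonneg[OF rep(1)[OF that, of n]] lam_pos[of n] by (metis mult_nonneg_nonneg less_imp_le real_sqrt_abs abs_of_nonneg)
  ultimately show ?thesis using measurable_cong[of M "\<lambda>\<omega>. sqrt (?q \<omega>)" "\<lambda>\<omega>. lam n * ip_norm ip (rep n \<omega>)" borel] by blast
qed

lemma rate_pos: "rate n > 0"
  using lam_pos[of n] by (simp add: rate_def)

lemma rate_eq: "rate n = lam n powr (- ((real CARD('d) + 2 * ord) / (4 * m)))"
proof -
  have "1 / (2 * m) * (- (real CARD('d) / 2) - ord) = - ((real CARD('d) + 2 * ord) / (4 * m))"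
    using m_pos by (simp add: field_simps)
  then show ?thesis by (simp only: rate_def powr_powr)
qed

lemma rate_sq: "(rate n)\<^sup>2 = lam n powr (- ((real CARD('d) + 2 * ord) / (2 * m)))"
proof -
  have "(rate n)\<^sup>2 = lam n powr (- ((real CARD('d) + 2 * ord) / (4 * m)) + - ((real CARD('d) + 2 * ord) / (4 * m)))"
    by (simp only: rate_eq power2_eq_square powr_add)
  also have "- ((real CARD('d) + 2 * ord) / (4 * m)) + - ((real CARD('d) + 2 * ord) / (4 * m)) = - ((real CARD('d) + 2 * ord) / (2 * m))"
    using m_pos by (simp add: field_simps)
  finally show ?thesis .
qed

lemma sqrt_rate: "sqrt (lam n) * rate n = lam n powr (1 / 2 - (real CARD('d) + 2 * ord) / (4 * m))"
proof -
  have "sqrt (lam n) * rate n = lam n powr (1 / 2) * lam n powr (- ((real CARD('d) + 2 * ord) / (4 * m)))"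
    using lam_pos[of n] by (simp add: rate_eq powr_half_sqrt)
  also have "\<dots> = lam n powr (1 / 2 + - ((real CARD('d) + 2 * ord) / (4 * m)))" by (simp only: powr_add)
  finally show ?thesis by simp
qed

lemma lam_powr_le:
  assumes "s > 0" shows "\<forall>\<^sub>F n in sequentially. lam n powr (1 / (2 * m)) \<le> s"
proof -
  have "\<forall>\<^sub>F n in sequentially. norm (lam n) \<le> s powr (2 * m) * norm (1::real)"
    using assms by (intro landau_o.smallD[OF lam_small]) simp
  then show ?thesis
  proof eventually_elim
    case (elim n)
    have "lam n powr (1 / (2 * m)) \<le> (s powr (2 * m)) powr (1 / (2 * m))"
      using elim lam_pos[of n] m_pos by (intro powr_mono2) auto
    then show ?case using assms m_pos by (simp add: powr_powr)
  qed
qed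

text \<open>The hypothesis on the reciprocal of \<open>lam\<close> after taking square roots, in the
  form in which it bounds the error coefficient of the norm comparison.\<close>

lemma lam_resolution:
  assumes "C > 0" "\<eta> > 0"
  shows "\<forall>\<^sub>F n in sequentially. C * real n powr (- m / real CARD('d)) \<le> \<eta> * sqrt (lam n)"
proof -
  have "\<forall>\<^sub>F n in sequentially. norm (1 / lam n) \<le> (\<eta> / C)\<^sup>2 * norm (real n powr (2 * m / real CARD('d)))"
    using assms by (intro landau_o.smallD[OF lam_large]) simp
  then show ?thesis using eventually_gt_at_top[of 0]
  proof eventually_elim
    case (elim n)
    define N where "N = real n powr (m / real CARD('d))"
    have N: "N > 0" using elim by (simp add: N_def)
    have N2: "real n powr (2 * m / real CARD('d)) = N\<^sup>2"
      by (simp add: N_def power2_eq_square flip: powr_add)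
    have Nm: "real n powr (- m / real CARD('d)) = 1 / N"
      by (simp add: N_def powr_minus_divide)
    have "1 / lam n \<le> (\<eta> / C)\<^sup>2 * N\<^sup>2" using elim lam_pos[of n] by (simp add: N2)
    then have "(C * (1 / N))\<^sup>2 \<le> \<eta>\<^sup>2 * lam n"
      using assms N lam_pos[of n] by (simp add: field_simps)
    then have "(C * (1 / N))\<^sup>2 \<le> (\<eta> * sqrt (lam n))\<^sup>2" using lam_pos[of n] by (simp add: power_mult_distrib)
    then have "C * (1 / N) \<le> \<eta> * sqrt (lam n)"
      by (rule power2_le_imp_le) (use assms lam_pos[of n] in simp)
    then show ?case by (simp only: Nm)
  qed
qed

text \<open>The two-sided bounds on the representer at a single outcome, with the empirical norm
  already expressed by the weights. One pair of constants serves both the squared and the plain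
  norms.\<close>

definition regular :: "real \<Rightarrow> real \<Rightarrow> nat \<Rightarrow> 'w \<Rightarrow> bool" where
  "regular A c n \<omega> \<longleftrightarrow>
    c * (rate n)\<^sup>2 \<le> real n * (\<Sum>i<n. (weight n (tuple n \<omega>) i)\<^sup>2) \<and> real n * (\<Sum>i<n. (weight n (tuple n \<omega>) i)\<^sup>2) \<le> A * (rate n)\<^sup>2 \<and>
    c * rate n \<le> sqrt (lam n) * ip_norm ip (rep n \<omega>) \<and> sqrt (lam n) * ip_norm ip (rep n \<omega>) \<le> A * rate n \<and>
    L2_norm \<Omega> (rep n \<omega>) \<le> A * rate n"

text \<open>The constants precede \<epsilon>: \<open>C1\<close> of the norm comparison does not
  depend on \<epsilon>, and the constant \<open>C\<close> that does is absorbed by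
  \<open>\<eta>\<close> once n is large.\<close>

lemma regular_event:
  obtains A c where "A > 0" "c > 0" "\<And>\<epsilon>. \<epsilon> > 0 \<Longrightarrow> \<forall>\<^sub>F n in sequentially. \<exists>G\<in>events. prob G \<ge> 1 - \<epsilon> \<and> (\<forall>\<omega>\<in>G. regular A c n \<omega>)"
proof -
  obtain C1 where C1: "C1 > 0" "\<forall>\<epsilon>>0. \<exists>C>0. \<forall>n\<ge>1.
        \<P>(\<omega> in M. \<forall>v\<in>H.
           L2_norm \<Omega> v \<le> max (C1 * emp_norm n (\<lambda>i. X n i \<omega>) v)
                              (C * real n powr (- m / real CARD('d)) * ip_norm ip v) \<and>
           emp_norm n (\<lambda>i. X n i \<omega>) v \<le> max (C1 * L2_norm \<Omega> v)
                              (C * real n powr (- m / real CARD('d)) * ip_norm ip v))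
        \<ge> 1 - \<epsilon>"
    using comparison unfolding norm_comparison_def by blast
  obtain CI where CI: "CI \<ge> 0" "\<And>v t. v \<in> H \<Longrightarrow> 0 < t \<Longrightarrow> t \<le> 1 \<Longrightarrow>
    \<bar>mi_deriv \<alpha> v x0\<bar> \<le> CI * (t powr (- (real CARD('d) / 2) - ord) * L2_norm \<Omega> v + t powr (m - (real CARD('d) / 2) - ord) * ip_norm ip v)"
    by (rule mi_deriv_interpolation) blast
  obtain h0 CT c0 where ct: "0 < h0" "CT > 0" "c0 > 0" "\<And>h. 0 < h \<Longrightarrow> h \<le> h0 \<Longrightarrow>
    \<exists>u\<in>H. ip_norm ip u \<le> CT * h powr ((real CARD('d) / 2) - m) \<and> L2_norm \<Omega> u \<le> CT * h powr (real CARD('d) / 2) \<and> \<bar>ip u ell\<bar> = c0 * h powr (- ord)"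
    by (rule test_functions) blast
  have "\<exists>A>0. \<exists>c1>0. \<exists>\<eta>>0. \<exists>s0>0. representer_bounded m (real CARD('d) / 2) ord (L2_norm \<Omega>) C1 ell A c1 \<eta> s0"
  proof (rule representer_bounds[where CI = CI and CT = CT and c = c0 and ?h0.0 = h0])
    show "real CARD('d) / 2 > 0" "ord \<ge> 0" "m > real CARD('d) / 2 + ord" "ell \<in> H" using m_gt ell(1) by auto
    show "L2_norm \<Omega> v \<ge> 0" for v by simp
    show "\<bar>ip v ell\<bar> \<le> CI * (t powr (- (real CARD('d) / 2) - ord) * L2_norm \<Omega> v + t powr (m - real CARD('d) / 2 - ord) * ip_norm ip v)"
      if "v \<in> H" "0 < t" "t \<le> 1" for v t using CI(2)[OF that] by (simp add: ell(2)[OF that(1)])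
    show "CI \<ge> 0" "CT > 0" "c0 > 0" "h0 > 0" "C1 > 0" using CI(1) ct(1-3) C1(1) by auto
    show "\<exists>u\<in>H. ip_norm ip u \<le> CT * h powr (real CARD('d) / 2 - m) \<and> L2_norm \<Omega> u \<le> CT * h powr (real CARD('d) / 2) \<and> \<bar>ip u ell\<bar> = c0 * h powr (- ord)"
      if "0 < h" "h \<le> h0" for h by (rule ct(4)[OF that])
  qed
  then obtain A c1 \<eta> s0 where bd: "A > 0" "c1 > 0" "\<eta> > 0" "s0 > 0" "representer_bounded m (real CARD('d) / 2) ord (L2_norm \<Omega>) C1 ell A c1 \<eta> s0"
    by blast
  define A' where "A' = A + A\<^sup>2"
  define c' where "c' = min c1 (c1\<^sup>2)"
  have A': "A' > 0" "A \<le> A'" "A\<^sup>2 \<le> A'" and c': "c' > 0" "c' \<le> c1" "c' \<le> c1\<^sup>2"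
    using bd(1,2) by (auto simp: A'_def c'_def add_pos_pos)
  show thesis
  proof (rule that[OF A'(1) c'(1)])
    fix \<epsilon> :: real assume "\<epsilon> > 0"
    \<comment> \<open>A probability of at least 1/2 rules out the default value 0 of sets that are
      not measurable; so the event below is measurable although it quantifies over all of
      \<open>H\<close>.\<close>
    then have "min \<epsilon> (1 / 2) > 0" by simp
    then obtain C where C: "C > 0" "\<And>n. n \<ge> 1 \<Longrightarrow>
        \<P>(\<omega> in M. \<forall>v\<in>H.
           L2_norm \<Omega> v \<le> max (C1 * emp_norm n (\<lambda>i. X n i \<omega>) v)
                              (C * real n powr (- m / real CARD('d)) * ip_norm ip v) \<and>
           emp_norm n (\<lambda>i. X n i \<omega>) v \<le> max (C1 * L2_norm \<Omega> v)
                              (C * real n powr (- m / real CARD('d)) * ip_norm ip v))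
        \<ge> 1 - min \<epsilon> (1 / 2)" using C1(2) by blast
    show "\<forall>\<^sub>F n in sequentially. \<exists>G\<in>events. prob G \<ge> 1 - \<epsilon> \<and> (\<forall>\<omega>\<in>G. regular A' c' n \<omega>)"
      using lam_powr_le[OF bd(4)] lam_resolution[OF C(1) bd(3)] eventually_ge_at_top[of 1]
    proof eventually_elim
      case (elim n)
      let ?\<kappa> = "C * real n powr (- m / real CARD('d))"
      let ?G = "{\<omega> \<in> space M. \<forall>v\<in>H. L2_norm \<Omega> v \<le> max (C1 * emp_norm n (\<lambda>i. X n i \<omega>) v) (?\<kappa> * ip_norm ip v) \<and>
           emp_norm n (\<lambda>i. X n i \<omega>) v \<le> max (C1 * L2_norm \<Omega> v) (?\<kappa> * ip_norm ip v)}"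
      have pr: "prob ?G \<ge> 1 - min \<epsilon> (1 / 2)" using C(2)[OF elim(3)] .
      then have "prob ?G \<noteq> 0" by (auto simp: min_def split: if_splits)
      then have ev: "?G \<in> events" using measure_notin_sets by blast
      have "regular A' c' n \<omega>" if \<omega>: "\<omega> \<in> ?G" for \<omega>
      proof -
        let ?x = "\<lambda>i. X n i \<omega>"
        have \<omega>M: "\<omega> \<in> space M" using \<omega> by simp
        have n: "real n > 0" using elim(3) by simp
        have eq: "\<forall>v\<in>H. ip v ell = 1 / real n * (\<Sum>i<n. rep n \<omega> (?x i) * v (?x i)) + lam n * ip (rep n \<omega>) v"
          using rep(3)[OF \<omega>M] n by (simp add: rep(2)[OF \<omega>M] sum_distrib_left)
        have b: "c1 * rate n \<le> emp_norm n ?x (rep n \<omega>) \<and> emp_norm n ?x (rep n \<omega>) \<le> A * rate n \<and>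
          c1 * rate n \<le> sqrt (lam n) * ip_norm ip (rep n \<omega>) \<and>
          sqrt (lam n) * ip_norm ip (rep n \<omega>) \<le> A * rate n \<and> L2_norm \<Omega> (rep n \<omega>) \<le> A * rate n"
          unfolding rate_def
          by (rule bd(5)[unfolded representer_bounded_def, THEN spec[of _ n], THEN spec[of _ ?x], THEN spec[of _ "lam n"],
              THEN spec[of _ ?\<kappa>], THEN spec[of _ "rep n \<omega>"], THEN mp, THEN mp, THEN mp, THEN mp, THEN mp, THEN mp, THEN mp])
            (use lam_pos elim(1,2) C(1) \<omega> rep(1)[OF \<omega>M] eq in auto)
        \<comment> \<open>The representer takes the value n times the weight at a design point: n^2
          from the squares meets 1/n from the mean.\<close>
        have en: "(emp_norm n ?x (rep n \<omega>))\<^sup>2 = real n * (\<Sum>i<n. (weight n (tuple n \<omega>) i)\<^sup>2)"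
          using n by (simp add: emp_norm_sq rep(2)[OF \<omega>M] power_mult_distrib sum_distrib_left power2_eq_square[of "real n"] del: mult_cancel_left)
        have r: "rate n > 0" by (rule rate_pos)
        have "c' * (rate n)\<^sup>2 \<le> (c1 * rate n)\<^sup>2" using c'(3) by (simp add: power_mult_distrib mult_right_mono)
        also have "\<dots> \<le> (emp_norm n ?x (rep n \<omega>))\<^sup>2" using b bd(2) r by (intro power_mono) auto
        finally have 1: "c' * (rate n)\<^sup>2 \<le> (emp_norm n ?x (rep n \<omega>))\<^sup>2" .
        have "(emp_norm n ?x (rep n \<omega>))\<^sup>2 \<le> (A * rate n)\<^sup>2" using b emp_norm_nonneg by (intro power_mono) auto
        also have "\<dots> \<le> A' * (rate n)\<^sup>2" using A'(3) by (simp add: power_mult_distrib mult_right_mono)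
        finally have 2: "(emp_norm n ?x (rep n \<omega>))\<^sup>2 \<le> A' * (rate n)\<^sup>2" .
        have "A * rate n \<le> A' * rate n" "c' * rate n \<le> c1 * rate n" using r A'(2) c'(2) by (auto intro: mult_right_mono)
        then show ?thesis using 1 2 b unfolding en regular_def by linarith
      qed
      moreover have "prob ?G \<ge> 1 - \<epsilon>" using pr by linarith
      ultimately show ?case using ev by blast
    qed
  qed
qed

end

subsection \<open>Rates of the variance, the bias and the error\<close>

context krr_setup
begin

lemma variance_asymp:
  "asymp_prob M (\<lambda>n \<omega>. krr_var K \<alpha> \<sigma> n (lam n) (\<lambda>i. X n i \<omega>) x0)
    (\<lambda>n \<omega>. \<sigma>\<^sup>2 * real n powr (-1) * lam n powr (- ((real CARD('d) + 2 * ord) / (2 * m))))" (is "asymp_prob M ?V ?v")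
proof (rule asymp_probI)
  have "(\<lambda>\<omega>. \<sigma>\<^sup>2 * (\<Sum>i<n. (weight n (tuple n \<omega>) i)\<^sup>2)) \<in> borel_measurable M" for n
    by (intro borel_measurable_times borel_measurable_const borel_measurable_sum borel_measurable_power weight_tuple_measurable) auto
  then show "?V n \<in> borel_measurable M" for n
    by (subst measurable_cong[OF krr_var_weight]) auto
  show "?v n \<in> borel_measurable M" for n
    by simp
  show "?v n \<omega> \<ge> 0" for n \<omega> by simp
  fix \<epsilon> :: real assume \<epsilon>: "\<epsilon> > 0"
  obtain A c where Ac: "A > 0" "c > 0" and good: "\<And>\<epsilon>. \<epsilon> > 0 \<Longrightarrow> \<forall>\<^sub>F n in sequentially. \<exists>G\<in>events. prob G \<ge> 1 - \<epsilon> \<and> (\<forall>\<omega>\<in>G. regular A c n \<omega>)"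
    by (rule regular_event) blast
  have "\<forall>\<^sub>F n in sequentially. \<exists>G\<in>events. prob G \<ge> 1 - \<epsilon> \<and>
      (\<forall>\<omega>\<in>G. c * ?v n \<omega> \<le>
          ?V n \<omega> \<and>
        ?V n \<omega> \<le>
          A * ?v n \<omega>)"
    using good[OF \<epsilon>] eventually_gt_at_top[of 0]
  proof eventually_elim
    case (elim n)
    then obtain G where G: "G \<in> events" "prob G \<ge> 1 - \<epsilon>" "\<And>\<omega>. \<omega> \<in> G \<Longrightarrow> regular A c n \<omega>" by blast
    have "c * ?v n \<omega> \<le>
        ?V n \<omega> \<and>
      ?V n \<omega> \<le>
        A * ?v n \<omega>" if \<omega>: "\<omega> \<in> G" for \<omega>
    proof -
      have \<omega>M: "\<omega> \<in> space M" using \<omega> sets.sets_into_space[OF G(1)] by blast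
      have n: "real n > 0" using elim by simp
      define R where "R = (rate n)\<^sup>2 / real n"
      have "c * R \<le> (\<Sum>i<n. (weight n (tuple n \<omega>) i)\<^sup>2)" "(\<Sum>i<n. (weight n (tuple n \<omega>) i)\<^sup>2) \<le> A * R"
        using G(3)[OF \<omega>] n by (simp_all add: regular_def R_def field_simps)
      then have "\<sigma>\<^sup>2 * (c * R) \<le> \<sigma>\<^sup>2 * (\<Sum>i<n. (weight n (tuple n \<omega>) i)\<^sup>2)" "\<sigma>\<^sup>2 * (\<Sum>i<n. (weight n (tuple n \<omega>) i)\<^sup>2) \<le> \<sigma>\<^sup>2 * (A * R)"
        by (auto intro: mult_left_mono)
      moreover have "?v n \<omega> = \<sigma>\<^sup>2 * R"
        using n by (simp add: R_def rate_sq powr_minus_divide)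
      ultimately show ?thesis by (simp only: krr_var_weight[OF \<omega>M] mult.left_commute[of c "\<sigma>\<^sup>2"] mult.left_commute[of A "\<sigma>\<^sup>2"])
    qed
    then show ?case using G by blast
  qed
  then show "\<exists>A. \<exists>c>0. \<forall>\<^sub>F n in sequentially. \<exists>G\<in>events. prob G \<ge> 1 - \<epsilon> \<and>
      (\<forall>\<omega>\<in>G. c * ?v n \<omega> \<le>
          ?V n \<omega> \<and>
        ?V n \<omega> \<le>
          A * ?v n \<omega>)"
    using Ac(2) by blast
qed

text \<open>The inner integral leaves the design fixed and averages the noise to zero; what remains
  is the penalty pairing with the representer.\<close>

lemma bias_SUP:
  assumes \<omega>: "\<omega> \<in> space M"
  shows "(SUP g\<in>{g \<in> H. ip_norm ip g \<le> 1}.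
      \<bar>(LINT \<omega>'|M. mi_deriv \<alpha> (krr_fit H ip n (lam n) (\<lambda>i. X n i \<omega>) (\<lambda>i. e i \<omega>') g) x0) - mi_deriv \<alpha> g x0\<bar>) =
    lam n * ip_norm ip (rep n \<omega>)"
proof -
  have mean: "(LINT \<omega>'|M. (\<Sum>i<n. weight n (tuple n \<omega>) i * e i \<omega>')) = 0"
    "integrable M (\<lambda>\<omega>'. \<Sum>i<n. weight n (tuple n \<omega>) i * e i \<omega>')"
    using iid iid_errors_integrable(2)[OF iid] by (auto simp: iid_errors_def)
  have "(LINT \<omega>'|M. mi_deriv \<alpha> (krr_fit H ip n (lam n) (\<lambda>i. X n i \<omega>) (\<lambda>i. e i \<omega>') g) x0) - mi_deriv \<alpha> g x0 =
      0 - lam n * ip (rep n \<omega>) g" if g: "g \<in> H" for g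
  proof -
    have "(\<lambda>\<omega>'. mi_deriv \<alpha> (krr_fit H ip n (lam n) (\<lambda>i. X n i \<omega>) (\<lambda>i. e i \<omega>') g) x0) =
      (\<lambda>\<omega>'. (mi_deriv \<alpha> g x0 - lam n * ip (rep n \<omega>) g) + (\<Sum>i<n. weight n (tuple n \<omega>) i * e i \<omega>'))"
      by (rule ext) (simp add: mi_deriv_fit[OF \<omega> g])
    then show ?thesis
      by (simp only: Bochner_Integration.integral_add[OF integrable_const mean(2)] mean(1)) (simp add: prob_space)
  qed
  then have "(SUP g\<in>{g \<in> H. ip_norm ip g \<le> 1}.
      \<bar>(LINT \<omega>'|M. mi_deriv \<alpha> (krr_fit H ip n (lam n) (\<lambda>i. X n i \<omega>) (\<lambda>i. e i \<omega>') g) x0) - mi_deriv \<alpha> g x0\<bar>) =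
    (SUP g\<in>{g \<in> H. ip_norm ip g \<le> 1}. \<bar>0 - lam n * ip (rep n \<omega>) g\<bar>)"
    by (intro SUP_cong refl) auto
  also have "\<dots> = \<bar>0\<bar> + lam n * ip_norm ip (rep n \<omega>)"
    by (rule SUP_unit_ball[OF rep(1)[OF \<omega>] less_imp_le[OF lam_pos]])
  finally show ?thesis by simp
qed

lemma error_SUP:
  assumes \<omega>: "\<omega> \<in> space M"
  shows "(SUP g\<in>{g \<in> H. ip_norm ip g \<le> 1}.
      \<bar>mi_deriv \<alpha> (krr_fit H ip n (lam n) (\<lambda>i. X n i \<omega>) (\<lambda>i. e i \<omega>) g) x0 - mi_deriv \<alpha> g x0\<bar>) =
    \<bar>\<Sum>i<n. weight n (tuple n \<omega>) i * e i \<omega>\<bar> + lam n * ip_norm ip (rep n \<omega>)"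
proof -
  have "(SUP g\<in>{g \<in> H. ip_norm ip g \<le> 1}.
      \<bar>mi_deriv \<alpha> (krr_fit H ip n (lam n) (\<lambda>i. X n i \<omega>) (\<lambda>i. e i \<omega>) g) x0 - mi_deriv \<alpha> g x0\<bar>) =
    (SUP g\<in>{g \<in> H. ip_norm ip g \<le> 1}. \<bar>(\<Sum>i<n. weight n (tuple n \<omega>) i * e i \<omega>) - lam n * ip (rep n \<omega>) g\<bar>)"
    by (intro SUP_cong refl) (auto simp: mi_deriv_fit[OF \<omega>])
  also have "\<dots> = \<bar>\<Sum>i<n. weight n (tuple n \<omega>) i * e i \<omega>\<bar> + lam n * ip_norm ip (rep n \<omega>)"
    by (rule SUP_unit_ball[OF rep(1)[OF \<omega>] less_imp_le[OF lam_pos]])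
  finally show ?thesis .
qed

lemma lam_rep_norm_bounds:
  assumes "regular A c n \<omega>"
  shows "c * (sqrt (lam n) * rate n) \<le> lam n * ip_norm ip (rep n \<omega>)" "lam n * ip_norm ip (rep n \<omega>) \<le> A * (sqrt (lam n) * rate n)"
proof -
  let ?u = "rep n \<omega>"
  have a: "c * rate n \<le> sqrt (lam n) * ip_norm ip ?u" "sqrt (lam n) * ip_norm ip ?u \<le> A * rate n"
    using assms by (auto simp: regular_def)
  have e: "lam n * ip_norm ip ?u = sqrt (lam n) * (sqrt (lam n) * ip_norm ip ?u)"
    using lam_pos[of n] by (simp add: mult.assoc[symmetric])
  have s: "sqrt (lam n) \<ge> 0" using lam_pos[of n] by simp
  show "c * (sqrt (lam n) * rate n) \<le> lam n * ip_norm ip ?u" "lam n * ip_norm ip ?u \<le> A * (sqrt (lam n) * rate n)"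
    using mult_left_mono[OF a(1) s] mult_left_mono[OF a(2) s] by (simp_all add: e mult_ac)
qed

lemma bias_asymp:
  "asymp_prob M (\<lambda>n \<omega>. SUP g\<in>{g \<in> H. ip_norm ip g \<le> 1}.
      \<bar>(LINT \<omega>'|M. mi_deriv \<alpha> (krr_fit H ip n (lam n) (\<lambda>i. X n i \<omega>) (\<lambda>i. e i \<omega>') g) x0) - mi_deriv \<alpha> g x0\<bar>)
    (\<lambda>n \<omega>. lam n powr (1 / 2 - (real CARD('d) + 2 * ord) / (4 * m)))" (is "asymp_prob M ?B ?b")
proof (rule asymp_probI)
  show "?B n \<in> borel_measurable M" for n
    by (subst measurable_cong[OF bias_SUP]) (use rep_norm_measurable in auto)
  show "?b n \<in> borel_measurable M" for n by simp
  show "?b n \<omega> \<ge> 0" for n \<omega> by simp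
  fix \<epsilon> :: real assume \<epsilon>: "\<epsilon> > 0"
  obtain A c where Ac: "A > 0" "c > 0" and good: "\<And>\<epsilon>. \<epsilon> > 0 \<Longrightarrow> \<forall>\<^sub>F n in sequentially. \<exists>G\<in>events. prob G \<ge> 1 - \<epsilon> \<and> (\<forall>\<omega>\<in>G. regular A c n \<omega>)"
    by (rule regular_event) blast
  have "\<forall>\<^sub>F n in sequentially. \<exists>G\<in>events. prob G \<ge> 1 - \<epsilon> \<and> (\<forall>\<omega>\<in>G. c * ?b n \<omega> \<le> ?B n \<omega> \<and> ?B n \<omega> \<le> A * ?b n \<omega>)"
    using good[OF \<epsilon>]
  proof eventually_elim
    case (elim n)
    then obtain G where G: "G \<in> events" "prob G \<ge> 1 - \<epsilon>" "\<And>\<omega>. \<omega> \<in> G \<Longrightarrow> regular A c n \<omega>" by blast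
    have "c * ?b n \<omega> \<le> ?B n \<omega> \<and> ?B n \<omega> \<le> A * ?b n \<omega>" if \<omega>: "\<omega> \<in> G" for \<omega>
    proof -
      have \<omega>M: "\<omega> \<in> space M" using \<omega> sets.sets_into_space[OF G(1)] by blast
      show ?thesis
        unfolding bias_SUP[OF \<omega>M] sqrt_rate[symmetric] using lam_rep_norm_bounds[OF G(3)[OF \<omega>]] by blast
    qed
    then show ?case using G by blast
  qed
  then show "\<exists>A. \<exists>c>0. \<forall>\<^sub>F n in sequentially. \<exists>G\<in>events. prob G \<ge> 1 - \<epsilon> \<and> (\<forall>\<omega>\<in>G. c * ?b n \<omega> \<le> ?B n \<omega> \<and> ?B n \<omega> \<le> A * ?b n \<omega>)"
    using Ac(2) by blast
qed

lemma noise_measurable: "(\<lambda>\<omega>. \<Sum>i<n. weight n (tuple n \<omega>) i * e i \<omega>) \<in> borel_measurable M"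
  by (intro borel_measurable_sum borel_measurable_times weight_tuple_measurable iid_errors_integrable(1)[OF iid]) simp

text \<open>Markov's inequality for the squared noise. The weights are set to zero where their sum
  of squares exceeds \<open>B\<close>; this cut depends on the design alone, so independence from
  the errors is preserved.\<close>

lemma noise_tail:
  assumes B: "B > 0" and \<delta>: "\<delta> > 0"
  obtains N where "N \<in> events" "prob N \<le> \<delta>" "\<And>\<omega>. \<omega> \<in> space M - N \<Longrightarrow> (\<Sum>i<n. (weight n (tuple n \<omega>) i)\<^sup>2) \<le> B \<Longrightarrow>
    (\<Sum>i<n. weight n (tuple n \<omega>) i * e i \<omega>)\<^sup>2 \<le> (\<sigma>\<^sup>2 + 1) * B / \<delta>"
proof -
  let ?S = "PiM {..<n} (\<lambda>_. borel) :: (nat \<Rightarrow> real ^ 'd) measure"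
  define D where "D = {x \<in> space ?S. (\<Sum>i<n. (weight n x i)\<^sup>2) \<le> B}"
  define g where "g i x = indicator D x * weight n x i" for i x
  have D: "D \<in> sets ?S" unfolding D_def
    by (intro borel_measurable_le borel_measurable_sum borel_measurable_power borel_measurable_weight borel_measurable_const) simp
  have gm: "g i \<in> borel_measurable ?S" if "i < n" for i
    unfolding g_def by (intro borel_measurable_times borel_measurable_indicator D borel_measurable_weight that)
  have gB: "(\<Sum>i<n. (g i x)\<^sup>2) \<le> B" for x
    using B by (cases "x \<in> D") (auto simp: g_def D_def)
  have "(\<integral>\<^sup>+\<omega>. ennreal ((\<Sum>i<n. g i (tuple n \<omega>) * e i \<omega>)\<^sup>2) \<partial>M) \<le> ennreal (\<sigma>\<^sup>2 * B)"
    by (rule weighted_errors_second_moment[OF iid _ gm gB]) (use indep[of n] B in \<open>auto simp: tuple_def[abs_def]\<close>)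
  also have "\<dots> \<le> ennreal ((\<sigma>\<^sup>2 + 1) * B)" using B by (intro ennreal_leI mult_right_mono) auto
  finally have m2: "(\<integral>\<^sup>+\<omega>. ennreal ((\<Sum>i<n. g i (tuple n \<omega>) * e i \<omega>)\<^sup>2) \<partial>M) \<le> ennreal ((\<sigma>\<^sup>2 + 1) * B)" .
  let ?Y = "\<lambda>\<omega>. (\<Sum>i<n. g i (tuple n \<omega>) * e i \<omega>)\<^sup>2"
  have Ym: "?Y \<in> borel_measurable M"
    by (intro borel_measurable_power borel_measurable_sum borel_measurable_times iid_errors_integrable(1)[OF iid]
        measurable_compose[OF tuple_measurable gm]) simp
  \<comment> \<open>Adding 1 to the variance keeps the threshold positive even when the errors
    vanish.\<close>
  let ?T = "(\<sigma>\<^sup>2 + 1) * B / \<delta>"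
  have T: "?T > 0" using B \<delta> by (simp add: add_nonneg_pos)
  define N where "N = {\<omega> \<in> space M. ?T \<le> ?Y \<omega>}"
  have N: "N \<in> events" unfolding N_def using Ym by measurable
  have "ennreal (?T * prob N) = (\<integral>\<^sup>+\<omega>. ennreal ?T * indicator N \<omega> \<partial>M)"
    unfolding nn_integral_cmult_indicator[OF N] emeasure_eq_measure using T by (intro ennreal_mult) auto
  also have "\<dots> \<le> (\<integral>\<^sup>+\<omega>. ennreal (?Y \<omega>) \<partial>M)"
    by (intro nn_integral_mono) (auto simp: N_def indicator_def intro: ennreal_leI)
  also have "\<dots> \<le> ennreal ((\<sigma>\<^sup>2 + 1) * B)" by (rule m2)
  finally have "?T * prob N \<le> (\<sigma>\<^sup>2 + 1) * B" using B by (subst (asm) ennreal_le_iff) auto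
  then have "(\<sigma>\<^sup>2 + 1) * B * prob N \<le> (\<sigma>\<^sup>2 + 1) * B * \<delta>" using \<delta> by (simp add: field_simps)
  moreover have "(\<sigma>\<^sup>2 + 1) * B > 0" using B by (simp add: add_nonneg_pos)
  ultimately have pN: "prob N \<le> \<delta>" by (simp only: mult_le_cancel_left_pos)
  show thesis
  proof (rule that[OF N pN])
    fix \<omega> assume \<omega>: "\<omega> \<in> space M - N" and le: "(\<Sum>i<n. (weight n (tuple n \<omega>) i)\<^sup>2) \<le> B"
    have "tuple n \<omega> \<in> space ?S" using measurable_space[OF tuple_measurable] \<omega> by blast
    then have "g i (tuple n \<omega>) = weight n (tuple n \<omega>) i" for i using le by (simp add: g_def D_def)
    then show "(\<Sum>i<n. weight n (tuple n \<omega>) i * e i \<omega>)\<^sup>2 \<le> ?T" using \<omega> by (auto simp: N_def)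
  qed
qed

text \<open>For \<open>lam\<close> of order 1/n the noise, of order at most
  \<open>rate / sqrt n\<close>, is no larger in order than the bias \<open>sqrt lam * rate\<close>.
  As noise and bias add up in the supremum, the bias alone gives the lower bound.\<close>

lemma error_asymp:
  assumes lam: "lam \<in> \<Theta>(\<lambda>n. 1 / real n)"
  shows "asymp_prob M (\<lambda>n \<omega>. SUP g\<in>{g \<in> H. ip_norm ip g \<le> 1}.
      \<bar>mi_deriv \<alpha> (krr_fit H ip n (lam n) (\<lambda>i. X n i \<omega>) (\<lambda>i. e i \<omega>) g) x0 - mi_deriv \<alpha> g x0\<bar>)
    (\<lambda>n \<omega>. real n powr (- 1 / 2 + (real CARD('d) + 2 * ord) / (4 * m)))" (is "asymp_prob M ?B ?b")
proof (rule asymp_probI)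
  have "(\<lambda>\<omega>. \<bar>\<Sum>i<n. weight n (tuple n \<omega>) i * e i \<omega>\<bar> + lam n * ip_norm ip (rep n \<omega>)) \<in> borel_measurable M" for n
    by (intro borel_measurable_add borel_measurable_abs noise_measurable rep_norm_measurable)
  then show "?B n \<in> borel_measurable M" for n
    by (subst measurable_cong[OF error_SUP]) auto
  show "?b n \<in> borel_measurable M" "?b n \<omega> \<ge> 0" for n \<omega> by simp_all
  fix \<epsilon> :: real assume \<epsilon>: "\<epsilon> > 0"
  obtain A c where Ac: "A > 0" "c > 0" and good: "\<And>\<epsilon>. \<epsilon> > 0 \<Longrightarrow> \<forall>\<^sub>F n in sequentially. \<exists>G\<in>events. prob G \<ge> 1 - \<epsilon> \<and> (\<forall>\<omega>\<in>G. regular A c n \<omega>)"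
    by (rule regular_event) blast
  define q where "q = 1 / 2 - (real CARD('d) + 2 * ord) / (4 * m)"
  obtain k1 where k1: "k1 > 0" "\<forall>\<^sub>F n in sequentially. lam n powr q \<le> k1 * real n powr (- q) \<and> real n powr (- q) \<le> k1 * lam n powr q"
    by (rule bigtheta_powr[OF lam lam_pos]) blast
  obtain k2 where k2: "k2 > 0" "\<forall>\<^sub>F n in sequentially. lam n powr 1 \<le> k2 * real n powr (- 1) \<and> real n powr (- 1) \<le> k2 * lam n powr 1"
    by (rule bigtheta_powr[OF lam lam_pos]) blast
  \<comment> \<open>The noise constant, from the tail bound at level \<epsilon>/2 with 1/n replaced
    by \<open>k2 * lam n\<close>, plus the bias constant.\<close>
  define k3 where "k3 = sqrt ((\<sigma>\<^sup>2 + 1) * A * 2 * k2 / \<epsilon>) + A"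
  have k3: "k3 > 0" using \<epsilon> Ac(1) k2(1) by (auto simp: k3_def intro!: add_nonneg_pos)
  have "\<forall>\<^sub>F n in sequentially. \<exists>G\<in>events. prob G \<ge> 1 - \<epsilon> \<and> (\<forall>\<omega>\<in>G. (c / k1) * ?b n \<omega> \<le> ?B n \<omega> \<and> ?B n \<omega> \<le> (k3 * k1) * ?b n \<omega>)"
    using good[OF half_gt_zero[OF \<epsilon>]] k1(2) k2(2) eventually_gt_at_top[of 0]
  proof eventually_elim
    case (elim n)
    then obtain G where G: "G \<in> events" "prob G \<ge> 1 - \<epsilon> / 2" "\<And>\<omega>. \<omega> \<in> G \<Longrightarrow> regular A c n \<omega>" by blast
    have n: "real n > 0" using elim by simp
    have Bpos: "A * (rate n)\<^sup>2 / real n > 0" using Ac(1) rate_pos[of n] n by simp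
    obtain N where N: "N \<in> events" "prob N \<le> \<epsilon> / 2" "\<And>\<omega>. \<omega> \<in> space M - N \<Longrightarrow> (\<Sum>i<n. (weight n (tuple n \<omega>) i)\<^sup>2) \<le> A * (rate n)\<^sup>2 / real n \<Longrightarrow>
      (\<Sum>i<n. weight n (tuple n \<omega>) i * e i \<omega>)\<^sup>2 \<le> (\<sigma>\<^sup>2 + 1) * (A * (rate n)\<^sup>2 / real n) / (\<epsilon> / 2)"
      by (rule noise_tail[OF Bpos half_gt_zero[OF \<epsilon>]]) blast
    have GN: "G - N \<in> events" using G N by blast
    have "prob (G - N) = prob G - prob (G \<inter> N)" by (rule finite_measure_Diff'[OF G(1) N(1)])
    moreover have "prob (G \<inter> N) \<le> prob N" using N(1) by (intro finite_measure_mono) auto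
    ultimately have pGN: "prob (G - N) \<ge> 1 - \<epsilon>" using G(2) N(2) by linarith
    define R where "R = sqrt (lam n) * rate n"
    have Rq: "R = lam n powr q" unfolding R_def q_def by (rule sqrt_rate)
    have R0: "R \<ge> 0" by (simp add: Rq)
    have bq: "- 1 / 2 + (real CARD('d) + 2 * ord) / (4 * m) = - q" by (simp add: q_def)
    have Rb: "R \<le> k1 * real n powr (- q)" "real n powr (- q) \<le> k1 * R" using elim(2) by (auto simp: Rq)
    have "(c / k1) * ?b n \<omega> \<le> ?B n \<omega> \<and> ?B n \<omega> \<le> (k3 * k1) * ?b n \<omega>" if \<omega>: "\<omega> \<in> G - N" for \<omega>
    proof -
      have \<omega>M: "\<omega> \<in> space M" using \<omega> sets.sets_into_space[OF G(1)] by blast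
      define V where "V = lam n * ip_norm ip (rep n \<omega>)"
      define Z where "Z = (\<Sum>i<n. weight n (tuple n \<omega>) i * e i \<omega>)"
      have reg: "regular A c n \<omega>" using G(3) \<omega> by blast
      note le = lam_rep_norm_bounds[OF reg, folded R_def V_def]
      have "(\<Sum>i<n. (weight n (tuple n \<omega>) i)\<^sup>2) \<le> A * (rate n)\<^sup>2 / real n" using reg n by (simp add: regular_def field_simps)
      then have "Z\<^sup>2 \<le> (\<sigma>\<^sup>2 + 1) * (A * (rate n)\<^sup>2 / real n) / (\<epsilon> / 2)"
        unfolding Z_def using N(3) \<omega> \<omega>M by blast
      also have "\<dots> = ((\<sigma>\<^sup>2 + 1) * A * 2 / \<epsilon> * (rate n)\<^sup>2) * (1 / real n)" using \<epsilon> n by (simp add: field_simps)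
      also have "\<dots> \<le> ((\<sigma>\<^sup>2 + 1) * A * 2 / \<epsilon> * (rate n)\<^sup>2) * (k2 * lam n)"
        using elim(3) n lam_pos[of n] Ac(1) \<epsilon> by (intro mult_left_mono) (auto simp: powr_minus_divide)
      also have "\<dots> = (sqrt ((\<sigma>\<^sup>2 + 1) * A * 2 * k2 / \<epsilon>) * R)\<^sup>2"
        using Ac(1) \<epsilon> k2(1) lam_pos[of n] by (simp add: power_mult_distrib R_def)
      finally have "\<bar>Z\<bar> \<le> \<bar>sqrt ((\<sigma>\<^sup>2 + 1) * A * 2 * k2 / \<epsilon>) * R\<bar>" by (simp only: abs_le_square_iff)
      then have "\<bar>Z\<bar> \<le> sqrt ((\<sigma>\<^sup>2 + 1) * A * 2 * k2 / \<epsilon>) * R" using R0 Ac(1) \<epsilon> k2(1) by (simp add: abs_mult)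
      then have "\<bar>Z\<bar> + V \<le> k3 * R" using le(2) by (simp add: k3_def distrib_right)
      also have "\<dots> \<le> k3 * (k1 * real n powr (- q))" using k3 Rb(1) by (intro mult_left_mono) auto
      finally have up: "\<bar>Z\<bar> + V \<le> (k3 * k1) * real n powr (- q)" by (simp only: mult.assoc)
      have "(c / k1) * real n powr (- q) \<le> (c / k1) * (k1 * R)" using Rb(2) Ac(2) k1(1) by (intro mult_left_mono) auto
      also have "\<dots> \<le> \<bar>Z\<bar> + V" using le(1) k1(1) by simp
      finally show ?thesis using up unfolding error_SUP[OF \<omega>M] bq by (simp only: V_def Z_def)
    qed
    then show ?case using GN pGN by blast
  qed
  moreover have "c / k1 > 0" using Ac(2) k1(1) by simp
  ultimately show "\<exists>A. \<exists>c>0. \<forall>\<^sub>F n in sequentially. \<exists>G\<in>events. prob G \<ge> 1 - \<epsilon> \<and> (\<forall>\<omega>\<in>G. c * ?b n \<omega> \<le> ?B n \<omega> \<and> ?B n \<omega> \<le> A * ?b n \<omega>)"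
    by blast
qed

end

subsection \<open>Asymptotic normality\<close>

text \<open>Off \<open>G\<close> the deviation is at most 2, weighted by a probability of at most
  \<epsilon>.\<close>

lemma (in prob_space) expectation_close_off_event:
  fixes h :: "'a \<Rightarrow> complex"
  assumes h: "integrable M h" and G: "G \<in> events" "prob G \<ge> 1 - \<epsilon>"
    and b: "\<And>\<omega>. \<omega> \<in> G \<Longrightarrow> cmod (h \<omega> - c) \<le> \<delta>" "\<And>\<omega>. \<omega> \<in> space M \<Longrightarrow> cmod (h \<omega> - c) \<le> 2" and \<delta>: "\<delta> \<ge> 0"
  shows "cmod ((CLINT \<omega>|M. h \<omega>) - c) \<le> \<delta> + 2 * \<epsilon>"
proof -
  have "(CLINT \<omega>|M. h \<omega>) - c = (CLINT \<omega>|M. h \<omega> - c)"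
    using h by (simp add: prob_space)
  also have "cmod \<dots> \<le> expectation (\<lambda>\<omega>. cmod (h \<omega> - c))" by (rule integral_norm_bound)
  also have "\<dots> \<le> expectation (\<lambda>\<omega>. \<delta> + 2 * indicator (space M - G) \<omega>)"
  proof (rule integral_mono)
    show "integrable M (\<lambda>\<omega>. cmod (h \<omega> - c))" using h by simp
    show "integrable M (\<lambda>\<omega>. \<delta> + 2 * indicator (space M - G) \<omega>)" using G(1) by (simp add: emeasure_eq_measure)
    show "cmod (h \<omega> - c) \<le> \<delta> + 2 * indicator (space M - G) \<omega>" if "\<omega> \<in> space M" for \<omega>
      using b(1)[of \<omega>] b(2)[OF that] \<delta> that by (cases "\<omega> \<in> G") auto
  qed
  also have "\<dots> = \<delta> + 2 * prob (space M - G)" using G(1) by (simp add: prob_space emeasure_eq_measure)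
  also have "prob (space M - G) \<le> \<epsilon>" using G by (simp add: prob_compl)
  finally show ?thesis by simp
qed

lemma cmod_iexp_diff_le: "cmod (iexp x - 1) \<le> \<bar>x\<bar>"
  using iexp_approx1[of x 0] by simp

context krr_setup
begin

text \<open>Equivalent to n s^d tending to infinity for s = lam^(1/(2m)), which is the lower bound
  on \<open>lam\<close> raised to the power d/(2m).\<close>

lemma design_density_tendsto:
  "(\<lambda>n. (lam n powr (1 / (2 * m))) powr (- (real CARD('d) / 2)) / sqrt (real n)) \<longlonglongrightarrow> 0"
proof (rule tendstoI)
  fix r :: real assume r: "r > 0"
  let ?d = "real CARD('d)"
  \<comment> \<open>Chosen so that its power d/(2m) is \<open>r / 2\<close>.\<close>
  define \<eta> where "\<eta> = (r / 2) powr (2 * m / ?d)"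
  have \<eta>: "\<eta> > 0" using r by (simp add: \<eta>_def)
  have "\<forall>\<^sub>F n in sequentially. 1 * real n powr (- m / ?d) \<le> \<eta> * sqrt (lam n)" by (rule lam_resolution) (use \<eta> in simp_all)
  then show "\<forall>\<^sub>F n in sequentially. dist ((lam n powr (1 / (2 * m))) powr (- (?d / 2)) / sqrt (real n)) 0 < r"
    using eventually_gt_at_top[of 0]
  proof eventually_elim
    case (elim n)
    have n: "real n > 0" using elim by simp
    have l: "lam n > 0" by (rule lam_pos)
    have "real n powr (- m / ?d) \<le> \<eta> * sqrt (lam n)" using elim by simp
    then have "(real n powr (- m / ?d)) powr (?d / (2 * m)) \<le> (\<eta> * sqrt (lam n)) powr (?d / (2 * m))"
      using m_pos by (intro powr_mono2) auto
    moreover have "(real n powr (- m / ?d)) powr (?d / (2 * m)) = 1 / sqrt (real n)"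
    proof -
      have "- m / ?d * (?d / (2 * m)) = - (1 / 2)" using m_pos by simp
      then show ?thesis using n by (simp only: powr_powr) (simp add: powr_minus_divide powr_half_sqrt)
    qed
    moreover have "(\<eta> * sqrt (lam n)) powr (?d / (2 * m)) = r / 2 * lam n powr (?d / (4 * m))"
    proof -
      have "\<eta> powr (?d / (2 * m)) = r / 2" using r m_pos by (simp add: \<eta>_def powr_powr)
      moreover have "sqrt (lam n) powr (?d / (2 * m)) = lam n powr (?d / (4 * m))"
      proof -
        have "sqrt (lam n) powr (?d / (2 * m)) = (lam n powr (1 / 2)) powr (?d / (2 * m))" using l by (simp add: powr_half_sqrt)
        also have "\<dots> = lam n powr (1 / 2 * (?d / (2 * m)))" by (rule powr_powr)
        finally show ?thesis by simp
      qed
      ultimately show ?thesis using \<eta> l by (simp add: powr_mult)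
    qed
    ultimately have le: "1 / sqrt (real n) \<le> r / 2 * lam n powr (?d / (4 * m))" by simp
    have e: "1 / (2 * m) * - (?d / 2) = - (?d / (4 * m))" by simp
    have s: "(lam n powr (1 / (2 * m))) powr (- (?d / 2)) = lam n powr (- (?d / (4 * m)))"
      by (simp only: powr_powr e)
    have "(lam n powr (1 / (2 * m))) powr (- (?d / 2)) / sqrt (real n) = lam n powr (- (?d / (4 * m))) * (1 / sqrt (real n))"
      by (simp only: s) simp
    also have "\<dots> \<le> lam n powr (- (?d / (4 * m))) * (r / 2 * lam n powr (?d / (4 * m)))"
      by (intro mult_left_mono le) simp
    also have "\<dots> = r / 2 * (lam n powr (- (?d / (4 * m))) * lam n powr (?d / (4 * m)))" by simp
    also have "\<dots> = r / 2" using l by (simp flip: powr_add)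
    finally have "(lam n powr (1 / (2 * m))) powr (- (?d / 2)) / sqrt (real n) < r" using r by linarith
    then show ?case by (simp add: dist_real_def)
  qed
qed

text \<open>A weight is the value of the representer at a design point divided by n, and the sup
  bound at scale s controls that value. Design points may lie on the boundary, which is why the sup
  bound was established on all of \<open>\<Omega>\<close>.\<close>

lemma weight_bound:
  obtains C where "C \<ge> 0" "\<And>A c n \<omega> i. \<omega> \<in> space M \<Longrightarrow> i < n \<Longrightarrow> lam n powr (1 / (2 * m)) \<le> 1 \<Longrightarrow> regular A c n \<omega> \<Longrightarrow>
    \<bar>weight n (tuple n \<omega>) i\<bar> \<le> C * A * (lam n powr (1 / (2 * m))) powr (- (real CARD('d) / 2)) * rate n / real n"
proof -
  obtain C where C: "C \<ge> 0" "\<And>v x t. v \<in> H \<Longrightarrow> x \<in> \<Omega> \<Longrightarrow> 0 < t \<Longrightarrow> t \<le> 1 \<Longrightarrow>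
    \<bar>v x\<bar> \<le> C * (t powr (- (real CARD('d) / 2)) * L2_norm \<Omega> v + t powr (m - (real CARD('d) / 2)) * ip_norm ip v)"
    by (rule H_sup_bound) blast
  have "\<bar>weight n (tuple n \<omega>) i\<bar> \<le> (2 * C) * A * (lam n powr (1 / (2 * m))) powr (- (real CARD('d) / 2)) * rate n / real n"
    if \<omega>: "\<omega> \<in> space M" and i: "i < n" and s: "lam n powr (1 / (2 * m)) \<le> 1"
      and reg: "regular A c n \<omega>" for A c n \<omega> i
  proof -
    have L2: "L2_norm \<Omega> (rep n \<omega>) \<le> A * rate n" and nm: "sqrt (lam n) * ip_norm ip (rep n \<omega>) \<le> A * rate n"
      using reg by (auto simp: regular_def)
    define t where "t = lam n powr (1 / (2 * m))"
    let ?h = "real CARD('d) / 2"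
    have t: "0 < t" "t \<le> 1" using lam_pos[of n] s by (auto simp: t_def)
    have n: "real n > 0" using i by simp
    have tm: "t powr m = sqrt (lam n)" using lam_pos[of n] m_pos by (simp add: t_def powr_powr powr_half_sqrt)
    have "t powr (m - ?h) = t powr (- ?h) * sqrt (lam n)"
      by (simp add: tm[symmetric] flip: powr_add)
    then have "t powr (m - ?h) * ip_norm ip (rep n \<omega>) = t powr (- ?h) * (sqrt (lam n) * ip_norm ip (rep n \<omega>))" by simp
    also have "\<dots> \<le> t powr (- ?h) * (A * rate n)" using nm by (intro mult_left_mono) auto
    finally have 1: "t powr (m - ?h) * ip_norm ip (rep n \<omega>) \<le> t powr (- ?h) * (A * rate n)" .
    have 2: "t powr (- ?h) * L2_norm \<Omega> (rep n \<omega>) \<le> t powr (- ?h) * (A * rate n)" using L2 by (intro mult_left_mono) auto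
    have "real n * \<bar>weight n (tuple n \<omega>) i\<bar> = \<bar>rep n \<omega> (X n i \<omega>)\<bar>" by (simp add: rep(2)[OF \<omega> i] abs_mult)
    also have "\<dots> \<le> C * (t powr (- ?h) * L2_norm \<Omega> (rep n \<omega>) + t powr (m - ?h) * ip_norm ip (rep n \<omega>))"
      by (rule C(2)[OF rep(1)[OF \<omega>] design[OF i \<omega>] t])
    also have "\<dots> \<le> C * (t powr (- ?h) * (A * rate n) + t powr (- ?h) * (A * rate n))"
      by (intro mult_left_mono add_mono 1 2 C(1))
    finally show ?thesis using n by (simp add: t_def field_simps)
  qed
  then show thesis using C(1) by (intro that[of "2 * C"]) auto
qed

text \<open>The bias is written without \<open>rep\<close>, as a function of the design tuple, which
  is the form that measurability and conditioning require.\<close>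

lemma fit_error_eq:
  assumes "\<omega> \<in> space M" "f \<in> H"
  shows "mi_deriv \<alpha> (krr_fit H ip n (lam n) (\<lambda>i. X n i \<omega>) (\<lambda>i. e i \<omega>) f) x0 - mi_deriv \<alpha> f x0 =
    (\<Sum>i<n. weight n (tuple n \<omega>) i * e i \<omega>) + ((\<Sum>i<n. weight n (tuple n \<omega>) i * f (tuple n \<omega> i)) - ip f ell)"
  using rep(3)[OF assms, of n] by (simp add: mi_deriv_fit[OF assms] tuple_def)

lemma studentised_error_measurable:
  assumes f: "f \<in> H"
  shows "(\<lambda>\<omega>. krr_var K \<alpha> \<sigma> n (lam n) (\<lambda>i. X n i \<omega>) x0 powr (- 1 / 2) *
    (mi_deriv \<alpha> (krr_fit H ip n (lam n) (\<lambda>i. X n i \<omega>) (\<lambda>i. e i \<omega>) f) x0 - mi_deriv \<alpha> f x0)) \<in> borel_measurable M"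
proof -
  have fx: "(\<lambda>\<omega>. f (tuple n \<omega> i)) \<in> borel_measurable M" if "i < n" for i
  proof -
    have "(\<lambda>\<omega>. tuple n \<omega> i) \<in> borel_measurable M"
      by (rule measurable_compose[OF tuple_measurable measurable_component_singleton]) (use that in simp)
    then show ?thesis by (rule measurable_compose[OF _ H_borel[OF f]])
  qed
  have "(\<lambda>\<omega>. (\<sigma>\<^sup>2 * (\<Sum>i<n. (weight n (tuple n \<omega>) i)\<^sup>2)) powr (- 1 / 2) *
      ((\<Sum>i<n. weight n (tuple n \<omega>) i * e i \<omega>) + ((\<Sum>i<n. weight n (tuple n \<omega>) i * f (tuple n \<omega> i)) - ip f ell)))
    \<in> borel_measurable M"
    by (intro powr_real_measurable borel_measurable_times borel_measurable_add borel_measurable_diff borel_measurable_const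
        borel_measurable_sum borel_measurable_power weight_tuple_measurable noise_measurable fx) auto
  then show ?thesis by (subst measurable_cong) (simp_all only: krr_var_weight fit_error_eq[OF _ f])
qed

text \<open>For a fixed design the error is a normalised weighted sum plus the bias. On
  \<open>G\<close> the phase of the bias is within |t| r of 1 and the product within the Lindeberg
  bound of the Gaussian; the rest of the space contributes 2 \<epsilon>.\<close>

lemma error_char_bound:
  assumes \<sigma>: "\<sigma>\<^sup>2 > 0" and f: "f \<in> H" and \<epsilon>: "\<epsilon> > 0" and n: "n > 0"
    and G: "G \<in> events" "prob G \<ge> 1 - \<epsilon>"
    and V: "\<And>\<omega>. \<omega> \<in> G \<Longrightarrow> (\<Sum>i<n. (weight n (tuple n \<omega>) i)\<^sup>2) > 0"
    and g: "\<And>\<omega> i. \<omega> \<in> G \<Longrightarrow> i < n \<Longrightarrow> \<bar>(\<sigma>\<^sup>2 * (\<Sum>i<n. (weight n (tuple n \<omega>) i)\<^sup>2)) powr (- 1 / 2) * weight n (tuple n \<omega>) i\<bar> \<le> \<delta>"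
    and \<rho>: "\<And>\<omega>. \<omega> \<in> G \<Longrightarrow> \<bar>(\<sigma>\<^sup>2 * (\<Sum>i<n. (weight n (tuple n \<omega>) i)\<^sup>2)) powr (- 1 / 2) * (lam n * ip (rep n \<omega>) f)\<bar> \<le> r"
    and \<delta>: "\<delta> \<ge> 0" and r: "r \<ge> 0"
  defines "Z \<equiv> \<lambda>\<omega>. krr_var K \<alpha> \<sigma> n (lam n) (\<lambda>i. X n i \<omega>) x0 powr (- 1 / 2) *
    (mi_deriv \<alpha> (krr_fit H ip n (lam n) (\<lambda>i. X n i \<omega>) (\<lambda>i. e i \<omega>) f) x0 - mi_deriv \<alpha> f x0)"
  shows "cmod (char (distr M borel Z) t - exp (- (t\<^sup>2 / 2))) \<le>
    \<bar>t\<bar> * r + t\<^sup>2 / \<sigma>\<^sup>2 * (lindeberg_moment M (e 0) (\<bar>t\<bar> * \<delta>) / 6 + t\<^sup>2 * \<delta>\<^sup>2 * \<sigma> ^ 4 / 8) + 2 * \<epsilon>"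
proof -
  let ?S = "PiM {..<n} (\<lambda>_. borel) :: (nat \<Rightarrow> real ^ 'd) measure"
  let ?\<phi> = "char (distr M borel (e 0))"
  define v where "v x = (\<sigma>\<^sup>2 * (\<Sum>i<n. (weight n x i)\<^sup>2)) powr (- 1 / 2)" for x
  define g' where "g' i x = v x * weight n x i" for i x
  define \<rho>' where "\<rho>' x = v x * ((\<Sum>i<n. weight n x i * f (x i)) - ip f ell)" for x
  have vm: "v \<in> borel_measurable ?S" unfolding v_def
    by (intro powr_real_measurable borel_measurable_times borel_measurable_const borel_measurable_sum borel_measurable_power borel_measurable_weight) auto
  have gm: "g' i \<in> borel_measurable ?S" if "i < n" for i unfolding g'_def
    by (intro borel_measurable_times vm borel_measurable_weight that)
  have fm: "(\<lambda>x. f (x i)) \<in> borel_measurable ?S" if "i < n" for i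
    by (rule measurable_compose[OF _ H_borel[OF f]], rule measurable_component_singleton) (use that in simp)
  have \<rho>m: "\<rho>' \<in> borel_measurable ?S" unfolding \<rho>'_def
    by (intro borel_measurable_times borel_measurable_diff borel_measurable_sum borel_measurable_const vm borel_measurable_weight fm) auto
  have \<rho>'_eq: "\<rho>' (tuple n \<omega>) = - (v (tuple n \<omega>) * (lam n * ip (rep n \<omega>) f))" if "\<omega> \<in> space M" for \<omega>
    using rep(3)[OF that f, of n] by (simp add: \<rho>'_def tuple_def)
  have Z_eq: "Z \<omega> = (\<Sum>i<n. g' i (tuple n \<omega>) * e i \<omega>) + \<rho>' (tuple n \<omega>)" if "\<omega> \<in> space M" for \<omega>
    unfolding Z_def krr_var_weight[OF that] fit_error_eq[OF that f] g'_def \<rho>'_def v_def[symmetric]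
    by (simp add: distrib_left sum_distrib_left mult.assoc)
  have ZM: "Z \<in> borel_measurable M" unfolding Z_def by (rule studentised_error_measurable[OF f])
  let ?h = "\<lambda>\<omega>. iexp (t * \<rho>' (tuple n \<omega>)) * (\<Prod>i<n. ?\<phi> (t * g' i (tuple n \<omega>)))"
  have "indep_rv M ?S (tuple n) (PiM {..<n} (\<lambda>_. borel)) (\<lambda>\<omega>. \<lambda>i\<in>{..<n}. e i \<omega>)"
    using indep[of n] by (simp add: tuple_def[abs_def])
  note wc = weighted_errors_char[OF iid this gm \<rho>m, where t = t]
  have "char (distr M borel Z) t = (CLINT \<omega>|M. iexp (t * Z \<omega>))"
    using ZM by (simp add: char_def integral_distr)
  also have "\<dots> = (CLINT \<omega>|M. iexp (t * ((\<Sum>i<n. g' i (tuple n \<omega>) * e i \<omega>) + \<rho>' (tuple n \<omega>))))"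
    by (intro Bochner_Integration.integral_cong refl) (simp only: Z_eq)
  also have "\<dots> = (CLINT \<omega>|M. ?h \<omega>)" by (rule wc(1))
  finally have ch: "char (distr M borel Z) t = (CLINT \<omega>|M. ?h \<omega>)" .
  interpret E0: real_distribution "distr M borel (e 0)" by (rule real_distribution_distr) (simp add: iid_errors_integrable(1)[OF iid])
  have p1: "cmod (\<Prod>i<n. ?\<phi> (t * g' i x)) \<le> 1" for x
  proof -
    have "cmod (\<Prod>i<n. ?\<phi> (t * g' i x)) = (\<Prod>i<n. cmod (?\<phi> (t * g' i x)))" by (simp add: prod_norm)
    also have "\<dots> \<le> 1" by (intro prod_le_1) (auto intro: E0.cmod_char_le_1)
    finally show ?thesis .
  qed
  have ie: "cmod (iexp x) = 1" for x :: real by (simp add: norm_exp_eq_Re)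
  have e1: "cmod (complex_of_real (exp (- (t\<^sup>2 / 2)))) \<le> 1" by (simp only: norm_of_real) simp
  let ?b = "t\<^sup>2 / \<sigma>\<^sup>2 * (lindeberg_moment M (e 0) (\<bar>t\<bar> * \<delta>) / 6 + t\<^sup>2 * \<delta>\<^sup>2 * \<sigma> ^ 4 / 8)"
  have lm: "lindeberg_moment M (e 0) (\<bar>t\<bar> * \<delta>) \<ge> 0"
    unfolding lindeberg_moment_def using \<delta> by (intro integral_nonneg_AE) auto
  have "cmod ((CLINT \<omega>|M. ?h \<omega>) - complex_of_real (exp (- (t\<^sup>2 / 2)))) \<le> (\<bar>t\<bar> * r + ?b) + 2 * \<epsilon>"
  proof (rule expectation_close_off_event[OF wc(2) G])
    show "\<bar>t\<bar> * r + ?b \<ge> 0" using r lm by simp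
    show "cmod (?h \<omega> - complex_of_real (exp (- (t\<^sup>2 / 2)))) \<le> 2" if "\<omega> \<in> space M" for \<omega>
    proof -
      have "cmod (?h \<omega> - complex_of_real (exp (- (t\<^sup>2 / 2)))) \<le> cmod (?h \<omega>) + cmod (complex_of_real (exp (- (t\<^sup>2 / 2))))"
        by (rule norm_triangle_ineq4)
      also have "cmod (?h \<omega>) \<le> 1" using p1 by (simp only: norm_mult ie mult_1)
      finally show ?thesis using e1 by linarith
    qed
    show "cmod (?h \<omega> - complex_of_real (exp (- (t\<^sup>2 / 2)))) \<le> \<bar>t\<bar> * r + ?b" if \<omega>: "\<omega> \<in> G" for \<omega>
    proof -
      have \<omega>M: "\<omega> \<in> space M" using \<omega> sets.sets_into_space[OF G(1)] by blast
      let ?x = "tuple n \<omega>"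
      let ?p = "\<Prod>i<n. ?\<phi> (t * g' i ?x)"
      have W: "\<sigma>\<^sup>2 * (\<Sum>i<n. (weight n ?x i)\<^sup>2) > 0" using V[OF \<omega>] \<sigma> by simp
      \<comment> \<open>The studentising factor gives the rescaled weights exactly the normalisation
        that the product bound assumes.\<close>
      have v2: "(v ?x)\<^sup>2 * (\<sigma>\<^sup>2 * (\<Sum>i<n. (weight n ?x i)\<^sup>2)) = 1"
      proof -
        have "(v ?x)\<^sup>2 = (\<sigma>\<^sup>2 * (\<Sum>i<n. (weight n ?x i)\<^sup>2)) powr (- 1)"
          unfolding v_def power2_eq_square by (simp flip: powr_add)
        then show ?thesis using W by (simp add: powr_minus_divide del: zero_less_mult_iff) auto
      qed
      have "\<sigma>\<^sup>2 * (\<Sum>i<n. (g' i ?x)\<^sup>2) = (v ?x)\<^sup>2 * (\<sigma>\<^sup>2 * (\<Sum>i<n. (weight n ?x i)\<^sup>2))"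
        by (simp add: g'_def power_mult_distrib sum_distrib_left mult_ac)
      then have s1: "\<sigma>\<^sup>2 * (\<Sum>i<n. (g' i ?x)\<^sup>2) = 1" using v2 by simp
      have cp: "cmod (?p - complex_of_real (exp (- (t\<^sup>2 / 2)))) \<le> ?b"
        using char_product_bound[OF iid \<sigma> s1, of \<delta> t] g[OF \<omega>] by (simp add: g'_def v_def)
      have "cmod ((iexp (t * \<rho>' ?x) - 1) * ?p) \<le> \<bar>t * \<rho>' ?x\<bar> * 1"
        unfolding norm_mult by (intro mult_mono cmod_iexp_diff_le p1) auto
      also have "\<dots> \<le> \<bar>t\<bar> * r"
        using \<rho>[OF \<omega>] by (simp add: abs_mult \<rho>'_eq[OF \<omega>M] v_def mult_left_mono)
      finally have "cmod ((iexp (t * \<rho>' ?x) - 1) * ?p) \<le> \<bar>t\<bar> * r" .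
      moreover have "?h \<omega> - complex_of_real (exp (- (t\<^sup>2 / 2))) =
          (iexp (t * \<rho>' ?x) - 1) * ?p + (?p - complex_of_real (exp (- (t\<^sup>2 / 2))))" by (simp only: left_diff_distrib) simp
      ultimately show ?thesis using cp norm_triangle_le add_mono by metis
    qed
  qed
  then show ?thesis unfolding ch by simp
qed

text \<open>Levy's continuity theorem. After division by the standard deviation, of order
  \<open>rate / sqrt n\<close>, the weights are at most of order s^(-d/2) / sqrt n and the bias at
  most of order sqrt(lam n); the latter is where \<open>lam = o(1/n)\<close> enters.\<close>

lemma error_clt:
  assumes \<sigma>: "\<sigma>\<^sup>2 > 0" and lam: "lam \<in> o(\<lambda>n. 1 / real n)"
    and f: "\<And>n. f n \<in> H" and f_bdd: "(\<lambda>n. ip_norm ip (f n)) \<in> O(\<lambda>n. 1)"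
  shows "weak_conv_m (\<lambda>n. distr M borel (\<lambda>\<omega>. krr_var K \<alpha> \<sigma> n (lam n) (\<lambda>i. X n i \<omega>) x0 powr (- 1 / 2) *
      (mi_deriv \<alpha> (krr_fit H ip n (lam n) (\<lambda>i. X n i \<omega>) (\<lambda>i. e i \<omega>) (f n)) x0 - mi_deriv \<alpha> (f n) x0)))
    std_normal_distribution" (is "weak_conv_m (\<lambda>n. distr M borel (?Z n)) _")
proof (rule levy_continuity)
  show "real_distribution (distr M borel (?Z n))" for n by (intro real_distribution_distr studentised_error_measurable f)
  show "real_distribution std_normal_distribution" by (rule real_dist_normal_dist)
  fix t :: real
  obtain A c where Ac: "A > 0" "c > 0" and good: "\<And>\<epsilon>. \<epsilon> > 0 \<Longrightarrow> \<forall>\<^sub>F n in sequentially. \<exists>G\<in>events. prob G \<ge> 1 - \<epsilon> \<and> (\<forall>\<omega>\<in>G. regular A c n \<omega>)"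
    by (rule regular_event) blast
  obtain C where C: "C \<ge> 0" "\<And>A c n \<omega> i. \<omega> \<in> space M \<Longrightarrow> i < n \<Longrightarrow> lam n powr (1 / (2 * m)) \<le> 1 \<Longrightarrow> regular A c n \<omega> \<Longrightarrow>
    \<bar>weight n (tuple n \<omega>) i\<bar> \<le> C * A * (lam n powr (1 / (2 * m))) powr (- (real CARD('d) / 2)) * rate n / real n"
    by (rule weight_bound) blast
  obtain F where F: "F > 0" "\<forall>\<^sub>F n in sequentially. norm (ip_norm ip (f n)) \<le> F * norm (1::real)"
    using f_bdd by (elim landau_o.bigE) blast
  define D where "D n = (lam n powr (1 / (2 * m))) powr (- (real CARD('d) / 2))" for n
  \<comment> \<open>On regular outcomes the standard deviation is at least
    \<open>\<kappa> * rate n / sqrt n\<close>.\<close>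
  define \<kappa> where "\<kappa> = sqrt (\<sigma>\<^sup>2 * c)"
  have \<kappa>: "\<kappa> > 0" using \<sigma> Ac(2) unfolding \<kappa>_def by (simp only: real_sqrt_gt_0_iff mult_pos_pos)
  define \<delta> where "\<delta> n = C * A / \<kappa> * (D n / sqrt (real n))" for n
  define r where "r n = A * F / \<kappa> * sqrt (lam n * real n)" for n
  have \<delta>0: "\<delta> n \<ge> 0" and r0: "r n \<ge> 0" for n
    using C(1) Ac(1) \<kappa> F(1) lam_pos[of n] by (auto simp: \<delta>_def r_def D_def)
  define err where "err n = \<bar>t\<bar> * r n + t\<^sup>2 / \<sigma>\<^sup>2 * (lindeberg_moment M (e 0) (\<bar>t\<bar> * \<delta> n) / 6 + t\<^sup>2 * (\<delta> n)\<^sup>2 * \<sigma> ^ 4 / 8)" for n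
  have err: "err \<longlonglongrightarrow> 0"
  proof -
    have "(\<lambda>n. C * A / \<kappa> * (D n / sqrt (real n))) \<longlonglongrightarrow> C * A / \<kappa> * 0"
      unfolding D_def by (intro tendsto_mult tendsto_const design_density_tendsto)
    then have \<delta>: "\<delta> \<longlonglongrightarrow> 0" by (simp add: \<delta>_def[abs_def])
    have "(\<lambda>n. lam n / (1 / real n)) \<longlonglongrightarrow> 0" by (rule smalloD_tendsto[OF lam])
    then have "(\<lambda>n. sqrt (lam n * real n)) \<longlonglongrightarrow> sqrt 0" by (intro tendsto_real_sqrt) simp
    then have "(\<lambda>n. A * F / \<kappa> * sqrt (lam n * real n)) \<longlonglongrightarrow> A * F / \<kappa> * 0" by (intro tendsto_mult tendsto_const) simp
    then have r: "r \<longlonglongrightarrow> 0" by (simp add: r_def[abs_def])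
    have "(\<lambda>n. \<bar>t\<bar> * \<delta> n) \<longlonglongrightarrow> \<bar>t\<bar> * 0" by (intro tendsto_mult tendsto_const \<delta>)
    then have "(\<lambda>n. lindeberg_moment M (e 0) (\<bar>t\<bar> * \<delta> n)) \<longlonglongrightarrow> 0"
      by (intro lindeberg_moment_tendsto iid_errors_integrable(1)[OF iid]) (use iid \<delta>0 in \<open>auto simp: iid_errors_def\<close>)
    then have "err \<longlonglongrightarrow> \<bar>t\<bar> * 0 + t\<^sup>2 / \<sigma>\<^sup>2 * (0 / 6 + t\<^sup>2 * 0\<^sup>2 * \<sigma> ^ 4 / 8)"
      unfolding err_def by (intro tendsto_intros r \<delta>) auto
    then show ?thesis by simp
  qed
  \<comment> \<open>The event and the threshold for n depend on \<epsilon>, but \<open>err\<close>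
    does not, since the constants of regularity do not.\<close>
  have main: "\<forall>\<^sub>F n in sequentially. cmod (char (distr M borel (?Z n)) t - exp (- (t\<^sup>2 / 2))) \<le> err n + 2 * \<epsilon>" if \<epsilon>: "\<epsilon> > 0" for \<epsilon>
    using good[OF \<epsilon>] lam_powr_le[of 1, simplified] F(2) eventually_gt_at_top[of 0]
  proof eventually_elim
    case (elim n)
    then obtain G where G: "G \<in> events" "prob G \<ge> 1 - \<epsilon>" and reg: "\<And>\<omega>. \<omega> \<in> G \<Longrightarrow> regular A c n \<omega>" by blast
    have GM: "\<omega> \<in> space M" if "\<omega> \<in> G" for \<omega> using that sets.sets_into_space[OF G(1)] by blast
    have n: "real n > 0" and n': "n > 0" using elim by simp_all
    have rp: "rate n > 0" by (rule rate_pos)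
    let ?S = "\<lambda>\<omega>. \<Sum>i<n. (weight n (tuple n \<omega>) i)\<^sup>2"
    let ?v = "\<lambda>\<omega>. (\<sigma>\<^sup>2 * ?S \<omega>) powr (- 1 / 2)"
    have Sle: "c * (rate n)\<^sup>2 / real n \<le> ?S \<omega>" if "\<omega> \<in> G" for \<omega>
      using reg[OF that] n by (simp add: regular_def field_simps)
    have v: "?v \<omega> \<le> sqrt (real n) / (\<kappa> * rate n)" if \<omega>: "\<omega> \<in> G" for \<omega>
    proof -
      let ?y = "\<sigma>\<^sup>2 * (c * (rate n)\<^sup>2 / real n)"
      have y: "?y > 0" using \<sigma> Ac(2) rp n by (intro mult_pos_pos divide_pos_pos) auto
      have "?v \<omega> \<le> ?y powr (- 1 / 2)" using y Sle[OF \<omega>] by (intro powr_mono2' mult_left_mono) auto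
      also have "\<dots> = 1 / sqrt ?y" using y by (simp add: powr_minus_divide powr_half_sqrt)
      also have "sqrt ?y = \<kappa> * rate n / sqrt (real n)"
        using rp by (simp add: \<kappa>_def real_sqrt_mult real_sqrt_divide)
      finally show ?thesis by simp
    qed
    show ?case unfolding err_def
    proof (rule error_char_bound[OF \<sigma> f \<epsilon> n' G _ _ _ \<delta>0 r0])
      fix \<omega> assume \<omega>: "\<omega> \<in> G"
      have "0 < c * (rate n)\<^sup>2 / real n" using Ac(2) rp n by simp
      then show "?S \<omega> > 0" using Sle[OF \<omega>] by linarith
      show "\<bar>?v \<omega> * weight n (tuple n \<omega>) i\<bar> \<le> \<delta> n" if i: "i < n" for i
      proof -
        have "\<bar>?v \<omega> * weight n (tuple n \<omega>) i\<bar> = ?v \<omega> * \<bar>weight n (tuple n \<omega>) i\<bar>" by (simp add: abs_mult)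
        also have "\<dots> \<le> sqrt (real n) / (\<kappa> * rate n) * (C * A * D n * rate n / real n)"
          unfolding D_def
          by (intro mult_mono v[OF \<omega>] C(2)[OF GM[OF \<omega>] i elim(2) reg[OF \<omega>]]) (use \<kappa> rp in auto)
        also have "\<dots> = \<delta> n"
        proof -
          have "sqrt (real n) / real n = 1 / sqrt (real n)" using n by (simp add: real_div_sqrt field_simps)
          then have "C * A / \<kappa> * D n * (sqrt (real n) / real n) = C * A / \<kappa> * D n * (1 / sqrt (real n))" by simp
          then show ?thesis using rp by (simp add: \<delta>_def mult_ac)
        qed
        finally show ?thesis .
      qed
      show "\<bar>?v \<omega> * (lam n * ip (rep n \<omega>) (f n))\<bar> \<le> r n"
      proof -
        have rH: "rep n \<omega> \<in> H" by (rule rep(1)[OF GM[OF \<omega>]])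
        have "\<bar>ip (rep n \<omega>) (f n)\<bar> \<le> ip_norm ip (rep n \<omega>) * F"
          using elim(3) by (intro order_trans[OF ip_cauchy_schwarz[OF rH f[of n]]] mult_left_mono ip_norm_nonneg rH) auto
        then have "lam n * \<bar>ip (rep n \<omega>) (f n)\<bar> \<le> (lam n * ip_norm ip (rep n \<omega>)) * F"
          using lam_pos[of n] by (simp add: mult.assoc)
        also have "\<dots> \<le> (A * (sqrt (lam n) * rate n)) * F"
          by (intro mult_right_mono lam_rep_norm_bounds(2)[OF reg[OF \<omega>]]) (use F(1) in simp)
        finally have le: "lam n * \<bar>ip (rep n \<omega>) (f n)\<bar> \<le> (A * (sqrt (lam n) * rate n)) * F" .
        have "\<bar>?v \<omega> * (lam n * ip (rep n \<omega>) (f n))\<bar> = ?v \<omega> * (lam n * \<bar>ip (rep n \<omega>) (f n)\<bar>)"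
          using lam_pos[of n] by (simp add: abs_mult)
        also have "\<dots> \<le> sqrt (real n) / (\<kappa> * rate n) * ((A * (sqrt (lam n) * rate n)) * F)"
          by (intro mult_mono v[OF \<omega>] le) (use \<kappa> rp lam_pos[of n] in auto)
        also have "\<dots> = r n" using rp by (simp add: r_def real_sqrt_mult)
        finally show ?thesis .
      qed
    qed
  qed
  have "(\<lambda>n. char (distr M borel (?Z n)) t) \<longlonglongrightarrow> complex_of_real (exp (- (t\<^sup>2 / 2)))"
  proof (rule tendstoI)
    fix r :: real assume "r > 0"
    \<comment> \<open>With \<epsilon> = r/8 the exceptional event contributes r/4, and
      \<open>err\<close> less than r/2.\<close>
    then have "r / 8 > 0" "r / 2 > 0" by auto
    have "\<forall>\<^sub>F n in sequentially. dist (err n) 0 < r / 2" by (rule tendstoD[OF err \<open>r / 2 > 0\<close>])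
    then show "\<forall>\<^sub>F n in sequentially. dist (char (distr M borel (?Z n)) t) (complex_of_real (exp (- (t\<^sup>2 / 2)))) < r"
      using main[OF \<open>r / 8 > 0\<close>]
    proof eventually_elim
      case (elim n)
      then have "cmod (char (distr M borel (?Z n)) t - complex_of_real (exp (- (t\<^sup>2 / 2)))) < r"
        using \<open>r > 0\<close> by (simp add: dist_real_def exp_of_real[symmetric])
      then show ?case by (simp only: dist_norm)
    qed
  qed
  then show "(\<lambda>n. char (distr M borel (?Z n)) t) \<longlonglongrightarrow> char std_normal_distribution t"
    by (simp add: char_std_normal_distribution)
qed

end

section \<open>The four asymptotic statements\<close>

theorem theorem8:
  fixes \<Omega> :: "(real ^ 'd::finite) set"
    and K :: "real ^ 'd \<Rightarrow> real ^ 'd \<Rightarrow> real"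
    and H :: "(real ^ 'd \<Rightarrow> real) set"
    and ip :: "(real ^ 'd \<Rightarrow> real) \<Rightarrow> (real ^ 'd \<Rightarrow> real) \<Rightarrow> real"
    and m \<sigma> :: real
    and \<alpha> :: "'d \<Rightarrow> nat"
    and x0 :: "real ^ 'd"
    and M :: "'w measure"
    and X :: "nat \<Rightarrow> nat \<Rightarrow> 'w \<Rightarrow> real ^ 'd"
    and e :: "nat \<Rightarrow> 'w \<Rightarrow> real"
    and lam :: "nat \<Rightarrow> real"
    and f :: "nat \<Rightarrow> real ^ 'd \<Rightarrow> real"
  assumes "convex \<Omega>" and "compact \<Omega>" and "interior \<Omega> \<noteq> {}"
    and "rkhs \<Omega> K H ip" and "equals_sobolev \<Omega> m H ip"
    and "m > real CARD('d) / 2 + real (mi_order \<alpha>)"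
    and "prob_space M"
    and "\<And>n i \<omega>. i < n \<Longrightarrow> \<omega> \<in> space M \<Longrightarrow> X n i \<omega> \<in> \<Omega>"
    and "\<And>n. indep_rv M
               (PiM {..<n} (\<lambda>_. borel)) (\<lambda>\<omega>. \<lambda>i\<in>{..<n}. X n i \<omega>)
               (PiM {..<n} (\<lambda>_. borel)) (\<lambda>\<omega>. \<lambda>i\<in>{..<n}. e i \<omega>)"
    and "iid_errors M e \<sigma>"
    and "norm_comparison M \<Omega> m H ip X"
    and "\<And>n. lam n > 0"
    and "lam \<in> o(\<lambda>n. 1)"
    and "(\<lambda>n. 1 / lam n) \<in> o(\<lambda>n. real n powr (2 * m / real CARD('d)))"
    and "x0 \<in> interior \<Omega>"
    and "\<And>n. f n \<in> H" and "(\<lambda>n. ip_norm ip (f n)) \<in> O(\<lambda>n. 1)"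
  shows
    "asymp_prob M
       (\<lambda>n \<omega>. krr_var K \<alpha> \<sigma> n (lam n) (\<lambda>i. X n i \<omega>) x0)
       (\<lambda>n \<omega>. \<sigma>\<^sup>2 * real n powr (-1) *
               lam n powr (- ((real CARD('d) + 2 * real (mi_order \<alpha>)) / (2 * m))))
     \<and>
     asymp_prob M
       (\<lambda>n \<omega>. SUP g\<in>{g \<in> H. ip_norm ip g \<le> 1}.
          \<bar>(LINT \<omega>'|M. mi_deriv \<alpha>
               (krr_fit H ip n (lam n) (\<lambda>i. X n i \<omega>) (\<lambda>i. e i \<omega>') g) x0)
            - mi_deriv \<alpha> g x0\<bar>)
       (\<lambda>n \<omega>. lam n powr (1 / 2 - (real CARD('d) + 2 * real (mi_order \<alpha>)) / (4 * m)))
     \<and>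
     (\<sigma>\<^sup>2 > 0 \<and> lam \<in> \<Theta>(\<lambda>n. 1 / real n) \<longrightarrow>
      asymp_prob M
       (\<lambda>n \<omega>. SUP g\<in>{g \<in> H. ip_norm ip g \<le> 1}.
          \<bar>mi_deriv \<alpha> (krr_fit H ip n (lam n) (\<lambda>i. X n i \<omega>) (\<lambda>i. e i \<omega>) g) x0
            - mi_deriv \<alpha> g x0\<bar>)
       (\<lambda>n \<omega>. real n powr (- 1 / 2 + (real CARD('d) + 2 * real (mi_order \<alpha>)) / (4 * m))))
     \<and>
     (\<sigma>\<^sup>2 > 0 \<and> lam \<in> o(\<lambda>n. 1 / real n) \<longrightarrow>
      weak_conv_m
       (\<lambda>n. distr M borel (\<lambda>\<omega>.
          krr_var K \<alpha> \<sigma> n (lam n) (\<lambda>i. X n i \<omega>) x0 powr (- 1 / 2) *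
          (mi_deriv \<alpha> (krr_fit H ip n (lam n) (\<lambda>i. X n i \<omega>) (\<lambda>i. e i \<omega>) (f n)) x0
            - mi_deriv \<alpha> (f n) x0)))
       std_normal_distribution)"
proof -
  interpret krr_setup \<Omega> K H ip M m \<sigma> \<alpha> x0 X e lam
    by (intro krr_setup.intro krr_setup_axioms.intro assms)
  show ?thesis
    using variance_asymp bias_asymp error_asymp error_clt[OF _ _ assms(16,17)] by blast
qed

end
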